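(* Let $S$ be a set of $n$ points with integer coordinates in $[1,n]$ (word RAM model, space measured in words of $\log n$ bits), and let $\varepsilon>0$ be an arbitrarily small constant. There exists a data structure that uses $O(n)$ space and answers sorted range reporting queries on $S$ in $O((k+1)\log^{\varepsilon} n)$ time, and there exists a data structure that uses $O(n\log\log n)$ space and answers sorted range reporting queries on $S$ in $O((k+1)(\log\log n)^2)$ time, where $k$ is the number of reported points.
   Context: A sorted range reporting query is given by a rectangle $Q=[a,b]\times[c,d]$; the points of $S\cap Q$ are to be reported in increasing order of their $x$-coordinates, where the reporting may be stopped after the $k$ leftmost points (the $k$ points of $S\cap Q$ with smallest $x$-coordinates, or all of them if fewer exist) have been output; $k$ need not be known in advance (online mode: points are output left to right until the user stops the procedure or all of $S\cap Q$ is reported). *)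

theory Defs
  imports Complex_Main "HOL-Library.Landau_Symbols" "HOL-Library.Log_Nat"
begin

(* Word RAM. A machine word of w bits is a natural number below 2 ^ w. The type 'a word is not
   used because one program has to run on machines of every word length. *)

datatype binop = Add | Sub | Mul | Div | Mod | And | Or | Xor | Shl | Shr

datatype instr =
    LoadConst nat nat
  | Move nat nat
  | Op binop nat nat nat
  | Load nat nat
  | Store nat nat
  | Jump nat
  | JumpLess nat nat nat
  | JumpEq nat nat nat
  | Report nat nat
  | Halt

record config =
  pc :: nat
  regs :: "nat \<Rightarrow> nat"
  cells :: "nat list"
  reported :: "(nat \<times> nat) list"

fun eval_op :: "nat \<Rightarrow> binop \<Rightarrow> nat \<Rightarrow> nat \<Rightarrow> nat" where
  "eval_op w Add x y = take_bit w (x + y)"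
| "eval_op w Sub x y = take_bit w (x + 2 ^ w - y)"
| "eval_op w Mul x y = take_bit w (x * y)"
| "eval_op w Div x y = x div y"
| "eval_op w Mod x y = x mod y"
| "eval_op w And x y = Bit_Operations.and x y"
| "eval_op w Or x y = Bit_Operations.or x y"
| "eval_op w Xor x y = Bit_Operations.xor x y"
| "eval_op w Shl x y = take_bit w (push_bit y x)"
| "eval_op w Shr x y = drop_bit y x"

definition set_reg :: "nat \<Rightarrow> nat \<Rightarrow> config \<Rightarrow> config" where
  "set_reg r v cf = cf\<lparr>pc := Suc (pc cf), regs := (regs cf)(r := v)\<rparr>"

(* Result None: the machine has halted or faulted. Accessing an address that is not below the
   length of the memory is a fault, so that length is the space available to the program. *)
fun exec :: "nat \<Rightarrow> instr \<Rightarrow> config \<Rightarrow> config option" where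
  "exec w (LoadConst r v) cf = Some (set_reg r (take_bit w v) cf)"
| "exec w (Move r s) cf = Some (set_reg r (regs cf s) cf)"
| "exec w (Op f r s u) cf = Some (set_reg r (eval_op w f (regs cf s) (regs cf u)) cf)"
| "exec w (Load r s) cf =
     (if regs cf s < length (cells cf)
      then Some (set_reg r (cells cf ! regs cf s) cf) else None)"
| "exec w (Store r s) cf =
     (if regs cf r < length (cells cf)
      then Some (cf\<lparr>pc := Suc (pc cf), cells := (cells cf)[regs cf r := regs cf s]\<rparr>) else None)"
| "exec w (Jump l) cf = Some (cf\<lparr>pc := l\<rparr>)"
| "exec w (JumpLess r s l) cf =
     Some (cf\<lparr>pc := if regs cf r < regs cf s then l else Suc (pc cf)\<rparr>)"
| "exec w (JumpEq r s l) cf =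
     Some (cf\<lparr>pc := if regs cf r = regs cf s then l else Suc (pc cf)\<rparr>)"
| "exec w (Report r s) cf =
     Some (cf\<lparr>pc := Suc (pc cf), reported := reported cf @ [(regs cf r, regs cf s)]\<rparr>)"
| "exec w Halt cf = None"

definition step :: "nat \<Rightarrow> instr list \<Rightarrow> config \<Rightarrow> config option" where
  "step w P cf = (if pc cf < length P then exec w (P ! pc cf) cf else None)"

fun run :: "nat \<Rightarrow> instr list \<Rightarrow> nat \<Rightarrow> config \<Rightarrow> config option" where
  "run w P 0 cf = Some cf"
| "run w P (Suc \<tau>) cf = Option.bind (run w P \<tau> cf) (step w P)"

definition halted :: "instr list \<Rightarrow> config \<Rightarrow> bool" where
  "halted P cf \<longleftrightarrow> pc cf < length P \<and> P ! pc cf = Halt"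

definition start :: "nat list \<Rightarrow> nat \<Rightarrow> nat \<Rightarrow> nat \<Rightarrow> nat \<Rightarrow> config" where
  "start m a b c d =
     \<lparr>pc = 0, regs = (\<lambda>_. 0)(0 := a, 1 := b, 2 := c, 3 := d), cells = m, reported = []\<rparr>"

(* Points with equal x-coordinate may come in any order. *)
definition sorted_report ::
    "(nat \<times> nat) set \<Rightarrow> nat \<Rightarrow> nat \<Rightarrow> nat \<Rightarrow> nat \<Rightarrow> (nat \<times> nat) list \<Rightarrow> bool" where
  "sorted_report S a b c d pts \<longleftrightarrow>
     distinct pts \<and> set pts = S \<inter> ({a..b} \<times> {c..d}) \<and> sorted (map fst pts)"

(* Online mode: the program is not told k. For every k up to the size of the answer, the k leftmost
   points are out after at most (k + 1) * T steps, and the program halts after at most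
   (K + 1) * T steps, where K is the size of the whole answer. *)
definition answers_query ::
    "nat \<Rightarrow> instr list \<Rightarrow> (nat \<times> nat) set \<Rightarrow> real \<Rightarrow> nat list \<Rightarrow> nat \<Rightarrow> nat \<Rightarrow> nat \<Rightarrow> nat \<Rightarrow> bool" where
  "answers_query w P S T m a b c d \<longleftrightarrow>
     (\<exists>pts. sorted_report S a b c d pts \<and>
        (\<forall>k\<le>length pts. \<exists>\<tau> cf. real \<tau> \<le> (real k + 1) * T \<and>
            run w P \<tau> (start m a b c d) = Some cf \<and> reported cf = take k pts) \<and>
        (\<exists>\<tau> cf. real \<tau> \<le> (real (length pts) + 1) * T \<and>
            run w P \<tau> (start m a b c d) = Some cf \<and> halted P cf \<and> reported cf = pts))"

(* M is the set of states the memory can be in between queries. The user may stop a query at any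
   time, hence the closure under all reachable configurations. *)
definition represents ::
    "nat \<Rightarrow> instr list \<Rightarrow> (nat \<times> nat) set \<Rightarrow> real \<Rightarrow> nat list set \<Rightarrow> bool" where
  "represents w P S T M \<longleftrightarrow>
     M \<noteq> {} \<and>
     (\<forall>m\<in>M. (\<forall>v\<in>set m. v < 2 ^ w) \<and>
        (\<forall>a b c d. a < 2 ^ w \<and> b < 2 ^ w \<and> c < 2 ^ w \<and> d < 2 ^ w \<longrightarrow>
           answers_query w P S T m a b c d \<and>
           (\<forall>\<tau> cf. run w P \<tau> (start m a b c d) = Some cf \<longrightarrow> cells cf \<in> M)))"

(* log n rounded up to a positive integer *)
definition lg_bits :: "nat \<Rightarrow> nat" where
  "lg_bits n = max 1 (ceillog2 n)"

(* Existence of a structure with space O(s n) and query time O((k + 1) * t n). The word length w is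
   any function of order log n, provided its constant factor is at least some \<kappa>\<^sub>0: addresses of
   superlinearly many cells need not fit into exactly log n bits. Space is counted in words of
   log n bits, so a memory of l machine words of w bits takes l * w / lg_bits n of them. *)
definition sorted_range_reporting_structure ::
    "(nat \<Rightarrow> real) \<Rightarrow> (nat \<Rightarrow> real) \<Rightarrow> bool" where
  "sorted_range_reporting_structure s t \<longleftrightarrow>
     (\<exists>P \<kappa>\<^sub>0. \<forall>\<kappa>. \<exists>space\<in>O(s). \<exists>time\<in>O(t). \<forall>n S w.
        S \<subseteq> {1..n} \<times> {1..n} \<and> card S = n \<and> \<kappa>\<^sub>0 * lg_bits n \<le> w \<and> w \<le> \<kappa> * lg_bits n \<longrightarrow>
        (\<exists>M. represents w P S (time n) M \<and>
           (\<forall>m\<in>M. real (length m) * real w / real (lg_bits n) \<le> space n)))"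

end

theory Submission
  imports Defs
begin

text \<open>
  The points are moved to rank space, where they form a permutation mapping \<open>y\<close>-ranks to \<open>x\<close>-ranks, and a
  sorted report is a sequence of range successor queries: the least \<open>x\<close>-rank that is at least \<open>p\<close> and has its
  \<open>y\<close>-rank in a given interval.

  Let \<open>2 ^ H\<close> be about \<open>n\<close> and \<open>lam\<close> about \<open>log H\<close>. The \<open>y\<close>-ranks are the leaves of a tree with branching
  \<open>2 ^ a\<close>, each node of which lists its points by \<open>x\<close>-rank without storing them. The point at a given list
  position is recovered by descending to the leaf. A node of height \<open>h\<close> descends in one jump by the largest
  power of \<open>2 ^ a\<close> dividing \<open>h\<close>, so that every jump lowers the digit sum of \<open>h\<close> in base \<open>2 ^ a\<close>; a descent
  then takes about \<open>2 ^ a * lam / a\<close> jumps and all jump tables together have about \<open>2 ^ H * lam / a\<close> words.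

  At the lowest common ancestor of the end points of the \<open>y\<close>-interval, only the two outermost of the at most
  \<open>2 ^ a\<close> relevant children carry a one-sided condition on \<open>y\<close>, one of the form \<open>y \<ge> c\<close> and the other, after reflection, of
  the same form. In such a child one looks for the first list position from a given one on whose point has
  \<open>y \<ge> c\<close>. Lists are cut into blocks of polylogarithmic length. Inside a block, packed positions of maxima
  guide the search. Between blocks it is guided by monotone step functions of few values, so few that all their
  break points fit into one trie whose levels are probed by binary search in a static dictionary, which takes
  about \<open>lam\<^sup>2\<close> steps.

  This gives about \<open>2 ^ H * (lam / a + 1)\<close> words and a query time of \<open>(2 ^ a) ^ 3 * lam\<^sup>2\<close> per point. The second
  structure is \<open>a = 1\<close>, and the first is \<open>a\<close> proportional to \<open>\<epsilon> * lam\<close>.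
\<close>

section \<open>A structured language and its compilation\<close>

text \<open>The three factors \<open>2 ^ a\<close> are three nested scans: over the children of a
  node, over sibling groups inside a block at each of \<open>G\<close> sizes, and over the
  decrements of a digit in every descent. The factor \<open>lam ^ 2\<close> arises twice, from group
  sizes times digits and from a trie search of about \<open>lam\<close> probes, each through
  \<open>lam + 2\<close> levels of the dictionary. The obstacle to small space is that about
  \<open>2 ^ H * H / a\<close> list positions exist over all heights while a word has about
  \<open>H\<close> bits, so a position may cost only about \<open>lam\<close> bits besides those of
  its jump. Hence a maximum is stored as an offset in its block and found by decoding, and a jump
  target as an offset from a base value shared by many positions. Step functions do need words for
  every trie node above a break point, but their number falls in proportion to the block length.
  Blocks of at least \<open>(H + 2) ^ 5\<close> positions make them few enough and keep offsets at
  \<open>O(lam)\<close> bits. The program is fixed while \<open>n\<close> and the number of arrays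
  vary, so it reads all parameters from memory; hash multipliers exist by averaging and are part of
  the data.\<close>

text \<open>\<open>Rd i j\<close> is entry \<open>j\<close> of array \<open>i\<close>.\<close>

datatype exp = V nat | C nat | B binop exp exp | Rd exp exp

fun aop :: "binop \<Rightarrow> nat \<Rightarrow> nat \<Rightarrow> nat" where
  "aop Add x y = x + y"
| "aop Sub x y = x - y"
| "aop Mul x y = x * y"
| "aop Div x y = x div y"
| "aop Mod x y = x mod y"
| "aop And x y = Bit_Operations.and x y"
| "aop Or x y = Bit_Operations.or x y"
| "aop Xor x y = Bit_Operations.xor x y"
| "aop Shl x y = x * 2 ^ y"
| "aop Shr x y = x div 2 ^ y"

text \<open>No overflow, so that machine arithmetic agrees with \<open>aop\<close>.\<close>

fun aok :: "nat \<Rightarrow> binop \<Rightarrow> nat \<Rightarrow> nat \<Rightarrow> bool" where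
  "aok w Add x y = (x + y < 2 ^ w)"
| "aok w Sub x y = (y \<le> x \<and> x < 2 ^ w)"
| "aok w Mul x y = (x * y < 2 ^ w)"
| "aok w Shl x y = (x * 2 ^ y < 2 ^ w)"
| "aok w _ x y = True"

lemma eval_op_aop: "aok w f x y \<Longrightarrow> eval_op w f x y = aop f x y"
proof (cases f)
  case Sub
  moreover assume "aok w f x y"
  ultimately have "y \<le> x" "x < 2 ^ w" by auto
  moreover from this have "x + 2 ^ w - y = (x - y) + 2 ^ w" by simp
  ultimately show ?thesis using Sub by (metis aop.simps(2) eval_op.simps(2) less_imp_diff_less mod_add_self2
        mod_less take_bit_eq_mod)
qed (auto simp: take_bit_eq_mod push_bit_eq_mult drop_bit_eq_div)

fun ev :: "nat list list \<Rightarrow> (nat \<Rightarrow> nat) \<Rightarrow> exp \<Rightarrow> nat" where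
  "ev AA s (V x) = s x"
| "ev AA s (C c) = c"
| "ev AA s (B f a b) = aop f (ev AA s a) (ev AA s b)"
| "ev AA s (Rd a b) = AA ! ev AA s a ! ev AA s b"

fun safe :: "nat \<Rightarrow> nat list list \<Rightarrow> (nat \<Rightarrow> nat) \<Rightarrow> exp \<Rightarrow> bool" where
  "safe w AA s (V x) = True"
| "safe w AA s (C c) = (c < 2 ^ w)"
| "safe w AA s (B f a b) = (safe w AA s a \<and> safe w AA s b \<and> aok w f (ev AA s a) (ev AA s b))"
| "safe w AA s (Rd a b) = (safe w AA s a \<and> safe w AA s b \<and> ev AA s a < length AA \<and>
     ev AA s b < length (AA ! ev AA s a))"

text \<open>Cells \<open>4 * i\<close> to \<open>4 * i + 3\<close> hold the start of array \<open>i\<close>, its number \<open>k\<close> of entries per word, its entry width \<open>d\<close>, and \<open>2 ^ d\<close>.\<close>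

definition lay :: "nat \<Rightarrow> nat list \<Rightarrow> nat list list \<Rightarrow> bool" where
  "lay w m AA \<longleftrightarrow> 3 \<le> w \<and> length m < 2 ^ w \<and> (\<forall>i<length AA. 4 * i + 3 < length m \<and>
     (\<forall>j<length (AA ! i). (j mod (m ! (4*i+1))) * (m ! (4*i+2)) < 2 ^ w \<and>
        m ! (4*i) + j div (m ! (4*i+1)) < length m \<and>
        m ! (m ! (4*i) + j div (m ! (4*i+1))) div 2 ^ ((j mod (m ! (4*i+1))) * (m ! (4*i+2)))
           mod (m ! (4*i+3)) = AA ! i ! j))"

section \<open>Straight-line code, its place in a program, and expressions\<close>

fun exs :: "nat \<Rightarrow> instr list \<Rightarrow> config \<Rightarrow> config option" where
  "exs w [] cf = Some cf"
| "exs w (i # is) cf = Option.bind (exec w i cf) (exs w is)"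

fun straight :: "instr \<Rightarrow> bool" where
  "straight (Jump _) = False"
| "straight (JumpLess _ _ _) = False"
| "straight (JumpEq _ _ _) = False"
| "straight _ = True"

definition code_at :: "instr list \<Rightarrow> nat \<Rightarrow> instr list \<Rightarrow> bool" where
  "code_at P k is \<longleftrightarrow> k + length is \<le> length P \<and> (\<forall>i<length is. P ! (k + i) = is ! i)"

lemma code_at_append:
  "code_at P k (xs @ ys) \<longleftrightarrow> code_at P k xs \<and> code_at P (k + length xs) ys"
proof
  assume l: "code_at P k (xs @ ys)"
  show "code_at P k xs \<and> code_at P (k + length xs) ys"
    unfolding code_at_def
  proof (intro conjI allI impI)
    fix i assume "i < length xs"
    then show "P ! (k + i) = xs ! i"
      using l[unfolded code_at_def, THEN conjunct2, rule_format, of i] by (simp add: nth_append)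
  next
    fix i assume "i < length ys"
    then show "P ! (k + length xs + i) = ys ! i"
      using l[unfolded code_at_def, THEN conjunct2, rule_format, of "length xs + i"]
      by (simp add: nth_append add.assoc)
  qed (use l in \<open>auto simp: code_at_def\<close>)
next
  assume r: "code_at P k xs \<and> code_at P (k + length xs) ys"
  show "code_at P k (xs @ ys)"
    unfolding code_at_def
  proof (intro conjI allI impI)
    fix i assume i: "i < length (xs @ ys)"
    show "P ! (k + i) = (xs @ ys) ! i"
    proof (cases "i < length xs")
      case False
      then show ?thesis
        using i r[unfolded code_at_def, THEN conjunct2, THEN conjunct2, rule_format, of "i - length xs"]
        by (simp add: nth_append)
    qed (use r in \<open>auto simp: code_at_def nth_append\<close>)
  qed (use r in \<open>auto simp: code_at_def\<close>)
qed

lemma code_at_Cons: "code_at P k (x # xs) \<longleftrightarrow> k < length P \<and> P ! k = x \<and> code_at P (Suc k) xs"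
  using code_at_append[of P k "[x]" xs] by (auto simp: code_at_def)

lemma run_add: "run w P (i + j) cf = Option.bind (run w P i cf) (run w P j)"
proof (induction j)
  case 0
  then show ?case by (cases "run w P i cf") auto
next
  case (Suc j)
  then show ?case by (cases "run w P i cf") auto
qed

lemma run_trans: "run w P i cf = Some cf1 \<Longrightarrow> run w P j cf1 = Some cf2 \<Longrightarrow> run w P (i + j) cf = Some cf2"
  by (simp add: run_add)

lemma exec_straight_pc: "straight i \<Longrightarrow> exec w i cf = Some cf' \<Longrightarrow> pc cf' = Suc (pc cf)"
  by (cases i) (auto simp: set_reg_def split: if_splits)

lemma run_exs:
  assumes "code_at P (pc cf) is" "\<forall>i\<in>set is. straight i" "exs w is cf = Some cf'"
  shows "run w P (length is) cf = Some cf'"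
  using assms
proof (induction "is" arbitrary: cf)
  case (Cons i "is")
  obtain cf1 where c1: "exec w i cf = Some cf1" "exs w is cf1 = Some cf'"
    using Cons.prems(3) by (cases "exec w i cf") auto
  have pc1: "pc cf1 = Suc (pc cf)"
    using exec_straight_pc[OF _ c1(1)] Cons.prems(2) by simp
  have "run w P 1 cf = Some cf1"
    using Cons.prems(1) c1(1) by (simp add: code_at_Cons step_def)
  moreover have "run w P (length is) cf1 = Some cf'"
    using Cons.IH[of cf1] Cons.prems c1 pc1 by (simp add: code_at_Cons)
  ultimately show ?case
    using run_trans[of w P 1 cf cf1 "length is" cf'] by simp
qed simp

lemma exs_append: "exs w (xs @ ys) cf = Option.bind (exs w xs cf) (exs w ys)"
proof (induction xs arbitrary: cf)
  case (Cons x xs)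
  then show ?case by (cases "exec w x cf") auto
qed simp

text \<open>The array number is a run-time value, so that a program of fixed length can address a
  number of arrays that grows with \<open>n\<close>. The four header cells of the array are loaded
  first; then the word holding the entry is fetched, shifted by \<open>(j mod k) * d\<close> and
  reduced modulo \<open>2 ^ d\<close>. The odd registers from \<open>2*d+5\<close> on are scratch
  space above the two operands.\<close>

definition read_code :: "nat \<Rightarrow> instr list" where
  "read_code d = [
     LoadConst (2*d+5) 4, Op Mul (2*d+1) (2*d+1) (2*d+5), Load (2*d+7) (2*d+1),
     LoadConst (2*d+5) 1, Op Add (2*d+1) (2*d+1) (2*d+5), Load (2*d+9) (2*d+1),
     Op Add (2*d+1) (2*d+1) (2*d+5), Load (2*d+11) (2*d+1),
     Op Add (2*d+1) (2*d+1) (2*d+5), Load (2*d+13) (2*d+1),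
     Op Div (2*d+15) (2*d+3) (2*d+9), Op Add (2*d+7) (2*d+7) (2*d+15), Load (2*d+7) (2*d+7),
     Op Mod (2*d+15) (2*d+3) (2*d+9), Op Mul (2*d+15) (2*d+15) (2*d+11),
     Op Shr (2*d+7) (2*d+7) (2*d+15), Op Mod (2*d+1) (2*d+7) (2*d+13)]"

text \<open>Variable \<open>x\<close> lives in register \<open>2 * x\<close>; the odd registers form the evaluation stack.\<close>

fun comp :: "exp \<Rightarrow> nat \<Rightarrow> instr list" where
  "comp (V x) d = [Move (2*d+1) (2*x)]"
| "comp (C c) d = [LoadConst (2*d+1) c]"
| "comp (B f a b) d = comp a d @ comp b (Suc d) @ [Op f (2*d+1) (2*d+1) (2*d+3)]"
| "comp (Rd a b) d = comp a d @ comp b (Suc d) @ read_code d"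

lemma straight_comp: "\<forall>i\<in>set (comp e d). straight i"
  by (induction e arbitrary: d) (auto simp: read_code_def)

text \<open>Besides the value at depth \<open>d\<close>, this records what a surrounding expression
  relies on: variables keep their values, and so do all stack entries below \<open>d\<close>, hence
  a left operand survives the evaluation of the right one. Memory and reported list are
  untouched.\<close>

definition evals_to :: "nat \<Rightarrow> instr list \<Rightarrow> nat \<Rightarrow> config \<Rightarrow> nat \<Rightarrow> bool" where
  "evals_to w is d cf v \<longleftrightarrow> (\<exists>rg. exs w is cf = Some (cf\<lparr>pc := pc cf + length is, regs := rg\<rparr>) \<and>
     rg (2*d+1) = v \<and> (\<forall>x. rg (2*x) = regs cf (2*x)) \<and> (\<forall>d'<d. rg (2*d'+1) = regs cf (2*d'+1)))"

lemma read_code_evals: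
  assumes lay: "lay w (cells cf) AA" and i: "i < length AA" and j: "j < length (AA ! i)"
    and ri: "regs cf (2*d+1) = i" and rj: "regs cf (2*d+3) = j"
  shows "evals_to w (read_code d) d cf (AA ! i ! j)"
proof -
  define m where "m = cells cf"
  have L: "3 \<le> w" "length m < 2 ^ w" "4 * i + 3 < length m"
    "(j mod (m ! (4*i+1))) * (m ! (4*i+2)) < 2 ^ w"
    "m ! (4*i) + j div (m ! (4*i+1)) < length m"
    "m ! (m ! (4*i) + j div (m ! (4*i+1))) div 2 ^ ((j mod (m ! (4*i+1))) * (m ! (4*i+2)))
           mod (m ! (4*i+3)) = AA ! i ! j"
    using lay i j by (auto simp: lay_def m_def)
  have w8: "(2::nat)^3 \<le> 2 ^ w" using L(1) by (intro power_increasing) auto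
  \<comment> \<open>None of the intermediate values is truncated; \<open>3 \<le> w\<close> is what
    makes the constant 4 a word.\<close>
  have t: "take_bit w (4::nat) = 4" "take_bit w (Suc 0) = Suc 0" "take_bit w (i * 4) = 4 * i"
    "take_bit w (Suc (4 * i)) = Suc (4*i)" "take_bit w (Suc (Suc (4 * i))) = Suc (Suc (4 * i))"
    "take_bit w (Suc (Suc (Suc (4 * i)))) = 4*i+3"
    "take_bit w (m ! (4*i) + j div (m ! (Suc (4*i)))) = m ! (4*i) + j div (m ! (Suc (4*i)))"
    "take_bit w (j mod (m ! (Suc (4*i))) * (m ! (Suc (Suc (4*i))))) =
       (j mod (m ! (Suc (4*i)))) * (m ! (Suc (Suc (4*i))))"
    using L w8 by (auto simp: take_bit_eq_mod)
  \<comment> \<open>Registers of variables and registers of the stack differ in parity, which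
    settles all register updates in the symbolic execution.\<close>
  have odd_even: "2 * x \<noteq> Suc (2 * d)" for x d :: nat by presburger
  have oe2: "2 * x = 2 * d + k \<longleftrightarrow> False" if "odd k" for x d k :: nat using that by presburger
  define pcf where "pcf = pc cf"
  obtain p r rep where cf: "cf = \<lparr>pc = p, regs = r, cells = m, reported = rep\<rparr>"
    by (cases cf) (auto simp: m_def)
  have rr: "r (Suc (2*d)) = i" "r (2*d+3) = j" using ri rj cf by auto
  show ?thesis
    unfolding evals_to_def read_code_def cf
    using L rr
    by (simp add: t set_reg_def drop_bit_eq_div odd_even oe2)
qed

lemma comp_evals:
  assumes "safe w AA (\<lambda>x. regs cf (2*x)) e" "lay w (cells cf) AA"
  shows "evals_to w (comp e d) d cf (ev AA (\<lambda>x. regs cf (2*x)) e)"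
  using assms
proof (induction e arbitrary: d cf)
  case (V x)
  have "2 * y \<noteq> Suc (2 * d)" for y d :: nat by presburger
  then show ?case
    by (simp add: evals_to_def set_reg_def exI[of _ "(regs cf)(Suc (2 * d) := regs cf (2 * x))"])
next
  case (C c)
  have "2 * y \<noteq> Suc (2 * d)" for y d :: nat by presburger
  with C show ?case
    by (simp add: evals_to_def set_reg_def take_bit_eq_mod exI[of _ "(regs cf)(Suc (2 * d) := c)"])
next
  case (B f a b)
  let ?s = "\<lambda>x. regs cf (2*x)"
  have "evals_to w (comp a d) d cf (ev AA ?s a)" using B by simp
  then obtain rg1 where r1: "exs w (comp a d) cf = Some (cf\<lparr>pc := pc cf + length (comp a d), regs := rg1\<rparr>)"
    "rg1 (2*d+1) = ev AA ?s a" "\<forall>x. rg1 (2*x) = regs cf (2*x)" "\<forall>d'<d. rg1 (2*d'+1) = regs cf (2*d'+1)"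
    by (auto simp: evals_to_def)
  let ?cf1 = "cf\<lparr>pc := pc cf + length (comp a d), regs := rg1\<rparr>"
  have "evals_to w (comp b (Suc d)) (Suc d) ?cf1 (ev AA (\<lambda>x. regs ?cf1 (2*x)) b)"
    using B.IH(2)[of ?cf1 "Suc d"] B.prems r1(3) by simp
  then obtain rg2 where r2: "exs w (comp b (Suc d)) ?cf1 =
      Some (?cf1\<lparr>pc := pc ?cf1 + length (comp b (Suc d)), regs := rg2\<rparr>)"
    "rg2 (2*d+3) = ev AA ?s b" "\<forall>x. rg2 (2*x) = regs cf (2*x)"
    "\<forall>d'<Suc d. rg2 (2*d'+1) = rg1 (2*d'+1)"
    using r1(3) by (auto simp: evals_to_def numeral_3_eq_3)
  have e: "eval_op w f (ev AA ?s a) (ev AA ?s b) = aop f (ev AA ?s a) (ev AA ?s b)"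
    using B.prems by (simp add: eval_op_aop)
  have "rg2 (2*d+1) = ev AA ?s a" using r2(4) r1(2) by simp
  moreover have "2 * x \<noteq> Suc (2 * d)" for x d :: nat by presburger
  moreover have "\<forall>d'<d. rg2 (2*d'+1) = regs cf (2*d'+1)" using r2(4) r1(4) by simp
  ultimately show ?case
    unfolding evals_to_def using r1(1) r2(1-3) e
    by (intro exI[of _ "rg2(Suc (2 * d) := aop f (ev AA ?s a) (ev AA ?s b))"])
      (simp add: exs_append set_reg_def add.assoc)
next
  case (Rd a b)
  let ?s = "\<lambda>x. regs cf (2*x)"
  have "evals_to w (comp a d) d cf (ev AA ?s a)" using Rd by simp
  then obtain rg1 where r1: "exs w (comp a d) cf = Some (cf\<lparr>pc := pc cf + length (comp a d), regs := rg1\<rparr>)"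
    "rg1 (2*d+1) = ev AA ?s a" "\<forall>x. rg1 (2*x) = regs cf (2*x)" "\<forall>d'<d. rg1 (2*d'+1) = regs cf (2*d'+1)"
    by (auto simp: evals_to_def)
  let ?cf1 = "cf\<lparr>pc := pc cf + length (comp a d), regs := rg1\<rparr>"
  have "evals_to w (comp b (Suc d)) (Suc d) ?cf1 (ev AA (\<lambda>x. regs ?cf1 (2*x)) b)"
    using Rd.IH(2)[of ?cf1 "Suc d"] Rd.prems r1(3) by simp
  then obtain rg2 where r2: "exs w (comp b (Suc d)) ?cf1 =
      Some (?cf1\<lparr>pc := pc ?cf1 + length (comp b (Suc d)), regs := rg2\<rparr>)"
    "rg2 (2*d+3) = ev AA ?s b" "\<forall>x. rg2 (2*x) = regs cf (2*x)"
    "\<forall>d'<Suc d. rg2 (2*d'+1) = rg1 (2*d'+1)"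
    using r1(3) by (auto simp: evals_to_def numeral_3_eq_3)
  let ?cf2 = "?cf1\<lparr>pc := pc ?cf1 + length (comp b (Suc d)), regs := rg2\<rparr>"
  have "rg2 (2*d+1) = ev AA ?s a" using r2(4) r1(2) by simp
  then have "evals_to w (read_code d) d ?cf2 (AA ! ev AA ?s a ! ev AA ?s b)"
    using Rd.prems r2 by (intro read_code_evals) auto
  then obtain rg3 where r3: "exs w (read_code d) ?cf2 =
      Some (?cf2\<lparr>pc := pc ?cf2 + length (read_code d), regs := rg3\<rparr>)"
    "rg3 (2*d+1) = AA ! ev AA ?s a ! ev AA ?s b" "\<forall>x. rg3 (2*x) = regs cf (2*x)"
    "\<forall>d'<d. rg3 (2*d'+1) = rg2 (2*d'+1)"
    using r2(3) by (auto simp: evals_to_def)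
  have "\<forall>d'<d. rg3 (2*d'+1) = regs cf (2*d'+1)" using r3(4) r2(4) r1(4) by simp
  then show ?case
    unfolding evals_to_def using r1(1) r2(1) r3
    by (intro exI[of _ rg3]) (simp add: exs_append add.assoc)
qed

section \<open>Control structures, their compilation and their cost\<close>

datatype com = Asg nat exp | Seq com com (infixr ";;" 60) | If exp exp com com | While exp exp com

fun clen :: "com \<Rightarrow> nat" where
  "clen (Asg x e) = length (comp e 0) + 1"
| "clen (c1 ;; c2) = clen c1 + clen c2"
| "clen (If a b c1 c2) = length (comp a 0) + length (comp b 1) + 2 + clen c1 + clen c2"
| "clen (While a b c) = length (comp a 0) + length (comp b 1) + 3 + clen c"

text \<open>Jump targets are absolute, so the load address \<open>k\<close> is a parameter. In a
  conditional the code of the second branch comes first, since \<open>JumpLess\<close> falls through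
  when the comparison fails.\<close>

fun ck :: "nat \<Rightarrow> com \<Rightarrow> instr list" where
  "ck k (Asg x e) = comp e 0 @ [Move (2*x) 1]"
| "ck k (c1 ;; c2) = ck k c1 @ ck (k + clen c1) c2"
| "ck k (If a b c1 c2) = (let l = k + (length (comp a 0) + length (comp b 1)) in
     comp a 0 @ comp b 1 @ [JumpLess 1 3 (l + 2 + clen c2)] @ ck (l + 1) c2 @
     [Jump (l + 2 + clen c2 + clen c1)] @ ck (l + 2 + clen c2) c1)"
| "ck k (While a b c) = (let l = k + (length (comp a 0) + length (comp b 1)) in
     comp a 0 @ comp b 1 @ [JumpLess 1 3 (l + 2), Jump (l + 3 + clen c)] @ ck (l + 2) c @ [Jump k])"

lemma length_ck [simp]: "length (ck k c) = clen c"
  by (induction c arbitrary: k) (auto simp: Let_def)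

text \<open>The cost of a run is its number of loop iterations; the instructions per iteration are bounded by the code length.\<close>

inductive bs :: "nat \<Rightarrow> nat list list \<Rightarrow> com \<Rightarrow> (nat \<Rightarrow> nat) \<Rightarrow> nat \<Rightarrow> (nat \<Rightarrow> nat) \<Rightarrow> bool"
  for w :: nat and AA :: "nat list list" where
  bs_Asg: "safe w AA s e \<Longrightarrow> bs w AA (Asg x e) s 0 (s(x := ev AA s e))"
| bs_Seq: "bs w AA c1 s t1 s1 \<Longrightarrow> bs w AA c2 s1 t2 s2 \<Longrightarrow> bs w AA (c1 ;; c2) s (t1 + t2) s2"
| bs_IfT: "safe w AA s a \<Longrightarrow> safe w AA s b \<Longrightarrow> ev AA s a < ev AA s b \<Longrightarrow> bs w AA c1 s t s' \<Longrightarrow>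
    bs w AA (If a b c1 c2) s t s'"
| bs_IfF: "safe w AA s a \<Longrightarrow> safe w AA s b \<Longrightarrow> \<not> ev AA s a < ev AA s b \<Longrightarrow> bs w AA c2 s t s' \<Longrightarrow>
    bs w AA (If a b c1 c2) s t s'"
| bs_WhileF: "safe w AA s a \<Longrightarrow> safe w AA s b \<Longrightarrow> \<not> ev AA s a < ev AA s b \<Longrightarrow>
    bs w AA (While a b c) s 0 s"
| bs_WhileT: "safe w AA s a \<Longrightarrow> safe w AA s b \<Longrightarrow> ev AA s a < ev AA s b \<Longrightarrow> bs w AA c s t1 s1 \<Longrightarrow>
    bs w AA (While a b c) s1 t2 s2 \<Longrightarrow> bs w AA (While a b c) s (t1 + t2 + 1) s2"

lemma run_comp:
  assumes "code_at P (pc cf) (comp e d)" "safe w AA (\<lambda>x. regs cf (2*x)) e" "lay w (cells cf) AA"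
  obtains rg where "run w P (length (comp e d)) cf = Some (cf\<lparr>pc := pc cf + length (comp e d), regs := rg\<rparr>)"
    "rg (2*d+1) = ev AA (\<lambda>x. regs cf (2*x)) e" "(\<lambda>x. rg (2*x)) = (\<lambda>x. regs cf (2*x))"
    "\<forall>d'<d. rg (2*d'+1) = regs cf (2*d'+1)"
proof -
  obtain rg where rg: "exs w (comp e d) cf = Some (cf\<lparr>pc := pc cf + length (comp e d), regs := rg\<rparr>)"
     "rg (2*d+1) = ev AA (\<lambda>x. regs cf (2*x)) e" "\<forall>x. rg (2*x) = regs cf (2*x)"
    "\<forall>d'<d. rg (2*d'+1) = regs cf (2*d'+1)"
    using comp_evals[OF assms(2,3)] unfolding evals_to_def by blast
  then show ?thesis
    using that[of rg] run_exs[OF assms(1) straight_comp rg(1)] by auto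
qed

lemma run_two_comp:
  assumes "code_at P (pc cf) (comp a 0 @ comp b 1)" "lay w (cells cf) AA"
    "safe w AA (\<lambda>x. regs cf (2*x)) a" "safe w AA (\<lambda>x. regs cf (2*x)) b"
  obtains rg where "run w P (length (comp a 0) + length (comp b 1)) cf =
      Some (cf\<lparr>pc := pc cf + (length (comp a 0) + length (comp b 1)), regs := rg\<rparr>)"
    "rg 1 = ev AA (\<lambda>x. regs cf (2*x)) a" "rg 3 = ev AA (\<lambda>x. regs cf (2*x)) b"
    "(\<lambda>x. rg (2*x)) = (\<lambda>x. regs cf (2*x))"
proof -
  have c: "code_at P (pc cf) (comp a 0)" "code_at P (pc cf + length (comp a 0)) (comp b 1)"
    using assms(1) by (simp_all add: code_at_append)
  obtain r1 where r1: "run w P (length (comp a 0)) cf = Some (cf\<lparr>pc := pc cf + length (comp a 0), regs := r1\<rparr>)"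
    "r1 1 = ev AA (\<lambda>x. regs cf (2*x)) a" "(\<lambda>x. r1 (2*x)) = (\<lambda>x. regs cf (2*x))"
    using run_comp[OF c(1) assms(3,2)] by auto
  let ?cf1 = "cf\<lparr>pc := pc cf + length (comp a 0), regs := r1\<rparr>"
  obtain r2 where r2: "run w P (length (comp b 1)) ?cf1 = Some (?cf1\<lparr>pc := pc ?cf1 + length (comp b 1), regs := r2\<rparr>)"
    "r2 3 = ev AA (\<lambda>x. regs cf (2*x)) b" "(\<lambda>x. r2 (2*x)) = (\<lambda>x. regs cf (2*x))" "r2 1 = r1 1"
    using run_comp[of P ?cf1 b 1 w AA] c(2) assms r1(3) by (auto simp: numeral_3_eq_3)
  show ?thesis
    using that[of r2] run_trans[OF r1(1) r2(1)] r1 r2 by (simp add: add.assoc)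
qed

text \<open>The bound \<open>clen c * (t + 1)\<close> is stable under every rule. In a sequence the
  code lengths add up while either count is at most the total. For an unfolded loop, test and body
  take at most \<open>t1 + 1\<close> times the length of the loop and the remaining iterations at
  most \<open>t2 + 1\<close> times; the iteration counted by \<open>bs\<close> makes the two add
  up.\<close>

theorem compile_correct:
  assumes "bs w AA c s t s'" "code_at P (pc cf) (ck (pc cf) c)" "lay w (cells cf) AA"
    "(\<lambda>x. regs cf (2*x)) = s"
  shows "\<exists>\<tau> rg. \<tau> \<le> clen c * (t + 1) \<and>
    run w P \<tau> cf = Some (cf\<lparr>pc := pc cf + clen c, regs := rg\<rparr>) \<and> (\<lambda>x. rg (2*x)) = s'"
  using assms
proof (induction arbitrary: cf rule: bs.induct)
  case (bs_Asg s e x)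
  have c: "code_at P (pc cf) (comp e 0)" "P ! (pc cf + length (comp e 0)) = Move (2*x) 1"
    "pc cf + length (comp e 0) < length P"
    using bs_Asg.prems by (auto simp: code_at_append code_at_Cons)
  obtain rg where rg: "run w P (length (comp e 0)) cf = Some (cf\<lparr>pc := pc cf + length (comp e 0), regs := rg\<rparr>)"
    "rg (2*0+1) = ev AA (\<lambda>x. regs cf (2*x)) e" "(\<lambda>x. rg (2*x)) = (\<lambda>x. regs cf (2*x))"
    using run_comp[OF c(1) _ bs_Asg.prems(2)] bs_Asg by metis
  let ?cf1 = "cf\<lparr>pc := pc cf + length (comp e 0), regs := rg\<rparr>"
  have "run w P 1 ?cf1 = Some (?cf1\<lparr>pc := pc cf + length (comp e 0) + 1, regs := rg(2*x := rg 1)\<rparr>)"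
    using c by (simp add: step_def set_reg_def)
  note r = run_trans[OF rg(1) this]
  show ?case
    apply (intro exI[of _ "length (comp e 0) + 1"] exI[of _ "rg(2*x := rg 1)"])
    using r rg bs_Asg.prems by (auto simp: fun_eq_iff)
next
  case (bs_Seq c1 s t1 s1 c2 t2 s2)
  have c: "code_at P (pc cf) (ck (pc cf) c1)" "code_at P (pc cf + clen c1) (ck (pc cf + clen c1) c2)"
    using bs_Seq.prems by (auto simp: code_at_append)
  obtain \<tau>1 r1 where 1: "\<tau>1 \<le> clen c1 * (t1 + 1)"
     "run w P \<tau>1 cf = Some (cf\<lparr>pc := pc cf + clen c1, regs := r1\<rparr>)" "(\<lambda>x. r1 (2*x)) = s1"
    using bs_Seq.IH(1)[OF c(1) bs_Seq.prems(2,3)] by auto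
  let ?cf1 = "cf\<lparr>pc := pc cf + clen c1, regs := r1\<rparr>"
  obtain \<tau>2 r2 where 2: "\<tau>2 \<le> clen c2 * (t2 + 1)"
     "run w P \<tau>2 ?cf1 = Some (?cf1\<lparr>pc := pc ?cf1 + clen c2, regs := r2\<rparr>)" "(\<lambda>x. r2 (2*x)) = s2"
    using bs_Seq.IH(2)[of ?cf1] c(2) bs_Seq.prems(2) 1(3) by auto
  have "\<tau>1 + \<tau>2 \<le> clen (c1 ;; c2) * (t1 + t2 + 1)"
    using 1(1) 2(1) by (simp add: algebra_simps)
  then show ?case
    using run_trans[OF 1(2) 2(2)] 2(3) by (intro exI[of _ "\<tau>1 + \<tau>2"] exI[of _ r2]) (auto simp: add.assoc)
next
  case (bs_IfT s a b c1 t s' c2)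
  let ?l = "pc cf + (length (comp a 0) + length (comp b 1))"
  have c: "code_at P (pc cf) (comp a 0 @ comp b 1)" "?l < length P"
    "P ! ?l = JumpLess 1 3 (?l + 2 + clen c2)"
    "code_at P (?l + 2 + clen c2) (ck (?l + 2 + clen c2) c1)"
    using bs_IfT.prems(1) by (simp_all add: Let_def code_at_append code_at_Cons add.assoc)
  obtain rg where rg: "run w P (length (comp a 0) + length (comp b 1)) cf = Some (cf\<lparr>pc := ?l, regs := rg\<rparr>)"
    "rg 1 = ev AA s a" "rg 3 = ev AA s b" "(\<lambda>x. rg (2*x)) = s"
    using run_two_comp[OF c(1) bs_IfT.prems(2), of thesis] bs_IfT by auto
  have "run w P 1 (cf\<lparr>pc := ?l, regs := rg\<rparr>) = Some (cf\<lparr>pc := ?l + 2 + clen c2, regs := rg\<rparr>)"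
    using c rg bs_IfT.hyps by (simp add: step_def)
  note r1 = run_trans[OF rg(1) this]
  obtain \<tau> r2 where 2: "\<tau> \<le> clen c1 * (t + 1)"
     "run w P \<tau> (cf\<lparr>pc := ?l + 2 + clen c2, regs := rg\<rparr>) =
        Some (cf\<lparr>pc := ?l + 2 + clen c2 + clen c1, regs := r2\<rparr>)" "(\<lambda>x. r2 (2*x)) = s'"
    using bs_IfT.IH[of "cf\<lparr>pc := ?l + 2 + clen c2, regs := rg\<rparr>"] c(4) bs_IfT.prems(2) rg(4) by auto
  show ?case
    using run_trans[OF r1 2(2)] 2(1,3)
    by (intro exI[of _ "length (comp a 0) + length (comp b 1) + 1 + \<tau>"] exI[of _ r2])
       (auto simp: algebra_simps)
next
  case (bs_IfF s a b c2 t s' c1)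
  let ?l = "pc cf + (length (comp a 0) + length (comp b 1))"
  have c: "code_at P (pc cf) (comp a 0 @ comp b 1)" "?l < length P"
    "P ! ?l = JumpLess 1 3 (?l + 2 + clen c2)"
    "code_at P (?l + 1) (ck (?l + 1) c2)" "?l + 1 + clen c2 < length P"
    "P ! (?l + 1 + clen c2) = Jump (?l + 2 + clen c2 + clen c1)"
    using bs_IfF.prems(1) by (simp_all add: Let_def code_at_append code_at_Cons add.assoc)
  obtain rg where rg: "run w P (length (comp a 0) + length (comp b 1)) cf = Some (cf\<lparr>pc := ?l, regs := rg\<rparr>)"
    "rg 1 = ev AA s a" "rg 3 = ev AA s b" "(\<lambda>x. rg (2*x)) = s"
    using run_two_comp[OF c(1) bs_IfF.prems(2), of thesis] bs_IfF by auto
  have "run w P 1 (cf\<lparr>pc := ?l, regs := rg\<rparr>) = Some (cf\<lparr>pc := ?l + 1, regs := rg\<rparr>)"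
    using c rg bs_IfF.hyps by (simp add: step_def)
  note r1 = run_trans[OF rg(1) this]
  obtain \<tau> r2 where 2: "\<tau> \<le> clen c2 * (t + 1)"
     "run w P \<tau> (cf\<lparr>pc := ?l + 1, regs := rg\<rparr>) =
        Some (cf\<lparr>pc := ?l + 1 + clen c2, regs := r2\<rparr>)" "(\<lambda>x. r2 (2*x)) = s'"
    using bs_IfF.IH[of "cf\<lparr>pc := ?l + 1, regs := rg\<rparr>"] c(4) bs_IfF.prems(2) rg(4) by auto
  have "run w P 1 (cf\<lparr>pc := ?l + 1 + clen c2, regs := r2\<rparr>) =
     Some (cf\<lparr>pc := ?l + 2 + clen c2 + clen c1, regs := r2\<rparr>)"
    using c by (simp add: step_def)
  note r3 = run_trans[OF run_trans[OF r1 2(2)] this]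
  show ?case
    using r3 2(1,3)
    by (intro exI[of _ "length (comp a 0) + length (comp b 1) + 1 + \<tau> + 1"] exI[of _ r2])
       (auto simp: algebra_simps)
next
  case (bs_WhileF s a b c)
  let ?l = "pc cf + (length (comp a 0) + length (comp b 1))"
  have c: "code_at P (pc cf) (comp a 0 @ comp b 1)" "?l < length P"
    "P ! ?l = JumpLess 1 3 (?l + 2)" "?l + 1 < length P"
    "P ! (?l + 1) = Jump (?l + 3 + clen c)"
    using bs_WhileF.prems(1) by (simp_all add: Let_def code_at_append code_at_Cons add.assoc)
  obtain rg where rg: "run w P (length (comp a 0) + length (comp b 1)) cf = Some (cf\<lparr>pc := ?l, regs := rg\<rparr>)"
    "rg 1 = ev AA s a" "rg 3 = ev AA s b" "(\<lambda>x. rg (2*x)) = s"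
    using run_two_comp[OF c(1) bs_WhileF.prems(2), of thesis] bs_WhileF by auto
  have "run w P 1 (cf\<lparr>pc := ?l, regs := rg\<rparr>) = Some (cf\<lparr>pc := ?l + 1, regs := rg\<rparr>)"
    using c rg bs_WhileF.hyps by (simp add: step_def)
  moreover have "run w P 1 (cf\<lparr>pc := ?l + 1, regs := rg\<rparr>) = Some (cf\<lparr>pc := ?l + 3 + clen c, regs := rg\<rparr>)"
    using c by (simp add: step_def)
  ultimately have "run w P (length (comp a 0) + length (comp b 1) + 1 + 1) cf =
      Some (cf\<lparr>pc := ?l + 3 + clen c, regs := rg\<rparr>)"
    using run_trans[OF run_trans[OF rg(1)]] by blast
  then show ?case
    using rg(4)
    by (intro exI[of _ "length (comp a 0) + length (comp b 1) + 1 + 1"] exI[of _ rg])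
       (auto simp: algebra_simps)
next
  case (bs_WhileT s a b c t1 s1 t2 s2)
  let ?l = "pc cf + (length (comp a 0) + length (comp b 1))"
  have c: "code_at P (pc cf) (comp a 0 @ comp b 1)" "?l < length P"
    "P ! ?l = JumpLess 1 3 (?l + 2)"
    "code_at P (?l + 2) (ck (?l + 2) c)" "?l + 2 + clen c < length P"
    "P ! (?l + 2 + clen c) = Jump (pc cf)"
    using bs_WhileT.prems(1) by (simp_all add: Let_def code_at_append code_at_Cons add.assoc)
  obtain rg where rg: "run w P (length (comp a 0) + length (comp b 1)) cf = Some (cf\<lparr>pc := ?l, regs := rg\<rparr>)"
    "rg 1 = ev AA s a" "rg 3 = ev AA s b" "(\<lambda>x. rg (2*x)) = s"
    using run_two_comp[OF c(1) bs_WhileT.prems(2), of thesis] bs_WhileT by auto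
  have "run w P 1 (cf\<lparr>pc := ?l, regs := rg\<rparr>) = Some (cf\<lparr>pc := ?l + 2, regs := rg\<rparr>)"
    using c rg bs_WhileT.hyps by (simp add: step_def)
  note r1 = run_trans[OF rg(1) this]
  obtain \<tau> r2 where 2: "\<tau> \<le> clen c * (t1 + 1)"
     "run w P \<tau> (cf\<lparr>pc := ?l + 2, regs := rg\<rparr>) =
        Some (cf\<lparr>pc := ?l + 2 + clen c, regs := r2\<rparr>)" "(\<lambda>x. r2 (2*x)) = s1"
    using bs_WhileT.IH(1)[of "cf\<lparr>pc := ?l + 2, regs := rg\<rparr>"] c(4) bs_WhileT.prems(2) rg(4) by auto
  have "run w P 1 (cf\<lparr>pc := ?l + 2 + clen c, regs := r2\<rparr>) = Some (cf\<lparr>regs := r2\<rparr>)"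
    using c by (simp add: step_def)
  note r3 = run_trans[OF run_trans[OF r1 2(2)] this]
  obtain \<tau>' r3 where 3: "\<tau>' \<le> clen (While a b c) * (t2 + 1)"
     "run w P \<tau>' (cf\<lparr>regs := r2\<rparr>) =
        Some (cf\<lparr>pc := pc cf + clen (While a b c), regs := r3\<rparr>)" "(\<lambda>x. r3 (2*x)) = s2"
    using bs_WhileT.IH(2)[of "cf\<lparr>regs := r2\<rparr>"] bs_WhileT.prems(1,2) 2(3) by auto
  have "length (comp a 0) + length (comp b 1) + 1 + \<tau> + 1 \<le> clen (While a b c) * (t1 + 1)"
    using 2(1) by (simp add: algebra_simps)
  then show ?case
    using run_trans[OF r3 3(2)] 3(1,3)
    by (intro exI[of _ "length (comp a 0) + length (comp b 1) + 1 + \<tau> + 1 + \<tau>'"] exI[of _ r3])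
       (auto simp: algebra_simps)
qed

text \<open>Total correctness with a budget: some run takes at most \<open>n\<close> iterations and
  ends in \<open>Q\<close>. Since the postcondition is a predicate on states, a sequence nests one
  \<open>tr\<close> inside another, and routines can be specified in continuation style, by what
  they guarantee to an arbitrary \<open>Q\<close>.\<close>

definition tr :: "nat \<Rightarrow> nat list list \<Rightarrow> com \<Rightarrow> (nat \<Rightarrow> nat) \<Rightarrow> nat \<Rightarrow> ((nat \<Rightarrow> nat) \<Rightarrow> bool) \<Rightarrow> bool" where
  "tr w AA c s n Q \<longleftrightarrow> (\<exists>t s'. bs w AA c s t s' \<and> t \<le> n \<and> Q s')"

lemma tr_Asg: "safe w AA s e \<Longrightarrow> Q (s(x := ev AA s e)) \<Longrightarrow> tr w AA (Asg x e) s n Q"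
  unfolding tr_def using bs_Asg by blast

lemma tr_Seq:
  assumes "tr w AA c1 s n1 (\<lambda>s'. tr w AA c2 s' n2 Q)" "n1 + n2 \<le> n"
  shows "tr w AA (c1 ;; c2) s n Q"
proof -
  obtain t s' t2 s2 where "bs w AA c1 s t s'" "t \<le> n1" "bs w AA c2 s' t2 s2" "t2 \<le> n2" "Q s2"
    using assms(1) unfolding tr_def by blast
  then show ?thesis
    using assms(2) unfolding tr_def by (intro exI[of _ "t + t2"] exI[of _ s2]) (auto intro: bs_Seq)
qed

lemma tr_AsgSeq:
  "safe w AA s e \<Longrightarrow> tr w AA c (s(x := ev AA s e)) n Q \<Longrightarrow> tr w AA (Asg x e ;; c) s n Q"
  by (rule tr_Seq[of _ _ _ _ 0 _ n]) (auto intro: tr_Asg)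

lemma tr_If:
  assumes "safe w AA s a" "safe w AA s b"
    "ev AA s a < ev AA s b \<Longrightarrow> tr w AA c1 s n Q" "\<not> ev AA s a < ev AA s b \<Longrightarrow> tr w AA c2 s n Q"
  shows "tr w AA (If a b c1 c2) s n Q"
  using assms unfolding tr_def by (cases "ev AA s a < ev AA s b") (blast intro: bs_IfT bs_IfF)+

text \<open>The variant \<open>\<mu>\<close> bounds the number of iterations, each of which costs at
  most \<open>k\<close> for its body and 1 for itself.\<close>

lemma tr_While:
  assumes "I s"
    and safe: "\<And>s. I s \<Longrightarrow> safe w AA s a \<and> safe w AA s b"
    and body: "\<And>s. I s \<Longrightarrow> ev AA s a < ev AA s b \<Longrightarrow> tr w AA c s k (\<lambda>s'. I s' \<and> \<mu> s' < \<mu> s)"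
    and n: "(k + 1) * \<mu> s \<le> n"
    and Q: "\<And>s'. I s' \<Longrightarrow> \<not> ev AA s' a < ev AA s' b \<Longrightarrow> Q s'"
  shows "tr w AA (While a b c) s n Q"
proof -
  have "\<exists>t s'. bs w AA (While a b c) s t s' \<and> t \<le> (k + 1) * \<mu> s \<and> I s' \<and> \<not> ev AA s' a < ev AA s' b"
    using assms(1)
  proof (induction "\<mu> s" arbitrary: s rule: less_induct)
    case less
    show ?case
    proof (cases "ev AA s a < ev AA s b")
      case False
      then show ?thesis using safe[OF less.prems] less.prems bs_WhileF by (metis zero_le)
    next
      case True
      obtain t s' where 1: "bs w AA c s t s'" "t \<le> k" "I s'" "\<mu> s' < \<mu> s"
        using body[OF less.prems True] unfolding tr_def by blast
      obtain t' s'' where 2: "bs w AA (While a b c) s' t' s''" "t' \<le> (k + 1) * \<mu> s'" "I s''"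
         "\<not> ev AA s'' a < ev AA s'' b"
        using less.hyps[OF 1(4,3)] by blast
      have "(k + 1) * \<mu> s' + (k + 1) \<le> (k + 1) * \<mu> s"
        using 1(4) by (metis add_mult_distrib2 mult.right_neutral mult_le_mono2 Suc_eq_plus1 Suc_leI)
      then have "t + t' + 1 \<le> (k + 1) * \<mu> s" using 1 2 by linarith
      then show ?thesis using bs_WhileT[OF _ _ True 1(1) 2(1)] safe[OF less.prems] 2 by blast
    qed
  qed
  then show ?thesis using n Q unfolding tr_def by (meson order_trans)
qed

section \<open>Packed arrays\<close>

fun packw :: "nat \<Rightarrow> nat list \<Rightarrow> nat" where
  "packw d [] = 0"
| "packw d (v # vs) = v + 2 ^ d * packw d vs"

lemma packw_less: "\<forall>v\<in>set vs. v < 2 ^ d \<Longrightarrow> packw d vs < 2 ^ (d * length vs)"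
proof (induction vs)
  case (Cons v vs)
  have "packw d vs + 1 \<le> 2 ^ (d * length vs)" using Cons by simp
  then have "2 ^ d * (packw d vs + 1) \<le> 2 ^ d * 2 ^ (d * length vs)" by (rule mult_le_mono2)
  moreover have "v < 2 ^ d" using Cons.prems by simp
  ultimately have "v + 2 ^ d * packw d vs < 2 ^ d * 2 ^ (d * length vs)"
    unfolding distrib_left by linarith
  then show ?case by (simp add: power_add)
qed simp

lemma packw_nth: "\<forall>v\<in>set vs. v < 2 ^ d \<Longrightarrow> r < length vs \<Longrightarrow> packw d vs div 2 ^ (r * d) mod 2 ^ d = vs ! r"
proof (induction vs arbitrary: r)
  case (Cons v vs)
  show ?case
  proof (cases r)
    case 0
    then show ?thesis using Cons.prems by simp
  next
    case (Suc q)
    have "(v + 2 ^ d * packw d vs) div 2 ^ (d + q * d) = (v + 2 ^ d * packw d vs) div 2 ^ d div 2 ^ (q * d)"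
      by (simp add: power_add div_mult2_eq)
    also have "(v + 2 ^ d * packw d vs) div 2 ^ d = packw d vs" using Cons.prems by simp
    finally show ?thesis using Cons Suc by simp
  qed
qed simp

text \<open>Each word takes \<open>w div d\<close> entries, the first one in the lowest bits. One
  word more than the quotient of lengths is allotted, in place of rounding up.\<close>

definition packs :: "nat \<Rightarrow> nat \<Rightarrow> nat list \<Rightarrow> nat list" where
  "packs w d vs = map (\<lambda>q. packw d (take (w div d) (drop (q * (w div d)) vs)))
      [0..<length vs div (w div d) + 1]"

lemma packs_nth:
  assumes "\<forall>v\<in>set vs. v < 2 ^ d" "0 < d" "d \<le> w" "j < length vs"
  defines "c \<equiv> w div d"
  shows "j div c < length (packs w d vs)"
    "packs w d vs ! (j div c) div 2 ^ ((j mod c) * d) mod 2 ^ d = vs ! j"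
proof -
  have c: "0 < c" using assms by (simp add: c_def div_greater_zero_iff)
  show l: "j div c < length (packs w d vs)"
    using assms(4) by (simp add: packs_def c_def div_le_mono less_Suc_eq_le)
  have jc: "j div c * c + j mod c = j" by simp
  let ?u = "take c (drop (j div c * c) vs)"
  have "j mod c < length vs - j div c * c" using jc assms(4) by linarith
  then have r: "j mod c < length ?u" using c by simp
  have "packw d ?u div 2 ^ ((j mod c) * d) mod 2 ^ d = ?u ! (j mod c)"
    using assms(1) r by (intro packw_nth) (auto dest: in_set_takeD in_set_dropD)
  also have "\<dots> = vs ! j" using r jc assms(4) c by (simp add: add.commute)
  finally show "packs w d vs ! (j div c) div 2 ^ ((j mod c) * d) mod 2 ^ d = vs ! j"
    using l by (simp add: packs_def c_def del: upt_Suc)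
qed

lemma packs_less:
  assumes "\<forall>v\<in>set vs. v < 2 ^ d" "x \<in> set (packs w d vs)"
  shows "x < 2 ^ w"
proof -
  obtain q where x: "x = packw d (take (w div d) (drop (q * (w div d)) vs))"
    using assms(2) by (auto simp: packs_def)
  have "x < 2 ^ (d * length (take (w div d) (drop (q * (w div d)) vs)))"
    unfolding x using assms(1) by (intro packw_less) (auto dest: in_set_takeD in_set_dropD)
  also have "\<dots> \<le> 2 ^ (d * (w div d))" by (intro power_increasing mult_le_mono2) auto
  also have "\<dots> \<le> 2 ^ w" by (intro power_increasing) (auto simp: div_times_less_eq_dividend)
  finally show ?thesis .
qed

lemma nth_concat_off:
  "i < length xss \<Longrightarrow> q < length (xss ! i) \<Longrightarrow>
   sum_list (map length (take i xss)) + q < length (concat xss) \<and>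
   concat xss ! (sum_list (map length (take i xss)) + q) = xss ! i ! q"
proof (induction xss arbitrary: i)
  case (Cons xs xss)
  then show ?case by (cases i) (auto simp: nth_append)
qed simp

text \<open>The header comes first, because the program must find the four cells of array
  \<open>i\<close> at \<open>4 * i\<close> without further information; the packed arrays follow one
  after another.\<close>

definition mem_of :: "nat \<Rightarrow> (nat \<times> nat list) list \<Rightarrow> nat list" where
  "mem_of w ds = (let bl = map (\<lambda>(d, vs). packs w d vs) ds in
     concat (map (\<lambda>i. [4 * length ds + sum_list (map length (take i bl)), w div fst (ds ! i),
        fst (ds ! i), 2 ^ fst (ds ! i)]) [0..<length ds]) @ concat bl)"

lemma nth_concat_4:
  assumes "i < n" "r < 4"
  shows "concat (map (\<lambda>i. [f i, g i, h i, k i]) [0..<n]) ! (4 * i + r) = [f i, g i, h i, k i] ! r"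
  using assms
proof (induction n)
  case (Suc n)
  have l: "length (concat (map (\<lambda>i. [f i, g i, h i, k i]) [0..<m])) = 4 * m" for m
    by (induction m) auto
  show ?case
  proof (cases "i < n")
    case True
    then show ?thesis using Suc l[of n] by (simp add: nth_append)
  next
    case False
    then have "i = n" using Suc.prems by simp
    then show ?thesis using l[of n] by (simp add: nth_append)
  qed
qed simp

lemma length_concat_4: "length (concat (map (\<lambda>i. [f i, g i, h i, k i]) [0..<n])) = 4 * n"
  by (induction n) auto

lemma length_mem_of:
  "length (mem_of w ds) = 4 * length ds + (\<Sum>(d, vs)\<leftarrow>ds. length vs div (w div d) + 1)"
  unfolding mem_of_def Let_def length_append length_concat_4
  by (simp add: length_concat comp_def case_prod_unfold packs_def)

text \<open>The width is strictly below \<open>w\<close> because \<open>2 ^ d\<close> is itself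
  stored in a header cell.\<close>

lemma mem_of_lay:
  assumes d: "\<forall>(d, vs)\<in>set ds. 0 < d \<and> d < w \<and> (\<forall>v\<in>set vs. v < 2 ^ d)"
    and w: "3 \<le> w" and len: "length (mem_of w ds) < 2 ^ w"
  shows "lay w (mem_of w ds) (map snd ds)" and "\<forall>v\<in>set (mem_of w ds). v < 2 ^ w"
proof -
  define bl where "bl = map (\<lambda>(d, vs). packs w d vs) ds"
  define hd where "hd = concat (map (\<lambda>i. [4 * length ds + sum_list (map length (take i bl)), w div fst (ds ! i),
        fst (ds ! i), 2 ^ fst (ds ! i)]) [0..<length ds])"
  have m: "mem_of w ds = hd @ concat bl" by (simp add: mem_of_def bl_def hd_def Let_def)
  have lhd: "length hd = 4 * length ds" by (simp add: hd_def length_concat_4)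
  have H: "mem_of w ds ! (4 * i + r) = [4 * length ds + sum_list (map length (take i bl)), w div fst (ds ! i),
        fst (ds ! i), 2 ^ fst (ds ! i)] ! r" if "i < length ds" "r < 4" for i r
    using that nth_concat_4[OF that] lhd unfolding m by (simp add: nth_append hd_def)
  have H0: "mem_of w ds ! (4*i) = 4 * length ds + sum_list (map length (take i bl))"
    and H1: "mem_of w ds ! (4*i+1) = w div fst (ds ! i)" and H2: "mem_of w ds ! (4*i+2) = fst (ds ! i)"
    and H3: "mem_of w ds ! (4*i+3) = 2 ^ fst (ds ! i)" if "i < length ds" for i
    using H[OF that, of 0] H[OF that, of 1] H[OF that, of 2] H[OF that, of 3] by simp_all
  show "lay w (mem_of w ds) (map snd ds)"
    unfolding lay_def
  proof (intro conjI allI impI)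
    fix i assume i: "i < length (map snd ds)"
    then show "4 * i + 3 < length (mem_of w ds)" using lhd m by simp
    fix j assume j: "j < length (map snd ds ! i)"
    obtain d vs where dv: "ds ! i = (d, vs)" by fastforce
    have i': "i < length ds" using i by simp
    have D: "0 < d" "d < w" "\<forall>v\<in>set vs. v < 2 ^ d" using d i' dv nth_mem[OF i'] by auto
    have j': "j < length vs" using j i' dv by simp
    have b: "bl ! i = packs w d vs" using dv i' by (simp add: bl_def)
    note p = packs_nth[OF D(3,1) _ j', of w]
    have p1: "j div (w div d) < length (bl ! i)" and
      p2: "bl ! i ! (j div (w div d)) div 2 ^ ((j mod (w div d)) * d) mod 2 ^ d = vs ! j"
      using p D b by auto
    have ib: "i < length bl" using i' by (simp add: bl_def)
    note c = nth_concat_off[OF ib p1]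
    have "0 < w div d" using D by (simp add: div_greater_zero_iff)
    then have "j mod (w div d) < w div d" by simp
    then have "j mod (w div d) * d \<le> w div d * d" by (intro mult_le_mono1) simp
    also have "\<dots> \<le> w" by simp
    also have "w < 2 ^ w" by simp
    finally show "j mod mem_of w ds ! (4 * i + 1) * mem_of w ds ! (4 * i + 2) < 2 ^ w"
      unfolding H1[OF i'] H2[OF i'] dv by simp
    show "mem_of w ds ! (4 * i) + j div mem_of w ds ! (4 * i + 1) < length (mem_of w ds)"
      unfolding H0[OF i'] H1[OF i'] dv using c lhd by (simp add: m)
    show "mem_of w ds ! (mem_of w ds ! (4 * i) + j div mem_of w ds ! (4 * i + 1)) div
       2 ^ (j mod mem_of w ds ! (4 * i + 1) * mem_of w ds ! (4 * i + 2)) mod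
       mem_of w ds ! (4 * i + 3) = map snd ds ! i ! j"
    proof -
      have "mem_of w ds ! (4 * length ds + sum_list (map length (take i bl)) + j div (w div d)) =
        bl ! i ! (j div (w div d))"
        using c lhd unfolding m by (simp add: nth_append)
      then show ?thesis unfolding H0[OF i'] H1[OF i'] H2[OF i'] H3[OF i'] dv using p2 i' dv by simp
    qed
  qed (use w len in auto)
  show "\<forall>v\<in>set (mem_of w ds). v < 2 ^ w"
  proof
    fix v assume "v \<in> set (mem_of w ds)"
    then consider "v \<in> set hd" | "v \<in> set (concat bl)" unfolding m by auto
    then show "v < 2 ^ w"
    proof cases
      case 1
      then obtain i where i: "i < length ds" and
        v: "v = 4 * length ds + sum_list (map length (take i bl)) \<or> v = w div fst (ds ! i) \<or>
          v = fst (ds ! i) \<or> v = 2 ^ fst (ds ! i)"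
        unfolding hd_def by auto
      have D: "0 < fst (ds ! i)" "fst (ds ! i) < w" using d nth_mem[OF i] by (auto simp: case_prod_unfold)
      have "sum_list (map length (take i bl)) + sum_list (map length (drop i bl)) = sum_list (map length bl)"
        by (metis append_take_drop_id map_append sum_list_append)
      then have "sum_list (map length (take i bl)) \<le> length (concat bl)"
        by (simp add: length_concat)
      then have "4 * length ds + sum_list (map length (take i bl)) < 2 ^ w"
        using len lhd unfolding m by simp
      moreover have "w div fst (ds ! i) < 2 ^ w"
        by (rule le_less_trans[OF div_le_dividend]) simp
      moreover have "fst (ds ! i) < 2 ^ w" using D less_trans[OF D(2), of "2 ^ w"] by simp
      moreover have "(2::nat) ^ fst (ds ! i) < 2 ^ w" using D by (intro power_strict_increasing) auto
      ultimately show ?thesis using v by auto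
    next
      case 2
      then obtain e vs where "(e, vs) \<in> set ds" "v \<in> set (packs w e vs)" by (auto simp: bl_def)
      then show ?thesis using d packs_less by blast
    qed
  qed
qed

section \<open>A static dictionary\<close>

text \<open>Multiplicative hashing of keys below \<open>Q\<close> into \<open>R\<close> slots: the
  residues modulo \<open>Q * R\<close> are cut into \<open>R\<close> windows of length
  \<open>Q\<close>, and the slot is the window into which \<open>a * x\<close> falls.\<close>

definition hsh :: "nat \<Rightarrow> nat \<Rightarrow> nat \<Rightarrow> nat \<Rightarrow> nat" where
  "hsh Q R a x = (a * x mod (Q * R)) div Q"

lemma hsh_less: "0 < Q \<Longrightarrow> 0 < R \<Longrightarrow> hsh Q R a x < R"
  unfolding hsh_def by (simp add: less_mult_imp_div_less mult.commute)

lemma card_multiples_in_window: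
  fixes d l Q :: nat
  assumes "0 < d"
  shows "finite {a. l \<le> a * d \<and> a * d < l + Q}" "card {a. l \<le> a * d \<and> a * d < l + Q} \<le> Q div d + 1"
proof -
  let ?A = "{a. l \<le> a * d \<and> a * d < l + Q}"
  show fin: "finite ?A"
  proof (rule finite_subset)
    show "?A \<subseteq> {..<l + Q}"
    proof
      fix a assume "a \<in> ?A"
      then have "a * d < l + Q" by simp
      moreover have "a \<le> a * d" using assms by simp
      ultimately show "a \<in> {..<l + Q}" unfolding lessThan_iff by linarith
    qed
  qed simp
  show "card ?A \<le> Q div d + 1"
  proof (cases "?A = {}")
    case False
    define a0 where "a0 = Min ?A"
    have a0: "a0 \<in> ?A" "\<And>a. a \<in> ?A \<Longrightarrow> a0 \<le> a"
      unfolding a0_def by (rule Min_in[OF fin False], rule Min_le[OF fin])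
    have "?A \<subseteq> {a0..a0 + Q div d}"
    proof
      fix a assume a: "a \<in> ?A"
      have "(a - a0) * d < Q" using a a0 by (auto simp: diff_mult_distrib)
      then have "a - a0 \<le> Q div d" using assms by (simp add: less_eq_div_iff_mult_less_eq)
      then show "a \<in> {a0..a0 + Q div d}" using a0(2)[OF a] by auto
    qed
    then have "card ?A \<le> card {a0..a0 + Q div d}" by (intro card_mono) auto
    then show ?thesis by simp
  next
    case True
    then show ?thesis by (metis card.empty zero_le)
  qed
qed

text \<open>While \<open>a\<close> runs below \<open>M\<close>, the product \<open>a * d\<close>
  sweeps over \<open>d\<close> periods of length \<open>M\<close>. In each of them the window
  contains at most \<open>Q div d + 1\<close> multiples of \<open>d\<close>, in total at most
  \<open>Q + d\<close>, and \<open>d \<le> Q\<close>.\<close>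

lemma card_mod_window:
  fixes d M Q u :: nat
  assumes d: "0 < d" "d \<le> Q" and u: "u + Q \<le> M"
  shows "card {a. a < M \<and> u \<le> a * d mod M \<and> a * d mod M < u + Q} \<le> 2 * Q"
proof -
  let ?W = "\<lambda>q. {a. q * M + u \<le> a * d \<and> a * d < q * M + u + Q}"
  let ?A = "{a. a < M \<and> u \<le> a * d mod M \<and> a * d mod M < u + Q}"
  have sub: "?A \<subseteq> (\<Union>q<d. ?W q)"
  proof
    fix a assume a: "a \<in> ?A"
    have M: "0 < M" using a by auto
    have "a * d < M * d" using a d by simp
    then have "a * d div M < d" using M by (simp add: less_mult_imp_div_less mult.commute)
    moreover have "a * d div M * M + a * d mod M = a * d" by (rule div_mult_mod_eq)
    moreover have "u \<le> a * d mod M" "a * d mod M < u + Q" using a by auto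
    ultimately have "a * d div M < d" "a \<in> ?W (a * d div M)" by (simp_all only: mem_Collect_eq, linarith)
    then show "a \<in> (\<Union>q<d. ?W q)" by blast
  qed
  have "card ?A \<le> card (\<Union>q<d. ?W q)"
    using sub card_multiples_in_window(1)[OF d(1)] by (intro card_mono) auto
  also have "\<dots> \<le> (\<Sum>q<d. card (?W q))" by (rule card_UN_le) simp
  also have "\<dots> \<le> (\<Sum>q<d. Q div d + 1)"
    using card_multiples_in_window(2)[OF d(1)] by (intro sum_mono)
  also have "\<dots> = d * (Q div d) + d" by simp
  also have "\<dots> \<le> 2 * Q" using d(2) mult_div_mod_eq[of d Q] by linarith
  finally show ?thesis .
qed

text \<open>Two keys share a slot only if the residues of \<open>a * x\<close> and
  \<open>a * y\<close> differ by less than \<open>Q\<close>, so that \<open>a * (y - x)\<close>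
  falls into the first or the last window of length \<open>Q\<close>; each of these is met by at
  most \<open>2 * Q\<close> multipliers.\<close>

lemma card_collisions:
  assumes xy: "x < y" "y < Q" and R: "0 < R"
  shows "card {a. a < Q * R \<and> hsh Q R a x = hsh Q R a y} \<le> 4 * Q"
proof -
  let ?M = "Q * R" and ?d = "y - x"
  have Q: "0 < Q" "Q \<le> ?M" using xy R by auto
  let ?A1 = "{a. a < ?M \<and> 0 \<le> a * ?d mod ?M \<and> a * ?d mod ?M < 0 + Q}"
  let ?A2 = "{a. a < ?M \<and> ?M - Q \<le> a * ?d mod ?M \<and> a * ?d mod ?M < (?M - Q) + Q}"
  have "{a. a < ?M \<and> hsh Q R a x = hsh Q R a y} \<subseteq> ?A1 \<union> ?A2"
  proof
    fix a assume "a \<in> {a. a < ?M \<and> hsh Q R a x = hsh Q R a y}"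
    then have a: "a < ?M" "hsh Q R a x = hsh Q R a y" by auto
    define X Y where "X = a * x mod ?M" and "Y = a * y mod ?M"
    have l: "X < ?M" "Y < ?M" using Q by (simp_all add: X_def Y_def)
    have eq: "X div Q = Y div Q" using a by (simp add: hsh_def X_def Y_def)
    have "X div Q * Q + X mod Q = X" "X div Q * Q + Y mod Q = Y" 
      using div_mult_mod_eq[of X Q] div_mult_mod_eq[of Y Q] by (simp_all only: eq)
    moreover have "X mod Q < Q" "Y mod Q < Q" using Q by auto
    ultimately have n: "X < Y + Q" "Y < X + Q" by linarith+
    have c: "(a * ?d + X) mod ?M = Y"
    proof -
      have "a * ?d + a * x = a * y" using xy by (simp add: diff_mult_distrib2)
      then show ?thesis unfolding X_def Y_def by (metis mod_add_right_eq)
    qed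
    define D where "D = a * ?d mod ?M"
    have D: "D < ?M" using Q by (simp add: D_def)
    have c': "(D + X) mod ?M = Y" using c unfolding D_def by (metis mod_add_left_eq)
    have "D < Q \<or> ?M - Q \<le> D"
    proof (cases "D + X < ?M")
      case True
      then show ?thesis using c' n by simp
    next
      case False
      then have "(D + X) mod ?M = D + X - ?M" using D l by (simp add: mod_if)
      then show ?thesis using c' n False by linarith
    qed
    then show "a \<in> ?A1 \<union> ?A2" using a D Q by (auto simp: D_def)
  qed
  then have "card {a. a < ?M \<and> hsh Q R a x = hsh Q R a y} \<le> card (?A1 \<union> ?A2)"
    by (intro card_mono) auto
  also have "\<dots> \<le> card ?A1 + card ?A2" by (rule card_Un_le)
  also have "\<dots> \<le> 2 * Q + 2 * Q"
    using xy Q by (intro add_mono card_mod_window) auto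
  finally show ?thesis by simp
qed

text \<open>A slot keeps its least key; these are the keys that a level cannot store and passes
  on.\<close>

definition rest :: "nat \<Rightarrow> nat \<Rightarrow> nat \<Rightarrow> nat set \<Rightarrow> nat set" where
  "rest Q R a K = {y \<in> K. \<exists>x\<in>K. x < y \<and> hsh Q R a x = hsh Q R a y}"

text \<open>Averaging over all \<open>Q * R\<close> multipliers: each of the at most
  \<open>card K ^ 2 / 2\<close> pairs collides for at most \<open>4 * Q\<close> of them, so some
  multiplier has at most \<open>2 * card K ^ 2 / R\<close> colliding pairs, and every key of
  \<open>rest\<close> is the larger member of such a pair.\<close>

lemma exists_good_multiplier:
  assumes K: "finite K" "K \<subseteq> {..<Q}" and R: "0 < R"
  shows "\<exists>a. (a = 0 \<or> a < Q * R) \<and> card (rest Q R a K) * R \<le> 2 * card K * card K"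
proof (cases "K = {}")
  case True
  then show ?thesis by (intro exI[of _ 0]) (auto simp: rest_def)
next
  case False
  then have Q: "0 < Q" using K by auto
  let ?M = "Q * R"
  let ?Pr = "{(x, y). x \<in> K \<and> y \<in> K \<and> x < y}"
  have finP: "finite ?Pr" by (rule finite_subset[of _ "K \<times> K"]) (use K in auto)
  \<comment> \<open>The pairs and their mirror images are disjoint parts of
    \<open>K \<times> K\<close>.\<close>
  have cP: "2 * card ?Pr \<le> card K * card K"
  proof -
    let ?Pr' = "(\<lambda>(x, y). (y, x)) ` ?Pr"
    have "card ?Pr' = card ?Pr" by (intro card_image) (auto simp: inj_on_def)
    moreover have "card (?Pr \<union> ?Pr') = card ?Pr + card ?Pr'"
      using finP by (intro card_Un_disjoint) auto
    moreover have "card (?Pr \<union> ?Pr') \<le> card (K \<times> K)" using K by (intro card_mono) auto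
    ultimately show ?thesis by (simp add: card_cartesian_product)
  qed
  let ?c = "\<lambda>a. card {(x, y) \<in> ?Pr. hsh Q R a x = hsh Q R a y}"
  have "(\<Sum>a<?M. ?c a) = (\<Sum>a<?M. \<Sum>p\<in>?Pr. if hsh Q R a (fst p) = hsh Q R a (snd p) then 1 else 0)"
  proof (intro sum.cong refl)
    fix a
    have "{(x, y) \<in> ?Pr. hsh Q R a x = hsh Q R a y} = {p \<in> ?Pr. hsh Q R a (fst p) = hsh Q R a (snd p)}" by auto
    then show "?c a = (\<Sum>p\<in>?Pr. if hsh Q R a (fst p) = hsh Q R a (snd p) then 1 else 0)"
      using finP by (simp add: sum.If_cases Int_def)
  qed
  also have "\<dots> = (\<Sum>p\<in>?Pr. \<Sum>a<?M. if hsh Q R a (fst p) = hsh Q R a (snd p) then 1 else 0)"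
    by (rule sum.swap)
  also have "\<dots> = (\<Sum>p\<in>?Pr. card {a. a < ?M \<and> hsh Q R a (fst p) = hsh Q R a (snd p)})"
    by (intro sum.cong refl) (simp add: sum.If_cases Int_def lessThan_def)
  also have "\<dots> \<le> (\<Sum>p\<in>?Pr. 4 * Q)"
    using K R by (intro sum_mono) (auto intro!: card_collisions)
  also have "\<dots> = card ?Pr * (4 * Q)" by simp
  finally have tot: "(\<Sum>a<?M. ?c a) \<le> card ?Pr * (4 * Q)" .
  have "\<exists>a<?M. ?c a * R \<le> 2 * card K * card K"
  proof (rule ccontr)
    assume "\<not> ?thesis"
    then have g: "2 * card K * card K < ?c a * R" if "a < ?M" for a using that by auto
    have "(\<Sum>a<?M. 2 * card K * card K) < (\<Sum>a<?M. ?c a * R)"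
      using g Q R by (intro sum_strict_mono) (auto simp: lessThan_empty_iff)
    also have "\<dots> = (\<Sum>a<?M. ?c a) * R" by (simp add: sum_distrib_right)
    also have "\<dots> \<le> card ?Pr * (4 * Q) * R" using tot by (rule mult_le_mono1)
    also have "\<dots> = (2 * card ?Pr) * (2 * ?M)" by simp
    also have "\<dots> \<le> (card K * card K) * (2 * ?M)" using cP by (rule mult_le_mono1)
    finally show False by simp
  qed
  then obtain a where a: "a < ?M" "?c a * R \<le> 2 * card K * card K" by blast
  have "rest Q R a K \<subseteq> snd ` {(x, y) \<in> ?Pr. hsh Q R a x = hsh Q R a y}"
    by (force simp: rest_def)
  moreover have finC: "finite {(x, y) \<in> ?Pr. hsh Q R a x = hsh Q R a y}"
    by (rule finite_subset[OF _ finP]) auto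
  ultimately have "card (rest Q R a K) \<le> ?c a" by (rule surj_card_le[rotated])
  then have "card (rest Q R a K) * R \<le> ?c a * R" by (rule mult_le_mono1)
  then show ?thesis using a by (meson order_trans)
qed

text \<open>Level \<open>i\<close> stores one key per slot and passes the others on. Since the number of colliding pairs
  is quadratic in the load, the load factor is squared from one level to the next.\<close>

lemma exists_dictionary:
  assumes K: "finite K" "K \<subseteq> {..<Q}" and Q: "0 < Q" and R: "0 < R" "4 * card K \<le> R" "R < 2 ^ (2 ^ L)"
  shows "\<exists>am tab. (\<forall>i<L. am i < Q * R) \<and> (\<forall>i s. tab i s = 0 \<or> tab i s - 1 \<in> K) \<and>
     (\<forall>x\<in>K. \<exists>i<L. tab i (hsh Q R (am i) x) = Suc x)"
proof -
  have "\<forall>K. finite K \<and> K \<subseteq> {..<Q} \<longrightarrow>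
    (\<exists>a. a < Q * R \<and> card (rest Q R a K) * R \<le> 2 * card K * card K)"
    using exists_good_multiplier[OF _ _ R(1)] Q R(1) by (metis nat_0_less_mult_iff)
  then obtain A where A: "\<And>K. finite K \<Longrightarrow> K \<subseteq> {..<Q} \<Longrightarrow> A K < Q * R \<and>
      card (rest Q R (A K) K) * R \<le> 2 * card K * card K" by metis
  define Ks where "Ks = rec_nat K (\<lambda>i K'. rest Q R (A K') K')"
  have Ks0: "Ks 0 = K" and KsS: "\<And>i. Ks (Suc i) = rest Q R (A (Ks i)) (Ks i)"
    by (simp_all add: Ks_def)
  have sub: "Ks i \<subseteq> K" for i
    by (induction i) (auto simp: Ks0 KsS rest_def)
  then have fin: "finite (Ks i)" "Ks i \<subseteq> {..<Q}" for i
    using K finite_subset by blast+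
  \<comment> \<open>Squaring of the load factor: if \<open>card (Ks i)\<close> is at most
    \<open>R / (2 * 2 ^ (2 ^ i))\<close>, the quadratic bound on \<open>rest\<close> gives the same
    for \<open>i + 1\<close>. The start is \<open>4 * card K \<le> R\<close>, and at level
    \<open>L\<close> there is no room left for a key because \<open>R < 2 ^ (2 ^ L)\<close>.\<close>
  have small: "2 * card (Ks i) * 2 ^ (2 ^ i) \<le> R" for i
  proof (induction i)
    case 0
    then show ?case using R by (simp add: Ks0)
  next
    case (Suc i)
    have "card (Ks (Suc i)) * R \<le> 2 * card (Ks i) * card (Ks i)"
      using A[OF fin] by (simp add: KsS)
    then have "2 * 2 ^ (2 ^ Suc i) * (card (Ks (Suc i)) * R) \<le>
        2 * 2 ^ (2 ^ Suc i) * (2 * card (Ks i) * card (Ks i))" by (rule mult_le_mono2)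
    also have sq: "(2::nat) ^ (2 ^ Suc i) = 2 ^ (2 ^ i) * 2 ^ (2 ^ i)" by (simp flip: power_add)
    also have "2 * (2 ^ (2 ^ i) * 2 ^ (2 ^ i)) * (2 * card (Ks i) * card (Ks i)) =
        (2 * card (Ks i) * 2 ^ (2 ^ i)) * (2 * card (Ks i) * 2 ^ (2 ^ i))" by simp
    also have "\<dots> \<le> R * R" using Suc by (intro mult_le_mono)
    finally have "(2 * card (Ks (Suc i)) * 2 ^ (2 ^ Suc i)) * R \<le> R * R" unfolding sq by (simp add: algebra_simps)
    then show ?case unfolding mult_le_cancel2 using R(1) by blast
  qed
  have empty: "Ks L = {}"
  proof -
    have "card (Ks L) = 0"
    proof (rule ccontr)
      assume "card (Ks L) \<noteq> 0"
      then have "2 ^ (2 ^ L) \<le> 2 * card (Ks L) * 2 ^ (2 ^ L)" by simp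
      then show False using small[of L] R(3) by linarith
    qed
    then show ?thesis using fin by simp
  qed
  define am where "am i = A (Ks i)" for i
  define tab where "tab i s = (let X = {x \<in> Ks i. hsh Q R (am i) x = s} in if X = {} then 0 else Suc (Min X))" for i s
  have finX: "finite {x \<in> Ks i. hsh Q R (am i) x = s}" for i s using fin by simp
  have t1: "tab i s = 0 \<or> tab i s - 1 \<in> K" for i s
    using Min_in[OF finX, of i s] sub by (auto simp: tab_def Let_def)
  have "\<exists>j<L. tab j (hsh Q R (am j) x) = Suc x" if x: "x \<in> K" for x
  proof -
    \<comment> \<open>The first level that has lost \<open>x\<close> is preceded by a level
      \<open>j\<close> that still had it. There \<open>x\<close> was not passed on, so it is the
      least key of its slot and the one stored.\<close>
    define i where "i = (LEAST i. x \<notin> Ks i)"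
    have ex: "x \<notin> Ks L" using empty by simp
    have i: "x \<notin> Ks i" "i \<le> L" unfolding i_def 
      by (rule LeastI[of "\<lambda>i. x \<notin> Ks i", OF ex], rule Least_le[of "\<lambda>i. x \<notin> Ks i", OF ex])
    then obtain j where j: "i = Suc j" using x by (cases i) (auto simp: Ks0)
    have xj: "x \<in> Ks j" using not_less_Least[of j "\<lambda>i. x \<notin> Ks i"] j by (simp add: i_def)
    have nor: "\<not> (\<exists>y\<in>Ks j. y < x \<and> hsh Q R (am j) y = hsh Q R (am j) x)"
      using i(1) xj unfolding j KsS rest_def am_def by blast
    have "Min {y \<in> Ks j. hsh Q R (am j) y = hsh Q R (am j) x} = x"
      using nor xj finX by (intro Min_eqI) (auto simp: not_less)
    then have "tab j (hsh Q R (am j) x) = Suc x" using xj by (auto simp: tab_def Let_def)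
    then show ?thesis using i j by (intro exI[of _ j]) auto
  qed
  then show ?thesis using A[OF fin] t1 by (intro exI[of _ am] exI[of _ tab]) (auto simp: am_def)
qed

section \<open>Step functions and node lists\<close>

definition breaks :: "nat \<Rightarrow> (nat \<Rightarrow> nat) \<Rightarrow> nat set" where
  "breaks U f = {x. x < U \<and> f x \<noteq> f (Suc x)}"

lemma finite_breaks: "finite (breaks U f)"
  by (simp add: breaks_def)

text \<open>Each break raises a monotone function by at least 1.\<close>

lemma card_breaks: 
  assumes "mono f" shows "card (breaks U f) \<le> f U"
proof -
  have "card (breaks U f) + f 0 \<le> f U"
  proof (induction U)
    case 0
    then show ?case by (simp add: breaks_def)
  next
    case (Suc U)
    have f: "f U \<le> f (Suc U)" using assms by (simp add: monoD)
    show ?case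
    proof (cases "f U = f (Suc U)")
      case True
      then have "breaks (Suc U) f = breaks U f" by (auto simp: breaks_def less_Suc_eq)
      then show ?thesis using Suc True by simp
    next
      case False
      then have "breaks (Suc U) f = insert U (breaks U f)" by (auto simp: breaks_def less_Suc_eq)
      then have "card (breaks (Suc U) f) = Suc (card (breaks U f))"
        using finite_breaks by (simp add: breaks_def)
      then show ?thesis using Suc False f by simp
    qed
  qed
  then show ?thesis by simp
qed

lemma const_between_breaks:
  assumes "x \<le> y" "y \<le> U" "\<And>k. x \<le> k \<Longrightarrow> k < y \<Longrightarrow> k \<notin> breaks U f"
  shows "f x = f y"
  using assms
proof (induction y)
  case (Suc y)
  show ?case
  proof (cases "x = Suc y")
    case False
    then have "f x = f y" using Suc by auto
    also have "f y = f (Suc y)" using Suc.prems(3)[of y] False Suc.prems(1,2) by (auto simp: breaks_def)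
    finally show ?thesis .
  qed simp
qed simp

text \<open>In the binary trie over the keys, the keys below node \<open>z\<close> of height
  \<open>g\<close>.\<close>

definition subt :: "nat set \<Rightarrow> nat \<Rightarrow> nat \<Rightarrow> nat set" where
  "subt K g z = {k \<in> K. k div 2 ^ g = z}"

lemma div_pow_mono_mid:
  fixes x y k :: nat
  assumes "x \<le> k" "k \<le> y" "x div 2 ^ g = y div 2 ^ g"
  shows "k div 2 ^ g = x div 2 ^ g"
  using assms div_le_mono[of x k "2 ^ g"] div_le_mono[of k y "2 ^ g"] by simp

lemma sibling_less:
  fixes a b :: nat
  assumes "a \<noteq> b" "a div 2 = b div 2"
  shows "b mod 2 = 0 \<Longrightarrow> b < a" "b mod 2 \<noteq> 0 \<Longrightarrow> a < b"
  using assms by presburger+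

text \<open>At the lowest ancestor of \<open>x\<close> that contains a key, all keys lie in the half not containing \<open>x\<close>.\<close>

lemma step_fun_lookup:
  fixes x :: nat
  assumes K: "K = breaks U f" and x: "x < U"
    and ne: "subt K g (x div 2 ^ g) \<noteq> {}"
    and min: "\<And>g'. g' < g \<Longrightarrow> subt K g' (x div 2 ^ g') = {}"
  shows "f x = (if 2 * x div 2 ^ g mod 2 = 0 then f (Min (subt K g (x div 2 ^ g)))
                else f (Suc (Max (subt K g (x div 2 ^ g)))))"
proof -
  let ?S = "subt K g (x div 2 ^ g)"
  have fin: "finite ?S" using finite_breaks[of U f] by (simp add: subt_def K)
  have mn: "Min ?S \<in> ?S" and mx: "Max ?S \<in> ?S" using ne fin by auto
  have kU: "k < U" if "k \<in> ?S" for k using that by (auto simp: subt_def K breaks_def)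
  show ?thesis
  proof (cases g)
    case 0
    \<comment> \<open>The tested bit is bit \<open>g - 1\<close> of \<open>x\<close>, written with a
      factor 2 in order to cover \<open>g = 0\<close>: the bit is then 0, and the value is the one
      at \<open>x\<close>, which is itself a break.\<close>
    then have "?S = {x}" using ne by (auto simp: subt_def)
    then show ?thesis using 0 by simp
  next
    case (Suc g')
    have bit: "2 * x div 2 ^ g = x div 2 ^ g'" using Suc by simp
    have half: "y div 2 ^ g = y div 2 ^ g' div 2" for y :: nat
      unfolding Suc power_Suc2 by (rule div_mult2_eq)
    \<comment> \<open>By minimality of \<open>g\<close> no key lies below the child that contains
      \<open>x\<close>, so all of them lie below its sibling.\<close>
    have e: "k div 2 ^ g' \<noteq> x div 2 ^ g'" "k div 2 ^ g' div 2 = x div 2 ^ g' div 2" if "k \<in> ?S" for k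
      using that min[of g'] Suc half by (auto simp: subt_def)
    show ?thesis
    proof (cases "x div 2 ^ g' mod 2 = 0")
      case True
      have gt: "x < k" if "k \<in> ?S" for k
      proof -
        have "x div 2 ^ g' < k div 2 ^ g'" using sibling_less(1)[OF e[OF that]] True by simp
        then show ?thesis by (metis div_le_mono not_less)
      qed
      have "f x = f (Min ?S)"
      proof (rule const_between_breaks[of x "Min ?S" U f])
        show "x \<le> Min ?S" using gt[OF mn] by simp
        show "Min ?S \<le> U" using kU[OF mn] by simp
        fix k assume k: "x \<le> k" "k < Min ?S"
        show "k \<notin> breaks U f"
        proof
          assume "k \<in> breaks U f"
          moreover have "k div 2 ^ g = x div 2 ^ g"
            using div_pow_mono_mid[of x k "Min ?S" g] k mn by (auto simp: subt_def)
          ultimately have "k \<in> ?S" by (simp add: subt_def K)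
          then show False using k(2) fin by (meson Min_le not_less)
        qed
      qed
      then show ?thesis using True bit by simp
    next
      case False
      have lt: "k < x" if "k \<in> ?S" for k
      proof -
        have "k div 2 ^ g' < x div 2 ^ g'" using sibling_less(2)[OF e[OF that]] False by simp
        then show ?thesis by (metis div_le_mono not_less)
      qed
      have "f (Suc (Max ?S)) = f x"
      proof (rule const_between_breaks[of "Suc (Max ?S)" x U f])
        show "Suc (Max ?S) \<le> x" using lt[OF mx] by simp
        show "x \<le> U" using x by simp
        fix k assume k: "Suc (Max ?S) \<le> k" "k < x"
        show "k \<notin> breaks U f"
        proof
          assume "k \<in> breaks U f"
          moreover have "k div 2 ^ g = x div 2 ^ g"
            using div_pow_mono_mid[of "Max ?S" k x g] k mx by (auto simp: subt_def)
          ultimately have "k \<in> ?S" by (simp add: subt_def K)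
          then have "k \<le> Max ?S" by (rule Max_ge[OF fin])
          then show False using k(1) by simp
        qed
      qed
      then show ?thesis using False bit by simp
    qed
  qed
qed

lemma step_fun_no_breaks:
  assumes "breaks U f = {}" "x \<le> U" shows "f x = f 0"
  using const_between_breaks[of 0 x U f] assms by auto

section \<open>Lists of the nodes of a tree over the y-ranks\<close>

lemma div_pow_split: "k \<le> e \<Longrightarrow> (x::nat) div 2 ^ e = x div 2 ^ k div 2 ^ (e - k)"
  by (simp add: div_mult2_eq[symmetric] power_add[symmetric])

text \<open>Level lists: for exponent \<open>e\<close> the values below \<open>2 ^ H\<close> are grouped into nodes of \<open>2 ^ e\<close> consecutive
  values, each of which is listed in the order given by \<open>P\<close>; \<open>pos e y\<close> is the position of \<open>y\<close>.\<close>

locale wave =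
  fixes H :: nat and P :: "nat \<Rightarrow> nat"
  assumes bij: "bij_betw P {..<2 ^ H} {..<2 ^ H}"
begin

definition pos :: "nat \<Rightarrow> nat \<Rightarrow> nat" where
  "pos e y = y div 2 ^ e * 2 ^ e + card {y'. y' div 2 ^ e = y div 2 ^ e \<and> P y' < P y}"

definition el :: "nat \<Rightarrow> nat \<Rightarrow> nat" where
  "el e = inv_into {..<2 ^ H} (pos e)"

lemma node_eq: "{y::nat. y div 2 ^ e = v} = {v * 2 ^ e..<(v + 1) * 2 ^ e}"
proof (intro set_eqI iffI)
  fix y :: nat assume "y \<in> {y. y div 2 ^ e = v}"
  then have "v = y div 2 ^ e" by simp
  then have "v * 2 ^ e + y mod 2 ^ e = y" by (simp only: div_mult_mod_eq)
  moreover have "y mod 2 ^ e < 2 ^ e" by simp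
  ultimately show "y \<in> {v * 2 ^ e..<(v + 1) * 2 ^ e}"
    unfolding atLeastLessThan_iff distrib_right mult_1 by linarith
next
  fix y :: nat assume "y \<in> {v * 2 ^ e..<(v + 1) * 2 ^ e}"
  then have a: "v * 2 ^ e \<le> y" "y < v * 2 ^ e + 2 ^ e" by auto
  define r where "r = y - v * 2 ^ e"
  have "y = r + v * 2 ^ e" "r < 2 ^ e" using a by (auto simp: r_def)
  then show "y \<in> {y. y div 2 ^ e = v}" by simp
qed

lemma finite_node: "finite {y::nat. y div 2 ^ e = v}" and card_node: "card {y::nat. y div 2 ^ e = v} = 2 ^ e"
  unfolding node_eq by simp_all

lemma finite_in_node: "finite {y. y div 2 ^ e = (v::nat) \<and> Q y}"
  by (rule finite_subset[OF _ finite_node[of e v]]) blast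

lemma pos_div: "pos e y div 2 ^ e = y div 2 ^ e"
proof -
  have "card {y'. y' div 2 ^ e = y div 2 ^ e \<and> P y' < P y} < card {y'. y' div 2 ^ e = y div 2 ^ e}"
    by (intro psubset_card_mono finite_node) auto
  then have "card {y'. y' div 2 ^ e = y div 2 ^ e \<and> P y' < P y} < 2 ^ e" unfolding card_node .
  then show ?thesis unfolding pos_def by simp
qed

lemma node_bound:
  assumes "y < 2 ^ H" "e \<le> H" "(x::nat) div 2 ^ e = y div 2 ^ e" shows "x < 2 ^ H"
proof -
  have "(2::nat) ^ H = 2 ^ (H - e) * 2 ^ e" using assms(2) by (simp flip: power_add)
  then have "y div 2 ^ e < 2 ^ (H - e)" using assms(1) by (simp add: less_mult_imp_div_less)
  then have "x div 2 ^ e < 2 ^ (H - e)" using assms(3) by simp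
  then show ?thesis using \<open>2 ^ H = 2 ^ (H - e) * 2 ^ e\<close> by (simp add: div_less_iff_less_mult)
qed

lemma pos_less: "y < 2 ^ H \<Longrightarrow> e \<le> H \<Longrightarrow> pos e y < 2 ^ H"
  using node_bound[OF _ _ pos_div] .

lemma pos_diff:
  assumes "y1 div 2 ^ e = y2 div 2 ^ e" "P y1 \<le> P y2"
  shows "pos e y2 = pos e y1 + card {y'. y' div 2 ^ e = y1 div 2 ^ e \<and> P y1 \<le> P y' \<and> P y' < P y2}"
proof -
  define v where "v = y1 div 2 ^ e"
  have v2: "y2 div 2 ^ e = v" using assms(1) by (simp add: v_def)
  have "{y'. y' div 2 ^ e = v \<and> P y' < P y2} =
      {y'. y' div 2 ^ e = v \<and> P y' < P y1} \<union> {y'. y' div 2 ^ e = v \<and> P y1 \<le> P y' \<and> P y' < P y2}"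
  proof (rule set_eqI)
    fix z
    have "P z < P y2 \<longleftrightarrow> P z < P y1 \<or> (P y1 \<le> P z \<and> P z < P y2)" using assms(2) by linarith
    then show "z \<in> {y'. y' div 2 ^ e = v \<and> P y' < P y2} \<longleftrightarrow> z \<in>
      {y'. y' div 2 ^ e = v \<and> P y' < P y1} \<union> {y'. y' div 2 ^ e = v \<and> P y1 \<le> P y' \<and> P y' < P y2}"
      by blast
  qed
  moreover have "{y'. y' div 2 ^ e = v \<and> P y' < P y1} \<inter>
      {y'. y' div 2 ^ e = v \<and> P y1 \<le> P y' \<and> P y' < P y2} = {}" by auto
  ultimately have "card {y'. y' div 2 ^ e = v \<and> P y' < P y2} = card {y'. y' div 2 ^ e = v \<and> P y' < P y1} +
     card {y'. y' div 2 ^ e = v \<and> P y1 \<le> P y' \<and> P y' < P y2}"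
    using card_Un_disjoint[OF finite_in_node finite_in_node] by simp
  then show ?thesis unfolding pos_def v2 v_def[symmetric] by simp
qed

lemma pos_mono:
  assumes "y1 div 2 ^ e = y2 div 2 ^ e" "P y1 < P y2" shows "pos e y1 < pos e y2"
proof -
  let ?A = "{y'. y' div 2 ^ e = y1 div 2 ^ e \<and> P y1 \<le> P y' \<and> P y' < P y2}"
  have "y1 \<in> ?A" using assms(2) by simp
  then have "?A \<noteq> {}" by blast
  then have "0 < card ?A" by (simp only: card_gt_0_iff finite_in_node) simp
  then show ?thesis using pos_diff[OF assms(1)] assms(2) by simp
qed

lemma P_inj: "y1 < 2 ^ H \<Longrightarrow> y2 < 2 ^ H \<Longrightarrow> P y1 = P y2 \<Longrightarrow> y1 = y2"
  using bij by (auto simp: bij_betw_def inj_on_def)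

lemma P_less: "y < 2 ^ H \<Longrightarrow> P y < 2 ^ H"
  using bij by (auto simp: bij_betw_def)

lemma pos_inj: "inj_on (pos e) {..<2 ^ H}"
proof (rule inj_onI)
  fix x y assume x: "x \<in> {..<2 ^ H}" and y: "y \<in> {..<2 ^ H}" and e: "pos e x = pos e y"
  have "x div 2 ^ e = y div 2 ^ e" using pos_div[of e x] pos_div[of e y] e by simp
  then have "\<not> P x < P y" "\<not> P y < P x"
    using pos_mono[of x e y] pos_mono[of y e x] e by auto
  then have "P x = P y" by simp
  then show "x = y" using P_inj x y by simp
qed

lemma pos_bij: "e \<le> H \<Longrightarrow> bij_betw (pos e) {..<2 ^ H} {..<2 ^ H}"
  unfolding bij_betw_def
  by (intro conjI pos_inj endo_inj_surj) (auto simp: pos_less)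

lemma
  assumes "e \<le> H" "j < 2 ^ H"
  shows el_less: "el e j < 2 ^ H" and pos_el: "pos e (el e j) = j" and el_div: "el e j div 2 ^ e = j div 2 ^ e"
proof -
  have j: "j \<in> pos e ` {..<2 ^ H}" using pos_bij[OF assms(1)] assms(2) by (auto simp: bij_betw_def)
  show "el e j < 2 ^ H" using inv_into_into[OF j] by (simp add: el_def)
  show p: "pos e (el e j) = j" unfolding el_def by (rule f_inv_into_f[OF j])
  show "el e j div 2 ^ e = j div 2 ^ e" using pos_div[of e "el e j"] p by simp
qed

lemma el_pos: "y < 2 ^ H \<Longrightarrow> el e (pos e y) = y"
  unfolding el_def using pos_inj by (intro inv_into_f_f) auto

lemma pos_0: "pos 0 y = y"
proof -
  have e: "{y'. y' = y \<and> P y' < P y} = {}" by auto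
  show ?thesis by (simp add: pos_def e)
qed

lemma el_0: "y < 2 ^ H \<Longrightarrow> el 0 y = y"
  using el_pos[of y 0] by (simp add: pos_0)

lemma P_el_mono:
  assumes "e \<le> H" "j1 < j2" "j2 < 2 ^ H" "j1 div 2 ^ e = j2 div 2 ^ e"
  shows "P (el e j1) < P (el e j2)"
proof (rule ccontr)
  assume "\<not> ?thesis"
  moreover have j1: "j1 < 2 ^ H" using assms by simp
  have "P (el e j1) \<noteq> P (el e j2)"
  proof
    assume "P (el e j1) = P (el e j2)"
    then have "el e j1 = el e j2" by (rule P_inj[OF el_less[OF assms(1) j1] el_less[OF assms(1,3)]])
    then have "pos e (el e j1) = pos e (el e j2)" by (rule arg_cong)
    then have "j1 = j2" unfolding pos_el[OF assms(1) j1] pos_el[OF assms(1,3)] .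
    then show False using assms(2) by simp
  qed
  ultimately have "P (el e j2) < P (el e j1)" by simp
  then have "pos e (el e j2) < pos e (el e j1)"
    by (rule pos_mono[rotated]) (simp add: el_div[OF assms(1) j1] el_div[OF assms(1,3)] assms(4))
  then show False using assms(2) by (simp add: pos_el[OF assms(1) j1] pos_el[OF assms(1,3)])
qed

text \<open>The list of a descendant is a subsequence of the list of its ancestor, so the passage to
  it preserves order and cannot increase distances.\<close>

lemma pos_contract:
  assumes e: "e' \<le> e" "e \<le> H" and j: "j1 \<le> j2" "j2 < 2 ^ H"
    and eq: "el e j1 div 2 ^ e' = el e j2 div 2 ^ e'"
  shows "pos e' (el e j1) \<le> pos e' (el e j2)" "pos e' (el e j2) - pos e' (el e j1) \<le> j2 - j1"
proof -
  let ?y1 = "el e j1" and ?y2 = "el e j2"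
  have eq2: "y div 2 ^ e = y' div 2 ^ e" if "y div 2 ^ e' = y' div 2 ^ e'" for y y' :: nat
    using that div_pow_split[OF e(1), of y] div_pow_split[OF e(1), of y'] by (simp only:)
  have le: "P ?y1 \<le> P ?y2"
  proof (cases "j1 = j2")
    case False
    then have "j1 < j2" "j1 < 2 ^ H" using j by auto
    moreover have "j1 div 2 ^ e = j2 div 2 ^ e"
      using eq2[OF eq] el_div[OF e(2) \<open>j1 < 2 ^ H\<close>] el_div[OF e(2) j(2)] by (simp only:)
    ultimately show ?thesis using P_el_mono[OF e(2) _ j(2)] by (simp add: less_imp_le)
  qed simp
  show "pos e' ?y1 \<le> pos e' ?y2" using pos_diff[OF eq le] by simp
  have "pos e' ?y2 - pos e' ?y1 = card {y'. y' div 2 ^ e' = ?y1 div 2 ^ e' \<and> P ?y1 \<le> P y' \<and> P y' < P ?y2}"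
    using pos_diff[OF eq le] by simp
  also have "\<dots> \<le> card {y'. y' div 2 ^ e = ?y1 div 2 ^ e \<and> P ?y1 \<le> P y' \<and> P y' < P ?y2}"
    by (intro card_mono finite_in_node) (use eq2 in blast)
  also have "\<dots> = pos e ?y2 - pos e ?y1" using pos_diff[OF eq2[OF eq] le] by simp
  also have "\<dots> = j2 - j1" using pos_el[OF e(2), of j1] pos_el[OF e(2) j(2)] j by (simp only: le_less_trans)
  finally show "pos e' ?y2 - pos e' ?y1 \<le> j2 - j1" .
qed

text \<open>A jump from exponent \<open>e\<close> to \<open>e' = e - k\<close>: the target position is split into a
  base value per block of \<open>2 ^ Eb\<close> positions and child, and a small offset.\<close>

definition sig :: "nat \<Rightarrow> nat \<Rightarrow> nat \<Rightarrow> nat" where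
  "sig e k j = el e j div 2 ^ (e - k) mod 2 ^ k"

definition jbase :: "nat \<Rightarrow> nat \<Rightarrow> nat \<Rightarrow> nat \<Rightarrow> nat \<Rightarrow> nat" where
  "jbase e k Eb \<beta> s = (let X = {j. j < 2 ^ H \<and> j div 2 ^ Eb = \<beta> \<and> sig e k j = s} in
     if X = {} then 0 else Min ((\<lambda>j. pos (e - k) (el e j)) ` X))"

definition jrec :: "nat \<Rightarrow> nat \<Rightarrow> nat \<Rightarrow> nat \<Rightarrow> nat" where
  "jrec e k Eb j = sig e k j * 2 ^ Eb + (pos (e - k) (el e j) - jbase e k Eb (j div 2 ^ Eb) (sig e k j))"

text \<open>Since \<open>Eb \<le> e\<close>, a block of positions lies in the list of one node.
  Those of its positions that go to the same child are less than \<open>2 ^ Eb\<close> apart, and by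
  \<open>pos_contract\<close> their targets are no farther apart, so the offset from the least
  target fits into \<open>Eb\<close> bits.\<close>

lemma jump:
  assumes "k \<le> e" "e \<le> H" "Eb \<le> e" "j < 2 ^ H"
  shows "jbase e k Eb (j div 2 ^ Eb) (jrec e k Eb j div 2 ^ Eb) + jrec e k Eb j mod 2 ^ Eb = pos (e - k) (el e j)"
    "jrec e k Eb j < 2 ^ (k + Eb)" "jrec e k Eb j div 2 ^ Eb < 2 ^ k"
proof -
  let ?f = "\<lambda>j. pos (e - k) (el e j)"
  let ?X = "{j'. j' < 2 ^ H \<and> j' div 2 ^ Eb = j div 2 ^ Eb \<and> sig e k j' = sig e k j}"
  let ?b = "jbase e k Eb (j div 2 ^ Eb) (sig e k j)"
  have jX: "j \<in> ?X" using assms by simp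
  have fin: "finite (?f ` ?X)" by simp
  have b: "?b = Min (?f ` ?X)" using jX unfolding jbase_def by (auto simp: Let_def)
  have "?b \<in> ?f ` ?X" unfolding b using jX fin by (intro Min_in) auto
  then obtain i where i: "i \<in> ?X" "?b = ?f i" by blast
  have ble: "?b \<le> ?f j" unfolding b using jX fin by (intro Min_le) auto
  have iN: "i < 2 ^ H" "i div 2 ^ Eb = j div 2 ^ Eb" "sig e k i = sig e k j" using i by auto
  have "i div 2 ^ e = j div 2 ^ e"
    using iN(2) div_pow_split[OF assms(3), of i] div_pow_split[OF assms(3), of j] by (simp only:)
  then have "el e i div 2 ^ e = el e j div 2 ^ e"
    using el_div[OF assms(2) iN(1)] el_div[OF assms(2,4)] by (simp only:)
  then have "el e i div 2 ^ (e - k) div 2 ^ k = el e j div 2 ^ (e - k) div 2 ^ k"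
    using div_pow_split[of "e - k" e "el e i"] div_pow_split[of "e - k" e "el e j"] assms(1) by simp
  moreover have "el e i div 2 ^ (e - k) mod 2 ^ k = el e j div 2 ^ (e - k) mod 2 ^ k"
    using iN(3) by (simp only: sig_def)
  \<comment> \<open>The descendant is determined by the node and the child number within it.\<close>
  ultimately have same: "el e i div 2 ^ (e - k) = el e j div 2 ^ (e - k)" by (metis div_mult_mod_eq)
  have close: "i - j < 2 ^ Eb \<and> j - i < 2 ^ Eb"
  proof -
    have "i div 2 ^ Eb = j div 2 ^ Eb" by (rule iN(2))
    then have "j div 2 ^ Eb * 2 ^ Eb + i mod 2 ^ Eb = i" "j div 2 ^ Eb * 2 ^ Eb + j mod 2 ^ Eb = j"
      using div_mult_mod_eq[of i "2 ^ Eb"] div_mult_mod_eq[of j "2 ^ Eb"] by simp_all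
    moreover have "i mod 2 ^ Eb < 2 ^ Eb" "j mod 2 ^ Eb < 2 ^ Eb" by simp_all
    ultimately show ?thesis by linarith
  qed
  have off: "?f j - ?b < 2 ^ Eb"
  proof (cases "i \<le> j")
    case True
    then show ?thesis using pos_contract(2)[OF diff_le_self assms(2) True assms(4) same] close i(2) by linarith
  next
    case False
    then have "?f j \<le> ?f i" using i(1) same pos_contract(1)[OF diff_le_self assms(2), of j i k] by simp
    then show ?thesis using i(2) by simp
  qed
  have s: "sig e k j < 2 ^ k" by (simp add: sig_def)
  have d: "jrec e k Eb j div 2 ^ Eb = sig e k j" "jrec e k Eb j mod 2 ^ Eb = ?f j - ?b"
    using off by (simp_all add: jrec_def mult.commute)
  show "jbase e k Eb (j div 2 ^ Eb) (jrec e k Eb j div 2 ^ Eb) + jrec e k Eb j mod 2 ^ Eb = pos (e - k) (el e j)"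
    unfolding d using ble by simp
  show "jrec e k Eb j div 2 ^ Eb < 2 ^ k" using d s by simp
  then have "jrec e k Eb j < 2 ^ k * 2 ^ Eb" by (simp add: div_less_iff_less_mult)
  then show "jrec e k Eb j < 2 ^ (k + Eb)" by (simp add: power_add)
qed

lemma jbase_less: "e \<le> H \<Longrightarrow> jbase e k Eb \<beta> s < 2 ^ H"
proof -
  assume e: "e \<le> H"
  let ?X = "{j. j < 2 ^ H \<and> j div 2 ^ Eb = \<beta> \<and> sig e k j = s}"
  show ?thesis
  proof (cases "?X = {}")
    case False
    then have "Min ((\<lambda>j. pos (e - k) (el e j)) ` ?X) \<in> (\<lambda>j. pos (e - k) (el e j)) ` ?X"
      by (intro Min_in) auto
    then obtain j where "j < 2 ^ H" "Min ((\<lambda>j. pos (e - k) (el e j)) ` ?X) = pos (e - k) (el e j)" by blast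
    moreover have "jbase e k Eb \<beta> s = Min ((\<lambda>j. pos (e - k) (el e j)) ` ?X)"
      unfolding jbase_def Let_def using False by (rule if_not_P)
    ultimately show ?thesis using e by (simp add: el_less pos_less)
  next
    case True
    then have "jbase e k Eb \<beta> s = 0" unfolding jbase_def Let_def by (rule if_P)
    then show ?thesis by simp
  qed
qed

definition hit :: "nat \<Rightarrow> nat \<Rightarrow> nat \<Rightarrow> bool" where
  "hit e c j \<longleftrightarrow> c \<le> el e j"

text \<open>Only the offset of a maximum is to be stored, which is below \<open>2 ^ r\<close>; the
  value is recovered by decoding the position.\<close>

definition amax :: "nat \<Rightarrow> nat \<Rightarrow> nat \<Rightarrow> nat" where
  "amax e r q = (SOME i. i < 2 ^ r \<and> (\<forall>i'<2 ^ r. el e (q * 2 ^ r + i') \<le> el e (q * 2 ^ r + i)))"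

lemma amax: "amax e r q < 2 ^ r \<and> (\<forall>i'<2 ^ r. el e (q * 2 ^ r + i') \<le> el e (q * 2 ^ r + amax e r q))"
  unfolding amax_def
proof (rule someI_ex)
  let ?F = "(\<lambda>i. el e (q * 2 ^ r + i)) ` {..<2 ^ r}"
  have "Max ?F \<in> ?F" by (intro Max_in) (auto simp: lessThan_empty_iff)
  then obtain i where i: "i < 2 ^ r" "Max ?F = el e (q * 2 ^ r + i)" by auto
  have "el e (q * 2 ^ r + i') \<le> Max ?F" if "i' < 2 ^ r" for i' using that by (intro Max_ge) auto
  then show "\<exists>i<2 ^ r. \<forall>i'<2 ^ r. el e (q * 2 ^ r + i') \<le> el e (q * 2 ^ r + i)" using i by auto
qed

lemma amax_hit: "c \<le> el e (q * 2 ^ r + amax e r q) \<longleftrightarrow> (\<exists>j. j div 2 ^ r = q \<and> hit e c j)"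
proof
  assume "c \<le> el e (q * 2 ^ r + amax e r q)"
  then show "\<exists>j. j div 2 ^ r = q \<and> hit e c j"
    using amax[of e r q] by (intro exI[of _ "q * 2 ^ r + amax e r q"]) (auto simp: hit_def)
next
  assume "\<exists>j. j div 2 ^ r = q \<and> hit e c j"
  then obtain j where j: "j div 2 ^ r = q" "c \<le> el e j" by (auto simp: hit_def)
  have "q * 2 ^ r + j mod 2 ^ r = j" using j(1) div_mult_mod_eq[of j "2 ^ r"] by simp
  moreover have "el e (q * 2 ^ r + j mod 2 ^ r) \<le> el e (q * 2 ^ r + amax e r q)" using amax[of e r q] by simp
  ultimately have "el e j \<le> el e (q * 2 ^ r + amax e r q)" by simp
  then show "c \<le> el e (q * 2 ^ r + amax e r q)" using j by simp
qed

text \<open>The three families of step functions stored in the dictionary: block of a node in which a position \<open>P\<close>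
  falls, height at which a hit to the right of a block occurs, and first block of a group with a hit.\<close>

definition f1 :: "nat \<Rightarrow> nat \<Rightarrow> nat \<Rightarrow> nat \<Rightarrow> nat" where
  "f1 e S v x = card {t. 1 \<le> t \<and> t < 2 ^ (e - S) \<and> P (el e (v * 2 ^ e + t * 2 ^ S)) < x}"

text \<open>Heights without a hit form an initial segment of \<open>1, ..., e - S\<close>, so their
  number is the last such height, and the full count means that there is no hit at all. The argument
  is the bound plus 1, which frees the argument 0 for the value 0, the result of a lookup for a
  function without breaks.\<close>

definition f2 :: "nat \<Rightarrow> nat \<Rightarrow> nat \<Rightarrow> nat \<Rightarrow> nat" where
  "f2 e S t x = (if x = 0 then 0 else card {e'. 1 \<le> e' \<and> e' \<le> e - S \<and>
     \<not> (\<exists>j. (t + 1) * 2 ^ S \<le> j \<and> j div 2 ^ (S + e') = t div 2 ^ e' \<and> hit e (x - 1) j)})"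

definition f3 :: "nat \<Rightarrow> nat \<Rightarrow> nat \<Rightarrow> nat \<Rightarrow> nat \<Rightarrow> nat" where
  "f3 e S e' d x = (if x = 0 then 0 else card {i. i < 2 ^ e' \<and>
     \<not> (\<exists>j. d * 2 ^ (S + e') \<le> j \<and> j < (d * 2 ^ e' + i + 1) * 2 ^ S \<and> hit e (x - 1) j)})"

lemma mono_f1: "mono (f1 e S v)"
proof (rule monoI)
  fix x y :: nat assume "x \<le> y"
  then show "f1 e S v x \<le> f1 e S v y"
    unfolding f1_def by (intro card_mono) auto
qed

lemma hit_mono: "hit e c j \<Longrightarrow> c' \<le> c \<Longrightarrow> hit e c' j"
  by (auto simp: hit_def)

lemma no_hit_mono:
  assumes "\<And>j. Y j \<Longrightarrow> X j"
  shows "{i. A i \<and> A' i \<and> \<not> (\<exists>j. D i j \<and> D' i j \<and> X j)} \<subseteq> {i. A i \<and> A' i \<and> \<not> (\<exists>j. D i j \<and> D' i j \<and> Y j)}"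
    "{i. A i \<and> \<not> (\<exists>j. D i j \<and> D' i j \<and> X j)} \<subseteq> {i. A i \<and> \<not> (\<exists>j. D i j \<and> D' i j \<and> Y j)}"
  using assms by blast+

lemma mono_f2: "mono (f2 e S t)"
proof (rule monoI)
  fix x y :: nat assume "x \<le> y"
  then have h: "hit e (y - 1) j \<Longrightarrow> hit e (x - 1) j" for j by (auto intro: hit_mono diff_le_mono)
  show "f2 e S t x \<le> f2 e S t y"
  proof (cases "x = 0")
    case False
    then have "y \<noteq> 0" using \<open>x \<le> y\<close> by simp
    show ?thesis unfolding f2_def if_not_P[OF False] if_not_P[OF \<open>y \<noteq> 0\<close>]
    proof (rule card_mono)
      show "finite {e'. 1 \<le> e' \<and> e' \<le> e - S \<and> \<not> (\<exists>j. (t + 1) * 2 ^ S \<le> j \<and>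
          j div 2 ^ (S + e') = t div 2 ^ e' \<and> hit e (y - 1) j)}"
        by (rule finite_subset[of _ "{..e - S}"]) auto
    qed (rule no_hit_mono(1)[OF h])
  qed (simp add: f2_def)
qed

lemma mono_f3: "mono (f3 e S e' d)"
proof (rule monoI)
  fix x y :: nat assume "x \<le> y"
  then have h: "hit e (y - 1) j \<Longrightarrow> hit e (x - 1) j" for j by (auto intro: hit_mono diff_le_mono)
  show "f3 e S e' d x \<le> f3 e S e' d y"
  proof (cases "x = 0")
    case False
    then have "y \<noteq> 0" using \<open>x \<le> y\<close> by simp
    show ?thesis unfolding f3_def if_not_P[OF False] if_not_P[OF \<open>y \<noteq> 0\<close>]
    proof (rule card_mono)
      show "finite {i. i < 2 ^ e' \<and> \<not> (\<exists>j. d * 2 ^ (S + e') \<le> j \<and>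
          j < (d * 2 ^ e' + i + 1) * 2 ^ S \<and> hit e (y - 1) j)}"
        by (rule finite_subset[of _ "{..<2 ^ e'}"]) auto
    qed (rule no_hit_mono(2)[OF h])
  qed (simp add: f3_def)
qed

lemma f1_0: "f1 e S v 0 = 0" and f2_0: "f2 e S t 0 = 0" and f3_0: "f3 e S e' d 0 = 0"
  by (simp_all add: f1_def f2_def f3_def)

lemma f1_le: "f1 e S v x \<le> 2 ^ (e - S) - 1"
proof -
  have "f1 e S v x \<le> card {1..<(2::nat) ^ (e - S)}" unfolding f1_def by (intro card_mono) auto
  then show ?thesis by simp
qed

lemma f2_le: "f2 e S t x \<le> e - S"
proof -
  have "card {e'. 1 \<le> e' \<and> e' \<le> e - S \<and> \<not> (\<exists>j. (t + 1) * 2 ^ S \<le> j \<and> j div 2 ^ (S + e') = t div 2 ^ e' \<and> hit e (x - 1) j)}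
     \<le> card {1..e - S}" by (intro card_mono) auto
  then show ?thesis by (auto simp: f2_def)
qed

lemma f3_le: "f3 e S e' d x \<le> 2 ^ e'"
proof -
  have "card {i. i < 2 ^ e' \<and> \<not> (\<exists>j. d * 2 ^ (S + e') \<le> j \<and> j < (d * 2 ^ e' + i + 1) * 2 ^ S \<and> hit e (x - 1) j)}
     \<le> card {..<(2::nat) ^ e'}" by (intro card_mono) auto
  then show ?thesis by (auto simp: f3_def)
qed

end

section \<open>Searching a node list\<close>

text \<open>Turns the counts \<open>f1\<close>, \<open>f2\<close> and \<open>f3\<close> into
  positions: a downward closed set of numbers from \<open>b\<close> on is an interval whose length
  is its size.\<close>

lemma down_closed_interval:
  fixes A :: "nat set"
  assumes "finite A" and "\<And>t. t \<in> A \<Longrightarrow> b \<le> t" and "\<And>t t'. t \<in> A \<Longrightarrow> b \<le> t' \<Longrightarrow> t' \<le> t \<Longrightarrow> t' \<in> A"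
  shows "A = {b..<b + card A}"
proof (cases "A = {}")
  case False
  have M: "Max A \<in> A" using assms(1) False by simp
  have "A = {b..Max A}"
  proof (intro set_eqI iffI)
    fix x assume "x \<in> A"
    then show "x \<in> {b..Max A}" using assms(1,2) by auto
  next
    fix x assume "x \<in> {b..Max A}"
    then show "x \<in> A" using assms(3)[OF M] by auto
  qed
  moreover from this have "card A = Suc (Max A) - b" by (metis card_atLeastAtMost)
  moreover have "b \<le> Max A" using M assms(2) by blast
  ultimately show ?thesis by (metis Suc_diff_le atLeastLessThanSuc_atLeastAtMost le_add_diff_inverse le_SucI)
qed simp

lemma div_pow_lower: "(q::nat) \<le> x div 2 ^ r \<longleftrightarrow> q * 2 ^ r \<le> x"
  by (simp add: less_eq_div_iff_mult_less_eq)

lemma div_pow_upper: "(x::nat) div 2 ^ r < q \<longleftrightarrow> x < q * 2 ^ r"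
  by (simp add: div_less_iff_less_mult)

lemma near_sibling: "(q::nat) \<le> x \<Longrightarrow> x div 2 = q div 2 \<Longrightarrow> x = q \<or> x = q + 1"
  by presburger

context wave
begin

lemma div_eq_iff_range: "(x::nat) div 2 ^ r = q \<longleftrightarrow> q * 2 ^ r \<le> x \<and> x < (q + 1) * 2 ^ r"
  using div_pow_lower[of q x r] div_pow_upper[of x r "q + 1"] by auto

text \<open>Ranks increase along a list, so the blocks whose first point lies below \<open>p\<close>
  form an initial segment, and \<open>f1\<close> counts them, leaving out the first block of the
  node. Hence block \<open>t\<close> is the last of them, or the first block if there is none:
  positions before it have rank below \<open>p\<close>, positions after it rank at least
  \<open>p\<close>.\<close>

lemma f1_block:
  fixes p :: nat
  assumes e: "S \<le> e" "e \<le> H" and v: "v < 2 ^ (H - e)"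
  defines "t \<equiv> v * 2 ^ (e - S) + f1 e S v p"
  shows "t div 2 ^ (e - S) = v"
    "\<And>j. j div 2 ^ e = v \<Longrightarrow> j < t * 2 ^ S \<Longrightarrow> P (el e j) < p"
    "\<And>j. j div 2 ^ e = v \<Longrightarrow> (t + 1) * 2 ^ S \<le> j \<Longrightarrow> p \<le> P (el e j)"
proof -
  define F where "F = f1 e S v p"
  define A where "A = {t. 1 \<le> t \<and> t < 2 ^ (e - S) \<and> P (el e (v * 2 ^ e + t * 2 ^ S)) < p}"
  have FA: "F = card A" by (simp add: F_def A_def f1_def)
  have pw: "(2::nat) ^ e = 2 ^ (e - S) * 2 ^ S" using e by (simp flip: power_add)
  have pwH: "(2::nat) ^ H = 2 ^ (H - e) * 2 ^ e" using e by (simp flip: power_add)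
  have inN: "j < 2 ^ H" if "j div 2 ^ e = v" for j
    using that v by (simp add: pwH div_pow_upper[symmetric])
  have st: "(v * 2 ^ e + t * 2 ^ S) div 2 ^ e = v" if "t < 2 ^ (e - S)" for t
  proof -
    have "t * 2 ^ S < 2 ^ e" unfolding pw using that by simp
    then show ?thesis by simp
  qed
  have A: "A = {1..<1 + F}"
    unfolding FA
  proof (rule down_closed_interval)
    show "finite A" by (rule finite_subset[of _ "{..<2 ^ (e - S)}"]) (auto simp: A_def)
    fix t t' assume t: "t \<in> A" "1 \<le> t'" "t' \<le> t"
    show "t' \<in> A"
    proof (cases "t' = t")
      case False
      then have "t' < t" using t by simp
      then have "v * 2 ^ e + t' * 2 ^ S < v * 2 ^ e + t * 2 ^ S" by simp
      moreover have "t < 2 ^ (e - S)" "t' < 2 ^ (e - S)" using t by (auto simp: A_def)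
      ultimately have "P (el e (v * 2 ^ e + t' * 2 ^ S)) < P (el e (v * 2 ^ e + t * 2 ^ S))"
        using st inN by (intro P_el_mono e(2)) auto
      then show ?thesis using t \<open>t' < t\<close> by (auto simp: A_def)
    qed (use t in simp)
  qed (auto simp: A_def)
  have Fl: "F < 2 ^ (e - S)" using f1_le[of e S v p] by (simp add: F_def le_diff_conv2 Suc_le_eq[symmetric])
  show "t div 2 ^ (e - S) = v" using Fl by (simp add: t_def F_def)
  have tS: "t * 2 ^ S = v * 2 ^ e + F * 2 ^ S" unfolding t_def F_def[symmetric] pw by (simp add: algebra_simps)
  fix j assume j: "j div 2 ^ e = v"
  show "P (el e j) < p" if "j < t * 2 ^ S"
  proof -
    have "v * 2 ^ e \<le> j" using j by (simp add: div_eq_iff_range)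
    then have "F \<noteq> 0" using that tS by (metis add.right_neutral leD mult_0)
    then have "F \<in> A" unfolding A by simp
    then have "P (el e (v * 2 ^ e + F * 2 ^ S)) < p" by (simp add: A_def)
    moreover have "P (el e j) < P (el e (v * 2 ^ e + F * 2 ^ S))"
      using that tS j st[OF Fl] inN by (intro P_el_mono e(2)) auto
    ultimately show ?thesis by simp
  qed
  show "p \<le> P (el e j)" if "(t + 1) * 2 ^ S \<le> j"
  proof -
    have s: "v * 2 ^ e + (F + 1) * 2 ^ S \<le> j" using that tS by (simp add: algebra_simps)
    have "j < (v + 1) * 2 ^ e" using j by (simp add: div_eq_iff_range)
    then have "(F + 1) * 2 ^ S < 2 ^ e" using s by (simp add: algebra_simps)
    then have F1: "F + 1 < 2 ^ (e - S)" unfolding pw by (simp only: mult_less_cancel2)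
    have "F + 1 \<notin> A" unfolding A by simp
    then have "p \<le> P (el e (v * 2 ^ e + (F + 1) * 2 ^ S))" using F1 by (auto simp: A_def)
    moreover have "P (el e (v * 2 ^ e + (F + 1) * 2 ^ S)) \<le> P (el e j)"
    proof (cases "v * 2 ^ e + (F + 1) * 2 ^ S = j")
      case False
      then have "P (el e (v * 2 ^ e + (F + 1) * 2 ^ S)) < P (el e j)"
        using s j st[OF F1] inN by (intro P_el_mono e(2)) auto
      then show ?thesis by simp
    qed simp
    ultimately show ?thesis by simp
  qed
qed

lemma f2_none:
  assumes "S \<le> e" "f2 e S t (c + 1) = e - S" "(t + 1) * 2 ^ S \<le> j" "j div 2 ^ e = t div 2 ^ (e - S)"
  shows "\<not> hit e c j"
proof (cases "e = S")
  case True
  then have "j div 2 ^ S = t" using assms by simp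
  then have "j < (t + 1) * 2 ^ S" unfolding div_eq_iff_range by simp
  then show ?thesis using assms(3) by simp
next
  case False
  define A where "A = {e'. 1 \<le> e' \<and> e' \<le> e - S \<and>
     \<not> (\<exists>j. (t + 1) * 2 ^ S \<le> j \<and> j div 2 ^ (S + e') = t div 2 ^ e' \<and> hit e c j)}"
  have "card A = card {1..e - S}" using assms(2) by (simp add: f2_def A_def)
  moreover have "A \<subseteq> {1..e - S}" by (auto simp: A_def)
  ultimately have "A = {1..e - S}" by (intro card_subset_eq) auto
  then have "e - S \<in> A" using False assms(1) by simp
  then show ?thesis using assms unfolding A_def by auto
qed

text \<open>The ancestor of \<open>t\<close> at height \<open>F\<close> contains no hit to the right
  of \<open>t\<close>, but its parent does. The parent consists of two halves, and only positions
  right of \<open>t\<close> count, so the hit lies in the right sibling \<open>d\<close> of that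
  ancestor. There \<open>f3\<close> counts the blocks before the first one with a hit.\<close>

lemma next_block:
  assumes e: "S \<le> e" and F: "f2 e S t (c + 1) = F" "F < e - S"
  defines "d \<equiv> t div 2 ^ F + 1"
  defines "t' \<equiv> d * 2 ^ F + f3 e S F d (c + 1)"
  shows "t < t'" "t' div 2 ^ (e - S) = t div 2 ^ (e - S)" "\<exists>j. j div 2 ^ S = t' \<and> hit e c j"
    "\<And>j. (t + 1) * 2 ^ S \<le> j \<Longrightarrow> j < t' * 2 ^ S \<Longrightarrow> \<not> hit e c j"
proof -
  define U where "U e' = (\<exists>j. (t + 1) * 2 ^ S \<le> j \<and> j div 2 ^ (S + e') = t div 2 ^ e' \<and> hit e c j)" for e'
  define A where "A = {e'. 1 \<le> e' \<and> e' \<le> e - S \<and> \<not> U e'}"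
  have FA: "F = card A" using F(1) by (simp add: A_def U_def f2_def)
  have Um: "U e'" if "U e''" "e'' \<le> e'" for e' e''
  proof -
    have "j div 2 ^ (S + e') = t div 2 ^ e'" if "j div 2 ^ (S + e'') = t div 2 ^ e''" for j
      using div_pow_split[of "S + e''" "S + e'" j] div_pow_split[of e'' e' t] \<open>e'' \<le> e'\<close> that by simp
    then show ?thesis using that unfolding U_def by blast
  qed
  have A: "A = {1..<1 + F}"
    unfolding FA
  proof (rule down_closed_interval)
    show "finite A" by (rule finite_subset[of _ "{..e - S}"]) (auto simp: A_def)
    fix t t' assume "t \<in> A" "1 \<le> t'" "t' \<le> t"
    then show "t' \<in> A" using Um[of t' t] by (auto simp: A_def)
  qed (auto simp: A_def)
  have "F + 1 \<notin> A" unfolding A by simp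
  then have U1: "U (F + 1)" using F(2) by (auto simp: A_def)
  have U0: "\<not> U F"
  proof (cases "F = 0")
    case True
    have False if "(t + 1) * 2 ^ S \<le> j" "j div 2 ^ S = t" for j
      using that unfolding div_eq_iff_range by simp
    then show ?thesis using True by (auto simp: U_def)
  next
    case False
    then have "F \<in> A" unfolding A by simp
    then show ?thesis by (simp add: A_def)
  qed
  define q where "q = t div 2 ^ F"
  have dq: "d = q + 1" by (simp add: d_def q_def)
  have grp: "j div 2 ^ (S + F) = q \<or> j div 2 ^ (S + F) = d"
    if j: "(t + 1) * 2 ^ S \<le> j" "j div 2 ^ (S + (F + 1)) = t div 2 ^ (F + 1)" for j
  proof -
    have "j div 2 ^ (S + (F + 1)) = j div 2 ^ (S + F) div 2" using div_pow_split[of "S + F" "S + (F + 1)" j] by simp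
    moreover have "t div 2 ^ (F + 1) = q div 2" using div_pow_split[of F "F + 1" t] by (simp add: q_def)
    ultimately have h: "j div 2 ^ (S + F) div 2 = q div 2" using j(2) by simp
    have "t * 2 ^ S \<le> j" using j(1) by simp
    then have "t \<le> j div 2 ^ S" unfolding div_pow_lower .
    then have "t div 2 ^ F \<le> j div 2 ^ S div 2 ^ F" by (rule div_le_mono)
    then have "q \<le> j div 2 ^ (S + F)" using div_pow_split[of S "S + F" j] by (simp add: q_def)
    then show ?thesis using near_sibling[OF _ h] dq by simp
  qed
  obtain j0 where j0: "(t + 1) * 2 ^ S \<le> j0" "j0 div 2 ^ (S + (F + 1)) = t div 2 ^ (F + 1)" "hit e c j0"
    using U1 by (auto simp: U_def)
  have j0d: "j0 div 2 ^ (S + F) = d"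
  proof (rule ccontr)
    assume "j0 div 2 ^ (S + F) \<noteq> d"
    then have "j0 div 2 ^ (S + F) = q" using grp[OF j0(1,2)] by simp
    then have "U F" unfolding U_def q_def using j0(1,3) by blast
    then show False using U0 by simp
  qed
  define Z where "Z i = (\<exists>j. d * 2 ^ (S + F) \<le> j \<and> j < (d * 2 ^ F + i + 1) * 2 ^ S \<and> hit e c j)" for i
  define A3 where "A3 = {i. i < 2 ^ F \<and> \<not> Z i}"
  define F3 where "F3 = f3 e S F d (c + 1)"
  have F3A: "F3 = card A3" by (simp add: F3_def A3_def Z_def f3_def)
  have Zm: "Z i'" if "Z i" "i \<le> i'" for i i'
  proof -
    have "(d * 2 ^ F + i + 1) * 2 ^ S \<le> (d * 2 ^ F + i' + 1) * 2 ^ S" using that by simp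
    then show ?thesis using that unfolding Z_def by (meson less_le_trans)
  qed
  have A3: "A3 = {0..<0 + F3}"
    unfolding F3A
  proof (rule down_closed_interval)
    show "finite A3" by (simp add: A3_def)
    fix t t' assume "t \<in> A3" "t' \<le> t"
    then show "t' \<in> A3" using Zm[of t' t] by (auto simp: A3_def)
  qed (auto simp: A3_def)
  have pwSF: "(2::nat) ^ (S + F) = 2 ^ F * 2 ^ S" by (simp add: power_add)
  have j0r: "d * 2 ^ (S + F) \<le> j0" "j0 < (d + 1) * 2 ^ (S + F)" using j0d by (simp_all add: div_eq_iff_range)
  \<comment> \<open>The number, within group \<open>d\<close>, of the block containing the hit
    \<open>j0\<close>; it shows that \<open>f3\<close> stays below \<open>2 ^ F\<close>.\<close>
  define i0 where "i0 = j0 div 2 ^ S - d * 2 ^ F"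
  have i0a: "d * 2 ^ F \<le> j0 div 2 ^ S" unfolding div_pow_lower using j0r(1) by (simp add: pwSF mult.assoc)
  have "j0 div 2 ^ S < (d + 1) * 2 ^ F" unfolding div_pow_upper using j0r(2) by (simp only: pwSF mult.assoc)
  then have i0l: "i0 < 2 ^ F" using i0a by (simp add: i0_def algebra_simps)
  have "j0 < (j0 div 2 ^ S + 1) * 2 ^ S" using div_eq_iff_range[of j0 S "j0 div 2 ^ S"] by simp
  then have "Z i0" unfolding Z_def using j0(3) j0r(1) i0a by (intro exI[of _ j0]) (simp add: i0_def)
  then have "i0 \<notin> A3" by (simp add: A3_def)
  then have F3l: "F3 < 2 ^ F" using i0l unfolding A3 by simp
  have "F3 \<notin> A3" unfolding A3 by simp
  then have ZF: "Z F3" using F3l by (simp add: A3_def)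
  have t'e: "t' = d * 2 ^ F + F3" by (simp add: t'_def F3_def)
  have noZ: "\<not> hit e c j" if "d * 2 ^ (S + F) \<le> j" "j < t' * 2 ^ S" for j
  proof (cases "F3 = 0")
    case True
    then show ?thesis using that by (simp add: t'e pwSF mult.assoc)
  next
    case False
    then have "F3 - 1 \<in> A3" unfolding A3 by simp
    then have "\<not> Z (F3 - 1)" by (simp add: A3_def)
    moreover have "d * 2 ^ F + (F3 - 1) + 1 = t'" using False by (simp add: t'e)
    ultimately show ?thesis using that unfolding Z_def by metis
  qed
  obtain j1 where j1: "d * 2 ^ (S + F) \<le> j1" "j1 < (t' + 1) * 2 ^ S" "hit e c j1"
    using ZF by (auto simp: Z_def t'e)
  have "\<not> j1 < t' * 2 ^ S" using noZ[OF j1(1)] j1(3) by blast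
  then have "j1 div 2 ^ S = t'" using j1(2) by (simp add: div_eq_iff_range)
  then show "\<exists>j. j div 2 ^ S = t' \<and> hit e c j" using j1(3) by blast
  have "t < d * 2 ^ F" unfolding div_pow_upper[symmetric] dq q_def by simp
  then show "t < t'" by (simp add: t'e)
  have t'd: "t' div 2 ^ F = d" using F3l by (simp add: t'e)
  have "t' div 2 ^ (F + 1) = t div 2 ^ (F + 1)"
  proof -
    have "j0 div 2 ^ (S + (F + 1)) = d div 2" using div_pow_split[of "S + F" "S + (F + 1)" j0] j0d by simp
    then show ?thesis using j0(2) div_pow_split[of F "F + 1" t'] t'd by simp
  qed
  then show "t' div 2 ^ (e - S) = t div 2 ^ (e - S)"
    using div_pow_split[of "F + 1" "e - S" t'] div_pow_split[of "F + 1" "e - S" t] F(2) by simp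
  fix j assume j: "(t + 1) * 2 ^ S \<le> j" "j < t' * 2 ^ S"
  show "\<not> hit e c j"
  proof (cases "d * 2 ^ (S + F) \<le> j")
    case True
    then show ?thesis using noZ j by blast
  next
    case False
    have "t * 2 ^ S \<le> j" using j(1) by simp
    then have "t div 2 ^ F \<le> j div 2 ^ S div 2 ^ F" unfolding div_pow_lower[symmetric] by (rule div_le_mono)
    then have "q \<le> j div 2 ^ (S + F)" using div_pow_split[of S "S + F" j] by (simp add: q_def)
    moreover have "j div 2 ^ (S + F) < d" unfolding div_pow_upper using False by simp
    ultimately have "j div 2 ^ (S + F) = t div 2 ^ F" using dq by (simp add: q_def)
    then show ?thesis using U0 j(1) unfolding U_def by blast
  qed
qed

end

section \<open>Binary length and digit sums\<close>

fun blen :: "nat \<Rightarrow> nat" where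
  "blen 0 = 0"
| "blen (Suc m) = Suc (blen (Suc m div 2))"

lemma blen_pos: "0 < m \<Longrightarrow> blen m = Suc (blen (m div 2))"
  by (cases m) auto

lemma blen_le: "m < 2 ^ k \<Longrightarrow> blen m \<le> k"
proof (induction k arbitrary: m)
  case (Suc k)
  show ?case
  proof (cases "m = 0")
    case False
    have "m div 2 < 2 ^ k" using Suc.prems by simp
    then show ?thesis using Suc.IH[of "m div 2"] False by (simp add: blen_pos)
  qed simp
qed simp

lemma blen_mono: "m \<le> m' \<Longrightarrow> blen m \<le> blen m'"
proof (induction m' arbitrary: m rule: less_induct)
  case (less m')
  show ?case
  proof (cases "m = 0")
    case False
    then have "blen (m div 2) \<le> blen (m' div 2)" using less.prems by (intro less.IH div_le_mono) auto
    then show ?thesis using False less.prems by (simp add: blen_pos)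
  qed simp
qed

text \<open>Makes \<open>blen\<close> of the length of an interval a variant for the binary
  searches.\<close>

lemma blen_halve: "0 < m \<Longrightarrow> m' \<le> m div 2 \<Longrightarrow> blen m' < blen m"
  using blen_mono[of m' "m div 2"] by (simp add: blen_pos)

text \<open>Base-\<open>D\<close> digits of heights: \<open>kf D h\<close> is the largest power of \<open>D\<close> dividing \<open>h\<close>, so that the step
  \<open>h \<mapsto> h - kf D h\<close> decrements the lowest nonzero digit.\<close>

function kf :: "nat \<Rightarrow> nat \<Rightarrow> nat" where
  "kf D h = (if h = 0 \<or> D < 2 then 0 else if h mod D \<noteq> 0 then 1 else D * kf D (h div D))"
  by pat_completeness auto
termination by (relation "measure snd") auto

function dsum :: "nat \<Rightarrow> nat \<Rightarrow> nat" where
  "dsum D h = (if h = 0 \<or> D < 2 then 0 else h mod D + dsum D (h div D))"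
  by pat_completeness auto
termination by (relation "measure snd") auto

declare kf.simps [simp del] dsum.simps [simp del]

text \<open>A final digit 0 can be stripped, which divides \<open>kf\<close> by \<open>D\<close> and
  keeps the digit sum. With a nonzero final digit the step subtracts 1 without a borrow.\<close>

lemma kf_step:
  assumes "2 \<le> D" "0 < h"
  shows "0 < kf D h" "kf D h \<le> h" "dsum D (h - kf D h) < dsum D h" "kf D h dvd h"
    "\<exists>i. kf D h = D ^ i"
proof -
  have "0 < kf D h \<and> kf D h \<le> h \<and> dsum D (h - kf D h) + 1 = dsum D h \<and> kf D h dvd h \<and> (\<exists>i. kf D h = D ^ i)"
    using assms(2)
  proof (induction h rule: less_induct)
    case (less h)
    show ?case
    proof (cases "h mod D = 0")
      case True
      then obtain g where g: "h = D * g" by auto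
      have g0: "0 < g" "g < h" using less.prems assms(1) g by auto
      have k: "kf D h = D * kf D g" using g g0 assms(1) by (subst kf.simps) auto
      note IH = less.IH[OF g0(2,1)]
      have sub: "h - kf D h = D * (g - kf D g)" unfolding k by (simp add: g diff_mult_distrib2)
      have ds: "dsum D (D * x) = dsum D x" for x
        using assms(1) by (subst dsum.simps) (auto simp: dsum.simps[of D 0])
      obtain i where "kf D g = D ^ i" using IH by blast
      then have "kf D h = D ^ Suc i" using k by simp
      then have "\<exists>i. kf D h = D ^ i" by blast
      then show ?thesis using IH sub ds g k assms(1) by auto
    next
      case False
      then have k: "kf D h = 1" using assms(1) less.prems by (subst kf.simps) auto
      define m where "m = h mod D"
      define x where "x = h div D"
      have hx: "h = x * D + m" by (simp add: x_def m_def)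
      have m: "0 < m" "m < D" using False assms(1) by (auto simp: m_def)
      obtain m' where m': "m = Suc m'" using m(1) by (cases m) auto
      have h1: "h - 1 = x * D + m'" "m' = m - 1" "m' < D" using m m' hx by simp_all
      have "(h - 1) mod D = m - 1" "(h - 1) div D = x" unfolding h1(1,2)[symmetric] unfolding h1(1) using h1(3) by auto
      then have "dsum D (h - 1) = m - 1 + dsum D x"
        using assms(1) less.prems by (cases "h = 1") (subst dsum.simps, auto simp: dsum.simps[of D 0])+
      moreover have "dsum D h = m + dsum D x"
        using assms(1) less.prems by (subst dsum.simps) (auto simp: m_def x_def)
      ultimately show ?thesis using k m less.prems by (auto intro: exI[of _ 0])
    qed
  qed
  then show "0 < kf D h" "kf D h \<le> h" "dsum D (h - kf D h) < dsum D h" "kf D h dvd h" "\<exists>i. kf D h = D ^ i"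
    by auto
qed

lemma dsum_le: "2 \<le> D \<Longrightarrow> h < D ^ J \<Longrightarrow> dsum D h \<le> D * J"
proof (induction J arbitrary: h)
  case 0
  then show ?case by (simp add: dsum.simps)
next
  case (Suc J)
  have "h div D < D ^ J" using Suc.prems by (simp add: div_less_iff_less_mult mult.commute)
  then have "dsum D (h div D) \<le> D * J" using Suc by simp
  moreover have "h mod D \<le> D" using Suc.prems(1) by (simp add: less_imp_le)
  ultimately have "h mod D + dsum D (h div D) \<le> D * Suc J" by simp
  then show ?case by (subst dsum.simps) simp
qed

section \<open>Dictionary lookup and evaluation of step functions\<close>

abbreviation "sc k \<equiv> Rd (C 0) (C k)"
abbreviation "pl \<equiv> B Add"
abbreviation "mi \<equiv> B Sub"
abbreviation "ti \<equiv> B Mul"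
abbreviation "di \<equiv> B Div"
abbreviation "mo \<equiv> B Mod"
abbreviation "shl \<equiv> B Shl"
abbreviation "shr \<equiv> B Shr"
abbreviation "IfEq e1 e2 c1 c2 \<equiv> If e1 e2 c2 (If e2 e1 c2 c1)"

text \<open>Each routine works on the variables from some number on and leaves those below it unchanged.
  Array 0 holds the scalars \<open>2 ^ H, H, a, n, R, Q, Q * R, L\<close>.\<close>

definition LOOK :: com where
  "LOOK = Asg 61 (C 0) ;; Asg 62 (C 0) ;;
    While (V 61) (sc 7) (
      Asg 63 (pl (ti (V 61) (sc 4)) (di (mo (ti (Rd (C 12) (V 61)) (V 60)) (sc 6)) (sc 5))) ;;
      IfEq (Rd (C 13) (V 63)) (pl (V 60) (C 1)) (Asg 62 (pl (V 63) (C 1))) (Asg 62 (V 62)) ;;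
      Asg 61 (pl (V 61) (C 1))) ;;
    Asg 60 (V 62)"

definition key_exp :: "nat \<Rightarrow> exp" where
  "key_exp g = pl (ti (pl (ti (V 40) (pl (sc 1) (C 2))) (V g)) (shl (C 1) (pl (sc 1) (C 1)))) (shr (V 41) (V g))"

text \<open>Evaluates function number \<open>V 40\<close> at \<open>V 41\<close>. If the root of its
  trie, at height \<open>H + 1\<close>, is not a key, the function has no breaks and the value is 0.
  Otherwise a binary search over the heights finds the lowest ancestor of the argument that is a
  key, and the bit of the argument just below it selects one of the two values stored there.\<close>

definition PRED :: com where
  "PRED = Asg 42 (C 0) ;; Asg 43 (pl (sc 1) (C 1)) ;; Asg 60 (key_exp 43) ;; LOOK ;;
    If (C 0) (V 60) (
      While (V 42) (V 43) (
        Asg 44 (di (pl (V 42) (V 43)) (C 2)) ;; Asg 60 (key_exp 44) ;; LOOK ;;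
        If (C 0) (V 60) (Asg 43 (V 44)) (Asg 42 (pl (V 44) (C 1)))) ;;
      Asg 60 (key_exp 42) ;; LOOK ;;
      If (mo (shr (ti (C 2) (V 41)) (V 42)) (C 2)) (C 1)
        (Asg 40 (Rd (C 14) (mi (V 60) (C 1)))) (Asg 40 (Rd (C 15) (mi (V 60) (C 1)))))
    (Asg 40 (C 0))"

text \<open>A mixed-radix number with the digits function, height and trie node, so that one
  dictionary serves all functions.\<close>

definition keyf :: "nat \<Rightarrow> nat \<Rightarrow> nat \<Rightarrow> nat \<Rightarrow> nat" where
  "keyf H i g z = (i * (H + 2) + g) * 2 ^ (H + 1) + z"

text \<open>The trie nodes above the break points of all functions, so that membership tells whether
  there is a break below a node. Arguments go up to \<open>2 ^ H\<close> inclusive, hence tries of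
  height \<open>H + 1\<close>.\<close>

definition keyset :: "nat \<Rightarrow> nat \<Rightarrow> (nat \<Rightarrow> nat \<Rightarrow> nat) \<Rightarrow> nat set" where
  "keyset H I F = {x. \<exists>i g k. x = keyf H i g (k div 2 ^ g) \<and> i < I \<and> g \<le> H + 1 \<and> k \<in> breaks (2 ^ (H + 1)) (F i)}"

definition key_sub :: "nat \<Rightarrow> (nat \<Rightarrow> nat \<Rightarrow> nat) \<Rightarrow> nat \<Rightarrow> nat set" where
  "key_sub H F x = (let i = x div 2 ^ (H + 1) div (H + 2) in
     subt (breaks (2 ^ (H + 1)) (F i)) (x div 2 ^ (H + 1) mod (H + 2)) (x mod 2 ^ (H + 1)))"

text \<open>\<open>plo\<close> and \<open>phi\<close> are the two candidate values at a trie node,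
  taken next to its least and its greatest break. With them a lookup needs no access to the
  breaks.\<close>

definition plo :: "nat \<Rightarrow> (nat \<Rightarrow> nat \<Rightarrow> nat) \<Rightarrow> nat \<Rightarrow> nat" where
  "plo H F x = F (x div 2 ^ (H + 1) div (H + 2)) (Min (key_sub H F x))"

definition phi :: "nat \<Rightarrow> (nat \<Rightarrow> nat \<Rightarrow> nat) \<Rightarrow> nat \<Rightarrow> nat" where
  "phi H F x = F (x div 2 ^ (H + 1) div (H + 2)) (Suc (Max (key_sub H F x)))"

lemma mult_plus_parts: "(g::nat) < m \<Longrightarrow> (i * m + g) div m = i \<and> (i * m + g) mod m = g"
  by simp

lemma keyf_parts:
  assumes "g \<le> H + 1" "z < 2 ^ (H + 1)"
  shows "keyf H i g z div 2 ^ (H + 1) div (H + 2) = i" "keyf H i g z div 2 ^ (H + 1) mod (H + 2) = g"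
    "keyf H i g z mod 2 ^ (H + 1) = z"
proof -
  have "keyf H i g z div 2 ^ (H + 1) = i * (H + 2) + g" "keyf H i g z mod 2 ^ (H + 1) = z"
    unfolding keyf_def using mult_plus_parts[OF assms(2)] by blast+
  moreover have "(i * (H + 2) + g) div (H + 2) = i" "(i * (H + 2) + g) mod (H + 2) = g"
    using mult_plus_parts[of g "H + 2" i] assms(1) by simp_all
  ultimately show "keyf H i g z div 2 ^ (H + 1) div (H + 2) = i" "keyf H i g z div 2 ^ (H + 1) mod (H + 2) = g"
    "keyf H i g z mod 2 ^ (H + 1) = z" by simp_all
qed

lemma keyf_less:
  assumes "i < I" "g \<le> H + 1" "z < 2 ^ (H + 1)" "I * (H + 2) * 2 ^ (H + 1) \<le> Q"
  shows "keyf H i g z < Q"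
proof -
  have "i * (H + 2) + g + 1 \<le> (i + 1) * (H + 2)" using assms(2) by simp
  also have "\<dots> \<le> I * (H + 2)" using assms(1) by (intro mult_le_mono1) simp
  finally have "(i * (H + 2) + g + 1) * 2 ^ (H + 1) \<le> I * (H + 2) * 2 ^ (H + 1)" by (rule mult_le_mono1)
  then show ?thesis using assms(3,4) unfolding keyf_def by (simp add: algebra_simps)
qed

lemma div_pow_le: "(k::nat) < u \<Longrightarrow> k div 2 ^ g < u"
  by (meson div_le_dividend le_less_trans)

lemma keyf_in_keyset:
  assumes "i < I" "g \<le> H + 1" "z < 2 ^ (H + 1)"
  shows "keyf H i g z \<in> keyset H I F \<longleftrightarrow> subt (breaks (2 ^ (H + 1)) (F i)) g z \<noteq> {}"
proof
  assume "keyf H i g z \<in> keyset H I F"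
  then obtain i' g' k where k: "keyf H i g z = keyf H i' g' (k div 2 ^ g')" "i' < I" "g' \<le> H + 1"
    "k \<in> breaks (2 ^ (H + 1)) (F i')" by (auto simp: keyset_def)
  have "k div 2 ^ g' < 2 ^ (H + 1)" using k(4) by (intro div_pow_le) (simp add: breaks_def)
  then have "i' = i" "g' = g" "k div 2 ^ g' = z"
    using keyf_parts[OF assms(2,3), of i] keyf_parts[OF k(3), of "k div 2 ^ g'" i'] k(1) by metis+
  then show "subt (breaks (2 ^ (H + 1)) (F i)) g z \<noteq> {}" using k(4) by (auto simp: subt_def)
next
  assume "subt (breaks (2 ^ (H + 1)) (F i)) g z \<noteq> {}"
  then show "keyf H i g z \<in> keyset H I F" using assms by (auto simp: subt_def keyset_def)
qed

lemma keyset_less: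
  assumes "I * (H + 2) * 2 ^ (H + 1) \<le> Q" shows "keyset H I F \<subseteq> {..<Q}"
proof
  fix x assume "x \<in> keyset H I F"
  then obtain i g k where k: "x = keyf H i g (k div 2 ^ g)" "i < I" "g \<le> H + 1" "k \<in> breaks (2 ^ (H + 1)) (F i)"
    by (auto simp: keyset_def)
  have "k div 2 ^ g < 2 ^ (H + 1)" using k(4) by (intro div_pow_le) (simp add: breaks_def)
  then show "x \<in> {..<Q}" using keyf_less[OF k(2,3) _ assms] k(1) by simp
qed

lemma tr_AsgSeqV:
  "safe w AA s e \<Longrightarrow> ev AA s e = v \<Longrightarrow> tr w AA c (s(x := v)) n Q \<Longrightarrow> tr w AA (Asg x e ;; c) s n Q"
  using tr_AsgSeq by blast

lemma tr_AsgV: "safe w AA s e \<Longrightarrow> ev AA s e = v \<Longrightarrow> Q (s(x := v)) \<Longrightarrow> tr w AA (Asg x e) s n Q"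
  using tr_Asg by blast

text \<open>What the program may assume about the memory: parameters in array 0, multipliers in
  array 12, keys in array 13, and the two values of each key in arrays 14 and 15. \<open>QRQ\<close>
  keeps the product of a multiplier and a key within a word.\<close>

locale dict_ds =
  fixes w H a n L Q R I :: nat and F :: "nat \<Rightarrow> nat \<Rightarrow> nat" and am :: "nat \<Rightarrow> nat"
    and tab :: "nat \<Rightarrow> nat \<Rightarrow> nat" and AA :: "nat list list"
  assumes H1: "1 \<le> H" and a1: "1 \<le> a" and w40: "40 * H \<le> w"
    and len16: "16 \<le> length AA"
    and A0: "AA ! 0 = [2 ^ H, H, a, n, R, Q, Q * R, L]"
    and A12: "length (AA ! 12) = L" "\<And>i. i < L \<Longrightarrow> AA ! 12 ! i = am i"
    and A13: "length (AA ! 13) = L * R" "\<And>i s. i < L \<Longrightarrow> s < R \<Longrightarrow> AA ! 13 ! (i * R + s) = tab i s"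
    and A14: "length (AA ! 14) = L * R" "\<And>i s. i < L \<Longrightarrow> s < R \<Longrightarrow>
        AA ! 14 ! (i * R + s) = (if tab i s = 0 then 0 else plo H F (tab i s - 1))"
    and A15: "length (AA ! 15) = L * R" "\<And>i s. i < L \<Longrightarrow> s < R \<Longrightarrow>
        AA ! 15 ! (i * R + s) = (if tab i s = 0 then 0 else phi H F (tab i s - 1))"
    and am_less: "\<And>i. i < L \<Longrightarrow> am i < Q * R"
    and tab_key: "\<And>i s. tab i s = 0 \<or> tab i s - 1 \<in> keyset H I F"
    and key_tab: "\<And>x. x \<in> keyset H I F \<Longrightarrow> \<exists>i<L. tab i (hsh Q R (am i) x) = Suc x"
    and Q0: "0 < Q" and R0: "0 < R" and QRQ: "Q * R * Q \<le> 2 ^ w" and LR: "L * R < 2 ^ w"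
    and IQ: "I * (H + 2) * 2 ^ (H + 1) \<le> Q" and Qw: "Q < 2 ^ w"
    and F0: "\<And>i. F i 0 = 0"
begin

abbreviation "TR \<equiv> tr w AA"

lemma num_lt [simp]: "numeral k \<le> (255::nat) \<Longrightarrow> numeral k < (2::nat) ^ w"
proof -
  assume "numeral k \<le> (255::nat)"
  also have "(255::nat) < 2 ^ 8" by simp
  also have "(2::nat) ^ 8 \<le> 2 ^ w" using w40 H1 by (intro power_increasing) auto
  finally show ?thesis .
qed

lemma one_lt [simp]: "Suc 0 < 2 ^ w"
proof -
  have "(2::nat) < 2 ^ w" by (rule num_lt) simp
  then show ?thesis by linarith
qed

lemma pow_lt: "k * H < 40 * H \<Longrightarrow> x \<le> 2 ^ (k * H) \<Longrightarrow> x < (2::nat) ^ w"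
  using w40 by (meson le_less_trans less_le_trans power_strict_increasing one_less_numeral_iff semiring_norm(76))

lemma lenAA [simp]: "numeral k \<le> (15::nat) \<Longrightarrow> numeral k < length AA" "0 < length AA" "Suc 0 < length AA" "AA \<noteq> []"
proof -
  show "numeral k < length AA" if "numeral k \<le> (15::nat)" using that len16 by linarith
qed (use len16 in auto)

lemma scal [simp]: "AA ! 0 = [2 ^ H, H, a, n, R, Q, Q * R, L]"
  by (rule A0)

lemma tr_IfEq:
  assumes "safe w AA s e1" "safe w AA s e2"
    "ev AA s e1 = ev AA s e2 \<Longrightarrow> TR c1 s k T" "ev AA s e1 \<noteq> ev AA s e2 \<Longrightarrow> TR c2 s k T"
  shows "TR (IfEq e1 e2 c1 c2) s k T"
  using assms by (intro tr_If) auto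

text \<open>A slot may hold another key, so the stored key is compared on every level. The result is
  0 or the slot number plus 1. The invariant says that a nonzero result is correct and that the
  result has become nonzero if one of the levels passed stores the key.\<close>

lemma LOOK_tr:
  assumes x: "s 60 < Q"
    and post: "\<And>s'. \<forall>r<60. s' r = s r \<Longrightarrow> (s' 60 \<noteq> 0 \<longleftrightarrow> s 60 \<in> keyset H I F) \<Longrightarrow>
      (s' 60 \<noteq> 0 \<Longrightarrow> s' 60 - 1 < L * R \<and> AA ! 14 ! (s' 60 - 1) = plo H F (s 60) \<and>
         AA ! 15 ! (s' 60 - 1) = phi H F (s 60)) \<Longrightarrow> s' 60 < 2 ^ w \<Longrightarrow> T s'"
  shows "TR LOOK s L T"
proof -
  let ?x = "s 60"
  define ok where "ok p \<longleftrightarrow> p \<noteq> 0 \<longrightarrow> ?x \<in> keyset H I F \<and> p - 1 < L * R \<and> AA ! 14 ! (p - 1) = plo H F ?x \<and>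
         AA ! 15 ! (p - 1) = phi H F ?x" for p
  define Inv where "Inv t \<longleftrightarrow> (\<forall>r<61. t r = s r) \<and> t 61 \<le> L \<and> ok (t 62) \<and>
    ((\<exists>i<t 61. tab i (hsh Q R (am i) ?x) = Suc ?x) \<longrightarrow> t 62 \<noteq> 0)" for t :: "nat \<Rightarrow> nat"
  have L2: "L < 2 ^ w"
  proof -
    have "L * 1 \<le> L * R" using R0 by (intro mult_le_mono2) simp
    then show ?thesis using LR by linarith
  qed
  have x2: "Suc ?x < 2 ^ w" using x Qw by simp
  show ?thesis
    unfolding LOOK_def
  proof (rule tr_AsgSeqV[where v = 0], simp, simp, rule tr_AsgSeqV[where v = 0], simp, simp,
      rule tr_Seq[where ?n1.0 = L and ?n2.0 = 0], rule tr_While[where I = Inv and k = 0 and \<mu> = "\<lambda>t. L - t 61"])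
    show "Inv (s(61 := 0, 62 := 0))"
      by (auto simp: Inv_def ok_def)
  next
    fix t assume t: "Inv t"
    then show "safe w AA t (V 61) \<and> safe w AA t (sc 7)" by simp
  next
    fix t assume t: "Inv t" and c: "ev AA t (V 61) < ev AA t (sc 7)"
    define i where "i = t 61"
    have ti: "t 61 = i" by (simp add: i_def)
    have i: "i < L" using c by (simp add: i_def)
    have tx: "t 60 = ?x" using t by (simp add: Inv_def)
    define h where "h = hsh Q R (am i) ?x"
    have h: "h < R" unfolding h_def by (rule hsh_less[OF Q0 R0])
    have he: "am i * ?x mod (Q * R) div Q = h" by (simp add: h_def hsh_def)
    have amx: "am i * ?x < 2 ^ w"
    proof -
      have "am i * ?x < Q * R * Q" using am_less[OF i] x Q0 R0 by (intro mult_strict_mono) auto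
      then show ?thesis using QRQ by simp
    qed
    have pos: "i * R + h < L * R"
    proof -
      have "i * R + h < (i + 1) * R" using h by simp
      also have "\<dots> \<le> L * R" using i by (intro mult_le_mono1) simp
      finally show ?thesis .
    qed
    then have iR: "i * R < 2 ^ w" "i * R + h < 2 ^ w" "Suc (i * R + h) < 2 ^ w" using LR by auto
    have v: "AA ! 13 ! (i * R + h) = tab i h" using A13(2)[OF i h] .
    have ok': "ok (Suc (i * R + h))" if "tab i h = Suc ?x"
      using that tab_key[of i h] A14(2)[OF i h] A15(2)[OF i h] pos by (simp add: ok_def)
    have A: "AA ! 12 ! i = am i" "i < length (AA ! 12)" using A12 i by auto
    show "TR (Asg 63 (pl (ti (V 61) (sc 4)) (di (mo (ti (Rd (C 12) (V 61)) (V 60)) (sc 6)) (sc 5))) ;;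
      IfEq (Rd (C 13) (V 63)) (pl (V 60) (C 1)) (Asg 62 (pl (V 63) (C 1))) (Asg 62 (V 62)) ;;
      Asg 61 (pl (V 61) (C 1))) t 0 (\<lambda>s'. Inv s' \<and> L - s' 61 < L - t 61)"
    proof (rule tr_AsgSeqV[where v = "i * R + h"])
      show "safe w AA t (pl (ti (V 61) (sc 4)) (di (mo (ti (Rd (C 12) (V 61)) (V 60)) (sc 6)) (sc 5)))"
        by (simp add: ti A tx amx iR he)
      show "ev AA t (pl (ti (V 61) (sc 4)) (di (mo (ti (Rd (C 12) (V 61)) (V 60)) (sc 6)) (sc 5))) = i * R + h"
        by (simp add: ti A tx he)
      let ?u = "t(63 := i * R + h)"
      have i1: "Suc i < 2 ^ w" using i L2 by simp
      show "TR (IfEq (Rd (C 13) (V 63)) (pl (V 60) (C 1)) (Asg 62 (pl (V 63) (C 1))) (Asg 62 (V 62)) ;;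
        Asg 61 (pl (V 61) (C 1))) ?u 0 (\<lambda>s'. Inv s' \<and> L - s' 61 < L - t 61)"
      proof (rule tr_Seq[where ?n1.0 = 0 and ?n2.0 = 0], rule tr_IfEq, goal_cases)
        case 3
        then have tb: "tab i h = Suc ?x" by (simp add: tx v)
        show ?case
          apply (rule tr_AsgV[where v = "Suc (i * R + h)"])
            apply (simp add: iR)
           apply simp
          apply (rule tr_AsgV[where v = "Suc i"])
            apply (simp add: ti i1)
           apply (simp add: ti)
          using t i ok'[OF tb] by (auto simp: Inv_def ti)
      next
        case 4
        then have tb: "tab i h \<noteq> Suc ?x" by (simp add: tx v)
        show ?case
          apply (rule tr_AsgV[where v = "t 62"])
            apply simp
           apply simp
          apply (rule tr_AsgV[where v = "Suc i"])
            apply (simp add: ti i1)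
           apply (simp add: ti)
          using t i tb by (auto simp: Inv_def ti h_def less_Suc_eq)
      qed (auto simp: tx x2 A13(1) pos)
    qed
  next
    fix t assume t: "Inv t" and c: "\<not> ev AA t (V 61) < ev AA t (sc 7)"
    have tL: "t 61 = L" using t c by (simp add: Inv_def)
    have o: "ok (t 62)" using t by (simp add: Inv_def)
    show "TR (Asg 60 (V 62)) t 0 T"
    proof (rule tr_Asg)
      show "T (t(60 := ev AA t (V 62)))"
      proof (rule post)
        show "\<forall>r<60. (t(60 := ev AA t (V 62))) r = s r" using t by (simp add: Inv_def)
        show "((t(60 := ev AA t (V 62))) 60 \<noteq> 0) = (s 60 \<in> keyset H I F)"
          using t o key_tab[of ?x] tL by (auto simp: Inv_def ok_def)
        show "(t(60 := ev AA t (V 62))) 60 < 2 ^ w" using o LR by (cases "t 62") (auto simp: ok_def)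
      qed (use o in \<open>auto simp: ok_def\<close>)
    qed simp
  qed auto
qed

lemma key_exp_ok:
  assumes "t 40 < I" "t g \<le> H + 1" "t 41 < 2 ^ (H + 1)"
  shows "safe w AA t (key_exp g)" "ev AA t (key_exp g) = keyf H (t 40) (t g) (t 41 div 2 ^ t g)"
    "keyf H (t 40) (t g) (t 41 div 2 ^ t g) < Q"
proof -
  have z: "t 41 div 2 ^ t g < 2 ^ (H + 1)" by (rule div_pow_le[OF assms(3)])
  show kq: "keyf H (t 40) (t g) (t 41 div 2 ^ t g) < Q" using keyf_less[OF assms(1,2) z IQ] .
  then have k: "(t 40 * (H + 2) + t g) * 2 ^ (H + 1) + t 41 div 2 ^ t g < 2 ^ w"
    using Qw by (simp add: keyf_def)
  have "t 40 * (H + 2) + t g \<le> (t 40 * (H + 2) + t g) * 2 ^ (H + 1)" by simp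
  then have k2: "t 40 * (H + 2) + t g < 2 ^ w" using k by linarith
  have k3: "(t 40 * (H + 2) + t g) * 2 ^ (H + 1) < 2 ^ w" using k by linarith
  have H3: "(2::nat) ^ (H + 1) < 2 ^ w" using w40 H1 by (intro power_strict_increasing) auto
  have H4: "H + 2 < 2 ^ w" using H3 less_exp[of "H + 1"] by linarith
  show "ev AA t (key_exp g) = keyf H (t 40) (t g) (t 41 div 2 ^ t g)"
    by (simp add: key_exp_def keyf_def)
  have k4: "t 40 * (H + 2) < 2 ^ w" using k2 by linarith
  show "safe w AA t (key_exp g)"
    using k k2 k3 k4 H3 H4 by (simp add: key_exp_def)
qed

lemma PRED_tr:
  assumes i: "s 40 < I" and x: "s 41 < 2 ^ (H + 1)"
    and post: "\<And>s'. \<forall>r<40. s' r = s r \<Longrightarrow> s' 40 = F (s 40) (s 41) \<Longrightarrow> T s'"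
    and k: "(L + 1) * (blen (H + 1) + 2) \<le> k"
  shows "TR PRED s k T"
proof -
  let ?K = "breaks (2 ^ (H + 1)) (F (s 40))"
  let ?x = "s 41"
  define E where "E g \<longleftrightarrow> subt ?K g (?x div 2 ^ g) \<noteq> {}" for g
  \<comment> \<open>An ancestor of a node with a break below it has one too; the binary search over
    heights rests on this.\<close>
  have Emono: "E g'" if Eg: "E g" and le: "g \<le> g'" for g g'
  proof -
    obtain y where y: "y \<in> ?K" "y div 2 ^ g = ?x div 2 ^ g" using Eg unfolding E_def subt_def by blast
    then have "y div 2 ^ g' = ?x div 2 ^ g'"
      using div_pow_split[OF le, of y] div_pow_split[OF le, of ?x] by simp
    then show ?thesis using y unfolding E_def subt_def by blast
  qed
  have keyE: "keyf H (s 40) g (?x div 2 ^ g) \<in> keyset H I F \<longleftrightarrow> E g" if "g \<le> H + 1" for g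
    using keyf_in_keyset[OF i that div_pow_le[OF x]] by (simp add: E_def)
  have H5: "2 * H + 4 < 2 ^ w"
  proof -
    have "2 * H + 4 \<le> 2 ^ (6 * H)"
    proof -
      have "2 * H + 4 \<le> 6 * H" using H1 by simp
      then show ?thesis using less_exp[of "6 * H"] by linarith
    qed
    then show ?thesis using H1 by (intro pow_lt[of 6]) auto
  qed
  define Inv where "Inv t \<longleftrightarrow> (\<forall>r<42. t r = s r) \<and> t 42 \<le> t 43 \<and> t 43 \<le> H + 1 \<and> E (t 43) \<and>
     (\<forall>g<t 42. \<not> E g)" for t :: "nat \<Rightarrow> nat"
  have x2: "2 * ?x < 2 ^ w"
  proof -
    have "2 * ?x < 2 * 2 ^ (H + 1)" using x by simp
    also have "\<dots> = 2 ^ (H + 2)" by simp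
    also have "\<dots> < 2 ^ w" using w40 H1 by (intro power_strict_increasing) auto
    finally show ?thesis .
  qed
  have k': "L + (L + 1) * blen (H + 1) + L \<le> k" using k by (simp add: algebra_simps)
  show ?thesis
    unfolding PRED_def
  proof (intro tr_AsgSeq, goal_cases)
    case 4
    let ?t0 = "s(42 := ev AA s (C 0), 43 := ev AA (s(42 := ev AA s (C 0))) (pl (sc 1) (C 1)))"
    have kx: "safe w AA ?t0 (key_exp 43)" "ev AA ?t0 (key_exp 43) = keyf H (s 40) (H + 1) (?x div 2 ^ (H + 1))"
      "keyf H (s 40) (H + 1) (?x div 2 ^ (H + 1)) < Q"
      using key_exp_ok[of ?t0 43] i x by (simp_all del: power_Suc)
    show ?case
    proof (rule tr_Seq[OF LOOK_tr, where ?n2.0 = "(L + 1) * blen (H + 1) + L"], goal_cases)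
      case 1
      then show ?case using kx by (simp del: power_Suc)
    next
      case (2 t)
      have fr: "t r = s r" if "r < 42" for r using 2(1) that by simp
      have t4: "t 42 = 0" "t 43 = H + 1" using 2(1) by auto
      have tE: "t 60 \<noteq> 0 \<longleftrightarrow> E (H + 1)" using 2(2) keyE[of "H + 1"] kx(2) by (simp del: power_Suc)
      show ?case
      proof (rule tr_If, goal_cases)
        case 3
        then have EH: "E (H + 1)" using tE by simp
        show ?case
        proof (rule tr_Seq[where ?n1.0 = "(L + 1) * blen (H + 1)" and ?n2.0 = L],
            rule tr_While[where I = Inv and k = L and \<mu> = "\<lambda>t. blen (t 43 - t 42)"], goal_cases)
          case 1
          then show ?case using fr t4 EH by (simp add: Inv_def)
        next
          case (2 u)
          then show ?case by simp
        next
          case (3 u)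
          have uf: "u r = s r" if "r < 42" for r using 3(1) that by (simp add: Inv_def)
          have ub: "u 42 < u 43" "u 43 \<le> H + 1" "E (u 43)" "\<forall>g<u 42. \<not> E g" using 3 by (auto simp: Inv_def)
          define m where "m = (u 42 + u 43) div 2"
          have m: "u 42 \<le> m" "m < u 43" "m \<le> H + 1" using ub by (auto simp: m_def)
          let ?u1 = "u(44 := m)"
          have kx: "safe w AA ?u1 (key_exp 44)" "ev AA ?u1 (key_exp 44) = keyf H (s 40) m (?x div 2 ^ m)"
            "keyf H (s 40) m (?x div 2 ^ m) < Q"
            using key_exp_ok[of ?u1 44] i x uf m by simp_all
          have add: "u 42 + u 43 < 2 ^ w" using ub H5 by simp
          have dm: "u 43 - u 42 > 0" "m - u 42 \<le> (u 43 - u 42) div 2" "u 43 - Suc m \<le> (u 43 - u 42) div 2"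
            using ub by (auto simp: m_def)
          show ?case
            apply (rule tr_AsgSeq)
             apply (simp add: add)
            apply (rule tr_AsgSeq)
             apply (simp add: m_def[symmetric] kx(1))
            apply (rule tr_Seq[OF LOOK_tr, where ?n2.0 = 0])
              apply (simp add: m_def[symmetric] kx)
            subgoal premises p for v
            proof -
              have vf: "v r = s r" if "r < 42" for r using p(1) uf that by simp
              have v4: "v 42 = u 42" "v 43 = u 43" "v 44 = m" using p(1) by (auto simp: m_def)
              have vE: "v 60 \<noteq> 0 \<longleftrightarrow> E m" using p(2) keyE[OF m(3)] kx(2) by (simp add: m_def[symmetric])
              have H6: "Suc m < 2 ^ w" using m H5 by linarith
              show ?thesis
              proof (rule tr_If, goal_cases)
                case 3
                then have "E m" using vE by simp
                then show ?case
                  using vf v4 m ub blen_halve[OF dm(1,2)] by (intro tr_Asg) (auto simp: Inv_def)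
              next
                case 4
                then have "\<not> E m" using vE by simp
                then have "\<forall>g<Suc m. \<not> E g" using Emono by (metis less_Suc_eq_le)
                then show ?case
                  using vf v4 m ub H6 blen_halve[OF dm(1,3)] by (intro tr_Asg) (auto simp: Inv_def)
              qed simp_all
            qed
            apply simp
            done
        next
          case 4
          then show ?case using t4 by simp
        next
          case (5 u)
          have uf: "u r = s r" if "r < 42" for r using 5(1) that by (simp add: Inv_def)
          define g where "g = u 42"
          have g: "g \<le> H + 1" "E g" "\<And>g'. g' < g \<Longrightarrow> \<not> E g'" using 5 by (auto simp: Inv_def g_def)
          have kx: "safe w AA u (key_exp 42)" "ev AA u (key_exp 42) = keyf H (s 40) g (?x div 2 ^ g)"
            "keyf H (s 40) g (?x div 2 ^ g) < Q"
            using key_exp_ok[of u 42] i x uf g(1) by (simp_all add: g_def)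
          let ?kk = "keyf H (s 40) g (?x div 2 ^ g)"
          note kp = keyf_parts[OF g(1) div_pow_le[OF x], of "s 40" g]
          have res: "F (s 40) ?x = (if 2 * ?x div 2 ^ g mod 2 = 0 then plo H F ?kk else phi H F ?kk)"
            unfolding plo_def phi_def key_sub_def kp Let_def
            by (rule step_fun_lookup[OF refl x]) (use g in \<open>auto simp: E_def\<close>)
          show ?case
            apply (rule tr_AsgSeq)
             apply (rule kx)
            apply (rule tr_Seq[OF LOOK_tr, where ?n2.0 = 0])
              apply (simp add: kx)
            subgoal premises p for v
            proof -
              have vf: "v r = s r" if "r < 42" for r using p(1) uf that by simp
              have v42: "v 42 = g" using p(1) by (simp add: g_def)
              have v0: "v 60 \<noteq> 0" using p(2) keyE[OF g(1)] kx(2) g(2) by simp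
              have pv: "v 60 - 1 < L * R" "AA ! 14 ! (v 60 - 1) = plo H F ?kk" "AA ! 15 ! (v 60 - 1) = phi H F ?kk"
                using p(3)[OF v0] kx(2) by simp_all
              show ?thesis
                apply (rule tr_If)
                   apply (simp add: vf x2)
                  apply simp
                 apply (rule tr_Asg)
                  apply (use v0 pv p(4) A14 in simp)
                 apply (rule post)
                  apply (use vf in simp)
                 apply (use pv res v42 vf in simp)
                apply (rule tr_Asg)
                 apply (use v0 pv p(4) A15 in simp)
                apply (rule post)
                 apply (use vf in simp)
                apply (use pv res v42 vf in simp)
                done
            qed
            apply simp
            done
        qed simp
      next
        case 4
        then have nE: "\<not> E (H + 1)" using tE by simp
        \<comment> \<open>All arguments share one root, so a root that is not a key excludes every
          break. The value is then the one at 0, which is 0 for all functions.\<close>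
        have "?K = {}"
        proof (rule ccontr)
          assume "?K \<noteq> {}"
          then obtain y where y: "y \<in> ?K" by blast
          then have "y div 2 ^ (H + 1) = ?x div 2 ^ (H + 1)" using x by (simp add: breaks_def)
          then show False using nE y unfolding E_def subt_def by blast
        qed
        then have "F (s 40) ?x = 0" using step_fun_no_breaks[of "2 ^ (H + 1)" "F (s 40)" ?x] x F0 by simp
        then show ?case using fr by (intro tr_Asg post) auto
      qed simp_all
    next
      case 3
      then show ?case using k' by simp
    qed
  next
    case 3
    then show ?case using key_exp_ok[of "s(42 := ev AA s (C 0), 43 := ev AA (s(42 := ev AA s (C 0))) (pl (sc 1) (C 1)))" 43] i x
      by (simp del: power_Suc)
  qed (use H5 in simp_all)
qed

end

section \<open>Decoding list positions\<close>

text \<open>Exponent of the block length at height \<open>h\<close>: it is \<open>a * G\<close>,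
  unless a whole node with its \<open>2 ^ (a * h)\<close> positions is shorter.\<close>

definition shf :: "nat \<Rightarrow> nat \<Rightarrow> nat \<Rightarrow> nat" where
  "shf a G h = a * min h G"

definition kkf :: "nat \<Rightarrow> nat \<Rightarrow> nat" where
  "kkf a h = a * kf (2 ^ a) h"

text \<open>A block of \<open>2 ^ (kkf a h + lam)\<close> positions needs \<open>2 ^ kkf a h\<close>
  base values, so all blocks of a height together need only \<open>2 ^ (H - lam)\<close>. The second
  term keeps a block within one node.\<close>

definition ebf :: "nat \<Rightarrow> nat \<Rightarrow> nat \<Rightarrow> nat" where
  "ebf a lam h = min (kkf a h + lam) (a * h)"

definition mkid :: "nat \<Rightarrow> nat \<Rightarrow> nat \<Rightarrow> nat \<Rightarrow> nat \<Rightarrow> nat \<Rightarrow> nat" where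
  "mkid H f b h e' i = (((f * 2 + b) * (H + 1) + h) * (H + 1) + e') * 2 ^ H + i"

text \<open>The dictionary entry with identifier \<open>mkid H f b h e' i\<close> belongs to family \<open>f\<close> of structure \<open>b\<close> at height \<open>h\<close>.\<close>

definition Fam :: "nat \<Rightarrow> nat \<Rightarrow> nat \<Rightarrow> (nat \<Rightarrow> nat \<Rightarrow> nat) \<Rightarrow> nat \<Rightarrow> nat \<Rightarrow> nat" where
  "Fam H a G Pf z x = (let i = z mod 2 ^ H; r = z div 2 ^ H; e' = r mod (H + 1); r2 = r div (H + 1);
     h = r2 mod (H + 1); r3 = r2 div (H + 1); b = r3 mod 2; f = r3 div 2; e = a * h; S = shf a G h in
     if e < H then
       if f = 0 then if i < 2 ^ (H - e) then wave.f1 H (Pf b) e S i x else 0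
       else if f = 1 then if i < 2 ^ (H - S) then wave.f2 H (Pf b) e S i x else 0
       else if e' < e - S \<and> i < 2 ^ (H - S - e') then wave.f3 H (Pf b) e S e' i x else 0
     else 0)"

lemma mkid_parts:
  fixes f :: nat
  assumes "b < 2" "h \<le> H" "e' \<le> H" "i < 2 ^ H"
  defines "z \<equiv> mkid H f b h e' i"
  shows "z mod 2 ^ H = i" "z div 2 ^ H mod (H + 1) = e'" "z div 2 ^ H div (H + 1) mod (H + 1) = h"
    "z div 2 ^ H div (H + 1) div (H + 1) mod 2 = b" "z div 2 ^ H div (H + 1) div (H + 1) div 2 = f"
    "f < 3 \<Longrightarrow> z < 6 * (H + 1) * (H + 1) * 2 ^ H"
proof -
  have 1: "z div 2 ^ H = ((f * 2 + b) * (H + 1) + h) * (H + 1) + e'" "z mod 2 ^ H = i"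
    unfolding z_def mkid_def using mult_plus_parts[OF assms(4)] by blast+
  have 2: "z div 2 ^ H div (H + 1) = (f * 2 + b) * (H + 1) + h" "z div 2 ^ H mod (H + 1) = e'"
    unfolding 1 using mult_plus_parts[of e' "H + 1"] assms(3) by auto
  have 3: "z div 2 ^ H div (H + 1) div (H + 1) = f * 2 + b" "z div 2 ^ H div (H + 1) mod (H + 1) = h"
    unfolding 2 using mult_plus_parts[of h "H + 1"] assms(2) by auto
  show "z mod 2 ^ H = i" "z div 2 ^ H mod (H + 1) = e'" "z div 2 ^ H div (H + 1) mod (H + 1) = h"
    using 1 2 3 by auto
  show "z div 2 ^ H div (H + 1) div (H + 1) mod 2 = b" "z div 2 ^ H div (H + 1) div (H + 1) div 2 = f"
    unfolding 3 using assms(1) by auto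
  assume f: "f < 3"
  then have "f * 2 + b < 6" using assms(1) by simp
  then have "z div 2 ^ H div (H + 1) div (H + 1) < 6" using 3 by simp
  then have "z div 2 ^ H div (H + 1) < 6 * (H + 1)" by (subst (asm) div_less_iff_less_mult) auto
  then have "z div 2 ^ H < 6 * (H + 1) * (H + 1)" by (subst (asm) div_less_iff_less_mult) auto
  then show "z < 6 * (H + 1) * (H + 1) * 2 ^ H" by (subst (asm) div_less_iff_less_mult) auto
qed

lemma Fam_mkid:
  assumes "b < 2" "h \<le> H" "e' \<le> H" "i < 2 ^ H" "a * h < H"
  shows "i < 2 ^ (H - a * h) \<Longrightarrow> Fam H a G Pf (mkid H 0 b h e' i) = wave.f1 H (Pf b) (a * h) (shf a G h) i"
    "i < 2 ^ (H - shf a G h) \<Longrightarrow> Fam H a G Pf (mkid H 1 b h e' i) = wave.f2 H (Pf b) (a * h) (shf a G h) i"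
    "i < 2 ^ (H - shf a G h - e') \<Longrightarrow> e' < a * h - shf a G h \<Longrightarrow>
       Fam H a G Pf (mkid H 2 b h e' i) = wave.f3 H (Pf b) (a * h) (shf a G h) e' i"
  unfolding Fam_def Let_def mkid_parts[OF assms(1-4)] using assms(5) by (auto simp: fun_eq_iff)

definition DEC :: com where
  "DEC = While (C 0) (V 71) (
      Asg 73 (Rd (pl (pl (C 16) (ti (C 6) (V 71))) (ti (C 3) (V 70))) (V 72)) ;;
      Asg 74 (Rd (C 10) (V 71)) ;;
      Asg 72 (pl (Rd (pl (pl (C 17) (ti (C 6) (V 71))) (ti (C 3) (V 70)))
                    (pl (shl (shr (V 72) (V 74)) (Rd (C 9) (V 71))) (shr (V 73) (V 74))))
                 (mo (V 73) (shl (C 1) (V 74)))) ;;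
      Asg 71 (Rd (C 8) (V 71))) ;;
    Asg 70 (V 72)"

text \<open>The maxima for all block lengths of one height share an array: block \<open>q\<close> of
  length \<open>2 ^ r\<close> has slot \<open>2 ^ (H - r) + q\<close>, as in a heap, so the slot is
  a right shift of \<open>2 ^ H + j\<close>. The result is the y-rank at the stored maximum, ready
  for comparison with a bound.\<close>

definition TST :: com where
  "TST = Asg 70 (V 50) ;; Asg 71 (V 51) ;;
    Asg 72 (pl (V 52) (Rd (pl (pl (C 18) (ti (C 6) (V 51))) (ti (C 3) (V 50))) (shr (pl (sc 0) (V 52)) (V 53)))) ;;
    DEC ;; Asg 50 (V 70)"

text \<open>From array 16 on there are six arrays per height: for each of the two structures the
  jump records, the base values and the offsets of maxima.\<close>

locale level_ds = dict_ds w H a n L Q R "6 * (H + 1) * (H + 1) * 2 ^ H" "Fam H a G Pf" am tab AA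
  for w H a n L Q R G Pf am tab AA +
  fixes lam J hm :: nat
  assumes hm: "hm = (H - 1) div a"
    and waveP: "\<And>b. b < 2 \<Longrightarrow> wave H (Pf b)"
    and lenAA6: "length AA = 16 + 6 * (hm + 1)"
    and A67: "\<And>b. b < 2 \<Longrightarrow> length (AA ! (6 + b)) = 2 ^ H" "\<And>b y. b < 2 \<Longrightarrow> y < 2 ^ H \<Longrightarrow> AA ! (6 + b) ! y = Pf b y"
    and A8: "length (AA ! 8) = hm + 1" "\<And>h. h \<le> hm \<Longrightarrow> AA ! 8 ! h = h - kf (2 ^ a) h"
    and A9: "length (AA ! 9) = hm + 1" "\<And>h. h \<le> hm \<Longrightarrow> AA ! 9 ! h = kkf a h"
    and A10: "length (AA ! 10) = hm + 1" "\<And>h. h \<le> hm \<Longrightarrow> AA ! 10 ! h = ebf a lam h"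
    and A11: "length (AA ! 11) = hm + 1" "\<And>h. h \<le> hm \<Longrightarrow> AA ! 11 ! h = shf a G h"
    and Arec: "\<And>b h. b < 2 \<Longrightarrow> 0 < h \<Longrightarrow> h \<le> hm \<Longrightarrow> length (AA ! (16 + 6 * h + 3 * b)) = 2 ^ H"
       "\<And>b h j. b < 2 \<Longrightarrow> 0 < h \<Longrightarrow> h \<le> hm \<Longrightarrow> j < 2 ^ H \<Longrightarrow>
          AA ! (16 + 6 * h + 3 * b) ! j = wave.jrec H (Pf b) (a * h) (kkf a h) (ebf a lam h) j"
    and Abase: "\<And>b h. b < 2 \<Longrightarrow> 0 < h \<Longrightarrow> h \<le> hm \<Longrightarrow>
          length (AA ! (17 + 6 * h + 3 * b)) = 2 ^ (H - ebf a lam h) * 2 ^ kkf a h"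
       "\<And>b h i s. b < 2 \<Longrightarrow> 0 < h \<Longrightarrow> h \<le> hm \<Longrightarrow> i < 2 ^ (H - ebf a lam h) \<Longrightarrow> s < 2 ^ kkf a h \<Longrightarrow>
          AA ! (17 + 6 * h + 3 * b) ! (i * 2 ^ kkf a h + s) = wave.jbase H (Pf b) (a * h) (kkf a h) (ebf a lam h) i s"
    and Amax: "\<And>b h. b < 2 \<Longrightarrow> h \<le> hm \<Longrightarrow> length (AA ! (18 + 6 * h + 3 * b)) = 2 * 2 ^ H"
       "\<And>b h r q. b < 2 \<Longrightarrow> h \<le> hm \<Longrightarrow> r \<le> shf a G h \<Longrightarrow> q < 2 ^ (H - r) \<Longrightarrow>
          AA ! (18 + 6 * h + 3 * b) ! (2 ^ (H - r) + q) = wave.amax H (Pf b) (a * h) r q"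
    and J: "hm < (2 ^ a) ^ J"
    and a2H: "a \<le> 2 * H"
begin

lemma ah: "h \<le> hm \<Longrightarrow> a * h < H"
proof -
  assume "h \<le> hm"
  then have "a * h \<le> a * hm" by simp
  also have "\<dots> \<le> H - 1" unfolding hm by simp
  finally show ?thesis using H1 by simp
qed

lemma hH: "h \<le> hm \<Longrightarrow> h \<le> H"
proof -
  assume "h \<le> hm"
  then have "a * h < H" by (rule ah)
  moreover have "1 * h \<le> a * h" using a1 by (rule mult_le_mono1)
  ultimately show "h \<le> H" by linarith
qed

lemma A2: "2 \<le> (2::nat) ^ a"
  using a1 power_increasing[of 1 a "2::nat"] by simp

lemma pw_lt: "k \<le> 8 * H \<Longrightarrow> x \<le> 2 ^ k \<Longrightarrow> x < (2::nat) ^ w"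
proof -
  assume "k \<le> 8 * H" "x \<le> 2 ^ k"
  moreover from this have "(2::nat) ^ k \<le> 2 ^ (8 * H)" by (intro power_increasing) auto
  ultimately have "x \<le> 2 ^ (8 * H)" by linarith
  then show "x < 2 ^ w" using H1 by (intro pow_lt[of 8]) auto
qed

lemma aid: "h \<le> hm \<Longrightarrow> b < 2 \<Longrightarrow> 18 + 6 * h + 3 * b < length AA"
  using lenAA6 by auto

lemma aid_lt: "h \<le> hm \<Longrightarrow> b < 2 \<Longrightarrow> 18 + 6 * h + 3 * b < 2 ^ w"
proof -
  assume "h \<le> hm" "b < 2"
  then have "18 + 6 * h + 3 * b \<le> 27 * H" using hH[of h] H1 by simp
  also have "\<dots> < 32 * 2 ^ H" using less_exp[of H] by linarith
  also have "\<dots> = 2 ^ (5 + H)" by (simp add: power_add)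
  finally show ?thesis using H1 by (intro pw_lt[of "5 + H"]) auto
qed

lemma aid_lt': "h \<le> hm \<Longrightarrow> b < 2 \<Longrightarrow> 6 * h < 2 ^ w" "h \<le> hm \<Longrightarrow> b < 2 \<Longrightarrow> 3 * b < 2 ^ w"
    "h \<le> hm \<Longrightarrow> b < 2 \<Longrightarrow> k \<le> 18 \<Longrightarrow> k + 6 * h < 2 ^ w" "h \<le> hm \<Longrightarrow> b < 2 \<Longrightarrow> k \<le> 18 \<Longrightarrow> k + 6 * h + 3 * b < 2 ^ w"
    "h \<le> hm \<Longrightarrow> b < 2 \<Longrightarrow> k \<le> 18 \<Longrightarrow> k + 6 * h + 3 * b < length AA"
  using aid_lt[of h b] aid[of h b] by linarith+

lemma N_lt: "(2::nat) ^ H < 2 ^ w" "2 * (2::nat) ^ H < 2 ^ w" "4 * (2::nat) ^ H < 2 ^ w"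
proof -
  have "4 * (2::nat) ^ H \<le> 2 ^ (2 + H)" by (simp add: power_add)
  then show "4 * (2::nat) ^ H < 2 ^ w" using H1 by (intro pw_lt[of "2 + H"]) auto
  then show "(2::nat) ^ H < 2 ^ w" "2 * (2::nat) ^ H < 2 ^ w" by linarith+
qed

lemma kkeb:
  assumes "0 < h" "h \<le> hm"
  shows "kkf a h \<le> a * h" "ebf a lam h \<le> a * h" "a * (h - kf (2 ^ a) h) = a * h - kkf a h"
    "h - kf (2 ^ a) h \<le> hm" "dsum (2 ^ a) (h - kf (2 ^ a) h) < dsum (2 ^ a) h"
  using kf_step[OF A2 assms(1)] assms by (auto simp: kkf_def ebf_def diff_mult_distrib2)

text \<open>A jump keeps the decoded point and replaces its position in the list of a node by that
  in the list of a descendant; at height 0 the position is the y-rank itself. The digit sum of the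
  height is the variant.\<close>

lemma DEC_tr:
  assumes b: "s 70 < 2" and h: "s 71 \<le> hm" and j: "s 72 < 2 ^ H"
    and post: "\<And>s'. \<forall>r<70. s' r = s r \<Longrightarrow> s' 70 = wave.el H (Pf (s 70)) (a * s 71) (s 72) \<Longrightarrow> T s'"
    and k: "2 ^ a * J \<le> k"
  shows "TR DEC s k T"
proof -
  interpret W: wave H "Pf (s 70)" using waveP b by blast
  define y where "y = W.el (a * s 71) (s 72)"
  have y: "y < 2 ^ H" unfolding y_def using ah[OF h] j by (intro W.el_less) auto
  define Inv where "Inv t \<longleftrightarrow> (\<forall>r<71. t r = s r) \<and> t 71 \<le> hm \<and> t 72 < 2 ^ H \<and> W.el (a * t 71) (t 72) = y"
    for t :: "nat \<Rightarrow> nat"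
  show ?thesis
    unfolding DEC_def
  proof (rule tr_Seq[where ?n1.0 = k and ?n2.0 = 0],
      rule tr_While[where I = Inv and k = 0 and \<mu> = "\<lambda>t. dsum (2 ^ a) (t 71)"], goal_cases)
    case 1
    then show ?case using h j by (simp add: Inv_def y_def)
  next
    case (2 t)
    then show ?case by simp
  next
    case (3 t)
    have invt: "Inv t" by (rule 3(1))
    define h where "h = t 71"
    define j where "j = t 72"
    have hh: "0 < h" "h \<le> hm" using 3 by (auto simp: Inv_def h_def)
    have jj: "j < 2 ^ H" "W.el (a * h) j = y" "t 70 = s 70" using 3(1) by (auto simp: Inv_def h_def j_def)
    define e where "e = a * h"
    have eH: "e \<le> H" using ah[OF hh(2)] by (simp add: e_def)
    note K = kkeb[OF hh]
    define K' where "K' = kkf a h"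
    define E where "E = ebf a lam h"
    have KE: "K' \<le> e" "E \<le> e" using K by (auto simp: K'_def E_def e_def)
    note jp = W.jump[OF KE(1) eH KE(2) jj(1)]
    define rc where "rc = W.jrec e K' E j"
    have rca: "AA ! (16 + 6 * h + 3 * s 70) ! j = rc"
      using Arec(2)[OF b hh jj(1)] by (simp add: rc_def e_def K'_def E_def)
    have pE: "(2::nat) ^ H = 2 ^ (H - E) * 2 ^ E" using KE eH by (simp flip: power_add)
    have jE: "j div 2 ^ E < 2 ^ (H - E)" unfolding div_pow_upper using jj(1) pE by simp
    have rE: "rc div 2 ^ E < 2 ^ K'" using jp(3) by (simp add: rc_def)
    have idx: "j div 2 ^ E * 2 ^ K' + rc div 2 ^ E < 2 ^ (H - E) * 2 ^ K'"
    proof -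
      have "j div 2 ^ E * 2 ^ K' + rc div 2 ^ E < (j div 2 ^ E + 1) * 2 ^ K'" using rE by simp
      also have "\<dots> \<le> 2 ^ (H - E) * 2 ^ K'" using jE by (intro mult_le_mono1) simp
      finally show ?thesis .
    qed
    have bs: "AA ! (17 + 6 * h + 3 * s 70) ! (j div 2 ^ E * 2 ^ K' + rc div 2 ^ E) = W.jbase e K' E (j div 2 ^ E) (rc div 2 ^ E)"
      using Abase(2)[OF b hh, of "j div 2 ^ E" "rc div 2 ^ E"] jE rE by (simp add: e_def K'_def E_def)
    have lb: "length (AA ! (17 + 6 * h + 3 * s 70)) = 2 ^ (H - E) * 2 ^ K'"
      using Abase(1)[OF b hh] by (simp add: K'_def E_def)
    have lr: "length (AA ! (16 + 6 * h + 3 * s 70)) = 2 ^ H" using Arec(1)[OF b hh] .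
    have sm: "W.jbase e K' E (j div 2 ^ E) (rc div 2 ^ E) + rc mod 2 ^ E = W.pos (e - K') y"
      using jp(1) jj(2) by (simp add: rc_def e_def)
    have ph: "W.pos (e - K') y < 2 ^ H" using W.pos_less[OF y] eH by simp
    have big: "2 ^ (H - E) * 2 ^ K' < (2::nat) ^ w"
    proof -
      have "2 ^ (H - E) * 2 ^ K' = (2::nat) ^ (H - E + K')" by (simp add: power_add)
      then show ?thesis using KE eH H1 by (intro pw_lt[of "H - E + K'"]) auto
    qed
    have sl: "j div 2 ^ E * 2 ^ K' < 2 ^ w" "j div 2 ^ E * 2 ^ K' + rc div 2 ^ E < 2 ^ w" using idx big by linarith+
    have E1: "(2::nat) ^ E < 2 ^ w" using KE eH H1 by (intro pw_lt[of E]) auto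
    have e1: "AA ! 10 ! h = E" "AA ! 9 ! h = K'" "AA ! 8 ! h = h - kf (2 ^ a) h" "h < hm + 1"
      using A8 A9 A10 hh by (auto simp: E_def K'_def)
    note id = aid_lt'[OF hh(2) b]
    have id16: "16 + 6 * h < 2 ^ w" "16 + 6 * h + 3 * s 70 < 2 ^ w" "16 + 6 * h + 3 * s 70 < length AA"
      "17 + 6 * h < 2 ^ w" "17 + 6 * h + 3 * s 70 < 2 ^ w" "17 + 6 * h + 3 * s 70 < length AA"
      using id(3)[of 16] id(4)[of 16] id(5)[of 16] id(3)[of 17] id(4)[of 17] id(5)[of 17] by auto
    have fin: "W.el (a * (h - kf (2 ^ a) h)) (W.pos (e - K') y) = y"
      using K(3) W.el_pos[OF y] by (simp add: e_def K'_def)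
    have th: "t 71 = h" "t 72 = j" by (simp_all add: h_def j_def)
    have hl: "h < Suc hm" using hh by simp
    have sum_lt: "W.jbase e K' E (j div 2 ^ E) (rc div 2 ^ E) + rc mod 2 ^ E < 2 ^ w" using sm ph N_lt by linarith
    show ?case
    proof (rule tr_AsgSeqV[where v = rc])
      show "safe w AA t (Rd (pl (pl (C 16) (ti (C 6) (V 71))) (ti (C 3) (V 70))) (V 72))"
        by (simp add: th jj id id16 lr)
      show "ev AA t (Rd (pl (pl (C 16) (ti (C 6) (V 71))) (ti (C 3) (V 70))) (V 72)) = rc"
        by (simp add: th jj rca)
      show "TR (Asg 74 (Rd (C 10) (V 71)) ;;
        Asg 72 (pl (Rd (pl (pl (C 17) (ti (C 6) (V 71))) (ti (C 3) (V 70)))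
                    (pl (shl (shr (V 72) (V 74)) (Rd (C 9) (V 71))) (shr (V 73) (V 74))))
                 (mo (V 73) (shl (C 1) (V 74)))) ;;
        Asg 71 (Rd (C 8) (V 71))) (t(73 := rc)) 0 (\<lambda>s'. Inv s' \<and> dsum (2 ^ a) (s' 71) < dsum (2 ^ a) (t 71))"
      proof (rule tr_AsgSeqV[where v = E], goal_cases)
        case 3
        let ?u = "t(73 := rc, 74 := E)"
        show ?case
        proof (rule tr_AsgSeqV[where v = "W.pos (e - K') y"], goal_cases)
          case 1
          then show ?case
            by (simp add: th jj(3) id id16 lb e1 hl A9(1) sl idx bs sum_lt E1)
        next
          case 2
          then show ?case by (simp add: th jj(3) e1 bs sm)
        next
          case 3
          show ?case
            apply (rule tr_AsgV[where v = "h - kf (2 ^ a) h"])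
              apply (simp add: th hl A8(1))
             apply (simp add: th e1)
            using invt K(4,5) ph fin by (simp add: th Inv_def)
        qed
      qed (auto simp: th e1 hl A10(1))
    qed
  next
    case 4
    have "dsum (2 ^ a) (s 71) \<le> 2 ^ a * J" using h J by (intro dsum_le[OF A2]) simp
    then show ?case using k by simp
  next
    case (5 t)
    then have t: "t 71 = 0" "t 72 < 2 ^ H" "W.el 0 (t 72) = y" "\<forall>r<71. t r = s r" by (auto simp: Inv_def)
    then have "t 72 = y" using W.el_0 by simp
    then show ?case using t(4) by (intro tr_Asg post) (auto simp: y_def)
  qed simp
qed

lemma TST_tr:
  assumes b: "s 50 < 2" and h: "s 51 \<le> hm" and j: "s 52 < 2 ^ H" and r: "s 53 \<le> shf a G (s 51)" "2 ^ s 53 dvd s 52"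
    and post: "\<And>s' y. \<forall>r<50. s' r = s r \<Longrightarrow> s' 50 = y \<Longrightarrow>
      (\<And>c. c \<le> y \<longleftrightarrow> (\<exists>j. j div 2 ^ s 53 = s 52 div 2 ^ s 53 \<and> wave.hit H (Pf (s 50)) (a * s 51) c j)) \<Longrightarrow> T s'"
    and k: "2 ^ a * J \<le> k"
  shows "TR TST s k T"
proof -
  interpret W: wave H "Pf (s 50)" using waveP b by blast
  define r j q where "r = s 53" and "j = s 52" and "q = j div 2 ^ r"
  have sha: "shf a G (s 51) \<le> a * s 51" by (simp add: shf_def)
  then have rH: "r \<le> H" using ah[OF h] assms(4) by (simp add: r_def)
  have jq: "j = q * 2 ^ r" using assms(5) by (simp add: j_def q_def r_def)
  have pr: "(2::nat) ^ H = 2 ^ (H - r) * 2 ^ r" using rH by (simp flip: power_add)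
  have q: "q < 2 ^ (H - r)" unfolding q_def div_pow_upper using assms(3) pr by (simp add: j_def)
  have ix: "(2 ^ H + j) div 2 ^ r = 2 ^ (H - r) + q" unfolding jq pr by (simp flip: add_mult_distrib)
  define m where "m = W.amax (a * s 51) r q"
  have am: "AA ! (18 + 6 * s 51 + 3 * s 50) ! ((2 ^ H + j) div 2 ^ r) = m"
    unfolding ix m_def using Amax(2)[OF b h _ q] r by (simp add: r_def)
  have ml: "m < 2 ^ r" using W.amax by (simp add: m_def)
  have jm: "j + m < 2 ^ H"
  proof -
    have "j + m < (q + 1) * 2 ^ r" using ml jq by simp
    also have "\<dots> \<le> 2 ^ H" unfolding pr using q by (intro mult_le_mono1) simp
    finally show ?thesis .
  qed
  have il: "(2 ^ H + j) div 2 ^ r < 2 * 2 ^ H"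
    using assms(3) by (intro div_pow_le) (simp add: j_def)
  note id = aid_lt'[OF h b]
  have id18: "18 + 6 * s 51 < 2 ^ w" "18 + 6 * s 51 + 3 * s 50 < 2 ^ w" "18 + 6 * s 51 + 3 * s 50 < length AA"
    using id(3)[of 18] id(4)[of 18] id(5)[of 18] by auto
  have Nj: "2 ^ H + j < 2 ^ w" "j + m < 2 ^ w" using N_lt jm assms(3) by (auto simp: j_def)
  have jr: "s 52 = j" "s 53 = r" by (simp_all add: j_def r_def)
  show ?thesis
    unfolding TST_def
  proof (rule tr_AsgSeqV[where v = "s 50"], simp, simp, rule tr_AsgSeqV[where v = "s 51"], simp, simp,
      rule tr_AsgSeqV[where v = "j + m"], goal_cases)
    case 1
    then show ?case by (simp add: jr id id18 Amax(1)[OF b h] il Nj am)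
  next
    case 2
    then show ?case by (simp add: jr am)
  next
    case 3
    show ?case
    proof (rule tr_Seq[where ?n1.0 = k and ?n2.0 = 0], rule DEC_tr[where k = k], goal_cases)
      case (4 s')
      show ?case
      proof (rule tr_AsgV[where v = "W.el (a * s 51) (j + m)"], goal_cases)
        case 2
        then show ?case using 4(2) by simp
      next
        case 3
        show ?case
        proof (rule post[where y = "W.el (a * s 51) (j + m)"], goal_cases)
          case (3 c)
          show ?case
            using W.amax_hit[of c "a * s 51" q r] unfolding m_def[symmetric] jq[symmetric] jr q_def[symmetric] .
        qed (use 4(1) in auto)
      qed simp
    qed (use b h jm k in auto)
  qed
qed

end

section \<open>The first point of a node above a bound\<close>

definition id_exp :: "nat \<Rightarrow> exp \<Rightarrow> exp \<Rightarrow> exp" where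
  "id_exp f ee ie = pl (ti (pl (ti (pl (ti (pl (C (f * 2)) (V 20)) (pl (sc 1) (C 1))) (V 21)) (pl (sc 1) (C 1))) ee) (sc 0)) ie"

abbreviation "she \<equiv> Rd (C 11) (V 21)"
abbreviation "nbe \<equiv> mi (ti (sc 2) (V 21)) she"

text \<open>Ranks increase along the list of a node, so the first position in the half-open range
  from \<open>V 26\<close> to \<open>V 27\<close> whose x-rank is at least \<open>V 23\<close> can
  be found by bisection; every probe costs a descent.\<close>

definition BIN :: com where
  "BIN = While (V 26) (V 27) (
     Asg 30 (di (pl (V 26) (V 27)) (C 2)) ;; Asg 70 (V 20) ;; Asg 71 (V 21) ;; Asg 72 (V 30) ;; DEC ;;
     If (Rd (pl (C 6) (V 20)) (V 70)) (V 23) (Asg 26 (pl (V 30) (C 1))) (Asg 27 (V 30)))"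

text \<open>Walks from position \<open>V 26\<close> to the end of its block in aligned groups of
  \<open>2 ^ V 28\<close> positions, which grow by a factor \<open>2 ^ a\<close> whenever the
  position is aligned to the next size. \<open>V 29\<close> records success, and setting
  \<open>V 27\<close> to 0 leaves the loop.\<close>

definition UP :: com where
  "UP = Asg 28 (C 0) ;; Asg 29 (C 0) ;; Asg 27 (shl (pl (V 25) (C 1)) she) ;;
    While (V 26) (V 27) (
      Asg 50 (V 20) ;; Asg 51 (V 21) ;; Asg 52 (V 26) ;; Asg 53 (V 28) ;; TST ;;
      If (V 50) (V 24)
        (Asg 26 (pl (V 26) (shl (C 1) (V 28))) ;;
         If (mo (V 26) (shl (C 1) (pl (V 28) (sc 2)))) (C 1) (Asg 28 (pl (V 28) (sc 2))) (Asg 28 (V 28)))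
        (Asg 29 (C 1) ;; Asg 27 (C 0)))"

definition NEXT :: com where
  "NEXT = Asg 40 (id_exp 1 (C 0) (V 25)) ;; Asg 41 (pl (V 24) (C 1)) ;; PRED ;; Asg 32 (V 40) ;;
    If (V 32) nbe
      (Asg 33 (pl (shr (V 25) (V 32)) (C 1)) ;; Asg 40 (id_exp 2 (V 32) (V 33)) ;; Asg 41 (pl (V 24) (C 1)) ;;
       PRED ;; Asg 26 (shl (pl (shl (V 33) (V 32)) (V 40)) she) ;; Asg 28 she ;; Asg 29 (C 1))
      (Asg 29 (C 0))"

definition DOWN :: com where
  "DOWN = While (C 0) (V 28) (
      Asg 50 (V 20) ;; Asg 51 (V 21) ;; Asg 52 (V 26) ;; Asg 53 (mi (V 28) (sc 2)) ;; TST ;;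
      If (V 50) (V 24) (Asg 26 (pl (V 26) (shl (C 1) (mi (V 28) (sc 2))))) (Asg 28 (mi (V 28) (sc 2))))"

text \<open>Inputs are the structure in \<open>V 20\<close>, height and number of a node in
  \<open>V 21\<close> and \<open>V 22\<close>, a lower bound for x-ranks in \<open>V 23\<close> and
  one for y-ranks in \<open>V 24\<close>. The result in \<open>V 20\<close> is the least x-rank
  found, or \<open>2 ^ H\<close>.\<close>

definition FIND :: com where
  "FIND = Asg 40 (id_exp 0 (C 0) (V 22)) ;; Asg 41 (V 23) ;; PRED ;; Asg 25 (pl (shl (V 22) nbe) (V 40)) ;;
    Asg 26 (shl (V 25) she) ;; Asg 27 (shl (pl (V 25) (C 1)) she) ;; BIN ;; UP ;;
    If (V 29) (C 1) NEXT (Asg 29 (V 29)) ;;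
    If (V 29) (C 1) (Asg 20 (sc 0))
      (DOWN ;; Asg 70 (V 20) ;; Asg 71 (V 21) ;; Asg 72 (V 26) ;; DEC ;; Asg 20 (Rd (pl (C 6) (V 20)) (V 70)))"

section \<open>Correctness and cost of the search in one node\<close>

context level_ds
begin

abbreviation "TD \<equiv> 2 ^ a * J"

abbreviation "TP \<equiv> (L + 1) * (blen (H + 1) + 2)"

text \<open>Every partial result is at most the identifier, and identifiers are below a word by
  \<open>IQ\<close> and \<open>Qw\<close>; this excludes overflow.\<close>

lemma id_exp_ok:
  assumes "t 20 < 2" "t 21 \<le> hm" "safe w AA t ee" "safe w AA t ie" "ev AA t ee \<le> H" "ev AA t ie < 2 ^ H" "f < 3"
  shows "safe w AA t (id_exp f ee ie)" "ev AA t (id_exp f ee ie) = mkid H f (t 20) (t 21) (ev AA t ee) (ev AA t ie)"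
    "mkid H f (t 20) (t 21) (ev AA t ee) (ev AA t ie) < 6 * (H + 1) * (H + 1) * 2 ^ H"
proof -
  note mp = mkid_parts(6)[OF assms(1) hH[OF assms(2)] assms(5,6,7)]
  show "mkid H f (t 20) (t 21) (ev AA t ee) (ev AA t ie) < 6 * (H + 1) * (H + 1) * 2 ^ H" by (rule mp)
  show "ev AA t (id_exp f ee ie) = mkid H f (t 20) (t 21) (ev AA t ee) (ev AA t ie)"
    by (simp add: id_exp_def mkid_def)
  have "6 * (H + 1) * (H + 1) * 2 ^ H * 1 \<le> 6 * (H + 1) * (H + 1) * 2 ^ H * ((H + 2) * 2 ^ (H + 1))"
    by (intro mult_le_mono2) (simp only: Suc_le_eq One_nat_def nat_0_less_mult_iff zero_less_power pos2, simp)
  then have lt: "mkid H f (t 20) (t 21) (ev AA t ee) (ev AA t ie) < 2 ^ w"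
    using mp IQ Qw by (simp only: mult.assoc)
  define x1 where "x1 = f * 2 + t 20"
  define x2 where "x2 = x1 * (H + 1) + t 21"
  define x3 where "x3 = x2 * (H + 1) + ev AA t ee"
  have m: "mkid H f (t 20) (t 21) (ev AA t ee) (ev AA t ie) = x3 * 2 ^ H + ev AA t ie"
    by (simp add: mkid_def x1_def x2_def x3_def)
  have l0: "x3 * 2 ^ H + ev AA t ie < 2 ^ w" "x3 * 2 ^ H < 2 ^ w" using lt m by linarith+
  have l: "x \<le> x * (H + 1)" "x \<le> x * 2 ^ H" for x by simp_all
  have l3: "x3 < 2 ^ w" "x2 * (H + 1) < 2 ^ w" using l0 l(2)[of x3] unfolding x3_def by linarith+
  have l2: "x2 < 2 ^ w" "x1 * (H + 1) < 2 ^ w" using l3 l(1)[of x2] unfolding x2_def by linarith+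
  have l1: "x1 < 2 ^ w" using l2 l(1)[of x1] by linarith
  have f2: "f * 2 < 2 ^ w" using l1 unfolding x1_def by linarith
  have H2: "H + 1 < 2 ^ w" using less_exp[of H] N_lt by linarith
  show "safe w AA t (id_exp f ee ie)"
    using assms(3,4) f2 H2 l1 l2 l3 l0 unfolding id_exp_def x3_def x2_def x1_def by simp
qed

lemma she_ok:
  assumes "t 21 \<le> hm"
  shows "safe w AA t she" "ev AA t she = shf a G (t 21)" "safe w AA t nbe" "ev AA t nbe = a * t 21 - shf a G (t 21)"
    "shf a G (t 21) \<le> a * t 21" "a * t 21 < H"
proof -
  have l: "t 21 < length (AA ! 11)" using A11(1) assms by simp
  show s: "safe w AA t she" using l by simp
  show e: "ev AA t she = shf a G (t 21)" using A11(2) assms by simp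
  show "shf a G (t 21) \<le> a * t 21" by (simp add: shf_def)
  moreover show "a * t 21 < H" by (rule ah[OF assms])
  moreover have "a * t 21 < 2 ^ w" using \<open>a * t 21 < H\<close> less_exp[of H] N_lt by linarith
  ultimately show "safe w AA t nbe" "ev AA t nbe = a * t 21 - shf a G (t 21)" using s e by auto
qed

lemma BIN_tr:
  assumes b: "s 20 < 2" and h: "s 21 \<le> hm" and lh: "s 26 \<le> s 27" "s 27 \<le> 2 ^ H"
    and nd: "\<And>j. s 26 \<le> j \<Longrightarrow> j < s 27 \<Longrightarrow> j div 2 ^ (a * s 21) = v"
    and post: "\<And>s'. \<forall>r<26. s' r = s r \<Longrightarrow> s 26 \<le> s' 26 \<Longrightarrow> s' 26 \<le> s 27 \<Longrightarrow>
      (\<And>j. s 26 \<le> j \<Longrightarrow> j < s' 26 \<Longrightarrow> Pf (s 20) (wave.el H (Pf (s 20)) (a * s 21) j) < s 23) \<Longrightarrow>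
      (\<And>j. s' 26 \<le> j \<Longrightarrow> j < s 27 \<Longrightarrow> s 23 \<le> Pf (s 20) (wave.el H (Pf (s 20)) (a * s 21) j)) \<Longrightarrow> T s'"
    and k: "(TD + 1) * blen (s 27 - s 26) \<le> k"
  shows "TR BIN s k T"
proof -
  interpret W: wave H "Pf (s 20)" using waveP b by blast
  define e where "e = a * s 21"
  have e: "e < H" using ah[OF h] by (simp add: e_def)
  define p where "p j = Pf (s 20) (W.el e j)" for j
  have pm: "p j \<le> p j'" if "s 26 \<le> j" "j \<le> j'" "j' < s 27" for j j'
  proof (cases "j = j'")
    case False
    then have "p j < p j'" unfolding p_def using that lh e nd[of j] nd[of j']
      by (intro W.P_el_mono) (auto simp: e_def)
    then show ?thesis by simp
  qed simp
  define Inv where "Inv t \<longleftrightarrow> (\<forall>r<26. t r = s r) \<and> s 26 \<le> t 26 \<and> t 26 \<le> t 27 \<and> t 27 \<le> s 27 \<and>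
    (\<forall>j. s 26 \<le> j \<and> j < t 26 \<longrightarrow> p j < s 23) \<and> (\<forall>j. t 27 \<le> j \<and> j < s 27 \<longrightarrow> s 23 \<le> p j)" for t :: "nat \<Rightarrow> nat"
  show ?thesis
    unfolding BIN_def
  proof (rule tr_While[where I = Inv and k = TD and \<mu> = "\<lambda>t. blen (t 27 - t 26)"], goal_cases)
    case 1
    then show ?case using lh by (simp add: Inv_def)
  next
    case (2 t)
    then show ?case by simp
  next
    case (3 t)
    have tf: "t r = s r" if "r < 26" for r using 3(1) that by (simp add: Inv_def)
    have tb: "s 26 \<le> t 26" "t 26 < t 27" "t 27 \<le> s 27"
      "\<And>j. s 26 \<le> j \<Longrightarrow> j < t 26 \<Longrightarrow> p j < s 23" "\<And>j. t 27 \<le> j \<Longrightarrow> j < s 27 \<Longrightarrow> s 23 \<le> p j"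
      using 3 by (auto simp: Inv_def)
    define m where "m = (t 26 + t 27) div 2"
    have m: "t 26 \<le> m" "m < t 27" using tb by (auto simp: m_def)
    have mN: "m < 2 ^ H" using m tb lh by linarith
    have dm: "t 27 - t 26 > 0" "m - t 26 \<le> (t 27 - t 26) div 2" "t 27 - Suc m \<le> (t 27 - t 26) div 2"
      using tb by (auto simp: m_def)
    have ov: "t 26 + t 27 < 2 ^ w" "Suc m < 2 ^ w" using tb lh N_lt mN by linarith+
    show ?case
    proof (rule tr_AsgSeqV[where v = m], goal_cases)
      case 3
      show ?case
      proof (rule tr_AsgSeqV[where v = "s 20"], simp, simp add: tf, rule tr_AsgSeqV[where v = "s 21"], simp, simp add: tf,
          rule tr_AsgSeqV[where v = m], simp, simp, rule tr_Seq[where ?n1.0 = TD and ?n2.0 = 0], rule DEC_tr[where k = TD], goal_cases)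
        case (4 u)
        have uf: "u r = s r" if "r < 26" for r using 4(1) tf that by simp
        have u: "u 26 = t 26" "u 27 = t 27" "u 30 = m" using 4(1) by simp_all
        have u70: "u 70 = W.el e m" using 4(2) by (simp add: e_def)
        have yl: "W.el e m < 2 ^ H" using e mN by (intro W.el_less) auto
        have sf: "safe w AA u (Rd (pl (C 6) (V 20)) (V 70))" "ev AA u (Rd (pl (C 6) (V 20)) (V 70)) = p m"
        proof -
          have "(8::nat) < 2 ^ w" by (rule num_lt) simp
          then have "6 + s 20 < 2 ^ w" using b by linarith
          then show "safe w AA u (Rd (pl (C 6) (V 20)) (V 70))" using A67(1)[OF b] len16 b yl by (simp add: uf u70)
          show "ev AA u (Rd (pl (C 6) (V 20)) (V 70)) = p m" using A67(2)[OF b yl] by (simp add: uf u70 p_def)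
        qed
        show ?case
        proof (rule tr_If, goal_cases)
          case 3
          then have "p m < s 23" using sf uf by simp
          then have "p j < s 23" if "s 26 \<le> j" "j < Suc m" for j
            using pm[of j m] that m tb by fastforce
          then show ?case
            using uf u m tb ov blen_halve[OF dm(1,3)] by (intro tr_Asg) (auto simp: Inv_def)
        next
          case 4
          then have "s 23 \<le> p m" using sf uf by simp
          then have "s 23 \<le> p j" if "m \<le> j" "j < s 27" for j
            using pm[of m j] that m tb by fastforce
          then show ?case
            using uf u m tb ov blen_halve[OF dm(1,2)] by (intro tr_Asg) (auto simp: Inv_def)
        qed (use sf in simp_all)
      qed (use b h mN in auto)
    qed (use ov in \<open>auto simp: m_def\<close>)
  next
    case 4
    then show ?case by (rule k)
  next
    case (5 t)
    then have t: "t 26 = t 27" "\<forall>r<26. t r = s r" "s 26 \<le> t 26" "t 27 \<le> s 27"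
      "\<And>j. s 26 \<le> j \<Longrightarrow> j < t 26 \<Longrightarrow> p j < s 23" "\<And>j. t 27 \<le> j \<Longrightarrow> j < s 27 \<Longrightarrow> s 23 \<le> p j"
      by (auto simp: Inv_def)
    show ?case by (rule post) (use t in \<open>auto simp: p_def e_def\<close>)
  qed
qed

lemma mod_pow_split: "(2::nat) ^ r dvd j \<Longrightarrow> j mod 2 ^ (r + k) = 0 \<longleftrightarrow> j div 2 ^ r mod 2 ^ k = 0"
  by (auto simp: power_add mod_eq_0_iff_dvd)

lemma group_range: "(2::nat) ^ r dvd j \<Longrightarrow> j' div 2 ^ r = j div 2 ^ r \<longleftrightarrow> j \<le> j' \<and> j' < j + 2 ^ r"
proof -
  assume "(2::nat) ^ r dvd j"
  then obtain q where q: "j = 2 ^ r * q" by blast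
  show ?thesis
    using div_pow_lower[of q j' r] div_pow_upper[of j' r "q + 1"] unfolding q by (auto simp: algebra_simps)
qed

text \<open>The variant works like an odometer: a failed test moves to the next group, which either
  raises the digit of the position in base \<open>2 ^ a\<close> at the current size or leads to
  larger groups. So there are at most \<open>2 ^ a\<close> tests per size.\<close>

lemma UP_tr:
  assumes b: "s 20 < 2" and h: "s 21 \<le> hm" and t: "(s 25 + 1) * 2 ^ shf a G (s 21) \<le> 2 ^ H"
    and i: "s 25 * 2 ^ shf a G (s 21) \<le> s 26" "s 26 \<le> (s 25 + 1) * 2 ^ shf a G (s 21)"
    and post: "\<And>s'. \<forall>r<26. s' r = s r \<Longrightarrow> s' 29 = 0 \<Longrightarrow>
        (\<And>j. s 26 \<le> j \<Longrightarrow> j < (s 25 + 1) * 2 ^ shf a G (s 21) \<Longrightarrow> \<not> wave.hit H (Pf (s 20)) (a * s 21) (s 24) j) \<Longrightarrow> T s'"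
      "\<And>s' g. \<forall>r<26. s' r = s r \<Longrightarrow> s' 29 = 1 \<Longrightarrow> s' 28 = a * g \<Longrightarrow> g \<le> min (s 21) G \<Longrightarrow>
        2 ^ (a * g) dvd s' 26 \<Longrightarrow> s 26 \<le> s' 26 \<Longrightarrow> s' 26 < (s 25 + 1) * 2 ^ shf a G (s 21) \<Longrightarrow>
        (\<And>j. s 26 \<le> j \<Longrightarrow> j < s' 26 \<Longrightarrow> \<not> wave.hit H (Pf (s 20)) (a * s 21) (s 24) j) \<Longrightarrow>
        (\<exists>j. j div 2 ^ (a * g) = s' 26 div 2 ^ (a * g) \<and> wave.hit H (Pf (s 20)) (a * s 21) (s 24) j) \<Longrightarrow> T s'"
    and k: "(TD + 1) * (2 ^ a * (G + 1)) \<le> k"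
  shows "TR UP s k T"
proof -
  interpret W: wave H "Pf (s 20)" using waveP b by blast
  define e S end' st where "e = a * s 21" and "S = shf a G (s 21)" and "end' = (s 25 + 1) * 2 ^ shf a G (s 21)"
    and "st = s 25 * 2 ^ shf a G (s 21)"
  define g0 where "g0 = min (s 21) G"
  have Sg: "S = a * g0" by (simp add: S_def shf_def g0_def)
  have ed: "end' = st + 2 ^ S" by (simp add: end'_def st_def S_def)
  have eN: "end' \<le> 2 ^ H" using t by (simp add: end'_def)
  have SH: "S \<le> H" using she_ok[of s, OF h] by (simp add: S_def)
  define HT where "HT j = W.hit e (s 24) j" for j
  define GH where "GH q g \<longleftrightarrow> (\<exists>j. j div 2 ^ (a * g) = q div 2 ^ (a * g) \<and> HT j)" for q g :: nat
  define dig where "dig j g = j div 2 ^ (a * g) mod 2 ^ a" for j g :: nat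
  define Inv where "Inv u \<longleftrightarrow> (\<forall>r<26. u r = s r) \<and> s 26 \<le> u 26 \<and> (\<forall>j. s 26 \<le> j \<and> j < u 26 \<longrightarrow> \<not> HT j) \<and>
     (\<exists>g. u 28 = a * g \<and> 2 ^ (a * g) dvd u 26 \<and> 
       ((u 29 = 0 \<and> u 27 = end' \<and> (u 26 < end' \<longrightarrow> g \<le> g0 \<and> (g = 0 \<or> g < g0))) \<or>
        (u 29 = 1 \<and> u 27 = 0 \<and> u 26 < end' \<and> g \<le> g0 \<and> GH (u 26) g)))"
    for u :: "nat \<Rightarrow> nat"
  define \<mu> where "\<mu> u = (if u 26 < u 27 then 2 ^ a * (g0 - u 28 div a) + (2 ^ a - dig (u 26) (u 28 div a)) else 0)"
    for u :: "nat \<Rightarrow> nat"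
  have aG: "(a * g) div a = g" for g using a1 by simp
  have digl: "dig j g < 2 ^ a" for j g by (simp add: dig_def)
  have w1: "2 ^ (S + a) < (2::nat) ^ w" if "a \<le> H" using SH that H1 by (intro pw_lt[of "S + a"]) auto
  have t25: "s 25 + 1 \<le> 2 ^ H"
  proof -
    have "(s 25 + 1) * 1 \<le> (s 25 + 1) * 2 ^ shf a G (s 21)" by (intro mult_le_mono2) simp
    then show ?thesis using order_trans[OF _ t] by (simp only: mult_1_right)
  qed
  show ?thesis
    unfolding UP_def
  proof (rule tr_AsgSeqV[where v = 0], simp, simp, rule tr_AsgSeqV[where v = 0], simp, simp,
      rule tr_AsgSeqV[where v = end'], goal_cases)
    case 1
    then show ?case using she_ok[of "s(28 := 0, 29 := 0)"] h t25 N_lt eN by (simp add: end'_def)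
  next
    case 2
    then show ?case using she_ok[of "s(28 := 0, 29 := 0)"] h by (simp add: end'_def)
  next
    case 3
    show ?case
    proof (rule tr_While[where I = Inv and k = TD and \<mu> = \<mu>], goal_cases)
      case 1
      then show ?case using i by (auto simp: Inv_def intro!: exI[of _ 0])
    next
      case (2 u)
      then show ?case by simp
    next
      case (3 u)
      have uf: "u r = s r" if "r < 26" for r using 3(1) that by (simp add: Inv_def)
      obtain g where g: "u 28 = a * g" "2 ^ (a * g) dvd u 26" "u 27 = end'" "u 29 = 0" "u 26 < end'" "g \<le> g0" "g = 0 \<or> g < g0"
        using 3 unfolding Inv_def by fastforce
      have uj: "s 26 \<le> u 26" "\<And>j. s 26 \<le> j \<Longrightarrow> j < u 26 \<Longrightarrow> \<not> HT j" using 3(1) by (auto simp: Inv_def)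
      define j where "j = u 26"
      have agS: "a * g \<le> S" unfolding Sg using g(6) by simp
      show ?case
      proof (rule tr_AsgSeqV[where v = "s 20"], simp, simp add: uf, rule tr_AsgSeqV[where v = "s 21"], simp, simp add: uf,
          rule tr_AsgSeqV[where v = j], simp, simp add: j_def, rule tr_AsgSeqV[where v = "a * g"], simp, simp add: g(1),
          rule tr_Seq[where ?n1.0 = TD and ?n2.0 = 0], rule TST_tr[where k = TD], goal_cases)
        case 3
        then show ?case using g(5) eN by (simp add: j_def)
      next
        case 4
        then show ?case using agS by (simp add: S_def)
      next
        case 5
        then show ?case using g(2) by (simp add: j_def)
      next
        case (6 x y)
        have xf: "x r = s r" if "r < 26" for r using 6(1) uf that by simp
        have x: "x 26 = j" "x 27 = end'" "x 28 = a * g" "x 29 = 0" using 6(1) g by (simp_all add: j_def)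
        have y: "c \<le> y \<longleftrightarrow> (\<exists>j'. j' div 2 ^ (a * g) = j div 2 ^ (a * g) \<and> W.hit e c j')" for c
          using 6(3)[of c] by (simp add: e_def)
        show ?case
        proof (rule tr_If, goal_cases)
          case 3
          then have "\<not> s 24 \<le> y" using 6(2) xf by simp
          then have nohit: "\<not> HT j'" if "j \<le> j'" "j' < j + 2 ^ (a * g)" for j'
            using y[of "s 24"] group_range[OF g(2), of j'] that by (auto simp: HT_def j_def)
          have nh: "\<not> HT j'" if "s 26 \<le> j'" "j' < j + 2 ^ (a * g)" for j'
            using nohit[of j'] uj(2)[of j'] that by (cases "j \<le> j'") (auto simp: j_def not_le)
          have pS: "(2::nat) ^ (a * g) \<le> 2 ^ S" using agS by (intro power_increasing) auto
          define j' where "j' = j + 2 ^ (a * g)"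
          have dv: "2 ^ (a * g) dvd j'" using g(2) by (simp add: j'_def j_def)
          have stj: "st \<le> j" using i(1) uj(1) by (simp add: st_def j_def)
          have d1: "j' div 2 ^ (a * g) = Suc (j div 2 ^ (a * g))" by (simp add: j'_def)
          have jl: "j < end'" using g(5) by (simp add: j_def)
          have jN: "j' < 2 ^ w" "2 ^ (a * g) < (2::nat) ^ w"
          proof -
            have "(2::nat) ^ S \<le> 2 ^ H" using SH by (intro power_increasing) auto
            then show "j' < 2 ^ w" "2 ^ (a * g) < (2::nat) ^ w" using jl eN pS N_lt unfolding j'_def by linarith+
          qed
          have aH: "a * g + a < 2 ^ w" "2 ^ (a * g + a) < (2::nat) ^ w"
          proof -
            have "a * g + a \<le> 8 * H" using agS SH a2H by linarith
            then show "2 ^ (a * g + a) < (2::nat) ^ w" by (intro pw_lt[of "a * g + a"]) auto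
            then show "a * g + a < 2 ^ w" using less_exp[of "a * g + a"] by linarith
          qed
          have q1: "j' mod 2 ^ (a * g + a) = 0 \<longleftrightarrow> j' div 2 ^ (a * g) mod 2 ^ a = 0"
            by (rule mod_pow_split[OF dv])
          have sg: "s 26 \<le> j'" using uj(1) by (simp add: j'_def j_def)
          have old: "2 ^ a * (g0 - g) + 1 \<le> \<mu> u" "\<mu> u = 2 ^ a * (g0 - g) + (2 ^ a - dig j g)"
            using g(3,5) digl[of j g] by (simp_all add: \<mu>_def g(1) aG j_def)
          show ?case
          proof (rule tr_AsgSeqV[where v = j'], goal_cases)
            case 3
            show ?case
            proof (rule tr_If, goal_cases)
              case 3
              then have dv2: "2 ^ (a * Suc g) dvd j'" using x by (simp add: mod_eq_0_iff_dvd add.commute)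
              \<comment> \<open>A position right of the block start that is aligned to the block
                length is at or beyond the end of the block. So while the walk is inside the block,
                the next size is still smaller than the block.\<close>
              have gg: "Suc g < g0" if "j' < end'"
              proof (rule ccontr)
                assume "\<not> Suc g < g0"
                then have "S \<le> a * Suc g" unfolding Sg by (intro mult_le_mono2) simp
                then have "(2::nat) ^ S dvd 2 ^ (a * Suc g)" by (rule le_imp_power_dvd)
                then have "2 ^ S dvd j'" using dv2 dvd_trans by blast
                moreover have "2 ^ S dvd st" by (simp add: st_def S_def)
                ultimately have "2 ^ S dvd j' - st" by (rule dvd_diff_nat)
                moreover have "0 < (2::nat) ^ (a * g)" by simp
                then have "0 < j' - st" using stj unfolding j'_def by linarith
                ultimately have "2 ^ S \<le> j' - st" "0 < j' - st" by (auto intro: dvd_imp_le)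
                then show False using that ed by linarith
              qed
              have "\<mu> (x(26 := j', 28 := a * Suc g)) < \<mu> u"
              proof (cases "j' < end'")
                case True
                have "g0 - g = Suc (g0 - Suc g)" using gg[OF True] by simp
                then have "2 ^ a * (g0 - Suc g) + (2 ^ a - dig j' (Suc g)) \<le> 2 ^ a * (g0 - g)" by simp
                moreover have "\<mu> (x(26 := j', 28 := a * Suc g)) = 2 ^ a * (g0 - Suc g) + (2 ^ a - dig j' (Suc g))"
                  using True x aG[of "Suc g"] by (simp add: \<mu>_def del: mult_Suc_right)
                ultimately show ?thesis using old(1) by linarith
              qed (use old x in \<open>simp add: \<mu>_def\<close>)
              moreover have "Inv (x(26 := j', 28 := a * Suc g))"
                unfolding Inv_def using xf x nh sg gg dv2
                by (intro conjI exI[of _ "Suc g"]) (auto simp: j'_def)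
              ultimately show ?case using x aH by (intro tr_AsgV[where v = "a * Suc g"]) (auto simp: add.commute)
            next
              case 4
              then have nz: "j' mod 2 ^ (a * g + a) \<noteq> 0" using x by simp
              then have "dig j' g = Suc (dig j g)" using q1 d1 by (simp add: dig_def mod_Suc split: if_splits)
              then have d2: "2 ^ a - dig j' g < 2 ^ a - dig j g" using digl[of j' g] by simp
              have "\<mu> (x(26 := j', 28 := a * g)) \<le> 2 ^ a * (g0 - g) + (2 ^ a - dig j' g)"
                using x by (simp add: \<mu>_def aG)
              then have "\<mu> (x(26 := j', 28 := a * g)) < \<mu> u" using old(2) d2 by linarith
              moreover have "Inv (x(26 := j', 28 := a * g))"
                unfolding Inv_def using xf x nh sg g(6,7) dv
                by (intro conjI exI[of _ g]) (auto simp: j'_def)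
              ultimately show ?case using x by (intro tr_AsgV[where v = "a * g"]) auto
            qed (use x aH in auto)
          qed (use x jN in \<open>auto simp: j'_def\<close>)
        next
          case 4
          then have "s 24 \<le> y" using 6(2) xf by simp
          then have ex: "GH j g" using y by (simp add: HT_def GH_def)
          have "j < end'" using g(5) by (simp add: j_def)
          then have mu: "0 < \<mu> u" using g(3,5) digl[of "u 26" g] by (simp add: \<mu>_def g(1) aG)
          show ?case
            apply (rule tr_AsgSeqV[where v = 1])
              apply simp
             apply simp
            apply (rule tr_AsgV[where v = 0])
              apply simp
             apply simp
            using xf x uj g ex mu by (auto simp: Inv_def \<mu>_def j_def intro!: exI[of _ g])
        qed simp_all
      qed (use b h in auto)
    next
      case 4
      have "2 ^ a * (g0 - 0) + (2 ^ a - dig (s 26) 0) \<le> 2 ^ a * g0 + 2 ^ a" by simp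
      also have "\<dots> \<le> 2 ^ a * (G + 1)" unfolding distrib_left g0_def by simp
      finally have "\<mu> (s(28 := 0, 29 := 0, 27 := end')) \<le> 2 ^ a * (G + 1)" by (simp add: \<mu>_def)
      then have "(TD + 1) * \<mu> (s(28 := 0, 29 := 0, 27 := end')) \<le> (TD + 1) * (2 ^ a * (G + 1))" by (rule mult_le_mono2)
      then show ?case using k by linarith
    next
      case (5 u)
      have uf: "\<forall>r<26. u r = s r" using 5(1) by (simp add: Inv_def)
      have uj: "s 26 \<le> u 26" "\<And>j. s 26 \<le> j \<Longrightarrow> j < u 26 \<Longrightarrow> \<not> HT j" using 5(1) by (auto simp: Inv_def)
      obtain g where g: "u 28 = a * g" "2 ^ (a * g) dvd u 26"
        "(u 29 = 0 \<and> u 27 = end' \<and> (u 26 < end' \<longrightarrow> g \<le> g0 \<and> (g = 0 \<or> g < g0))) \<or>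
        (u 29 = 1 \<and> u 27 = 0 \<and> u 26 < end' \<and> g \<le> g0 \<and> GH (u 26) g)"
        using 5(1) unfolding Inv_def by blast
      from g(3) show ?case
      proof
        assume c: "u 29 = 0 \<and> u 27 = end' \<and> (u 26 < end' \<longrightarrow> g \<le> g0 \<and> (g = 0 \<or> g < g0))"
        then have "end' \<le> u 26" using 5(2) by simp
        then show ?thesis using uf uj c by (intro post(1)) (auto simp: HT_def e_def end'_def)
      next
        assume c: "u 29 = 1 \<and> u 27 = 0 \<and> u 26 < end' \<and> g \<le> g0 \<and> GH (u 26) g"
        then show ?thesis using uf uj g(1,2)
          by (intro post(2)[of u g]) (auto simp: GH_def HT_def e_def end'_def g0_def)
      qed
    qed
  qed
qed

text \<open>The current group is known to contain a hit at or right of \<open>V 26\<close>, and no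
  hit has been passed. Testing the subgroup at \<open>V 26\<close> leads either into it or to its
  right sibling; when the size is 1, the position is the first hit.\<close>

lemma DOWN_tr:
  assumes b: "s 20 < 2" and h: "s 21 \<le> hm" and g1: "s 28 = a * g1" "g1 \<le> min (s 21) G" "2 ^ (a * g1) dvd s 26"
    and j0: "s 26 < 2 ^ H"
    and ex: "\<exists>j. j div 2 ^ (a * g1) = s 26 div 2 ^ (a * g1) \<and> wave.hit H (Pf (s 20)) (a * s 21) (s 24) j"
    and post: "\<And>s'. \<forall>r<26. s' r = s r \<Longrightarrow> s 26 \<le> s' 26 \<Longrightarrow> s' 26 div 2 ^ (a * g1) = s 26 div 2 ^ (a * g1) \<Longrightarrow>
        wave.hit H (Pf (s 20)) (a * s 21) (s 24) (s' 26) \<Longrightarrow>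
        (\<And>j. s 26 \<le> j \<Longrightarrow> j < s' 26 \<Longrightarrow> \<not> wave.hit H (Pf (s 20)) (a * s 21) (s 24) j) \<Longrightarrow> T s'"
    and k: "(TD + 1) * (2 ^ a * G) \<le> k"
  shows "TR DOWN s k T"
proof -
  interpret W: wave H "Pf (s 20)" using waveP b by blast
  define e where "e = a * s 21"
  define HT where "HT j = W.hit e (s 24) j" for j
  define dig where "dig j g = j div 2 ^ (a * g) mod 2 ^ a" for j g :: nat
  have g1S: "a * g1 \<le> shf a G (s 21)" using g1(2) by (simp add: shf_def)
  then have g1H: "a * g1 \<le> H" using she_ok[of s, OF h] by simp
  have grpN: "j < 2 ^ H" if "j div 2 ^ (a * g1) = s 26 div 2 ^ (a * g1)" for j
    using W.node_bound[OF j0 g1H that] .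
  define Qd where "Qd u g \<longleftrightarrow> u 28 = a * g \<and> (0 < g \<longrightarrow> 2 ^ (a * (g - 1)) dvd u 26) \<and>
       u 26 div 2 ^ (a * g1) = s 26 div 2 ^ (a * g1) \<and>
       (\<exists>j. u 26 \<le> j \<and> j div 2 ^ (a * g) = u 26 div 2 ^ (a * g) \<and> HT j)" for u :: "nat \<Rightarrow> nat" and g
  define Inv where "Inv u \<longleftrightarrow> (\<forall>r<26. u r = s r) \<and> s 26 \<le> u 26 \<and> (\<forall>j. s 26 \<le> j \<and> j < u 26 \<longrightarrow> \<not> HT j) \<and>
     (\<exists>g\<le>g1. Qd u g)"
    for u :: "nat \<Rightarrow> nat"
  \<comment> \<open>Every remaining size has at most \<open>2 ^ a\<close> subgroups; the digit of
    the position counts those already passed at the current size.\<close>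
  define \<mu> where "\<mu> u = (if u 28 = 0 then 0 else 2 ^ a * (u 28 div a) - dig (u 26) (u 28 div a - 1))"
    for u :: "nat \<Rightarrow> nat"
  have aG: "(a * g) div a = g" for g using a1 by simp
  have digl: "dig j g < 2 ^ a" for j g by (simp add: dig_def)
  show ?thesis
    unfolding DOWN_def
  proof (rule tr_While[where I = Inv and k = TD and \<mu> = \<mu>], goal_cases)
    case 1
    obtain j where j: "j div 2 ^ (a * g1) = s 26 div 2 ^ (a * g1)" "HT j" using ex by (auto simp: HT_def e_def)
    have "s 26 \<le> j" using j(1) group_range[OF g1(3)] by simp
    moreover have "2 ^ (a * (g1 - 1)) dvd s 26"
      using g1(3) by (rule dvd_trans[rotated]) (intro le_imp_power_dvd mult_le_mono2, simp)
    ultimately have "Qd s g1" using j g1 unfolding Qd_def by blast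
    then show ?case unfolding Inv_def by auto
  next
    case (2 u)
    then show ?case by simp
  next
    case (3 u)
    have uf: "u r = s r" if "r < 26" for r using 3(1) that by (simp add: Inv_def)
    have uj: "s 26 \<le> u 26" "\<And>j. s 26 \<le> j \<Longrightarrow> j < u 26 \<Longrightarrow> \<not> HT j" using 3(1) by (auto simp: Inv_def)
    obtain g where g: "g \<le> g1" "u 28 = a * g" "0 < g \<longrightarrow> 2 ^ (a * (g - 1)) dvd u 26"
      "u 26 div 2 ^ (a * g1) = s 26 div 2 ^ (a * g1)"
      "\<exists>j. u 26 \<le> j \<and> j div 2 ^ (a * g) = u 26 div 2 ^ (a * g) \<and> HT j"
      using 3(1) unfolding Inv_def Qd_def by blast
    have g0: "0 < g" using 3(2) g(2) by (cases g) auto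
    then obtain f where f: "g = Suc f" by (cases g) auto
    define j where "j = u 26"
    have dv: "2 ^ (a * f) dvd j" using g(3) f by (simp add: j_def)
    have jN: "j < 2 ^ H" using grpN[OF g(4)] by (simp add: j_def)
    obtain jh where jh: "j \<le> jh" "jh div 2 ^ (a * g) = j div 2 ^ (a * g)" "HT jh" using g(5) by (auto simp: j_def)
    have afS: "a * f \<le> a * g1" using g(1) f by (intro mult_le_mono2) simp
    have ra: "a * g - a = a * f" using f by simp
    have al: "a < 2 ^ w" "a \<le> a * g" "a * g < 2 ^ w"
    proof -
      have "a * g \<le> a * g1" using g(1) by simp
      then show "a * g < 2 ^ w" using g1H less_exp[of H] N_lt by linarith
      show "a \<le> a * g" using g0 by simp
      then show "a < 2 ^ w" using \<open>a * g < 2 ^ w\<close> by linarith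
    qed
    have point_ds: "x div 2 ^ (a * g) = x div 2 ^ (a * f) div 2 ^ a" for x :: nat
      using div_pow_split[of "a * f" "a * g" x] f by simp
    have old: "\<mu> u = 2 ^ a * g - dig j f" using g0 a1 by (simp add: \<mu>_def g(2) aG f j_def)
    have oldb: "2 ^ a * f < 2 ^ a * g - dig j f" using digl[of j f] unfolding f by simp
    show ?case
    proof (rule tr_AsgSeqV[where v = "s 20"], simp, simp add: uf, rule tr_AsgSeqV[where v = "s 21"], simp, simp add: uf,
        rule tr_AsgSeqV[where v = j], simp, simp add: j_def, rule tr_AsgSeqV[where v = "a * f"], goal_cases)
      case 1
      then show ?case using al by (simp add: g(2))
    next
      case 2
      then show ?case using ra by (simp add: g(2))
    next
      case 3
      show ?case
      proof (rule tr_Seq[where ?n1.0 = TD and ?n2.0 = 0], rule TST_tr[where k = TD], goal_cases)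
        case 4
        then show ?case using order_trans[OF afS g1S] by simp
      next
        case (6 x y)
        have xf: "x r = s r" if "r < 26" for r using 6(1) uf that by simp
        have x: "x 26 = j" "x 28 = a * g" using 6(1) g by (simp_all add: j_def)
        have y: "c \<le> y \<longleftrightarrow> (\<exists>j'. j' div 2 ^ (a * f) = j div 2 ^ (a * f) \<and> W.hit e c j')" for c
          using 6(3)[of c] by (simp add: e_def)
        show ?case
        proof (rule tr_If, goal_cases)
          case 3
          then have "\<not> s 24 \<le> y" using 6(2) xf by simp
          then have nohit: "\<not> HT j'" if "j \<le> j'" "j' < j + 2 ^ (a * f)" for j'
            using y[of "s 24"] group_range[OF dv, of j'] that by (auto simp: HT_def)
          define j' where "j' = j + 2 ^ (a * f)"
          have nh: "\<not> HT i" if "s 26 \<le> i" "i < j'" for i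
            using nohit[of i] uj(2)[of i] that by (cases "j \<le> i") (auto simp: j_def j'_def not_le)
          have jj: "j' \<le> jh" unfolding j'_def using nohit[OF jh(1)] jh(3) leI by blast
          have jmid: "j' div 2 ^ r = j div 2 ^ r" if "jh div 2 ^ r = j div 2 ^ r" for r
            using div_pow_mono_mid[of j j' jh r] jj that by (simp add: j'_def)
          have same: "j' div 2 ^ (a * g) = j div 2 ^ (a * g)" using jmid jh(2) by simp
          have "jh div 2 ^ (a * g1) = j div 2 ^ (a * g1)"
            using jh(2) g(1) div_pow_split[of "a * g" "a * g1" jh] div_pow_split[of "a * g" "a * g1" j] by simp
          then have same1: "j' div 2 ^ (a * g1) = s 26 div 2 ^ (a * g1)" using jmid g(4) by (simp add: j_def)
          have dv': "2 ^ (a * f) dvd j'" using dv by (simp add: j'_def)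
          have d1: "j' div 2 ^ (a * f) = Suc (j div 2 ^ (a * f))" by (simp add: j'_def)
          \<comment> \<open>The hit \<open>jh\<close> lies in the same group and beyond the subgroup
            just tested, so the step to the sibling does not leave the group and the digit does not
            wrap around.\<close>
          have "dig j' f = Suc (dig j f)"
          proof -
            have "Suc (j div 2 ^ (a * f)) div 2 ^ a = j div 2 ^ (a * f) div 2 ^ a" using same point_ds d1 by simp
            then have "Suc (j div 2 ^ (a * f)) mod 2 ^ a \<noteq> 0" by (simp add: div_Suc split: if_splits)
            then show ?thesis unfolding dig_def d1 by (simp add: mod_Suc split: if_splits)
          qed
          then have "\<mu> (x(26 := j')) < \<mu> u"
            using old oldb x g0 a1 by (simp add: \<mu>_def aG f)
          moreover have "Qd (x(26 := j')) g"
            unfolding Qd_def using x dv' same same1 jh jj f by (intro conjI exI[of _ jh]) simp_all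
          then have "Inv (x(26 := j'))"
            unfolding Inv_def using xf nh uj(1) g(1) by (auto simp: j'_def j_def)
          moreover have "j' < 2 ^ w" "2 ^ (a * f) < (2::nat) ^ w" using grpN[OF same1] N_lt unfolding j'_def by linarith+
          ultimately show ?case using x al ra by (intro tr_AsgV[where v = j']) (auto simp: j'_def)
        next
          case 4
          then have "s 24 \<le> y" using 6(2) xf by simp
          then obtain j' where j': "j' div 2 ^ (a * f) = j div 2 ^ (a * f)" "HT j'" using y by (auto simp: HT_def)
          have jl: "j \<le> j'" using j'(1) group_range[OF dv] by simp
          have "2 ^ (a * (f - 1)) dvd j"
            using dv by (rule dvd_trans[rotated]) (intro le_imp_power_dvd mult_le_mono2, simp)
          then have "Qd (x(28 := a * f)) f"
            unfolding Qd_def using x j' jl g(4) by (intro conjI exI[of _ j']) (simp_all add: j_def)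
          then have "Inv (x(28 := a * f))"
            unfolding Inv_def using xf x uj g(1) f by (auto simp: j_def intro!: exI[of _ f])
          moreover have "\<mu> (x(28 := a * f)) \<le> 2 ^ a * f" by (simp add: \<mu>_def aG)
          then have "\<mu> (x(28 := a * f)) < \<mu> u" using old oldb by linarith
          ultimately show ?case using x al ra by (intro tr_AsgV[where v = "a * f"]) auto
        qed simp_all
      qed (use b h jN dv in auto)
    qed
  next
    case 4
    have "\<mu> s \<le> 2 ^ a * g1" by (simp add: \<mu>_def g1(1) aG)
    also have "\<dots> \<le> 2 ^ a * G" using g1(2) by simp
    finally have "(TD + 1) * \<mu> s \<le> (TD + 1) * (2 ^ a * G)" by (rule mult_le_mono2)
    then show ?case using k by linarith
  next
    case (5 u)
    have uf: "\<forall>r<26. u r = s r" using 5(1) by (simp add: Inv_def)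
    have uj: "s 26 \<le> u 26" "\<And>j. s 26 \<le> j \<Longrightarrow> j < u 26 \<Longrightarrow> \<not> HT j" using 5(1) by (auto simp: Inv_def)
    obtain g where g: "u 28 = a * g" "u 26 div 2 ^ (a * g1) = s 26 div 2 ^ (a * g1)"
      "\<exists>j. u 26 \<le> j \<and> j div 2 ^ (a * g) = u 26 div 2 ^ (a * g) \<and> HT j"
      using 5(1) unfolding Inv_def Qd_def by blast
    have "g = 0" using 5(2) g(1) a1 by simp
    then have "HT (u 26)" using g(3) by auto
    then show ?case using uf uj g(2) by (intro post) (auto simp: HT_def e_def)
  qed
qed

text \<open>Two evaluations suffice: \<open>f2\<close> gives the height at which a hit to the right
  of block \<open>s 25\<close> occurs, and \<open>f3\<close> the first block with a hit in the
  sibling group at that height. Correctness is \<open>next_block\<close>, or \<open>f2_none\<close>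
  if the first value is \<open>e - S\<close>.\<close>

lemma NEXT_tr:
  assumes b: "s 20 < 2" and h: "s 21 \<le> hm" and c: "s 24 < 2 ^ H"
    and t: "(s 25 + 1) * 2 ^ shf a G (s 21) \<le> 2 ^ H"
    and post: "\<And>s'. \<forall>r<26. s' r = s r \<Longrightarrow> s' 29 = 0 \<Longrightarrow>
        (\<And>j. (s 25 + 1) * 2 ^ shf a G (s 21) \<le> j \<Longrightarrow> j div 2 ^ (a * s 21) = s 25 div 2 ^ (a * s 21 - shf a G (s 21)) \<Longrightarrow>
           \<not> wave.hit H (Pf (s 20)) (a * s 21) (s 24) j) \<Longrightarrow> T s'"
      "\<And>s' t'. \<forall>r<26. s' r = s r \<Longrightarrow> s' 29 = 1 \<Longrightarrow> s' 28 = shf a G (s 21) \<Longrightarrow>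
        s' 26 = t' * 2 ^ shf a G (s 21) \<Longrightarrow> s 25 < t' \<Longrightarrow> t' * 2 ^ shf a G (s 21) < 2 ^ H \<Longrightarrow>
        t' div 2 ^ (a * s 21 - shf a G (s 21)) = s 25 div 2 ^ (a * s 21 - shf a G (s 21)) \<Longrightarrow>
        (\<And>j. (s 25 + 1) * 2 ^ shf a G (s 21) \<le> j \<Longrightarrow> j < t' * 2 ^ shf a G (s 21) \<Longrightarrow>
           \<not> wave.hit H (Pf (s 20)) (a * s 21) (s 24) j) \<Longrightarrow>
        (\<exists>j. j div 2 ^ shf a G (s 21) = t' \<and> wave.hit H (Pf (s 20)) (a * s 21) (s 24) j) \<Longrightarrow> T s'"
    and k: "2 * TP \<le> k"
  shows "TR NEXT s k T"
proof -
  interpret W: wave H "Pf (s 20)" using waveP b by blast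
  define e where "e = a * s 21"
  define S where "S = shf a G (s 21)"
  have eS: "S \<le> e" "e < H" using she_ok[of s, OF h] by (simp_all add: e_def S_def)
  define t0 where "t0 = s 25"
  have tS: "(t0 + 1) * 2 ^ S \<le> 2 ^ H" using t by (simp add: t0_def S_def)
  have pS: "(2::nat) ^ H = 2 ^ (H - S) * 2 ^ S" using eS by (simp flip: power_add)
  have tb: "t0 < 2 ^ (H - S)"
  proof -
    have "(t0 + 1) * 2 ^ S \<le> 2 ^ (H - S) * 2 ^ S" using tS pS by simp
    then have "t0 + 1 \<le> 2 ^ (H - S)" by (simp only: mult_le_cancel2) simp
    then show ?thesis by simp
  qed
  have HSH: "(2::nat) ^ (H - S) \<le> 2 ^ H" by (intro power_increasing) auto
  have tN: "t0 < 2 ^ H" using tb HSH by linarith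
  define c1 where "c1 = s 24 + 1"
  have c1: "c1 < 2 ^ (H + 1)" "c1 < 2 ^ w" using c N_lt by (auto simp: c1_def)
  define F where "F = W.f2 e S t0 c1"
  define id1 where "id1 = mkid H 1 (s 20) (s 21) 0 t0"
  have id1: "safe w AA s (id_exp 1 (C 0) (V 25))" "ev AA s (id_exp 1 (C 0) (V 25)) = id1"
    "id1 < 6 * (H + 1) * (H + 1) * 2 ^ H"
    using id_exp_ok[of s "C 0" "V 25" 1] b h tN by (simp_all add: id1_def t0_def)
  have Fam1: "Fam H a G Pf id1 = W.f2 e S t0"
    unfolding id1_def e_def S_def by (rule Fam_mkid(2)) (use b h hH ah tN tb in \<open>auto simp: S_def\<close>)
  have Fe: "F \<le> e - S" unfolding F_def by (rule W.f2_le)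
  show ?thesis
    unfolding NEXT_def
  proof (rule tr_AsgSeqV[where v = id1], rule id1, rule id1, rule tr_AsgSeqV[where v = c1], goal_cases)
    case 1
    then show ?case using c1 by (simp add: c1_def)
  next
    case 2
    then show ?case by (simp add: c1_def)
  next
    case 3
    show ?case
    proof (rule tr_Seq[where ?n1.0 = TP and ?n2.0 = TP], rule PRED_tr[where k = TP], goal_cases)
      case 1
      then show ?case using id1(3) by simp
    next
      case 2
      then show ?case using c1 by (simp del: power_Suc)
    next
      case (3 u)
      have uf: "u r = s r" if "r < 40" for r using 3(1) that by simp
      have u40: "u 40 = F" using 3(2) by (simp add: Fam1 F_def)
      show ?case
      proof (rule tr_AsgSeqV[where v = F], simp, simp add: u40, rule tr_If, goal_cases)
        case 2
        then show ?case using she_ok(3)[of "u(32 := F)"] uf h by simp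
      next
        case 3
        then have FS: "F < e - S" using she_ok(4)[of "u(32 := F)"] uf h by (simp add: e_def S_def)
        define d where "d = t0 div 2 ^ F + 1"
        define F3 where "F3 = W.f3 e S F d c1"
        define t' where "t' = d * 2 ^ F + F3"
        note nb = W.next_block[OF eS(1) F_def[symmetric, unfolded c1_def] FS,
          folded d_def, folded c1_def, folded F3_def, folded t'_def]
        have t'N: "t' < 2 ^ (H - S)"
        proof -
          have p: "(2::nat) ^ (H - S) = 2 ^ (H - e) * 2 ^ (e - S)" using eS by (simp flip: power_add)
          have "t0 div 2 ^ (e - S) < 2 ^ (H - e)" unfolding div_pow_upper using tb p by simp
          then have "t' div 2 ^ (e - S) < 2 ^ (H - e)" using nb(2) by simp
          then show ?thesis unfolding div_pow_upper p .
        qed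
        have pF: "(2::nat) ^ (H - S) = 2 ^ (H - S - F) * 2 ^ F" using FS eS by (simp flip: power_add)
        have dl: "d < 2 ^ (H - S - F)"
        proof -
          have "d * 2 ^ F \<le> t'" by (simp add: t'_def)
          then have "d * 2 ^ F < 2 ^ (H - S - F) * 2 ^ F" using t'N unfolding pF by (rule le_less_trans)
          then show ?thesis by simp
        qed
        have dN: "d < 2 ^ H" using dl by (rule less_le_trans) (intro power_increasing, auto)
        have FH: "F \<le> H" using FS eS by simp
        define id2 where "id2 = mkid H 2 (s 20) (s 21) F d"
        have Fam2: "Fam H a G Pf id2 = W.f3 e S F d"
          unfolding id2_def e_def S_def
          by (rule Fam_mkid(3)) (use b h hH ah dl dN FS FH in \<open>auto simp: S_def e_def\<close>)
        let ?u1 = "u(32 := F, 33 := d)"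
        have id2: "safe w AA ?u1 (id_exp 2 (V 32) (V 33))" "ev AA ?u1 (id_exp 2 (V 32) (V 33)) = id2"
          "id2 < 6 * (H + 1) * (H + 1) * 2 ^ H"
          using id_exp_ok[of ?u1 "V 32" "V 33" 2] b h dN FS eS uf by (simp_all add: id2_def)
        have t'S: "t' * 2 ^ S < 2 ^ H" unfolding pS using t'N by simp
        have ov: "d < 2 ^ w" "d * 2 ^ F < 2 ^ w" "t' < 2 ^ w" "t' * 2 ^ S < 2 ^ w"
        proof -
          show "d < 2 ^ w" using dN N_lt by linarith
          have "d * 2 ^ F \<le> t'" by (simp add: t'_def)
          moreover show "t' < 2 ^ w" using t'N HSH N_lt by linarith
          ultimately show "d * 2 ^ F < 2 ^ w" by linarith
          show "t' * 2 ^ S < 2 ^ w" using t'S N_lt by linarith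
        qed
        show ?case
        proof (rule tr_AsgSeqV[where v = d], goal_cases)
          case 1
          then show ?case using ov(1) by (simp add: uf t0_def d_def)
        next
          case 2
          then show ?case by (simp add: uf t0_def d_def)
        next
          case 3
          show ?case
          proof (rule tr_AsgSeqV[where v = id2], rule id2, rule id2, rule tr_AsgSeqV[where v = c1], goal_cases)
            case 1
            then show ?case using c1 by (simp add: uf c1_def)
          next
            case 2
            then show ?case by (simp add: uf c1_def)
          next
            case 3
            show ?case
            proof (rule tr_Seq[where ?n1.0 = TP and ?n2.0 = 0], rule PRED_tr[where k = TP], goal_cases)
              case 1
              then show ?case using id2(3) by simp
            next
              case 2
              then show ?case using c1 by (simp del: power_Suc)
            next
              case (3 x)
              have xf: "x r = s r" if "r < 32" for r using 3(1) uf that by simp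
              have x: "x 32 = F" "x 33 = d" using 3(1) by simp_all
              have x40: "x 40 = F3" using 3(2) by (simp add: Fam2 F3_def)
              show ?case
              proof (rule tr_AsgSeqV[where v = "t' * 2 ^ S"], goal_cases)
                case 1
                then show ?case using she_ok(1,2)[of x] h ov by (simp add: x x40 xf t'_def[symmetric] S_def)
              next
                case 2
                then show ?case using she_ok(1,2)[of x] h by (simp add: x x40 xf t'_def[symmetric] S_def)
              next
                case 3
                show ?case
                proof (rule tr_AsgSeqV[where v = S], goal_cases)
                  case 3
                  show ?case
                  proof (rule tr_AsgV[where v = 1], simp, simp, rule post(2)[where t' = t'], goal_cases)
                    case (8 j)
                    then show ?case using nb(4)[of j] by (simp add: t0_def S_def e_def)
                  qed (use xf nb(1,2,3) t'S in \<open>auto simp: S_def t0_def e_def\<close>)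
                qed (use she_ok(1,2)[of "x(26 := t' * 2 ^ S)"] h xf in \<open>auto simp: S_def\<close>)
              qed
            qed simp_all
          qed
        qed
      next
        case 4
        then have "F = e - S" using she_ok(4)[of "u(32 := F)"] uf h Fe by (simp add: e_def S_def)
        then have "W.f2 e S t0 (s 24 + 1) = e - S" by (simp add: F_def c1_def)
        note f2 = W.f2_none[OF eS(1) this]
        show ?case
        proof (rule tr_AsgV[where v = 0], simp, simp, rule post(1), goal_cases)
          case (3 j)
          then show ?case using f2[of j] by (simp add: t0_def S_def e_def)
        qed (use uf in auto)
      qed simp
    qed (use k in auto)
  qed
qed

text \<open>The value \<open>2 ^ H\<close> stands for the absence of a point.\<close>

definition first_in :: "nat \<Rightarrow> (nat \<Rightarrow> bool) \<Rightarrow> nat \<Rightarrow> nat \<Rightarrow> bool" where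
  "first_in b D p r \<longleftrightarrow> (r = 2 ^ H \<and> (\<forall>y<2 ^ H. D y \<longrightarrow> Pf b y < p)) \<or>
     (\<exists>y<2 ^ H. D y \<and> p \<le> Pf b y \<and> r = Pf b y \<and> (\<forall>y'<2 ^ H. D y' \<longrightarrow> p \<le> Pf b y' \<longrightarrow> r \<le> Pf b y'))"

text \<open>Three evaluations of step functions, one of each family, and the descents: those of the
  bisection in a block, at most \<open>2 ^ a * (G + 1)\<close> upward and \<open>2 ^ a * G\<close>
  downward tests, and one for the final answer.\<close>

abbreviation "TF \<equiv> 3 * TP + (TD + 1) * (blen (2 ^ (a * G)) + 2 ^ a * (2 * G + 1) + 1)"

text \<open>Since x-ranks increase along the list of a node, the answer is the first hit from
  position \<open>i\<close> on, where \<open>i\<close> is the first position with x-rank at least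
  the bound. The hit is sought in the remainder of the block of \<open>i\<close> and, failing that,
  in the next block with a hit.\<close>

lemma FIND_tr:
  assumes b: "s 20 < 2" and h: "s 21 \<le> hm" and v: "s 22 < 2 ^ (H - a * s 21)" and p: "s 23 \<le> 2 ^ H" and c: "s 24 < 2 ^ H"
    and post: "\<And>s'. \<forall>r<20. s' r = s r \<Longrightarrow>
        first_in (s 20) (\<lambda>y. y div 2 ^ (a * s 21) = s 22 \<and> s 24 \<le> y) (s 23) (s' 20) \<Longrightarrow> s' 20 \<le> 2 ^ H \<Longrightarrow> T s'"
    and k: "TF \<le> k"
  shows "TR FIND s k T"
proof -
  interpret W: wave H "Pf (s 20)" using waveP b by blast
  define e where "e = a * s 21"
  define S where "S = shf a G (s 21)"
  have eS: "S \<le> e" "e < H" using she_ok[of s, OF h] by (simp_all add: e_def S_def)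
  have eH: "e \<le> H" using eS by simp
  have vN: "s 22 < 2 ^ H" using v by (rule less_le_trans) (intro power_increasing, auto)
  have v': "s 22 < 2 ^ (H - e)" using v by (simp add: e_def)
  define t0 where "t0 = s 22 * 2 ^ (e - S) + W.f1 e S (s 22) (s 23)"
  note fb = W.f1_block[where p = "s 23", OF eS(1) eH v', folded t0_def]
  define id0 where "id0 = mkid H 0 (s 20) (s 21) 0 (s 22)"
  have id0: "safe w AA s (id_exp 0 (C 0) (V 22))" "ev AA s (id_exp 0 (C 0) (V 22)) = id0"
    "id0 < 6 * (H + 1) * (H + 1) * 2 ^ H"
    using id_exp_ok[of s "C 0" "V 22" 0] b h vN by (simp_all add: id0_def)
  have Fam0: "Fam H a G Pf id0 = W.f1 e S (s 22)"
    unfolding id0_def e_def S_def by (rule Fam_mkid(1)) (use b h hH ah vN v in auto)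
  have pS: "(2::nat) ^ H = 2 ^ (H - S) * 2 ^ S" using eS by (simp flip: power_add)
  have pe: "(2::nat) ^ (H - S) = 2 ^ (H - e) * 2 ^ (e - S)" using eS by (simp flip: power_add)
  have t0l: "t0 < 2 ^ (H - S)"
  proof -
    have "t0 div 2 ^ (e - S) < 2 ^ (H - e)" using fb(1) v' by simp
    then show ?thesis unfolding div_pow_upper pe .
  qed
  have t1: "(t0 + 1) * 2 ^ S \<le> 2 ^ H" unfolding pS using t0l by (intro mult_le_mono1) simp
  have HSH: "(2::nat) ^ (H - S) \<le> 2 ^ H" by (intro power_increasing) auto
  have ov: "t0 < 2 ^ w" "t0 + 1 < 2 ^ w" "t0 * 2 ^ S < 2 ^ w" "(t0 + 1) * 2 ^ S < 2 ^ w" "s 22 * 2 ^ (e - S) < 2 ^ w"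
  proof -
    show a1: "t0 < 2 ^ w" "t0 + 1 < 2 ^ w" using t0l HSH N_lt by linarith+
    show "(t0 + 1) * 2 ^ S < 2 ^ w" using t1 N_lt by linarith
    then show "t0 * 2 ^ S < 2 ^ w" by (simp add: add_mult_distrib)
    show "s 22 * 2 ^ (e - S) < 2 ^ w" using a1(1) unfolding t0_def by linarith
  qed
  have blk: "j div 2 ^ e = s 22" if "j div 2 ^ S div 2 ^ (e - S) = s 22" for j
    using that div_pow_split[OF eS(1), of j] by simp
  have inblk: "j div 2 ^ e = s 22" if "t0 * 2 ^ S \<le> j" "j < (t0 + 1) * 2 ^ S" for j
  proof -
    have "j div 2 ^ S = t0" using that by (simp add: W.div_eq_iff_range)
    then show ?thesis using blk fb(1) by simp
  qed
  define D where "D y \<longleftrightarrow> y div 2 ^ e = s 22 \<and> s 24 \<le> y" for y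
  define GH where "GH q g \<longleftrightarrow> (\<exists>j. j div 2 ^ (a * g) = q div 2 ^ (a * g) \<and> W.hit e (s 24) j)" for q g :: nat
  have Deq: "D = (\<lambda>y. y div 2 ^ (a * s 21) = s 22 \<and> s 24 \<le> y)" by (simp add: D_def e_def fun_eq_iff)
  have none: "first_in (s 20) D (s 23) (2 ^ H)" if i: "\<And>j. j div 2 ^ e = s 22 \<Longrightarrow> j < i \<Longrightarrow> Pf (s 20) (W.el e j) < s 23"
      and nh: "\<And>j. i \<le> j \<Longrightarrow> j div 2 ^ e = s 22 \<Longrightarrow> \<not> W.hit e (s 24) j" for i
  proof -
    have "Pf (s 20) y < s 23" if y: "y < 2 ^ H" "D y" for y
    proof -
      define j where "j = W.pos e y"
      have jd: "j div 2 ^ e = s 22" using W.pos_div[of e y] y by (simp add: j_def D_def)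
      have ey: "W.el e j = y" using W.el_pos[OF y(1)] by (simp add: j_def)
      have "W.hit e (s 24) j" using y by (simp add: W.hit_def ey D_def)
      then have "j < i" using nh[of j] jd by (meson not_le)
      then show ?thesis using i[OF jd] ey by simp
    qed
    then show ?thesis by (simp add: first_in_def)
  qed
  have some: "first_in (s 20) D (s 23) (Pf (s 20) (W.el e j0))"
    if i: "\<And>j. j div 2 ^ e = s 22 \<Longrightarrow> j < i \<Longrightarrow> Pf (s 20) (W.el e j) < s 23"
      and i2: "\<And>j. j div 2 ^ e = s 22 \<Longrightarrow> i \<le> j \<Longrightarrow> s 23 \<le> Pf (s 20) (W.el e j)"
      and j0: "i \<le> j0" "j0 div 2 ^ e = s 22" "W.hit e (s 24) j0" "j0 < 2 ^ H"
      and nh: "\<And>j. i \<le> j \<Longrightarrow> j < j0 \<Longrightarrow> \<not> W.hit e (s 24) j" for i j0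
  proof -
    define y where "y = W.el e j0"
    have y: "y < 2 ^ H" "D y" using j0 W.el_less[OF eH j0(4)] W.el_div[OF eH j0(4)]
      by (auto simp: y_def D_def W.hit_def)
    have py: "s 23 \<le> Pf (s 20) y" using i2[OF j0(2,1)] by (simp add: y_def)
    have "Pf (s 20) y \<le> Pf (s 20) y'" if y': "y' < 2 ^ H" "D y'" "s 23 \<le> Pf (s 20) y'" for y'
    proof -
      define j where "j = W.pos e y'"
      have jd: "j div 2 ^ e = s 22" using W.pos_div[of e y'] y' by (simp add: j_def D_def)
      have ey: "W.el e j = y'" using W.el_pos[OF y'(1)] by (simp add: j_def)
      have jN: "j < 2 ^ H" using W.pos_less[OF y'(1) eH] by (simp add: j_def)
      have "W.hit e (s 24) j" using y' by (simp add: W.hit_def ey D_def)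
      moreover have "i \<le> j" using i[OF jd] ey y'(3) by (meson not_le)
      ultimately have "j0 \<le> j" using nh[of j] by (meson not_le)
      then consider "j0 = j" | "j0 < j" by linarith
      then show ?thesis
      proof cases
        case 2
        then have "Pf (s 20) (W.el e j0) < Pf (s 20) (W.el e j)"
          using jN jd j0(2) by (intro W.P_el_mono eH) auto
        then show ?thesis by (simp add: y_def ey)
      qed (simp add: y_def ey)
    qed
    then show ?thesis unfolding first_in_def using y py by (auto simp: y_def)
  qed
  have SG: "S \<le> a * G" by (simp add: S_def shf_def)
  have kk: "TP + ((TD + 1) * blen (2 ^ (a * G)) + ((TD + 1) * (2 ^ a * (G + 1)) + (2 * TP + ((TD + 1) * (2 ^ a * G) + TD)))) \<le> k"
    using k by (simp add: algebra_simps)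
  show ?thesis
    unfolding FIND_def
  proof (rule tr_AsgSeqV[where v = id0], rule id0, rule id0, rule tr_AsgSeqV[where v = "s 23"], simp, simp,
      rule tr_Seq[where ?n1.0 = TP and ?n2.0 = "(TD + 1) * blen (2 ^ (a * G)) + ((TD + 1) * (2 ^ a * (G + 1)) + (2 * TP + ((TD + 1) * (2 ^ a * G) + TD)))"],
      rule PRED_tr[where k = TP], goal_cases)
    case 1
    then show ?case using id0(3) by simp
  next
    case 2
    have "(0::nat) < 2 ^ H" by simp
    then have "s 23 < 2 * 2 ^ H" using p by linarith
    then show ?case by simp
  next
    case (3 u)
    have uf: "u r = s r" if "r < 40" for r using 3(1) that by simp
    have u40: "u 40 = W.f1 e S (s 22) (s 23)" using 3(2) by (simp add: Fam0)
    have u21: "u 21 \<le> hm" using uf h by simp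
    note su = she_ok[of u, OF u21]
    show ?case
    proof (rule tr_AsgSeqV[where v = t0], goal_cases)
      case 1
      then show ?case using su(3,4) ov by (simp add: uf u40 e_def[symmetric] S_def[symmetric] t0_def[symmetric])
    next
      case 2
      then show ?case using su(3,4) by (simp add: uf u40 e_def[symmetric] S_def[symmetric] t0_def[symmetric])
    next
      case 3
      show ?case
      proof (rule tr_AsgSeqV[where v = "t0 * 2 ^ S"], goal_cases)
        case 1
        then show ?case using she_ok(1,2)[of "u(25 := t0)"] uf h ov by (simp add: S_def)
      next
        case 2
        then show ?case using she_ok(1,2)[of "u(25 := t0)"] uf h by (simp add: S_def)
      next
        case 3
        show ?case
        proof (rule tr_AsgSeqV[where v = "(t0 + 1) * 2 ^ S"], goal_cases)
          case 1
          then show ?case using she_ok(1,2)[of "u(25 := t0, 26 := t0 * 2 ^ S)"] uf h ov by (simp add: S_def)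
        next
          case 2
          then show ?case using she_ok(1,2)[of "u(25 := t0, 26 := t0 * 2 ^ S)"] uf h by (simp add: S_def)
        next
          case 3
          show ?case
          proof (rule tr_Seq[OF _ order_refl], rule BIN_tr[where v = "s 22"], goal_cases)
            case (5 j)
            then show ?case using inblk[of j] uf by (simp add: e_def)
          next
            case (6 x)
            have xf: "x r = s r" if "r < 25" for r using 6(1) uf that by simp
            have x25: "x 25 = t0" using 6(1) by simp
            define i where "i = x 26"
            have i1: "t0 * 2 ^ S \<le> i" "i \<le> (t0 + 1) * 2 ^ S" using 6(2,3) by (simp_all add: i_def)
            have ia: "Pf (s 20) (W.el e j) < s 23" if "t0 * 2 ^ S \<le> j" "j < i" for j
              using 6(4)[of j] that uf by (simp add: i_def e_def)
            have ib: "s 23 \<le> Pf (s 20) (W.el e j)" if "i \<le> j" "j < (t0 + 1) * 2 ^ S" for j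
              using 6(5)[of j] that uf by (simp add: i_def e_def)
            have iA: "Pf (s 20) (W.el e j) < s 23" if "j div 2 ^ e = s 22" "j < i" for j
              using ia[of j] fb(2)[of j] that by (cases "t0 * 2 ^ S \<le> j") (auto simp: not_le)
            have iB: "s 23 \<le> Pf (s 20) (W.el e j)" if "j div 2 ^ e = s 22" "i \<le> j" for j
              using ib[of j] fb(3)[of j] that by (cases "j < (t0 + 1) * 2 ^ S") (auto simp: not_less)
            \<comment> \<open>The common end of both branches: either there is no hit from
              \<open>i\<close> on, or \<open>z 26\<close> starts an aligned group with a hit and no
              earlier one is missed.\<close>
            have fin: "TR (If (V 29) (C 1) (Asg 20 (sc 0))
                (DOWN ;; Asg 70 (V 20) ;; Asg 71 (V 21) ;; Asg 72 (V 26) ;; DEC ;; Asg 20 (Rd (pl (C 6) (V 20)) (V 70))))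
                z ((TD + 1) * (2 ^ a * G) + TD) T"
              if zf: "\<forall>r<25. z r = s r"
                and z: "(z 29 = 0 \<and> (\<forall>j. i \<le> j \<and> j div 2 ^ e = s 22 \<longrightarrow> \<not> W.hit e (s 24) j)) \<or>
                  (z 29 = 1 \<and> (\<exists>g\<le>min (s 21) G. z 28 = a * g \<and> 2 ^ (a * g) dvd z 26 \<and> i \<le> z 26 \<and> z 26 div 2 ^ e = s 22 \<and>
                     (\<forall>j. i \<le> j \<and> j < z 26 \<longrightarrow> \<not> W.hit e (s 24) j) \<and>
                     GH (z 26) g))" for z
              using z
            proof
              assume z0: "z 29 = 0 \<and> (\<forall>j. i \<le> j \<and> j div 2 ^ e = s 22 \<longrightarrow> \<not> W.hit e (s 24) j)"
              have "first_in (s 20) D (s 23) (2 ^ H)" by (rule none[OF iA]) (use z0 in auto)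
              then have "T (z(20 := 2 ^ H))"
                by (intro post) (use zf in \<open>auto simp: Deq\<close>)
              then show ?thesis using z0 N_lt by (intro tr_If tr_Asg) auto
            next
              assume z1: "z 29 = 1 \<and> (\<exists>g\<le>min (s 21) G. z 28 = a * g \<and> 2 ^ (a * g) dvd z 26 \<and> i \<le> z 26 \<and> z 26 div 2 ^ e = s 22 \<and>
                     (\<forall>j. i \<le> j \<and> j < z 26 \<longrightarrow> \<not> W.hit e (s 24) j) \<and>
                     GH (z 26) g)"
              then obtain g where g: "g \<le> min (s 21) G" "z 28 = a * g" "2 ^ (a * g) dvd z 26" "i \<le> z 26" "z 26 div 2 ^ e = s 22"
                 "\<And>j. i \<le> j \<Longrightarrow> j < z 26 \<Longrightarrow> \<not> W.hit e (s 24) j"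
                 "\<exists>j. j div 2 ^ (a * g) = z 26 div 2 ^ (a * g) \<and> W.hit e (s 24) j" unfolding GH_def by blast
              have inN: "j < 2 ^ H" if "j div 2 ^ e = s 22" for j
              proof -
                have "j div 2 ^ e < 2 ^ (H - e)" using that v' by simp
                then show ?thesis unfolding div_pow_upper using eH by (simp flip: power_add)
              qed
              have gS: "a * g \<le> e" using g(1) unfolding e_def by (intro mult_le_mono2) simp
              show ?thesis
              proof (rule tr_If, goal_cases)
                case 4
                show ?case
                proof (rule tr_Seq[where ?n1.0 = "(TD + 1) * (2 ^ a * G)" and ?n2.0 = TD], rule DOWN_tr[where ?g1.0 = g], goal_cases)
                  case (8 q)
                  have qf: "q r = s r" if "r < 25" for r using 8(1) zf that by simp
                  define j0 where "j0 = q 26"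
                  have j0d: "j0 div 2 ^ e = s 22"
                    using 8(3) g(5) div_pow_split[OF gS, of j0] div_pow_split[OF gS, of "z 26"] by (simp add: j0_def)
                  have j0N: "j0 < 2 ^ H" by (rule inN[OF j0d])
                  have hit0: "W.hit e (s 24) j0" using 8(4) zf by (simp add: j0_def e_def)
                  have nh0: "\<not> W.hit e (s 24) j" if "i \<le> j" "j < j0" for j
                    using g(6)[of j] 8(5)[of j] that zf by (cases "j < z 26") (auto simp: j0_def e_def not_less)
                  have ij0: "i \<le> j0" using g(4) 8(2) by (simp add: j0_def)
                  note res = some[OF iA iB ij0 j0d hit0 j0N nh0]
                  have yl: "W.el e j0 < 2 ^ H" using W.el_less[OF eH j0N] .
                  show ?case
                  proof (rule tr_AsgSeqV[where v = "s 20"], simp, simp add: qf, rule tr_AsgSeqV[where v = "s 21"], simp, simp add: qf,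
                      rule tr_AsgSeqV[where v = j0], simp, simp add: j0_def, rule tr_Seq[where ?n1.0 = TD and ?n2.0 = 0],
                      rule DEC_tr[where k = TD], goal_cases)
                    case (4 o1)
                    have of: "o1 r = s r" if "r < 25" for r using 4(1) qf that by simp
                    have o70: "o1 70 = W.el e j0" using 4(2) by (simp add: e_def)
                    have "(8::nat) < 2 ^ w" by (rule num_lt) simp
                    then have s6: "6 + s 20 < 2 ^ w" using b by linarith
                    have Pl: "Pf (s 20) (W.el e j0) \<le> 2 ^ H" using W.P_less[OF yl] by simp
                    show ?case
                    proof (rule tr_AsgV[where v = "Pf (s 20) (W.el e j0)"], goal_cases)
                      case 1
                      then show ?case using A67(1)[OF b] len16 b yl s6 by (simp add: of o70)
                    next
                      case 2
                      then show ?case using A67(2)[OF b yl] by (simp add: of o70)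
                    next
                      case 3
                      then show ?case using res Pl of by (intro post) (auto simp: Deq)
                    qed
                  qed (use b h j0N in auto)
                qed (use zf b h g inN[OF g(5)] in \<open>auto simp: e_def\<close>)
              qed (use z1 in auto)
            qed
            show ?case
            proof (rule tr_Seq[OF _ order_refl], rule UP_tr, goal_cases)
              case (6 y)
              have yf: "\<forall>r<25. y r = s r" "y 25 = t0" using 6(1) xf x25 by auto
              have y3: "\<not> W.hit e (s 24) j" if "i \<le> j" "j < (t0 + 1) * 2 ^ S" for j
                using 6(3)[of j] that xf x25 by (simp add: i_def S_def e_def)
              show ?case
              proof (rule tr_Seq[where ?n1.0 = "2 * TP" and ?n2.0 = "(TD + 1) * (2 ^ a * G) + TD"], rule tr_If, goal_cases)
                case 3
                show ?case
                proof (rule NEXT_tr[where k = "2 * TP"], goal_cases)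
                  case (5 z)
                  have "\<not> W.hit e (s 24) j" if "i \<le> j" "j div 2 ^ e = s 22" for j
                    using y3[of j] 5(3)[of j] that yf fb(1)
                    by (cases "j < (t0 + 1) * 2 ^ S") (auto simp: e_def S_def not_less)
                  then show ?case using 5(1,2) yf by (intro fin) auto
                next
                  case (6 z t')
                  have zd: "z 26 div 2 ^ e = s 22"
                    using 6(4,7) yf fb(1) by (intro blk) (simp add: e_def S_def)
                  have nh: "\<not> W.hit e (s 24) j" if "i \<le> j" "j < z 26" for j
                    using y3[of j] 6(8)[of j] 6(4) that yf
                    by (cases "j < (t0 + 1) * 2 ^ S") (auto simp: e_def S_def not_less)
                  have iz: "i \<le> z 26"
                  proof -
                    have "t0 + 1 \<le> t'" using 6(5) yf by simp
                    then have "(t0 + 1) * 2 ^ S \<le> t' * 2 ^ S" by (rule mult_le_mono1)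
                    then show ?thesis using i1(2) 6(4) yf by (simp add: S_def)
                  qed
                  have ex: "\<exists>j. j div 2 ^ S = t' \<and> W.hit e (s 24) j" using 6(9) yf by (simp add: e_def S_def)
                  have zS: "z 28 = S" "z 26 = t' * 2 ^ S" using 6(3,4) yf by (simp_all add: S_def)
                  have SS: "S = a * min (s 21) G" by (simp add: S_def shf_def)
                  have gh: "GH (z 26) (min (s 21) G)" using ex zS(2) unfolding GH_def SS[symmetric] by simp
                  show ?case
                  proof (rule fin)
                    show "\<forall>r<25. z r = s r" using 6(1) yf by simp
                    show "(z 29 = 0 \<and> (\<forall>j. i \<le> j \<and> j div 2 ^ e = s 22 \<longrightarrow> \<not> W.hit e (s 24) j)) \<or>
                      (z 29 = 1 \<and> (\<exists>g\<le>min (s 21) G. z 28 = a * g \<and> 2 ^ (a * g) dvd z 26 \<and> i \<le> z 26 \<and> z 26 div 2 ^ e = s 22 \<and>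
                     (\<forall>j. i \<le> j \<and> j < z 26 \<longrightarrow> \<not> W.hit e (s 24) j) \<and>
                     GH (z 26) g))"
                      by (intro disjI2 conjI exI[of _ "min (s 21) G"])
                        (use 6(2) zd nh iz gh zS in \<open>auto simp flip: SS\<close>)
                  qed
                qed (use yf b h c t1 in \<open>auto simp: S_def\<close>)
              next
                case 4
                then show ?case using 6(2) by simp
              qed simp_all
            next
              case (7 y g)
              have yf: "\<forall>r<25. y r = s r" using 7(1) xf by auto
              have y1: "i \<le> y 26" "y 26 < (t0 + 1) * 2 ^ S" using 7(6,7) xf x25 by (simp_all add: i_def S_def)
              have yd: "y 26 div 2 ^ e = s 22" using y1 i1 by (intro inblk) auto
              show ?case
              proof (rule tr_Seq[where ?n1.0 = "2 * TP" and ?n2.0 = "(TD + 1) * (2 ^ a * G) + TD"], rule tr_If, goal_cases)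
                case 3
                then show ?case using 7(2) by simp
              next
                case 4
                show ?case
                proof (rule tr_AsgV[where v = 1], simp, use 7(2) in simp, rule fin)
                  show "\<forall>r<25. (y(29 := 1)) r = s r" using yf by simp
                  show "((y(29 := 1)) 29 = 0 \<and> (\<forall>j. i \<le> j \<and> j div 2 ^ e = s 22 \<longrightarrow> \<not> W.hit e (s 24) j)) \<or>
                      ((y(29 := 1)) 29 = 1 \<and> (\<exists>g\<le>min (s 21) G. (y(29 := 1)) 28 = a * g \<and> 2 ^ (a * g) dvd (y(29 := 1)) 26 \<and>
                      i \<le> (y(29 := 1)) 26 \<and> (y(29 := 1)) 26 div 2 ^ e = s 22 \<and>
                     (\<forall>j. i \<le> j \<and> j < (y(29 := 1)) 26 \<longrightarrow> \<not> W.hit e (s 24) j) \<and>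
                     GH ((y(29 := 1)) 26) g))"
                    by (intro disjI2 conjI exI[of _ g])
                      (use 7 xf y1 yd in \<open>auto simp: e_def i_def GH_def\<close>)
                qed
              qed simp_all
            qed (use xf x25 b h t1 i1 in \<open>auto simp: S_def i_def\<close>)
          next
            case 7
            have "(t0 + 1) * 2 ^ S - t0 * 2 ^ S = 2 ^ S" by (simp add: add_mult_distrib)
            moreover have "blen (2 ^ S) \<le> blen (2 ^ (a * G))" using SG by (intro blen_mono power_increasing) auto
            ultimately show ?case by (simp del: mult_Suc)
          qed (use uf b h t1 in \<open>auto simp: S_def\<close>)
        qed
      qed
    qed
  qed (use kk in auto)
qed

end

section \<open>Range successor\<close>

text \<open>The xor of the end points yields through array 5 the height of the children of their
  lowest common ancestor. All children but the last are searched with the lower bound on y, which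
  has an effect only in the first; the last is searched in the reflected structure, where the upper
  bound becomes a lower one.\<close>

definition SUCC :: com where
  "SUCC = Asg 8 (sc 0) ;; Asg 10 (Rd (C 5) (B Xor (V 6) (mi (V 7) (C 1)))) ;;
   Asg 9 (ti (sc 2) (V 10)) ;; Asg 11 (shr (V 6) (V 9)) ;; Asg 12 (pl (shr (mi (V 7) (C 1)) (V 9)) (C 1)) ;;
   While (V 11) (V 12) (
      Asg 21 (V 10) ;; Asg 23 (V 4) ;;
      If (pl (V 11) (C 1)) (V 12) (Asg 20 (C 0) ;; Asg 22 (V 11) ;; Asg 24 (V 6))
          (Asg 20 (C 1) ;; Asg 22 (mi (mi (shr (sc 0) (V 9)) (C 1)) (V 11)) ;; Asg 24 (mi (sc 0) (V 7))) ;;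
      FIND ;; If (V 20) (V 8) (Asg 8 (V 20)) (Asg 8 (V 8)) ;; Asg 11 (pl (V 11) (C 1)))"

lemma xor_nat_eq_0: "Bit_Operations.xor (x::nat) y = 0 \<longleftrightarrow> x = y"
proof
  assume "Bit_Operations.xor x y = 0"
  then have "\<not> bit (Bit_Operations.xor x y) k" for k by simp
  then show "x = y" by (intro bit_eqI) (auto simp: bit_xor_iff)
qed simp

lemma xor_nat_div: "Bit_Operations.xor (x::nat) y div 2 ^ k = 0 \<longleftrightarrow> x div 2 ^ k = y div 2 ^ k"
  by (simp flip: drop_bit_eq_div add: xor_nat_eq_0)

lemma xor_nat_less: "x < 2 ^ k \<Longrightarrow> y < 2 ^ k \<Longrightarrow> Bit_Operations.xor (x::nat) y < 2 ^ k"
  using xor_nat_div[of x y k] by (simp add: div_eq_0_iff)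

text \<open>Reflection reverses the order of the nodes of each height: with
  \<open>y = q * 2 ^ e + r\<close> the remainder turns into \<open>2 ^ e - 1 - r\<close>, without a
  carry.\<close>

lemma mirror_div:
  fixes y :: nat
  assumes "y < 2 ^ H" "e \<le> H"
  shows "(2 ^ H - 1 - y) div 2 ^ e = 2 ^ (H - e) - 1 - y div 2 ^ e"
proof -
  define q r where "q = y div 2 ^ e" and "r = y mod 2 ^ e"
  have y: "y = q * 2 ^ e + r" unfolding q_def r_def by (rule div_mult_mod_eq[symmetric])
  have r: "r < 2 ^ e" by (simp add: r_def)
  have p: "(2::nat) ^ H = 2 ^ (H - e) * 2 ^ e" using assms(2) by (simp flip: power_add)
  have q: "q < 2 ^ (H - e)" unfolding q_def div_pow_upper using assms(1) p by simp
  then obtain m where m: "2 ^ (H - e) = q + 1 + m" by (metis Suc_eq_plus1 Suc_leI le_Suc_ex)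
  define r' where "r' = 2 ^ e - 1 - r"
  have r': "r' < 2 ^ e" unfolding r'_def by (rule le_less_trans[of _ "2 ^ e - 1"]) auto
  have "2 ^ H - 1 - y = m * 2 ^ e + r'"
    unfolding p m y r'_def using r by (simp add: algebra_simps)
  then have "(2 ^ H - 1 - y) div 2 ^ e = m" using mult_plus_parts[OF r', of m] by simp
  then show ?thesis using m by (simp add: q_def)
qed

lemma mirror_eq: "(x::nat) < m \<Longrightarrow> v < m \<Longrightarrow> m - 1 - x = m - 1 - v \<longleftrightarrow> x = v"
  by arith

lemma mirror_le: "(y::nat) < m \<Longrightarrow> s = q + 1 \<Longrightarrow> s \<le> m \<Longrightarrow> m - s \<le> m - 1 - y \<longleftrightarrow> y \<le> q"
  by arith

locale range_ds = level_ds w H a n L Q R G Pf am tab AA lam J hm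
  for w H a n L Q R G Pf am tab AA lam J hm +
  assumes A5: "length (AA ! 5) = 2 ^ H"
    "\<And>x. x < 2 ^ H \<Longrightarrow> AA ! 5 ! x \<le> hm \<and> x div 2 ^ (a * (AA ! 5 ! x + 1)) = 0 \<and>
        (AA ! 5 ! x = 0 \<or> x div 2 ^ (a * AA ! 5 ! x) \<noteq> 0)"
    and mir: "\<And>y. y < 2 ^ H \<Longrightarrow> Pf 1 y = Pf 0 (2 ^ H - 1 - y)"
begin

lemma Pf0_less: "y < 2 ^ H \<Longrightarrow> Pf 0 y < 2 ^ H"
  using wave.P_less[OF waveP[of 0]] by simp

text \<open>The code \<open>2 ^ H\<close> for absence exceeds every rank, so forming the union of
  two sets amounts to taking a minimum.\<close>

lemma first_in_union:
  assumes "first_in 0 D1 p r1" "first_in 0 D2 p r2" "\<And>y. y < 2 ^ H \<Longrightarrow> D y \<longleftrightarrow> D1 y \<or> D2 y"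
  shows "first_in 0 D p (if r2 < r1 then r2 else r1)"
proof -
  have le: "r \<le> 2 ^ H" if "first_in 0 E p r" for E r
    using that Pf0_less by (auto simp: first_in_def less_imp_le)
  have pick: "first_in 0 D p r" if r: "first_in 0 E p r" and E: "\<And>y. y < 2 ^ H \<Longrightarrow> E y \<Longrightarrow> D y"
    and E': "first_in 0 E' p r'" "r \<le> r'" "\<And>y. y < 2 ^ H \<Longrightarrow> D y \<Longrightarrow> E y \<or> E' y" for E E' r r'
    using r unfolding first_in_def[of _ E]
  proof (elim disjE conjE exE)
    assume h: "r = 2 ^ H" "\<forall>y<2 ^ H. E y \<longrightarrow> Pf 0 y < p"
    then have "r' = 2 ^ H" using le[OF E'(1)] E'(2) by simp
    moreover have "Pf 0 y \<noteq> 2 ^ H" if "y < 2 ^ H" for y using Pf0_less[OF that] by simp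
    ultimately have "\<forall>y<2 ^ H. E' y \<longrightarrow> Pf 0 y < p" using E'(1) unfolding first_in_def by metis
    then have "\<forall>y<2 ^ H. D y \<longrightarrow> Pf 0 y < p" using h E'(3) by blast
    then show ?thesis using h(1) by (simp add: first_in_def)
  next
    fix y assume y: "y < 2 ^ H" "E y" "p \<le> Pf 0 y" "r = Pf 0 y"
      and m: "\<forall>y'<2 ^ H. E y' \<longrightarrow> p \<le> Pf 0 y' \<longrightarrow> r \<le> Pf 0 y'"
    have "r \<le> Pf 0 y'" if z: "y' < 2 ^ H" "D y'" "p \<le> Pf 0 y'" for y'
    proof (cases "E y'")
      case False
      then have "E' y'" using E'(3) z by blast
      then have "r' \<le> Pf 0 y'" using E'(1) z unfolding first_in_def by (metis not_le)
      then show ?thesis using E'(2) by simp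
    qed (use m z in blast)
    then show ?thesis using y E unfolding first_in_def by blast
  qed
  show ?thesis
  proof (cases "r2 < r1")
    case True
    then show ?thesis using pick[OF assms(2) _ assms(1)] assms(3) by auto
  next
    case False
    then show ?thesis using pick[OF assms(1) _ assms(2)] assms(3) by auto
  qed
qed

lemma first_in_mirror:
  assumes "first_in 1 D p r" shows "first_in 0 (\<lambda>y. D (2 ^ H - 1 - y)) p r"
proof -
  have m: "2 ^ H - 1 - y < 2 ^ H" for y :: nat
    by (rule le_less_trans[of _ "2 ^ H - 1"]) auto
  have mm: "2 ^ H - 1 - (2 ^ H - 1 - y) = y" if "y < 2 ^ H" for y :: nat using that by auto
  have all: "(\<forall>y<2 ^ H. X (2 ^ H - 1 - y) y) \<longleftrightarrow> (\<forall>y<2 ^ H. X y (2 ^ H - 1 - y))" for X :: "nat \<Rightarrow> nat \<Rightarrow> bool"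
    using m mm by metis
  have P1: "Pf 1 (2 ^ H - 1 - y) = Pf 0 y" if "y < 2 ^ H" for y using mir[OF m, of y] mm[OF that] by simp
  show ?thesis
    using assms unfolding first_in_def[of 1]
  proof (elim disjE conjE exE)
    assume "r = 2 ^ H" "\<forall>y<2 ^ H. D y \<longrightarrow> Pf 1 y < p"
    then show ?thesis using P1 m unfolding first_in_def by metis
  next
    fix y assume y: "y < 2 ^ H" "D y" "p \<le> Pf 1 y" "r = Pf 1 y"
      and mn: "\<forall>y'<2 ^ H. D y' \<longrightarrow> p \<le> Pf 1 y' \<longrightarrow> r \<le> Pf 1 y'"
    let ?z = "2 ^ H - 1 - y"
    have "?z < 2 ^ H" "D (2 ^ H - 1 - ?z)" "p \<le> Pf 0 ?z" "r = Pf 0 ?z" using y m mm mir by auto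
    moreover have "\<forall>y'<2 ^ H. D (2 ^ H - 1 - y') \<longrightarrow> p \<le> Pf 0 y' \<longrightarrow> r \<le> Pf 0 y'"
      using mn P1 m by metis
    ultimately show ?thesis unfolding first_in_def by blast
  qed
qed

lemma first_in_cong:
  assumes "first_in b D p r" "\<And>y. y < 2 ^ H \<Longrightarrow> D y \<longleftrightarrow> D' y" shows "first_in b D' p r"
  using assms unfolding first_in_def by metis

lemma SUCC_tr:
  assumes p: "s 4 \<le> 2 ^ H" and q: "s 6 < s 7" "s 7 \<le> 2 ^ H"
    and post: "\<And>s'. \<forall>r<8. s' r = s r \<Longrightarrow> first_in 0 (\<lambda>y. s 6 \<le> y \<and> y < s 7) (s 4) (s' 8) \<Longrightarrow> s' 8 \<le> 2 ^ H \<Longrightarrow> T s'"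
    and k: "2 ^ a * (TF + 1) \<le> k"
  shows "TR SUCC s k T"
proof -
  define q1 q2 z where "q1 = s 6" and "q2 = s 7 - 1" and "z = Bit_Operations.xor q1 q2"
  have qq: "q1 \<le> q2" "q2 < 2 ^ H" "q1 < 2 ^ H" "s 7 = q2 + 1" using q by (auto simp: q1_def q2_def)
  have zl: "z < 2 ^ H" unfolding z_def by (rule xor_nat_less[OF qq(3,2)])
  define h where "h = AA ! 5 ! z"
  have h: "h \<le> hm" "z div 2 ^ (a * (h + 1)) = 0" "h = 0 \<or> z div 2 ^ (a * h) \<noteq> 0" using A5(2)[OF zl] by (auto simp: h_def)
  define e where "e = a * h"
  have eH: "e < H" using ah[OF h(1)] by (simp add: e_def)
  define v1 v2 where "v1 = q1 div 2 ^ e" and "v2 = q2 div 2 ^ e"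
  have top: "v1 div 2 ^ a = v2 div 2 ^ a"
  proof -
    have "q1 div 2 ^ (e + a) = q2 div 2 ^ (e + a)" using h(2) by (simp add: z_def xor_nat_div e_def add.commute)
    then show ?thesis using div_pow_split[of e "e + a" q1] div_pow_split[of e "e + a" q2] by (simp add: v1_def v2_def)
  qed
  have v12: "v1 \<le> v2" unfolding v1_def v2_def by (rule div_le_mono[OF qq(1)])
  \<comment> \<open>At positive height the two end points fall into different children; this makes
    the lower bound on y automatic in the last child.\<close>
  have lca: "e = 0 \<or> v1 < v2" using h(3) v12 by (auto simp: z_def xor_nat_div e_def v1_def v2_def)
  have pe: "(2::nat) ^ H = 2 ^ (H - e) * 2 ^ e" using eH by (simp flip: power_add)
  have v2l: "v2 < 2 ^ (H - e)" unfolding v2_def div_pow_upper using qq(2) pe by simp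
  have HeH: "(2::nat) ^ (H - e) \<le> 2 ^ H" by (intro power_increasing) auto
  \<comment> \<open>The children visited have a common parent, so there are at most
    \<open>2 ^ a\<close> of them.\<close>
  have few: "v2 + 1 - v1 \<le> 2 ^ a"
  proof -
    have "v2 div 2 ^ a * 2 ^ a + v1 mod 2 ^ a = v1" "v2 div 2 ^ a * 2 ^ a + v2 mod 2 ^ a = v2"
      using div_mult_mod_eq[of v1 "2 ^ a"] div_mult_mod_eq[of v2 "2 ^ a"] unfolding top by simp_all
    moreover have "v2 mod 2 ^ a < 2 ^ a" by simp
    ultimately show ?thesis by linarith
  qed
  define Inv where "Inv u \<longleftrightarrow> (\<forall>r<8. u r = s r) \<and> u 9 = e \<and> u 10 = h \<and> u 12 = v2 + 1 \<and> v1 \<le> u 11 \<and> u 11 \<le> v2 + 1 \<and> u 8 \<le> 2 ^ H \<and>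
    first_in 0 (\<lambda>y. q1 \<le> y \<and> y \<le> q2 \<and> y div 2 ^ e < u 11) (s 4) (u 8)" for u :: "nat \<Rightarrow> nat"
  have ew: "e < 2 ^ w" using eH less_exp[of H] N_lt by linarith
  have v2w: "v2 + 1 < 2 ^ w" using v2l HeH N_lt by linarith
  have q2w: "s 7 < 2 ^ w" using q N_lt by linarith
  have s7: "0 < s 7" using q by simp
  show ?thesis
    unfolding SUCC_def
  proof (rule tr_AsgSeqV[where v = "2 ^ H"], simp, simp, rule tr_AsgSeqV[where v = h], goal_cases)
    case 1
    then show ?case using zl s7 q2w A5(1) by (simp add: z_def q1_def q2_def)
  next
    case 2
    then show ?case by (simp add: h_def z_def q1_def q2_def)
  next
    case 3
    show ?case
    proof (rule tr_AsgSeqV[where v = e], use ew in \<open>simp add: e_def\<close>, simp add: e_def, rule tr_AsgSeqV[where v = v1], simp, simp add: v1_def q1_def,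
        rule tr_AsgSeqV[where v = "v2 + 1"], goal_cases)
      case 1
      then show ?case using s7 q2w v2w by (simp add: v2_def q2_def)
    next
      case 2
      then show ?case by (simp add: v2_def q2_def)
    next
      case 3
      show ?case
      proof (rule tr_While[where I = Inv and k = TF and \<mu> = "\<lambda>u. v2 + 1 - u 11"], goal_cases)
        case 1
        have "y div 2 ^ e \<ge> v1" if "q1 \<le> y" for y unfolding v1_def by (rule div_le_mono[OF that])
        then have "first_in 0 (\<lambda>y. q1 \<le> y \<and> y \<le> q2 \<and> y div 2 ^ e < v1) (s 4) (2 ^ H)"
          unfolding first_in_def by (auto simp: not_less[symmetric])
        then show ?case using v12 by (simp add: Inv_def)
      next
        case (2 u)
        then show ?case by simp
      next
        case (3 u)
        have uf: "u r = s r" if "r < 8" for r using 3(1) that by (simp add: Inv_def)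
        define v where "v = u 11"
        have u: "u 9 = e" "u 10 = h" "u 12 = v2 + 1" "u 11 = v" "v1 \<le> v" "v \<le> v2" "u 8 \<le> 2 ^ H"
          "first_in 0 (\<lambda>y. q1 \<le> y \<and> y \<le> q2 \<and> y div 2 ^ e < v) (s 4) (u 8)"
          using 3 by (auto simp: Inv_def v_def)
        have vw: "Suc v < 2 ^ w" using u(6) v2w by linarith
        have vl: "v < 2 ^ (H - e)" using u(6) v2l by linarith
        have rest: "TR (FIND ;; If (V 20) (V 8) (Asg 8 (V 20)) (Asg 8 (V 8)) ;; Asg 11 (pl (V 11) (C 1))) x TF
            (\<lambda>s'. Inv s' \<and> v2 + 1 - s' 11 < v2 + 1 - u 11)"
          if xf: "\<forall>r<20. x r = u r" and x21: "x 21 = h" "x 23 = s 4"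
            and x20: "x 20 < 2" "x 22 < 2 ^ (H - e)" "x 24 < 2 ^ H"
            and D: "\<And>r. first_in (x 20) (\<lambda>y. y div 2 ^ e = x 22 \<and> x 24 \<le> y) (s 4) r \<Longrightarrow>
                first_in 0 (\<lambda>y. q1 \<le> y \<and> y \<le> q2 \<and> y div 2 ^ e = v) (s 4) r" for x
        proof (rule tr_Seq[where ?n1.0 = TF and ?n2.0 = 0], rule FIND_tr, goal_cases)
          case (6 y)
          have yf: "y r = u r" if "r < 20" for r using 6(1) xf that by simp
          have f2: "first_in 0 (\<lambda>y. q1 \<le> y \<and> y \<le> q2 \<and> y div 2 ^ e = v) (s 4) (y 20)"
            using 6(2) x21 by (intro D) (simp add: e_def)
          have f3: "first_in 0 (\<lambda>y. q1 \<le> y \<and> y \<le> q2 \<and> y div 2 ^ e < Suc v) (s 4) (if y 20 < u 8 then y 20 else u 8)"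
            by (rule first_in_union[OF u(8) f2]) auto
          have inv: "Inv (y(8 := if y 20 < u 8 then y 20 else u 8, 11 := Suc v))"
            using f3 6(3) u yf uf unfolding Inv_def by simp
          have sm: "v2 + 1 - Suc v < v2 + 1 - v" using u(6) by simp
          show ?case
          proof (rule tr_Seq[where ?n1.0 = 0 and ?n2.0 = 0], rule tr_If, goal_cases)
            case 3
            then have "y 20 < u 8" using yf by simp
            then show ?case using inv sm vw yf u(4) by (intro tr_Asg) auto
          next
            case 4
            then have "\<not> y 20 < u 8" using yf by simp
            then show ?case using inv sm vw yf u(4) by (intro tr_Asg) auto
          qed auto
        qed (use x21 x20 h(1) p in \<open>auto simp: e_def\<close>)
        show ?case
        proof (rule tr_AsgSeqV[where v = h], simp, simp add: u, rule tr_AsgSeqV[where v = "s 4"], simp, simp add: uf,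
            rule tr_Seq[where ?n1.0 = 0 and ?n2.0 = TF], rule tr_If, goal_cases)
          case 1
          then show ?case using vw by (simp add: u)
        next
          case 2
          then show ?case by simp
        next
          case 3
          then have vv: "v < v2" by (simp add: u)
          show ?case
          proof (rule tr_AsgSeqV[where v = 0], simp, simp, rule tr_AsgSeqV[where v = v], simp, simp add: u,
              rule tr_AsgV[where v = q1], simp, simp add: uf q1_def, rule rest, goal_cases)
            case (7 r)
            \<comment> \<open>In a child left of the last one the upper bound on y holds
              automatically.\<close>
            have "y < q2" if "y div 2 ^ e = v" for y
            proof (rule ccontr)
              assume "\<not> y < q2"
              then have "q2 div 2 ^ e \<le> y div 2 ^ e" by (intro div_le_mono) simp
              then show False using that vv by (simp add: v2_def)
            qed
            then have "(y div 2 ^ e = v \<and> q1 \<le> y) = (q1 \<le> y \<and> y \<le> q2 \<and> y div 2 ^ e = v)" for y by force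
            then show ?case using 7 by simp
          qed (use vl qq in auto)
        next
          case 4
          then have vv: "v = v2" using u by simp
          have sb: "2 ^ (H - e) - 1 - v < 2 ^ (H - e)" by (rule le_less_trans[of _ "2 ^ (H - e) - 1"]) auto
          have NE: "2 ^ H div 2 ^ e = (2::nat) ^ (H - e)" using eH by (simp add: power_diff)
          show ?case
          proof (rule tr_AsgSeqV[where v = 1], simp, simp, rule tr_AsgSeqV[where v = "2 ^ (H - e) - 1 - v"], goal_cases)
            case 1
            have "v \<le> 2 ^ (H - e) - Suc 0" "2 ^ (H - e) - Suc 0 < (2::nat) ^ w" "(2::nat) ^ (H - e) < 2 ^ w"
              using vl HeH N_lt by linarith+
            then show ?case using 1 by (simp add: u NE)
          next
            case 2
            then show ?case by (simp add: u NE)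
          next
            case 3
            show ?case
            proof (rule tr_AsgV[where v = "2 ^ H - s 7"], goal_cases)
              case 1
              then show ?case using q N_lt by (simp add: uf)
            next
              case 2
              then show ?case by (simp add: uf)
            next
              case 3
              show ?case
              proof (rule rest, goal_cases)
                case (7 r)
                have 8: "first_in 1 (\<lambda>y. y div 2 ^ e = 2 ^ (H - e) - 1 - v \<and> 2 ^ H - s 7 \<le> y) (s 4) r" using 7 by simp
                show ?case
                proof (rule first_in_cong[OF first_in_mirror[OF 8]])
                  fix y :: nat assume y: "y < 2 ^ H"
                  have yd: "y div 2 ^ e < 2 ^ (H - e)" unfolding div_pow_upper using y pe by simp
                  have "(2 ^ H - 1 - y) div 2 ^ e = 2 ^ (H - e) - 1 - v \<longleftrightarrow> y div 2 ^ e = v"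
                    unfolding mirror_div[OF y less_imp_le[OF eH]] by (rule mirror_eq[OF yd vl])
                  moreover have "2 ^ H - s 7 \<le> 2 ^ H - 1 - y \<longleftrightarrow> y \<le> q2" by (rule mirror_le[OF y qq(4) q(2)])
                  moreover have "q1 \<le> y" if "y div 2 ^ e = v"
                    using lca
                  proof
                    assume "e = 0"
                    then show ?thesis using that u(5) by (simp add: v1_def)
                  next
                    assume "v1 < v2"
                    show ?thesis
                    proof (rule ccontr)
                      assume "\<not> q1 \<le> y"
                      then have "y div 2 ^ e \<le> q1 div 2 ^ e" by (intro div_le_mono) simp
                      then show False using that \<open>v1 < v2\<close> vv by (simp add: v1_def)
                    qed
                  qed
                  ultimately show "((2 ^ H - 1 - y) div 2 ^ e = 2 ^ (H - e) - 1 - v \<and> 2 ^ H - s 7 \<le> 2 ^ H - 1 - y) =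
                    (q1 \<le> y \<and> y \<le> q2 \<and> y div 2 ^ e = v)" by blast
                qed
              qed (use sb s7 q in auto)
            qed
          qed
        qed simp
      next
        case 4
        have "(TF + 1) * (v2 + 1 - v1) \<le> (TF + 1) * 2 ^ a" using few by (rule mult_le_mono2)
        also have "\<dots> \<le> k" using k by (simp only: mult.commute)
        finally show ?case by simp
      next
        case (5 u)
        have u: "u 11 = v2 + 1" "\<forall>r<8. u r = s r" "u 8 \<le> 2 ^ H"
          "first_in 0 (\<lambda>y. q1 \<le> y \<and> y \<le> q2 \<and> y div 2 ^ e < u 11) (s 4) (u 8)" using 5 by (auto simp: Inv_def)
        have "first_in 0 (\<lambda>y. s 6 \<le> y \<and> y < s 7) (s 4) (u 8)"
        proof (rule first_in_cong[OF u(4)])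
          fix y :: nat
          have "y div 2 ^ e \<le> v2" if "y \<le> q2" unfolding v2_def by (rule div_le_mono[OF that])
          then show "(q1 \<le> y \<and> y \<le> q2 \<and> y div 2 ^ e < u 11) = (s 6 \<le> y \<and> y < s 7)"
            using qq u(1) by (auto simp: q1_def)
        qed
        then show ?case using u by (intro post) auto
      qed
    qed
  qed
qed

end

section \<open>Sorted reporting\<close>

text \<open>Query coordinates may be arbitrary words while the rank tables have indices up to
  \<open>n + 1\<close>, so they are clamped. Upper ends are increased by 1, which turns closed
  intervals of coordinates into half-open intervals of ranks.\<close>

definition INIT :: com where
  "INIT = If (V 0) (pl (sc 3) (C 1)) (Asg 0 (V 0)) (Asg 0 (pl (sc 3) (C 1))) ;;
    If (V 1) (sc 3) (Asg 1 (pl (V 1) (C 1))) (Asg 1 (pl (sc 3) (C 1))) ;;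
    If (V 2) (pl (sc 3) (C 1)) (Asg 2 (V 2)) (Asg 2 (pl (sc 3) (C 1))) ;;
    If (V 3) (sc 3) (Asg 3 (pl (V 3) (C 1))) (Asg 3 (pl (sc 3) (C 1))) ;;
    Asg 4 (Rd (C 1) (V 0)) ;; Asg 5 (Rd (C 1) (V 1)) ;; Asg 6 (Rd (C 2) (V 2)) ;; Asg 7 (Rd (C 2) (V 3))"

text \<open>\<open>SUCC\<close> uses the last y-rank of the interval, so an empty interval is
  treated apart: the value \<open>V 5\<close> ends the reporting loop.\<close>

definition BODY :: com where
  "BODY = If (V 6) (V 7) SUCC (Asg 8 (V 5))"

definition l1 :: nat where "l1 = 3 + clen INIT"

definition l2 :: nat where "l2 = l1 + clen BODY"

definition rep_code :: "instr list" where
  "rep_code = comp (Rd (C 3) (V 8)) 0 @ comp (Rd (C 4) (V 8)) 1"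

definition l3 :: nat where "l3 = l2 + 4 + length rep_code + 1"

text \<open>The arguments arrive in registers 0 to 3 and are moved to the registers of variables 0
  to 3, the last one first so that none is overwritten. The loop halts when the next x-rank is not
  below the end of the x-range; otherwise it reports the point and continues after it.\<close>

definition PROG :: "instr list" where
  "PROG = [Move 6 3, Move 4 2, Move 2 1] @ ck 3 INIT @ ck l1 BODY @ (comp (V 8) 0 @ comp (V 5) 1) @
     [JumpLess 1 3 (l2 + 4), Halt] @ rep_code @ [Report 1 3] @ ck l3 (Asg 4 (pl (V 8) (C 1))) @ [Jump l1]"

lemma PROG_code:
  "code_at PROG 0 [Move 6 3, Move 4 2, Move 2 1]" "code_at PROG 3 (ck 3 INIT)" "code_at PROG l1 (ck l1 BODY)"
  "code_at PROG l2 (comp (V 8) 0 @ comp (V 5) 1)" "code_at PROG (l2 + 2) [JumpLess 1 3 (l2 + 4), Halt]"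
  "code_at PROG (l2 + 4) rep_code" "code_at PROG (l2 + 4 + length rep_code) [Report 1 3]"
  "code_at PROG l3 (ck l3 (Asg 4 (pl (V 8) (C 1))))"
  "code_at PROG (l3 + clen (Asg 4 (pl (V 8) (C 1)))) [Jump l1]"
proof -
  have c: "code_at PROG 0 PROG" by (simp add: code_at_def)
  have e: "length (comp (V 8) 0 @ comp (V 5) 1) = 2" by simp
  have "code_at PROG 0 ([Move 6 3, Move 4 2, Move 2 1] @ ck 3 INIT @ ck l1 BODY @ (comp (V 8) 0 @ comp (V 5) 1) @
     [JumpLess 1 3 (l2 + 4), Halt] @ rep_code @ [Report 1 3] @ ck l3 (Asg 4 (pl (V 8) (C 1))) @ [Jump l1])"
    using c by (simp only: PROG_def[symmetric])
  note f = this[unfolded code_at_append[of _ _ "[Move 6 3, Move 4 2, Move 2 1]"] code_at_append[of _ _ "ck 3 INIT"]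
     code_at_append[of _ _ "ck l1 BODY"] code_at_append[of _ _ "comp (V 8) 0 @ comp (V 5) 1"]
     code_at_append[of _ _ "[JumpLess 1 3 (l2 + 4), Halt]"] code_at_append[of _ _ rep_code]
     code_at_append[of _ _ "[Report 1 3]"] code_at_append[of _ _ "ck l3 (Asg 4 (pl (V 8) (C 1)))"] length_ck e]
  have n: "0 + length [Move 6 3, Move 4 2, Move 2 1] = 3" "3 + clen INIT = l1" "l1 + clen BODY = l2"
     "l2 + 2 + length [JumpLess 1 3 (l2 + 4), Halt] = l2 + 4" "l2 + 4 + length rep_code + length [Report 1 3] = l3"
    by (simp_all add: l1_def l2_def l3_def)
  show "code_at PROG 0 [Move 6 3, Move 4 2, Move 2 1]" "code_at PROG 3 (ck 3 INIT)" "code_at PROG l1 (ck l1 BODY)"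
  "code_at PROG l2 (comp (V 8) 0 @ comp (V 5) 1)" "code_at PROG (l2 + 2) [JumpLess 1 3 (l2 + 4), Halt]"
  "code_at PROG (l2 + 4) rep_code" "code_at PROG (l2 + 4 + length rep_code) [Report 1 3]"
  "code_at PROG l3 (ck l3 (Asg 4 (pl (V 8) (C 1))))"
  "code_at PROG (l3 + clen (Asg 4 (pl (V 8) (C 1)))) [Jump l1]"
    using f unfolding n by blast+
qed

fun is_store :: "instr \<Rightarrow> bool" where
  "is_store (Store _ _) = True"
| "is_store _ = False"

lemma comp_no_store: "list_all (\<lambda>i. \<not> is_store i) (comp e d)"
  by (induction e arbitrary: d) (simp_all add: read_code_def)

lemma ck_no_store: "list_all (\<lambda>i. \<not> is_store i) (ck k c)"
  by (induction c arbitrary: k) (simp_all add: Let_def comp_no_store)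

lemma PROG_no_store: "list_all (\<lambda>i. \<not> is_store i) PROG"
  by (simp add: PROG_def rep_code_def comp_no_store ck_no_store del: comp.simps ck.simps)

text \<open>The code contains no \<open>Store\<close>, so a query leaves the memory as it is even
  when it is stopped early, and a single memory state is closed under queries.\<close>

lemma run_cells: "run w PROG t cf = Some cf' \<Longrightarrow> cells cf' = cells cf"
proof (induction t arbitrary: cf')
  case (Suc t)
  obtain cf1 where 1: "run w PROG t cf = Some cf1" "step w PROG cf1 = Some cf'"
    using Suc.prems by (cases "run w PROG t cf") auto
  then have "pc cf1 < length PROG" "exec w (PROG ! pc cf1) cf1 = Some cf'"
    by (auto simp: step_def split: if_splits)
  moreover from this have "\<not> is_store (PROG ! pc cf1)" using PROG_no_store by (simp add: list_all_length)
  ultimately have "cells cf' = cells cf1"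
    by (cases "PROG ! pc cf1") (auto simp: set_reg_def split: if_splits)
  then show ?case using Suc.IH[OF 1(1)] by simp
qed simp

text \<open>In a sorted list the entries below \<open>x\<close> come first, so their number
  separates them from the others.\<close>

lemma sorted_rank:
  fixes zs :: "nat list"
  assumes "sorted zs" "i < length zs"
  shows "i < card {i. i < length zs \<and> zs ! i < x} \<longleftrightarrow> zs ! i < x"
proof -
  define A where "A = {i. i < length zs \<and> zs ! i < x}"
  have "A = {0..<0 + card A}"
  proof (rule down_closed_interval)
    show "finite A" by (simp add: A_def)
    fix t t' assume "t \<in> A" "t' \<le> t"
    then show "t' \<in> A" using assms(1) sorted_nth_mono[of zs t' t] by (auto simp: A_def)
  qed auto
  then have "i \<in> A \<longleftrightarrow> i \<in> {0..<0 + card A}" by (rule arg_cong)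
  then show ?thesis using assms(2) by (auto simp: A_def)
qed

section \<open>Correctness of the query program\<close>

locale point_ds = range_ds w H a n L Q R G Pf am tab AA lam J hm
  for w H a n L Q R G Pf am tab AA lam J hm +
  fixes xs ys :: "(nat \<times> nat) list" and S :: "(nat \<times> nat) set"
  assumes xs: "length xs = n" "distinct xs" "set xs = S" "sorted (map fst xs)"
    and ys: "length ys = n" "distinct ys" "set ys = S" "sorted (map snd ys)"
    and S: "S \<subseteq> {1..n} \<times> {1..n}" and nH: "n \<le> 2 ^ H"
    and A1: "length (AA ! 1) = n + 2" "\<And>x. x \<le> n + 1 \<Longrightarrow> AA ! 1 ! x = card {i. i < n \<and> fst (xs ! i) < x}"
    and A2': "length (AA ! 2) = n + 2" "\<And>x. x \<le> n + 1 \<Longrightarrow> AA ! 2 ! x = card {i. i < n \<and> snd (ys ! i) < x}"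
    and A3: "length (AA ! 3) = n" "\<And>p. p < n \<Longrightarrow> AA ! 3 ! p = fst (xs ! p)"
    and A4: "length (AA ! 4) = n" "\<And>p. p < n \<Longrightarrow> AA ! 4 ! p = snd (xs ! p)"
    and Pf0: "\<And>y. y < n \<Longrightarrow> Pf 0 y < n \<and> xs ! Pf 0 y = ys ! y"
begin

abbreviation "TS \<equiv> 2 ^ a * (TF + 1)"

lemma x_rank: "i < n \<Longrightarrow> x \<le> n + 1 \<Longrightarrow> i < AA ! 1 ! x \<longleftrightarrow> fst (xs ! i) < x"
proof -
  assume i: "i < n" and x: "x \<le> n + 1"
  have "{i. i < length (map fst xs) \<and> map fst xs ! i < x} = {i. i < n \<and> fst (xs ! i) < x}" using xs(1) by auto
  then show ?thesis using sorted_rank[OF xs(4), of i x] i xs(1) A1(2)[OF x] by simp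
qed

lemma y_rank: "i < n \<Longrightarrow> x \<le> n + 1 \<Longrightarrow> i < AA ! 2 ! x \<longleftrightarrow> snd (ys ! i) < x"
proof -
  assume i: "i < n" and x: "x \<le> n + 1"
  have "{i. i < length (map snd ys) \<and> map snd ys ! i < x} = {i. i < n \<and> snd (ys ! i) < x}" using ys(1) by auto
  then show ?thesis using sorted_rank[OF ys(4), of i x] i ys(1) A2'(2)[OF x] by simp
qed

lemma rank_le: "x \<le> n + 1 \<Longrightarrow> AA ! 1 ! x \<le> n" "x \<le> n + 1 \<Longrightarrow> AA ! 2 ! x \<le> n"
proof -
  have "card {i. i < n \<and> Q i} \<le> n" for Q
    using card_mono[of "{..<n}" "{i. i < n \<and> Q i}"] by auto
  then show "x \<le> n + 1 \<Longrightarrow> AA ! 1 ! x \<le> n" "x \<le> n + 1 \<Longrightarrow> AA ! 2 ! x \<le> n" using A1(2) A2'(2) by auto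
qed

text \<open>The x-ranks of the points in the rectangle, in increasing order, form
  \<open>idx\<close>, and each round of the loop finds the next of them. So the time is one
  initialization, one round per reported point and one final unsuccessful round.\<close>

lemma query:
  assumes qa: "qa < 2 ^ w" "qb < 2 ^ w" "qc < 2 ^ w" "qd < 2 ^ w" and lay: "lay w m AA"
    and T: "real (length PROG + clen INIT + clen BODY + 10) * real (TS + 1) \<le> T"
  shows "answers_query w PROG S T m qa qb qc qd"
proof -
  define p1 p2 q1 q2 where "p1 = AA ! 1 ! (min qa (n + 1))" and "p2 = AA ! 1 ! (min qb n + 1)"
    and "q1 = AA ! 2 ! (min qc (n + 1))" and "q2 = AA ! 2 ! (min qd n + 1)"
  have bnd: "p1 \<le> n" "p2 \<le> n" "q1 \<le> n" "q2 \<le> n" 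
    unfolding p1_def p2_def q1_def q2_def by (rule rank_le, simp)+
  define good where "good p \<longleftrightarrow> p < n \<and> xs ! p \<in> {qa..qb} \<times> {qc..qd}" for p
  have coord: "1 \<le> fst (xs ! p)" "fst (xs ! p) \<le> n" "1 \<le> snd (xs ! p)" "snd (xs ! p) \<le> n" if "p < n" for p
  proof -
    have "xs ! p \<in> {1..n} \<times> {1..n}" using that xs S nth_mem[of p xs] by auto
    then show "1 \<le> fst (xs ! p)" "fst (xs ! p) \<le> n" "1 \<le> snd (xs ! p)" "snd (xs ! p) \<le> n"
      by (auto simp: mem_Times_iff)
  qed
  have gx: "qa \<le> fst (xs ! p) \<and> fst (xs ! p) \<le> qb \<longleftrightarrow> p1 \<le> p \<and> p < p2" if "p < n" for p
    using x_rank[OF that, of "min qa (n + 1)"] x_rank[OF that, of "min qb n + 1"] coord[OF that]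
    by (auto simp: p1_def p2_def)
  have gy: "qc \<le> snd (ys ! y) \<and> snd (ys ! y) \<le> qd \<longleftrightarrow> q1 \<le> y \<and> y < q2" if "y < n" for y
  proof -
    have "snd (ys ! y) \<le> n"
    proof -
      have "ys ! y \<in> {1..n} \<times> {1..n}" using that ys S nth_mem[of y ys] by auto
      then show ?thesis by (auto simp: mem_Times_iff)
    qed
    then show ?thesis
      using y_rank[OF that, of "min qc (n + 1)"] y_rank[OF that, of "min qd n + 1"]
      by (auto simp: q1_def q2_def)
  qed
  \<comment> \<open>Ranks from \<open>n\<close> on are padding; \<open>q2 \<le> n\<close> keeps them
    out.\<close>
  have goodI: "good (Pf 0 y)" if "q1 \<le> y" "y < q2" "p1 \<le> Pf 0 y" "Pf 0 y < p2" for y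
  proof -
    have y: "y < n" using that bnd by simp
    then have "Pf 0 y < n" "xs ! Pf 0 y = ys ! y" using Pf0 by auto
    then show ?thesis using gx[of "Pf 0 y"] gy[OF y] that by (auto simp: good_def mem_Times_iff)
  qed
  have goodD: "p1 \<le> p \<and> p < p2 \<and> (\<exists>y<2 ^ H. q1 \<le> y \<and> y < q2 \<and> Pf 0 y = p)" if g: "good p" for p
  proof -
    have p: "p < n" using g by (simp add: good_def)
    then obtain y where y: "y < n" "ys ! y = xs ! p" using xs ys by (metis in_set_conv_nth)
    have "Pf 0 y = p" using Pf0[OF y(1)] y p xs by (metis nth_eq_iff_index_eq)
    moreover have "q1 \<le> y \<and> y < q2" using gy[OF y(1)] g y(2) by (auto simp: good_def mem_Times_iff)
    moreover have "y < 2 ^ H" using y nH by simp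
    ultimately show ?thesis using gx[OF p] g by (auto simp: good_def mem_Times_iff)
  qed
  define idx where "idx = filter good [0..<n]"
  have si: "sorted_wrt (<) idx" unfolding idx_def by (rule sorted_wrt_filter) simp
  have seti: "set idx = {p. good p}" by (auto simp: idx_def good_def)
  define pts where "pts = map ((!) xs) idx"
  have lp: "length pts = length idx" by (simp add: pts_def)
  have sr: "sorted_report S qa qb qc qd pts"
    unfolding sorted_report_def
  proof (intro conjI)
    have "inj_on ((!) xs) (set idx)" using xs by (auto simp: seti good_def inj_on_def nth_eq_iff_index_eq)
    then show "distinct pts" by (simp add: pts_def distinct_map idx_def)
    show "set pts = S \<inter> {qa..qb} \<times> {qc..qd}"
    proof (intro set_eqI iffI)
      fix z assume "z \<in> set pts"
      then obtain p where "good p" "z = xs ! p" by (auto simp: pts_def seti)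
      then show "z \<in> S \<inter> {qa..qb} \<times> {qc..qd}" using xs nth_mem[of p xs] by (simp add: good_def)
    next
      fix z assume z: "z \<in> S \<inter> {qa..qb} \<times> {qc..qd}"
      then obtain p where "p < n" "xs ! p = z" using xs by (metis IntE in_set_conv_nth)
      then show "z \<in> set pts" using z by (auto simp: pts_def seti good_def)
    qed
    show "sorted (map fst pts)"
      unfolding sorted_iff_nth_mono
    proof (intro allI impI)
      fix i j assume ij: "i \<le> j" "j < length (map fst pts)"
      then have j: "j < length idx" using lp by simp
      have "idx ! i \<le> idx ! j"
      proof (cases "i = j")
        case False
        then show ?thesis using si ij j sorted_wrt_nth_less[of "(<)" idx i j] by simp
      qed simp
      moreover have "idx ! j < n" using nth_mem[OF j] by (simp add: seti good_def)
      ultimately have "map fst xs ! (idx ! i) \<le> map fst xs ! (idx ! j)"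
        using sorted_nth_mono[OF xs(4), of "idx ! i" "idx ! j"] xs(1) by simp
      then show "map fst pts ! i \<le> map fst pts ! j" using ij j \<open>idx ! j < n\<close> \<open>idx ! i \<le> idx ! j\<close> xs(1)
        by (simp add: pts_def)
    qed
  qed
  \<comment> \<open>State at the loop head after \<open>k\<close> reports: the ranks reported are
    below \<open>p\<close>, and all other ranks of the answer are at least \<open>p\<close>.\<close>
  define atk :: "nat \<Rightarrow> nat \<Rightarrow> config \<Rightarrow> bool" where
    "atk k p cf \<longleftrightarrow> pc cf = l1 \<and> cells cf = m \<and> reported cf = take k pts \<and> p1 \<le> p \<and> p \<le> n \<and>
      regs cf 8 = p \<and> regs cf 10 = p2 \<and> regs cf 12 = q1 \<and> regs cf 14 = q2 \<and>
      (\<forall>i<k. idx ! i < p) \<and> (\<forall>i. k \<le> i \<and> i < length idx \<longrightarrow> p \<le> idx ! i)" for k p cf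
  define T0 where "T0 = 3 + clen INIT"
  define Tl where "Tl = clen BODY * (TS + 1) + 3 + length rep_code + 1 + clen (Asg 4 (pl (V 8) (C 1))) + 1"
  have w3: "3 \<le> w" using w40 H1 by simp
  have nw: "n < 2 ^ w" "n + 1 < 2 ^ w" using nH N_lt one_le_power[of "2::nat" H] by linarith+
  have start: "\<exists>\<tau> cf. \<tau> \<le> T0 \<and> run w PROG \<tau> (start m qa qb qc qd) = Some cf \<and> atk 0 p1 cf"
  proof -
    let ?c0 = "start m qa qb qc qd"
    let ?rg = "(regs ?c0)(6 := qd, 4 := qc, 2 := qb)"
    let ?c1 = "?c0\<lparr>pc := 3, regs := ?rg\<rparr>"
    have ex: "exs w [Move 6 3, Move 4 2, Move 2 1] ?c0 = Some ?c1"
      by (simp add: start_def set_reg_def fun_upd_twist)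
    have "run w PROG (length [Move 6 3, Move 4 2, Move 2 1]) ?c0 = Some ?c1"
      by (rule run_exs[OF _ _ ex]) (use PROG_code(1) in \<open>simp_all add: start_def\<close>)
    then have r1: "run w PROG 3 ?c0 = Some ?c1" by (simp only: list.size) (simp only: numeral_3_eq_3 add_0 add_Suc_right add_Suc Suc_eq_plus1[symmetric])
    define s where "s = (\<lambda>x. ?rg (2 * x))"
    have s: "s 0 = qa" "s 1 = qb" "s 2 = qc" "s 3 = qd" by (simp_all add: s_def start_def)
    have mn: "min qa (n + 1) \<le> n + 1" "min qc (n + 1) \<le> n + 1" "min qb n + 1 \<le> n + 1" "min qd n + 1 \<le> n + 1" by auto
    have "TR INIT s 0 (\<lambda>s'. s' 4 = p1 \<and> s' 5 = p2 \<and> s' 6 = q1 \<and> s' 7 = q2)"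
    proof -
      have fin: "TR (Asg 4 (Rd (C 1) (V 0)) ;; Asg 5 (Rd (C 1) (V 1)) ;; Asg 6 (Rd (C 2) (V 2)) ;; Asg 7 (Rd (C 2) (V 3))) u 0
          (\<lambda>s'. s' 4 = p1 \<and> s' 5 = p2 \<and> s' 6 = q1 \<and> s' 7 = q2)"
        if "u 0 = min qa (n + 1)" "u 1 = min qb n + 1" "u 2 = min qc (n + 1)" "u 3 = min qd n + 1" for u
        apply (rule tr_AsgSeqV[where v = p1])
          apply (use that A1(1) in \<open>simp\<close>)
         apply (use that in \<open>simp add: p1_def\<close>)
        apply (rule tr_AsgSeqV[where v = p2])
          apply (use that A1(1) in \<open>simp\<close>)
         apply (use that in \<open>simp add: p2_def\<close>)
        apply (rule tr_AsgSeqV[where v = q1])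
          apply (use that A2'(1) in \<open>simp\<close>)
         apply (use that in \<open>simp add: q1_def\<close>)
        apply (rule tr_AsgV[where v = q2])
          apply (use that A2'(1) in \<open>simp\<close>)
         apply (use that in \<open>simp add: q2_def\<close>)
        apply simp
        done
      have cl1: "TR (If (V x) (pl (sc 3) (C 1)) (Asg x (V x)) (Asg x (pl (sc 3) (C 1)))) u 0 T'"
        if "T' (u(x := min (u x) (n + 1)))" for x u T'
        using nw that by (intro tr_If tr_AsgV[where v = "min (u x) (n + 1)"]) (auto simp: min_def)
      have cl2: "TR (If (V x) (sc 3) (Asg x (pl (V x) (C 1))) (Asg x (pl (sc 3) (C 1)))) u 0 T'"
        if "T' (u(x := min (u x) n + 1))" for x u T'
        using nw that by (intro tr_If tr_AsgV[where v = "min (u x) n + 1"]) (auto simp: min_def)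
      show ?thesis
        unfolding INIT_def
        apply (rule tr_Seq[where ?n1.0 = 0 and ?n2.0 = 0], rule cl1)
        apply (rule tr_Seq[where ?n1.0 = 0 and ?n2.0 = 0], rule cl2)
        apply (rule tr_Seq[where ?n1.0 = 0 and ?n2.0 = 0], rule cl1)
        apply (rule tr_Seq[where ?n1.0 = 0 and ?n2.0 = 0], rule cl2)
        apply (rule fin)
        using s by simp_all
    qed
    then obtain t s' where bs: "bs w AA INIT s t s'" "t \<le> 0" "s' 4 = p1" "s' 5 = p2" "s' 6 = q1" "s' 7 = q2"
      unfolding tr_def by blast
    obtain \<tau> rg where r2: "\<tau> \<le> clen INIT * (t + 1)" "run w PROG \<tau> ?c1 = Some (?c1\<lparr>pc := pc ?c1 + clen INIT, regs := rg\<rparr>)"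
      "(\<lambda>x. rg (2 * x)) = s'"
      using compile_correct[OF bs(1), of PROG ?c1] PROG_code(2) lay by (auto simp: start_def s_def)
    have r3: "run w PROG (3 + \<tau>) ?c0 = Some (?c1\<lparr>pc := pc ?c1 + clen INIT, regs := rg\<rparr>)"
      by (rule run_trans[OF r1 r2(2)])
    have rv: "rg 8 = p1" "rg 10 = p2" "rg 12 = q1" "rg 14 = q2"
      using bs r2(3) fun_cong[OF r2(3), of 4] fun_cong[OF r2(3), of 5] fun_cong[OF r2(3), of 6] fun_cong[OF r2(3), of 7]
      by simp_all
    have "p1 \<le> idx ! i" if "i < length idx" for i using nth_mem[OF that] goodD by (auto simp: seti)
    then have "atk 0 p1 (?c1\<lparr>pc := pc ?c1 + clen INIT, regs := rg\<rparr>)"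
      using rv bnd by (simp add: atk_def l1_def start_def)
    then show ?thesis using r3 r2(1) bs(2) by (intro exI[of _ "3 + \<tau>"]) (auto simp: T0_def)
  qed
  have body: "\<exists>\<tau> rg r. \<tau> \<le> clen BODY * (TS + 1) + 2 \<and>
      run w PROG \<tau> cf = Some (cf\<lparr>pc := l2 + 2, regs := rg\<rparr>) \<and> rg 1 = r \<and> rg 3 = p2 \<and>
      (\<forall>x<8. rg (2 * x) = regs cf (2 * x)) \<and> rg 16 = r \<and>
      (r < p2 \<longrightarrow> good r \<and> p \<le> r \<and> (\<forall>p'. good p' \<longrightarrow> p \<le> p' \<longrightarrow> r \<le> p')) \<and>
      (\<not> r < p2 \<longrightarrow> (\<forall>p'. good p' \<longrightarrow> p' < p))" if A: "atk k p cf" for k p cf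
  proof -
    define s where "s = (\<lambda>x. regs cf (2 * x))"
    have s: "s 4 = p" "s 5 = p2" "s 6 = q1" "s 7 = q2" "p1 \<le> p" "p \<le> n" using A by (simp_all add: s_def atk_def)
    define G where "G r \<longleftrightarrow> (r < p2 \<longrightarrow> good r \<and> p \<le> r \<and> (\<forall>p'. good p' \<longrightarrow> p \<le> p' \<longrightarrow> r \<le> p')) \<and>
      (\<not> r < p2 \<longrightarrow> (\<forall>p'. good p' \<longrightarrow> p' < p))" for r
    have "TR BODY s TS (\<lambda>s'. (\<forall>x<8. s' x = s x) \<and> G (s' 8))"
      unfolding BODY_def
    proof (rule tr_If, goal_cases)
      case 3
      then have q: "q1 < q2" using s by simp
      show ?case
      proof (rule SUCC_tr, goal_cases)
        case (4 s')
        have fi: "first_in 0 (\<lambda>y. q1 \<le> y \<and> y < q2) p (s' 8)" using 4(2) s by simp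
        have "G (s' 8)"
          using fi unfolding first_in_def
        proof (elim disjE conjE exE)
          assume h: "s' 8 = 2 ^ H" "\<forall>y<2 ^ H. q1 \<le> y \<and> y < q2 \<longrightarrow> Pf 0 y < p"
          then have "\<not> s' 8 < p2" using bnd nH by simp
          moreover have "p' < p" if "good p'" for p' using goodD[OF that] h(2) by blast
          ultimately show ?thesis by (simp add: G_def)
        next
          fix y assume y: "y < 2 ^ H" "q1 \<le> y" "y < q2" "p \<le> Pf 0 y" "s' 8 = Pf 0 y"
            and mn: "\<forall>y'<2 ^ H. q1 \<le> y' \<and> y' < q2 \<longrightarrow> p \<le> Pf 0 y' \<longrightarrow> s' 8 \<le> Pf 0 y'"
          have le: "s' 8 \<le> p'" if "good p'" "p \<le> p'" for p' using goodD[OF that(1)] mn that(2) by blast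
          show ?thesis
            unfolding G_def
          proof (intro conjI impI allI)
            assume "s' 8 < p2"
            then show "good (s' 8)" using goodI[OF y(2,3)] y s(5) by simp
          next
            show "p \<le> s' 8" using y by simp
          next
            fix p' assume "good p'" "p \<le> p'"
            then show "s' 8 \<le> p'" by (rule le)
          next
            fix p' assume "\<not> s' 8 < p2" "good p'"
            then show "p' < p" using le[of p'] goodD[of p'] by (meson le_less_trans not_le)
          qed
        qed
        then show ?case using 4(1) by simp
      qed (use q s bnd nH in auto)
    next
      case 4
      then have "\<not> q1 < q2" using s by simp
      then have "\<not> good p'" for p' using goodD[of p'] by auto
      then have "G p2" by (simp add: G_def)
      then show ?case using s by (intro tr_AsgV[where v = p2]) auto
    qed auto
    then obtain t s' where bs: "bs w AA BODY s t s'" "t \<le> TS" "\<forall>x<8. s' x = s x" "G (s' 8)"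
      unfolding tr_def by blast
    obtain \<tau> rg where r2: "\<tau> \<le> clen BODY * (t + 1)" "run w PROG \<tau> cf = Some (cf\<lparr>pc := pc cf + clen BODY, regs := rg\<rparr>)"
      "(\<lambda>x. rg (2 * x)) = s'"
      using compile_correct[OF bs(1), of PROG cf] PROG_code(3) lay A by (auto simp: atk_def s_def)
    let ?c2 = "cf\<lparr>pc := l2, regs := rg\<rparr>"
    have r2': "run w PROG \<tau> cf = Some ?c2" using r2(2) A by (simp add: atk_def l2_def)
    obtain rg3 where r3: "run w PROG (length (comp (V 8) 0) + length (comp (V 5) 1)) ?c2 =
      Some (?c2\<lparr>pc := pc ?c2 + (length (comp (V 8) 0) + length (comp (V 5) 1)), regs := rg3\<rparr>)"
      "rg3 1 = s' 8" "rg3 3 = s' 5" "(\<lambda>x. rg3 (2*x)) = s'"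
      using run_two_comp[of PROG ?c2 "V 8" "V 5" w AA] PROG_code(4) lay A r2(3)
      by (auto simp: atk_def simp del: comp.simps)
    have r4: "run w PROG (\<tau> + 2) cf = Some (cf\<lparr>pc := l2 + 2, regs := rg3\<rparr>)"
      using run_trans[OF r2' r3(1)] by simp
    have "clen BODY * (t + 1) \<le> clen BODY * (TS + 1)" using bs(2) by (intro mult_le_mono2) simp
    then have tt: "\<tau> + 2 \<le> clen BODY * (TS + 1) + 2" using r2(1) by linarith
    have "rg3 (2 * x) = s' x" for x using fun_cong[OF r3(4), of x] by simp
    from this this[of 8] have "\<forall>x<8. rg3 (2 * x) = regs cf (2 * x)" "rg3 16 = s' 8" using bs(3) by (auto simp: s_def)
    then show ?thesis using r4 tt r3(2,3) bs(3,4) s(2) unfolding G_def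
      by (intro exI[of _ "\<tau> + 2"] exI[of _ rg3] exI[of _ "s' 8"]) auto
  qed
  have nxt: "\<exists>\<tau> cf' p'. \<tau> \<le> Tl \<and> run w PROG \<tau> cf = Some cf' \<and> atk (Suc k) p' cf'"
    if A: "atk k p cf" and k: "k < length idx" for k p cf
  proof -
    obtain \<tau> rg r where b: "\<tau> \<le> clen BODY * (TS + 1) + 2" "run w PROG \<tau> cf = Some (cf\<lparr>pc := l2 + 2, regs := rg\<rparr>)"
      "rg 1 = r" "rg 3 = p2" "\<forall>x<8. rg (2 * x) = regs cf (2 * x)" "rg 16 = r"
      "r < p2 \<longrightarrow> good r \<and> p \<le> r \<and> (\<forall>p'. good p' \<longrightarrow> p \<le> p' \<longrightarrow> r \<le> p')"
      "\<not> r < p2 \<longrightarrow> (\<forall>p'. good p' \<longrightarrow> p' < p)" using body[OF A] by blast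
    have gk: "good (idx ! k)" "p \<le> idx ! k" using nth_mem[OF k] A k by (auto simp: seti atk_def)
    \<comment> \<open>As long as a rank of the answer is outstanding, the search cannot
      fail.\<close>
    then have rp: "r < p2" using b(8) by (meson not_le)
    then have r: "good r" "p \<le> r" "r \<le> idx ! k" using b(7) gk by auto
    have rk: "r = idx ! k"
    proof -
      obtain i where i: "i < length idx" "idx ! i = r" using r(1) seti by (metis in_set_conv_nth mem_Collect_eq)
      have "k \<le> i" using A i r(2) by (metis atk_def not_le)
      then have "idx ! k \<le> idx ! i"
        using si i sorted_wrt_nth_less[of "(<)" idx k i] by (cases "k = i") auto
      then show ?thesis using r i by simp
    qed
    have rn: "r < n" using r(1) by (simp add: good_def)
    let ?c2 = "cf\<lparr>pc := l2 + 2, regs := rg\<rparr>"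
    let ?c3 = "cf\<lparr>pc := l2 + 4, regs := rg\<rparr>"
    have s1: "run w PROG 1 ?c2 = Some ?c3"
      using PROG_code(5) b(3,4) rp by (simp add: code_at_Cons step_def)
    let ?s = "\<lambda>x. regs ?c3 (2 * x)"
    have m3: "cells cf = m" using A by (simp add: atk_def)
    have sf: "safe w AA ?s (Rd (C 3) (V 8))" "safe w AA ?s (Rd (C 4) (V 8))"
      using b(6) rn A3(1) A4(1) by simp_all
    obtain rg4 where r4: "run w PROG (length rep_code) ?c3 = Some (?c3\<lparr>pc := l2 + 4 + length rep_code, regs := rg4\<rparr>)"
      "rg4 1 = fst (xs ! r)" "rg4 3 = snd (xs ! r)" "(\<lambda>x. rg4 (2*x)) = ?s"
      using run_two_comp[of PROG ?c3 "Rd (C 3) (V 8)" "Rd (C 4) (V 8)" w AA] PROG_code(6) lay m3 sf b(6) A3(2)[OF rn] A4(2)[OF rn]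
      by (auto simp: rep_code_def simp del: comp.simps)
    let ?c4 = "cf\<lparr>pc := l2 + 4 + length rep_code, regs := rg4\<rparr>"
    let ?c5 = "cf\<lparr>pc := l3, regs := rg4, reported := reported cf @ [xs ! r]\<rparr>"
    have s2: "run w PROG 1 ?c4 = Some ?c5"
      using PROG_code(7) r4(2,3) by (simp add: code_at_Cons step_def l3_def)
    let ?e = "Asg 4 (pl (V 8) (C 1))"
    have rg4: "rg4 (2 * x) = rg (2 * x)" for x using fun_cong[OF r4(4), of x] by simp
    have r16: "rg4 16 = r" using rg4[of 8] b(6) by simp
    have "bs w AA ?e (\<lambda>x. rg4 (2 * x)) 0 ((\<lambda>x. rg4 (2 * x))(4 := ev AA (\<lambda>x. rg4 (2 * x)) (pl (V 8) (C 1))))"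
      by (rule bs_Asg) (use r16 rn nw in simp)
    from compile_correct[OF this, of PROG ?c5]
    obtain \<tau>5 rg6 where r6: "\<tau>5 \<le> clen ?e" "run w PROG \<tau>5 ?c5 = Some (?c5\<lparr>pc := l3 + clen ?e, regs := rg6\<rparr>)"
      "(\<lambda>x. rg6 (2*x)) = (\<lambda>x. rg4 (2 * x))(4 := Suc r)"
      using PROG_code(8) lay m3 r16 by (auto simp del: ck.simps clen.simps)
    let ?c7 = "cf\<lparr>pc := l1, regs := rg6, reported := reported cf @ [xs ! r]\<rparr>"
    have s3: "run w PROG 1 (?c5\<lparr>pc := l3 + clen ?e, regs := rg6\<rparr>) = Some ?c7"
      using PROG_code(9) by (simp add: code_at_Cons step_def del: clen.simps)
    have R: "run w PROG (\<tau> + 1 + length rep_code + 1 + \<tau>5 + 1) cf = Some ?c7"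
      by (rule run_trans[OF run_trans[OF run_trans[OF run_trans[OF run_trans[OF b(2) s1] _] s2] r6(2)] s3])
        (use r4(1) in simp)
    have rg6: "rg6 (2 * x) = (if x = 4 then Suc r else rg (2 * x))" for x using fun_cong[OF r6(3), of x] rg4[of x] by simp
    have rv: "rg6 8 = Suc r" "rg6 10 = p2" "rg6 12 = q1" "rg6 14 = q2"
      using rg6[of 4] rg6[of 5] rg6[of 6] rg6[of 7] b(5)[rule_format, of 5] b(5)[rule_format, of 6]
        b(5)[rule_format, of 7] A by (simp_all add: atk_def)
    have tk: "take (Suc k) pts = take k pts @ [xs ! r]"
      using k lp rk by (simp add: take_Suc_conv_app_nth pts_def)
    have lt: "idx ! i < Suc r" if "i < Suc k" for i
      using that si k rk sorted_wrt_nth_less[of "(<)" idx i k] by (cases "i = k") auto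
    have ge: "Suc r \<le> idx ! i" if "Suc k \<le> i" "i < length idx" for i
      using that si rk sorted_wrt_nth_less[of "(<)" idx k i] by auto
    have "atk (Suc k) (Suc r) ?c7"
      using A rv tk lt ge rn r(2) m3 by (auto simp: atk_def)
    moreover have "\<tau> + 1 + length rep_code + 1 + \<tau>5 + 1 \<le> Tl" using b(1) r6(1) by (simp add: Tl_def del: clen.simps)
    ultimately show ?thesis using R by blast
  qed
  have reach: "\<exists>\<tau> cf p. \<tau> \<le> T0 + k * Tl \<and> run w PROG \<tau> (start m qa qb qc qd) = Some cf \<and> atk k p cf"
    if "k \<le> length idx" for k
    using that
  proof (induction k)
    case 0
    then show ?case using start by auto
  next
    case (Suc k)
    then obtain \<tau> cf p where 1: "\<tau> \<le> T0 + k * Tl" "run w PROG \<tau> (start m qa qb qc qd) = Some cf" "atk k p cf" by auto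
    obtain \<tau>' cf' p' where 2: "\<tau>' \<le> Tl" "run w PROG \<tau>' cf = Some cf'" "atk (Suc k) p' cf'"
      using nxt[OF 1(3)] Suc.prems by auto
    have "\<tau> + \<tau>' \<le> T0 + Suc k * Tl" using 1(1) 2(1) by simp
    then show ?case using run_trans[OF 1(2) 2(2)] 2(3) by blast
  qed
  \<comment> \<open>The initialization and the final unsuccessful round are charged to the summand 1
    in \<open>k + 1\<close>.\<close>
  have TT: "real (T0 + k * Tl + Tl) \<le> (real k + 1) * T" for k
  proof -
    define c where "c = length PROG + clen INIT + clen BODY + 10"
    have lP: "length rep_code + clen (Asg 4 (pl (V 8) (C 1))) \<le> length PROG" by (simp add: PROG_def)
    have "T0 + Tl \<le> clen INIT * (TS + 1) + clen BODY * (TS + 1) + (length PROG + 10) * (TS + 1)"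
    proof -
      have "clen INIT \<le> clen INIT * (TS + 1)" by simp
      moreover have "length PROG + 10 \<le> (length PROG + 10) * (TS + 1)" by simp
      ultimately show ?thesis using lP unfolding T0_def Tl_def by linarith
    qed
    also have "\<dots> = c * (TS + 1)" by (simp add: c_def algebra_simps)
    finally have c1: "T0 + Tl \<le> c * (TS + 1)" .
    have "T0 + k * Tl + Tl \<le> (k + 1) * (T0 + Tl)" by (simp add: algebra_simps)
    also have "\<dots> \<le> (k + 1) * (c * (TS + 1))" using c1 by (rule mult_le_mono2)
    finally have "real (T0 + k * Tl + Tl) \<le> real ((k + 1) * (c * (TS + 1)))" by (rule of_nat_mono)
    also have "\<dots> = (real k + 1) * (real c * real (TS + 1))" by (simp only: of_nat_mult of_nat_add of_nat_1)
    also have "\<dots> \<le> (real k + 1) * T" using T by (intro mult_left_mono) (auto simp: c_def)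
    finally show ?thesis .
  qed
  show ?thesis
    unfolding answers_query_def
  proof (intro exI[of _ pts] conjI allI impI)
    show "sorted_report S qa qb qc qd pts" by (rule sr)
  next
    fix k assume "k \<le> length pts"
    then obtain \<tau> cf p where 1: "\<tau> \<le> T0 + k * Tl" "run w PROG \<tau> (start m qa qb qc qd) = Some cf" "atk k p cf"
      using reach[of k] lp by auto
    have "real \<tau> \<le> real (T0 + k * Tl + Tl)" using 1(1) by (intro of_nat_mono) simp
    then have "real \<tau> \<le> (real k + 1) * T" using TT[of k] by linarith
    then show "\<exists>\<tau> cf. real \<tau> \<le> (real k + 1) * T \<and> run w PROG \<tau> (start m qa qb qc qd) = Some cf \<and> reported cf = take k pts"
      using 1 by (auto simp: atk_def)
  next
    obtain \<tau> cf p where 1: "\<tau> \<le> T0 + length idx * Tl" "run w PROG \<tau> (start m qa qb qc qd) = Some cf" "atk (length idx) p cf"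
      using reach[of "length idx"] by auto
    obtain \<tau>' rg r where b: "\<tau>' \<le> clen BODY * (TS + 1) + 2" "run w PROG \<tau>' cf = Some (cf\<lparr>pc := l2 + 2, regs := rg\<rparr>)"
      "rg 1 = r" "rg 3 = p2" 
      "r < p2 \<longrightarrow> good r \<and> p \<le> r \<and> (\<forall>p'. good p' \<longrightarrow> p \<le> p' \<longrightarrow> r \<le> p')" using body[OF 1(3)] by blast
    have nr: "\<not> r < p2"
    proof
      assume "r < p2"
      then have g: "good r" "p \<le> r" using b(5) by auto
      then obtain i where "i < length idx" "idx ! i = r" using seti by (metis in_set_conv_nth mem_Collect_eq)
      then show False using 1(3) g(2) by (auto simp: atk_def)
    qed
    let ?c = "cf\<lparr>pc := l2 + 3, regs := rg\<rparr>"
    have "run w PROG 1 (cf\<lparr>pc := l2 + 2, regs := rg\<rparr>) = Some ?c"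
      using PROG_code(5) b(3,4) nr by (simp add: code_at_Cons step_def)
    note r = run_trans[OF run_trans[OF 1(2) b(2)] this]
    have h: "halted PROG ?c" using PROG_code(5) by (simp add: code_at_Cons halted_def numeral_eq_Suc)
    have "\<tau> + \<tau>' + 1 \<le> T0 + length idx * Tl + Tl" using 1(1) b(1) by (simp add: Tl_def del: clen.simps)
    then have "real (\<tau> + \<tau>' + 1) \<le> real (T0 + length idx * Tl + Tl)" by (rule of_nat_mono)
    then have "real (\<tau> + \<tau>' + 1) \<le> (real (length pts) + 1) * T" using TT[of "length idx"] lp by simp
    moreover have "reported ?c = pts" using 1(3) lp by (simp add: atk_def)
    ultimately show "\<exists>\<tau> cf. real \<tau> \<le> (real (length pts) + 1) * T \<and> run w PROG \<tau> (start m qa qb qc qd) = Some cf \<and>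
        halted PROG cf \<and> reported cf = pts"
      using r h by blast
  qed
qed

lemma represents_mem:
  assumes "lay w m AA" "\<forall>v\<in>set m. v < 2 ^ w"
    and "real (length PROG + clen INIT + clen BODY + 10) * real (TS + 1) \<le> T"
  shows "represents w PROG S T {m}"
  unfolding represents_def
proof (intro conjI ballI allI impI)
  fix m' and qa qb qc qd \<tau> :: nat and cf
  assume "m' \<in> {m}" "run w PROG \<tau> (start m' qa qb qc qd) = Some cf"
  then show "cells cf \<in> {m}" using run_cells by (auto simp: start_def)
next
  fix m' v assume "m' \<in> {m}" "v \<in> set m'"
  then show "v < 2 ^ w" using assms(2) by simp
next
  fix m' and qa qb qc qd :: nat assume "m' \<in> {m}" "qa < 2 ^ w \<and> qb < 2 ^ w \<and> qc < 2 ^ w \<and> qd < 2 ^ w"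
  then show "answers_query w PROG S T m' qa qb qc qd" using query[OF _ _ _ _ assms(1,3)] by simp
qed simp

end

section \<open>Number of dictionary keys and jump table entries\<close>

lemma sum_lessThan_add: "(\<Sum>z<k + m. g z) = (\<Sum>z<k. g z) + (\<Sum>y<m. g (k + y))" for g :: "nat \<Rightarrow> nat"
  by (induction m) auto

lemma sum_nested: "(\<Sum>z<k * m. g z) = (\<Sum>x<k. \<Sum>y<m. g (x * m + y))" for g :: "nat \<Rightarrow> nat"
proof (induction k)
  case (Suc k)
  have "(\<Sum>z<Suc k * m. g z) = (\<Sum>z<k * m + m. g z)" by (simp add: add.commute)
  also have "\<dots> = (\<Sum>z<k * m. g z) + (\<Sum>y<m. g (k * m + y))" by (rule sum_lessThan_add)
  finally show ?case using Suc by simp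
qed simp

text \<open>Every break lies below \<open>H + 2\<close> trie nodes, one per height, and a monotone
  function has at most as many breaks as its last value.\<close>

lemma card_keyset:
  assumes "\<And>i. mono (F i)"
  shows "finite (keyset H I F)" "card (keyset H I F) \<le> (H + 2) * (\<Sum>i<I. F i (2 ^ (H + 1)))"
proof -
  let ?U = "2 ^ (H + 1)"
  let ?B = "\<lambda>i. \<Union>g\<in>{..H + 1}. (\<lambda>k. keyf H i g (k div 2 ^ g)) ` breaks ?U (F i)"
  have eq: "keyset H I F = (\<Union>i\<in>{..<I}. ?B i)" unfolding keyset_def by blast
  have fin: "finite (?B i)" for i using finite_breaks by blast
  show "finite (keyset H I F)" unfolding eq using fin by blast
  have cB: "card (?B i) \<le> (H + 2) * F i ?U" for i
  proof -
    have "card (?B i) \<le> (\<Sum>g\<in>{..H + 1}. card ((\<lambda>k. keyf H i g (k div 2 ^ g)) ` breaks ?U (F i)))"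
      by (rule card_UN_le) simp
    also have "\<dots> \<le> (\<Sum>g\<in>{..H + 1}. F i ?U)"
      by (intro sum_mono order_trans[OF card_image_le card_breaks[OF assms]] finite_breaks)
    also have "\<dots> = (H + 2) * F i ?U" by simp
    finally show ?thesis .
  qed
  have "card (keyset H I F) \<le> (\<Sum>i\<in>{..<I}. card (?B i))" unfolding eq by (rule card_UN_le) simp
  also have "\<dots> \<le> (\<Sum>i\<in>{..<I}. (H + 2) * F i ?U)" using cB by (intro sum_mono)
  also have "\<dots> = (H + 2) * (\<Sum>i<I. F i ?U)" by (simp add: sum_distrib_left)
  finally show "card (keyset H I F) \<le> (H + 2) * (\<Sum>i<I. F i ?U)" .
qed

lemma cube_sum: "(\<Sum>fb<(6::nat). \<Sum>h<k. \<Sum>e'<k. k * c) = 6 * k ^ 3 * c" for k c :: nat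
  by (simp add: power3_eq_cube)

lemma pow_shift: "k * (6 * k ^ 3 * c) = k ^ 4 * (6 * c)" "c * k ^ 5 = k ^ 4 * (c * k)" for k c :: nat
  by algebra+

lemma sum_prefix_const:
  fixes m N c :: nat
  assumes "m \<le> N" shows "(\<Sum>i<N. if i < m then c else 0) = m * c"
proof -
  have "(\<Sum>i<N. if i < m then c else 0) = (\<Sum>i\<in>{i \<in> {..<N}. i < m}. c)" by (rule sum.inter_filter[symmetric]) simp
  also have "{i \<in> {..<N}. i < m} = {..<m}" using assms by auto
  finally show ?thesis by simp
qed

context
  fixes H a G :: nat and Pf :: "nat \<Rightarrow> nat \<Rightarrow> nat"
  assumes waveP: "\<And>b. b < 2 \<Longrightarrow> wave H (Pf b)"
begin

lemma Fam_cases: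
  obtains (zero) "\<And>x. Fam H a G Pf z x = 0"
  | (one) b e S v where "b < 2" "e < H" "Fam H a G Pf z = wave.f1 H (Pf b) e S v"
  | (two) b e S v where "b < 2" "e < H" "Fam H a G Pf z = wave.f2 H (Pf b) e S v"
  | (three) b e S e' v where "b < 2" "e < H" "e' < e - S" "Fam H a G Pf z = wave.f3 H (Pf b) e S e' v"
proof -
  define i r where "i = z mod 2 ^ H" and "r = z div 2 ^ H"
  define e' h r3 where "e' = r mod (H + 1)" and "h = r div (H + 1) mod (H + 1)" and "r3 = r div (H + 1) div (H + 1)"
  define b f where "b = r3 mod 2" and "f = r3 div 2"
  define e S where "e = a * h" and "S = shf a G h"
  have eq: "Fam H a G Pf z x = (if e < H then
       if f = 0 then if i < 2 ^ (H - e) then wave.f1 H (Pf b) e S i x else 0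
       else if f = 1 then if i < 2 ^ (H - S) then wave.f2 H (Pf b) e S i x else 0
       else if e' < e - S \<and> i < 2 ^ (H - S - e') then wave.f3 H (Pf b) e S e' i x else 0
     else 0)" for x
    unfolding Fam_def Let_def i_def r_def e'_def h_def r3_def b_def f_def e_def S_def ..
  have b2: "b < 2" by (simp add: b_def)
  consider "\<And>x. Fam H a G Pf z x = 0" | "e < H" "Fam H a G Pf z = wave.f1 H (Pf b) e S i"
    | "e < H" "Fam H a G Pf z = wave.f2 H (Pf b) e S i"
    | "e < H" "e' < e - S" "Fam H a G Pf z = wave.f3 H (Pf b) e S e' i"
  proof -
    consider "e < H" "f = 0" "i < 2 ^ (H - e)" | "e < H" "f = 1" "i < 2 ^ (H - S)"
      | "e < H" "f \<noteq> 0" "f \<noteq> 1" "e' < e - S" "i < 2 ^ (H - S - e')"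
      | "\<not> e < H" | "f = 0" "\<not> i < 2 ^ (H - e)" | "f = 1" "\<not> i < 2 ^ (H - S)"
      | "f \<noteq> 0" "f \<noteq> 1" "\<not> (e' < e - S \<and> i < 2 ^ (H - S - e'))" by blast
    then show thesis
    proof cases
      case 1
      then show thesis using that(2) by (simp add: fun_eq_iff eq)
    next
      case 2
      then show thesis using that(3) by (simp add: fun_eq_iff eq)
    next
      case 3
      then show thesis using that(4) by (simp add: fun_eq_iff eq)
    qed (use that(1) eq in auto)
  qed
  then show thesis using that b2 by cases auto
qed

lemma mono_Fam: "mono (Fam H a G Pf z)"
proof (cases z rule: Fam_cases)
  case zero
  then show ?thesis by (intro monoI) simp
qed (use waveP wave.mono_f1 wave.mono_f2 wave.mono_f3 in auto)

lemma Fam_0: "Fam H a G Pf z 0 = 0"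
  by (cases z rule: Fam_cases) (use waveP wave.f1_0 wave.f2_0 wave.f3_0 in auto)

lemma Fam_le: "Fam H a G Pf z x \<le> 2 ^ H"
proof (cases z rule: Fam_cases)
  case (one b e S v)
  have "Fam H a G Pf z x \<le> 2 ^ (e - S) - 1" unfolding one(3) by (rule wave.f1_le[OF waveP[OF one(1)]])
  also have "\<dots> \<le> 2 ^ (e - S)" by simp
  also have "\<dots> \<le> 2 ^ H" using one(2) by (intro power_increasing) auto
  finally show ?thesis .
next
  case (two b e S v)
  have "Fam H a G Pf z x \<le> e - S" unfolding two(3) by (rule wave.f2_le[OF waveP[OF two(1)]])
  also have "\<dots> \<le> H" using two(2) by simp
  also have "\<dots> \<le> 2 ^ H" using less_exp[of H] by simp
  finally show ?thesis .
next
  case (three b e S e' v)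
  have "Fam H a G Pf z x \<le> 2 ^ e'" unfolding three(4) by (rule wave.f3_le[OF waveP[OF three(1)]])
  also have "\<dots> \<le> 2 ^ H" using three(2,3) by (intro power_increasing) auto
  finally show ?thesis .
qed simp

text \<open>With blocks of \<open>2 ^ S\<close> positions, \<open>f1\<close> has
  \<open>2 ^ (H - e)\<close> nodes with \<open>2 ^ (e - S)\<close> blocks each, \<open>f2\<close>
  has \<open>2 ^ (H - S)\<close> blocks with values up to \<open>H\<close>, and \<open>f3\<close>
  has \<open>2 ^ (H - S - e')\<close> groups of \<open>2 ^ e'\<close> blocks. In each case the
  values sum to at most \<open>(H + 1) * 2 ^ (H - S)\<close>.\<close>

lemma sum_Fam_tag:
  assumes "b < 2" "h \<le> H" "e' \<le> H"
  shows "(\<Sum>i<2 ^ H. Fam H a G Pf (mkid H f b h e' i) x) * 2 ^ (a * G) \<le> (H + 1) * 2 ^ H"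
proof (cases "a * h < H \<and> a * G < a * h")
  \<comment> \<open>Either the height is out of range or a node is a single block, and then all
    functions vanish.\<close>
  case False
  have "Fam H a G Pf (mkid H f b h e' i) x = 0" if "i < 2 ^ H" for i
  proof (cases "a * h < H")
    case True
    then have S: "shf a G h = a * h" using False by (auto simp: shf_def min_def)
    note w = waveP[OF assms(1)]
    have "wave.f1 H (Pf b) (a * h) (a * h) i x = 0" "wave.f2 H (Pf b) (a * h) (a * h) i x = 0"
      using wave.f1_le[OF w, of "a * h" "a * h" i x] wave.f2_le[OF w, of "a * h" "a * h" i x] by auto
    then show ?thesis unfolding Fam_def Let_def mkid_parts[OF assms that] S by simp
  next
    case False
    then show ?thesis unfolding Fam_def Let_def mkid_parts[OF assms that] by simp
  qed
  then show ?thesis by simp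
next
  case True
  then have S: "shf a G h = a * G" by (auto simp: shf_def min_def)
  define e S' where "e = a * h" and "S' = a * G"
  have eS: "S' < e" "e < H" using True by (auto simp: e_def S'_def)
  note w = waveP[OF assms(1)]
  have pw: "2 ^ H = 2 ^ (H - S') * (2::nat) ^ S'" using eS by (simp flip: power_add)
  have bound: "(\<Sum>i<2 ^ H. Fam H a G Pf (mkid H f b h e' i) x) \<le> (H + 1) * 2 ^ (H - S')"
  proof -
    consider "f = 0" | "f = 1" | "f \<noteq> 0" "f \<noteq> 1" by blast
    then show ?thesis
    proof cases
      case 1
      have "(\<Sum>i<2 ^ H. Fam H a G Pf (mkid H f b h e' i) x) \<le> (\<Sum>i<(2::nat) ^ H. if i < 2 ^ (H - e) then 2 ^ (e - S') else 0)"
      proof (rule sum_mono)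
        fix i assume "i \<in> {..<(2::nat) ^ H}"
        then have i: "i < 2 ^ H" by simp
        have "wave.f1 H (Pf b) e S' i x \<le> 2 ^ (e - S')" using wave.f1_le[OF w, of e S' i x] by linarith
        then show "Fam H a G Pf (mkid H f b h e' i) x \<le> (if i < 2 ^ (H - e) then 2 ^ (e - S') else 0)"
          unfolding Fam_def Let_def mkid_parts[OF assms i] S using 1 eS by (simp add: e_def S'_def)
      qed
      also have "\<dots> = 2 ^ (H - e) * 2 ^ (e - S')" by (rule sum_prefix_const) (simp add: power_increasing)
      also have "\<dots> = 2 ^ (H - S')" using eS by (simp flip: power_add)
      finally show ?thesis by simp
    next
      case 2
      have "(\<Sum>i<2 ^ H. Fam H a G Pf (mkid H f b h e' i) x) \<le> (\<Sum>i<(2::nat) ^ H. if i < 2 ^ (H - S') then H + 1 else 0)"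
      proof (rule sum_mono)
        fix i assume "i \<in> {..<(2::nat) ^ H}"
        then have i: "i < 2 ^ H" by simp
        have "wave.f2 H (Pf b) e S' i x \<le> H + 1" using wave.f2_le[OF w, of e S' i x] eS by linarith
        then show "Fam H a G Pf (mkid H f b h e' i) x \<le> (if i < 2 ^ (H - S') then H + 1 else 0)"
          unfolding Fam_def Let_def mkid_parts[OF assms i] S using 2 eS by (simp add: e_def S'_def)
      qed
      also have "\<dots> = 2 ^ (H - S') * (H + 1)" by (rule sum_prefix_const) (simp add: power_increasing)
      finally show ?thesis by (simp add: mult.commute)
    next
      case 3
      have "(\<Sum>i<2 ^ H. Fam H a G Pf (mkid H f b h e' i) x) \<le>
          (\<Sum>i<(2::nat) ^ H. if i < 2 ^ (H - S' - e') then (if e' < e - S' then 2 ^ e' else 0) else 0)"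
      proof (rule sum_mono)
        fix i assume "i \<in> {..<(2::nat) ^ H}"
        then have i: "i < 2 ^ H" by simp
        have "wave.f3 H (Pf b) e S' e' i x \<le> 2 ^ e'" using wave.f3_le[OF w, of e S' e' i x] .
        then show "Fam H a G Pf (mkid H f b h e' i) x \<le> (if i < 2 ^ (H - S' - e') then (if e' < e - S' then 2 ^ e' else 0) else 0)"
          unfolding Fam_def Let_def mkid_parts[OF assms i] S using 3 eS by (simp add: e_def S'_def)
      qed
      also have "\<dots> = 2 ^ (H - S' - e') * (if e' < e - S' then 2 ^ e' else 0)"
        by (rule sum_prefix_const) (simp add: power_increasing)
      also have "\<dots> \<le> 2 ^ (H - S')"
      proof (cases "e' < e - S'")
        case True
        then have "2 ^ (H - S' - e') * 2 ^ e' = (2::nat) ^ (H - S')" using eS by (simp flip: power_add)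
        then show ?thesis using True by simp
      qed simp
      finally show ?thesis by simp
    qed
  qed
  have "(\<Sum>i<2 ^ H. Fam H a G Pf (mkid H f b h e' i) x) * 2 ^ S' \<le> (H + 1) * 2 ^ (H - S') * 2 ^ S'"
    using bound by (rule mult_le_mono1)
  also have "\<dots> = (H + 1) * 2 ^ H" by (simp only: pw mult.assoc)
  finally show ?thesis by (simp add: S'_def)
qed

lemma sum_Fam: "(\<Sum>z<6 * (H + 1) * (H + 1) * 2 ^ H. Fam H a G Pf z x) * 2 ^ (a * G) \<le> 6 * (H + 1) ^ 3 * 2 ^ H"
proof -
  have "(\<Sum>z<6 * (H + 1) * (H + 1) * 2 ^ H. Fam H a G Pf z x) * 2 ^ (a * G) =
     (\<Sum>fb<6. \<Sum>h<H + 1. \<Sum>e'<H + 1. \<Sum>i<2 ^ H. Fam H a G Pf (((fb * (H + 1) + h) * (H + 1) + e') * 2 ^ H + i) x) * 2 ^ (a * G)"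
    unfolding sum_nested[of _ "6 * (H + 1) * (H + 1)"] sum_nested[of _ "6 * (H + 1)"] sum_nested[of _ 6] ..
  also have "\<dots> = (\<Sum>fb<6. \<Sum>h<H + 1. \<Sum>e'<H + 1. (\<Sum>i<2 ^ H. Fam H a G Pf (((fb * (H + 1) + h) * (H + 1) + e') * 2 ^ H + i) x) * 2 ^ (a * G))"
    by (simp only: sum_distrib_right)
  also have "\<dots> \<le> (\<Sum>fb<(6::nat). \<Sum>h<H + 1. \<Sum>e'<H + 1. (H + 1) * 2 ^ H)"
  proof (intro sum_mono)
    fix fb h e' assume "fb \<in> {..<(6::nat)}" "h \<in> {..<H + 1}" "e' \<in> {..<H + 1}"
    then have he: "h \<le> H" "e' \<le> H" by auto
    have m: "((fb * (H + 1) + h) * (H + 1) + e') * 2 ^ H + i = mkid H (fb div 2) (fb mod 2) h e' i" for i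
      unfolding mkid_def by simp
    show "(\<Sum>i<2 ^ H. Fam H a G Pf (((fb * (H + 1) + h) * (H + 1) + e') * 2 ^ H + i) x) * 2 ^ (a * G) \<le> (H + 1) * 2 ^ H"
      unfolding m by (rule sum_Fam_tag) (use he in auto)
  qed
  also have "\<dots> = 6 * (H + 1) ^ 3 * 2 ^ H" by (rule cube_sum)
  finally show ?thesis .
qed

text \<open>Of the factor \<open>(H + 2) ^ 5\<close> gained by long blocks, three powers cover the
  heights, the group sizes and the values of \<open>f2\<close>, and the fourth the ancestors of a
  break in its trie. The fifth remains in the conclusion: it allows about \<open>2 ^ H / H\<close>
  slots on each level of the dictionary, so that all levels together stay linear.\<close>

lemma card_keyset_Fam:
  assumes "(H + 2) ^ 5 \<le> 2 ^ (a * G)"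
  defines "K \<equiv> keyset H (6 * (H + 1) * (H + 1) * 2 ^ H) (Fam H a G Pf)"
  shows "finite K" "card K * (H + 2) \<le> 6 * 2 ^ H"
proof -
  note c = card_keyset[of "Fam H a G Pf" H "6 * (H + 1) * (H + 1) * 2 ^ H", OF mono_Fam, folded K_def]
  show "finite K" by (rule c)
  have "card K * 2 ^ (a * G) \<le> (H + 2) * (\<Sum>i<6 * (H + 1) * (H + 1) * 2 ^ H. Fam H a G Pf i (2 ^ (H + 1))) * 2 ^ (a * G)"
    using c(2) by (rule mult_le_mono1)
  also have "\<dots> \<le> (H + 2) * (6 * (H + 1) ^ 3 * 2 ^ H)"
    unfolding mult.assoc using sum_Fam[of "2 ^ (H + 1)"] by (intro mult_le_mono2) (simp only: mult.assoc)
  also have "\<dots> \<le> (H + 2) * (6 * (H + 2) ^ 3 * 2 ^ H)"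
    by (intro mult_le_mono2 mult_le_mono1 power_mono) auto
  also have "\<dots> = (H + 2) ^ 4 * (6 * 2 ^ H)" by (rule pow_shift(1))
  finally have 1: "card K * 2 ^ (a * G) \<le> (H + 2) ^ 4 * (6 * 2 ^ H)" .
  have "card K * (H + 2) ^ 5 \<le> card K * 2 ^ (a * G)" using assms(1) by (rule mult_le_mono2)
  then have "card K * (H + 2) ^ 5 \<le> (H + 2) ^ 4 * (6 * 2 ^ H)" using 1 by linarith
  moreover have "card K * (H + 2) ^ 5 = (H + 2) ^ 4 * (card K * (H + 2))" by (rule pow_shift(2))
  ultimately have "(H + 2) ^ 4 * (card K * (H + 2)) \<le> (H + 2) ^ 4 * (6 * 2 ^ H)" by simp
  then show "card K * (H + 2) \<le> 6 * 2 ^ H" by (simp only: mult_le_cancel1) simp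
qed

end

text \<open>Each of the \<open>J\<close> possible values \<open>D ^ i\<close> of \<open>kf D\<close> contributes at most \<open>m\<close>.\<close>

lemma sum_kf:
  assumes D: "2 \<le> D" and J: "m < D ^ J"
  shows "(\<Sum>h = 1..m. kf D h) \<le> J * m"
proof -
  have le: "kf D h \<le> (\<Sum>i<J. if D ^ i dvd h then D ^ i else 0)" if "h \<in> {1..m}" for h
  proof -
    have h: "0 < h" "h \<le> m" using that by auto
    obtain i where i: "kf D h = D ^ i" using kf_step(5)[OF D h(1)] by blast
    have "D ^ i < D ^ J" using kf_step(2)[OF D h(1)] i h(2) J by linarith
    then have "i < J" using D by (simp add: power_less_imp_less_exp)
    moreover have "D ^ i dvd h" using kf_step(4)[OF D h(1)] i by simp
    ultimately have "(if D ^ i dvd h then D ^ i else 0) \<le> (\<Sum>i<J. if D ^ i dvd h then D ^ i else 0)"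
      by (intro member_le_sum) auto
    then show ?thesis using i \<open>D ^ i dvd h\<close> by simp
  qed
  have cls: "(\<Sum>h = 1..m. if D ^ i dvd h then D ^ i else 0) \<le> m" for i
  proof -
    have p: "0 < D ^ i" using D by simp
    have "(\<Sum>h = 1..m. if D ^ i dvd h then D ^ i else 0) = card {h \<in> {1..m}. D ^ i dvd h} * D ^ i"
      by (simp flip: sum.inter_filter)
    note first = this
    have "{h \<in> {1..m}. D ^ i dvd h} \<subseteq> (\<lambda>q. D ^ i * q) ` {1..m div D ^ i}"
    proof
      fix h assume "h \<in> {h \<in> {1..m}. D ^ i dvd h}"
      then have h: "D ^ i dvd h" "1 \<le> h" "h \<le> m" by auto
      obtain q where "h = D ^ i * q" using h(1) by (rule dvdE)
      note q = this h(2,3)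
      then have "1 \<le> q" by (cases q) auto
      moreover have "q \<le> m div D ^ i" using q p by (simp add: less_eq_div_iff_mult_less_eq mult.commute)
      ultimately show "h \<in> (\<lambda>q. D ^ i * q) ` {1..m div D ^ i}" using q by auto
    qed
    then have "card {h \<in> {1..m}. D ^ i dvd h} \<le> card ((\<lambda>q. D ^ i * q) ` {1..m div D ^ i})" by (intro card_mono) auto
    also have "\<dots> \<le> m div D ^ i" using card_image_le[of "{1..m div D ^ i}" "\<lambda>q. D ^ i * q"] by simp
    finally have "card {h \<in> {1..m}. D ^ i dvd h} * D ^ i \<le> m div D ^ i * D ^ i" by (rule mult_le_mono1)
    also have "\<dots> \<le> m" by (rule div_times_less_eq_dividend)
    finally show ?thesis using first by simp
  qed
  have "(\<Sum>h = 1..m. kf D h) \<le> (\<Sum>h = 1..m. \<Sum>i<J. if D ^ i dvd h then D ^ i else 0)" using le by (intro sum_mono)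
  also have "\<dots> = (\<Sum>i<J. \<Sum>h = 1..m. if D ^ i dvd h then D ^ i else 0)" by (rule sum.swap)
  also have "\<dots> \<le> (\<Sum>i<J. m)" using cls by (intro sum_mono)
  finally show ?thesis by simp
qed

lemma sum_half_pow: "(\<Sum>i<(n::nat). (1/2::real) ^ i) \<le> 2"
proof -
  have "(\<Sum>i<n. (1/2::real) ^ i) = 2 - 2 * (1/2) ^ n" by (induction n) (auto simp: field_simps)
  then show ?thesis by simp
qed

text \<open>For a fixed value \<open>D ^ i\<close> of \<open>kf\<close> the exponents
  \<open>h - D ^ i\<close> are distinct, so the terms are part of a geometric series with sum at
  most 2. This bounds the base tables of those heights at which a block is limited by its
  node.\<close>

lemma sum_kf_half:
  assumes D: "2 \<le> D" and J: "m < D ^ J"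
  shows "(\<Sum>h = 1..m. (1/2::real) ^ (h - kf D h)) \<le> 2 * real J"
proof -
  have le: "(1/2::real) ^ (h - kf D h) \<le> (\<Sum>i<J. if D ^ i \<le> h then (1/2::real) ^ (h - D ^ i) else 0)" if "h \<in> {1..m}" for h
  proof -
    have h: "0 < h" "h \<le> m" using that by auto
    obtain i where i: "kf D h = D ^ i" using kf_step(5)[OF D h(1)] by blast
    have Dh: "D ^ i \<le> h" using kf_step(2)[OF D h(1)] i by simp
    then have "D ^ i < D ^ J" using h(2) J by linarith
    then have "i < J" using D by (simp add: power_less_imp_less_exp)
    then have "(if D ^ i \<le> h then (1/2::real) ^ (h - D ^ i) else 0) \<le> (\<Sum>i<J. if D ^ i \<le> h then (1/2::real) ^ (h - D ^ i) else 0)"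
      by (intro member_le_sum) auto
    then show ?thesis using i Dh by simp
  qed
  have cls: "(\<Sum>h = 1..m. if q \<le> h then (1/2::real) ^ (h - q) else 0) \<le> 2" for q
  proof -
    have "(\<Sum>h = 1..m. if q \<le> h then (1/2::real) ^ (h - q) else 0) = (\<Sum>h\<in>{h \<in> {1..m}. q \<le> h}. (1/2::real) ^ (h - q))"
      by (rule sum.inter_filter[symmetric]) simp
    also have "\<dots> = (\<Sum>i\<in>(\<lambda>h. h - q) ` {h \<in> {1..m}. q \<le> h}. (1/2::real) ^ i)"
      by (subst sum.reindex) (auto simp: inj_on_def)
    also have "\<dots> \<le> (\<Sum>i<Suc m. (1/2::real) ^ i)" by (intro sum_mono2) auto
    also have "\<dots> \<le> 2" by (rule sum_half_pow)
    finally show ?thesis .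
  qed
  have "(\<Sum>h = 1..m. (1/2::real) ^ (h - kf D h)) \<le> (\<Sum>h = 1..m. \<Sum>i<J. if D ^ i \<le> h then (1/2::real) ^ (h - D ^ i) else 0)"
    using le by (intro sum_mono)
  also have "\<dots> = (\<Sum>i<J. \<Sum>h = 1..m. if D ^ i \<le> h then (1/2::real) ^ (h - D ^ i) else 0)" by (rule sum.swap)
  also have "\<dots> \<le> (\<Sum>i<J. 2)" using cls by (intro sum_mono)
  finally show ?thesis by simp
qed

section \<open>Construction of the memory\<close>

lemma exists_sorted_list:
  assumes "finite S"
  shows "\<exists>xs. distinct xs \<and> set xs = S \<and> sorted (map (f :: 'a \<Rightarrow> 'b::linorder) xs)"
proof -
  obtain l where "set l = S" "distinct l" using finite_distinct_list[OF assms] by blast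
  then show ?thesis by (intro exI[of _ "sort_key f l"]) simp
qed

lemma blen_power: "2 ^ k \<le> m \<Longrightarrow> m < 2 ^ (k + 1) \<Longrightarrow> blen m = k + 1"
proof (induction k arbitrary: m)
  case 0
  then have "m = Suc 0" by simp
  then show ?case by simp
next
  case (Suc k)
  have "blen (m div 2) = k + 1" using Suc.prems by (intro Suc.IH) auto
  moreover have "0 < m" using Suc.prems(1) by (cases m) auto
  ultimately show ?case by (simp add: blen_pos)
qed

lemma exp_ge_add2: "1 \<le> k \<Longrightarrow> k + 2 \<le> 2 ^ (k + 1)"
proof (induction k rule: dec_induct)
  case (step k)
  have "2 ^ (k + 1) \<ge> (1::nat)" by simp
  then show ?case using step.IH by simp
qed simp

lemma exp_ge_Suc: "k + 1 \<le> (2::nat) ^ k"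
  using Suc_leI[OF less_exp[of k]] by simp

locale build_points =
  fixes n w a :: nat and S :: "(nat \<times> nat) set" and xs ys :: "(nat \<times> nat) list"
  assumes S: "S \<subseteq> {1..n} \<times> {1..n}" "card S = n"
    and w: "40 * lg_bits n \<le> w"
    and a1: "1 \<le> a" and alam: "a \<le> ceillog2 (lg_bits n + 2)"
    and xs: "distinct xs" "set xs = S" "sorted (map fst xs)"
    and ys: "distinct ys" "set ys = S" "sorted (map snd ys)"
begin

definition "H = lg_bits n"
definition "lam = ceillog2 (H + 2)"
text \<open>\<open>a * G\<close> is at least \<open>5 * lam\<close>, hence full blocks have at least
  \<open>(H + 2) ^ 5\<close> positions.\<close>

definition "G = 5 * lam div a + 1"
text \<open>\<open>(2 ^ a) ^ J\<close> exceeds all heights, so \<open>J\<close> digits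
  suffice.\<close>

definition "J = lam div a + 1"
definition "hm = (H - 1) div a"
text \<open>Exceeds all keys: \<open>6 * (H + 1) ^ 2 * 2 ^ H\<close> functions, \<open>H + 2\<close>
  heights and \<open>2 ^ (H + 1)\<close> nodes multiply to at most
  \<open>2 ^ (5 * H + 5)\<close>.\<close>

definition "Q = (2::nat) ^ (10 * H)"
text \<open>Four slots per key: 24 is 4 times the constant 6 in the bound on
  \<open>card K * (H + 2)\<close>.\<close>

definition "R = 24 * 2 ^ H div (H + 2) + (1::nat)"
text \<open>\<open>2 ^ L\<close> is at least \<open>4 * (H + 2)\<close> and thus exceeds the
  exponent in \<open>R \<le> 2 ^ (H + 4)\<close>, as the dictionary requires.\<close>

definition "L = lam + 2"

text \<open>Sends a y-rank to the x-rank of the same point; the identity from \<open>n\<close> on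
  pads this to a permutation of \<open>2 ^ H\<close> numbers.\<close>

definition Px :: "nat \<Rightarrow> nat" where
  "Px y = (if y < n then SOME p. p < n \<and> xs ! p = ys ! y else y)"

definition Pf :: "nat \<Rightarrow> nat \<Rightarrow> nat" where
  "Pf b y = (if b = 0 then Px y else if y < 2 ^ H then Px (2 ^ H - 1 - y) else y)"

lemma H1: "1 \<le> H" by (simp add: H_def lg_bits_def)

lemma nH: "n \<le> 2 ^ H"
proof -
  have "n \<le> 2 ^ ceillog2 n" by (rule le_two_power_ceillog2)
  also have "\<dots> \<le> 2 ^ H" unfolding H_def lg_bits_def by (intro power_increasing) auto
  finally show ?thesis .
qed

lemma w40: "40 * H \<le> w" using w by (simp add: H_def)

lemma lam: "H + 2 \<le> 2 ^ lam" "lam \<le> H + 1" "2 \<le> lam" "a \<le> lam"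
proof -
  show "H + 2 \<le> 2 ^ lam" unfolding lam_def by (rule le_two_power_ceillog2)
  then have "2 < (2::nat) ^ lam" using H1 by linarith
  then have "(2::nat) ^ 1 < 2 ^ lam" by simp
  then show "2 \<le> lam" using power_less_imp_less_exp[of "2::nat" 1 lam] by simp
  show "lam \<le> H + 1" unfolding lam_def using exp_ge_add2[OF H1] by (subst ceillog2_le_iff) auto
  show "a \<le> lam" using alam by (simp add: lam_def H_def)
qed

lemma GJ: "5 * lam \<le> a * G" "a * G \<le> 6 * lam" "lam \<le> a * J" "G \<le> 6 * lam" "J \<le> lam + 1"
proof -
  have m: "a * (x div a) \<le> x" "x < a * (x div a) + a" for x
    using a1 by (simp, metis mult_div_mod_eq mod_less_divisor nat_add_left_cancel_less less_le_trans zero_less_one)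
  show "5 * lam \<le> a * G" using m(2)[of "5 * lam"] by (simp add: G_def)
  show 1: "a * G \<le> 6 * lam" using m(1)[of "5 * lam"] lam(4) unfolding G_def add_mult_distrib2 by linarith
  show "lam \<le> a * J" using m(2)[of lam] by (simp add: J_def)
  have "1 * G \<le> a * G" using a1 by (intro mult_le_mono1)
  then show "G \<le> 6 * lam" using 1 by linarith
  show "J \<le> lam + 1" by (simp add: J_def)
qed

lemma hmH: "h \<le> hm \<Longrightarrow> a * h \<le> H - 1" "h \<le> hm \<Longrightarrow> a * h < H" "h \<le> hm \<Longrightarrow> h < H"
proof -
  assume "h \<le> hm"
  then have "a * h \<le> a * hm" by simp
  also have "\<dots> \<le> H - 1" unfolding hm_def by simp
  finally show 1: "a * h \<le> H - 1" .
  then show 2: "a * h < H" using H1 by simp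
  have "1 * h \<le> a * h" using a1 by (intro mult_le_mono1)
  then show "h < H" using 2 by linarith
qed

lemma hmJ: "hm < (2 ^ a) ^ J"
proof -
  have "hm < H" by (rule hmH(3)) simp
  also have "H \<le> 2 ^ lam" using lam(1) by simp
  also have "\<dots> \<le> 2 ^ (a * J)" using GJ(3) by (intro power_increasing) auto
  finally show ?thesis by (simp add: power_mult)
qed

lemma len_xs: "length xs = n" using xs S by (metis distinct_card)
lemma len_ys: "length ys = n" using ys S by (metis distinct_card)

lemma Px: "y < n \<Longrightarrow> Px y < n \<and> xs ! Px y = ys ! y"
proof -
  assume y: "y < n"
  then have "ys ! y \<in> set xs" using nth_mem[of y ys] xs(2) ys(2) len_ys by simp
  then have "\<exists>p. p < n \<and> xs ! p = ys ! y" using len_xs by (metis in_set_conv_nth)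
  from someI_ex[OF this] show ?thesis using y by (simp add: Px_def)
qed

lemma Px_less: "y < 2 ^ H \<Longrightarrow> Px y < 2 ^ H"
  using Px[of y] nH by (cases "y < n") (auto simp: Px_def)

lemma inj_Px: "inj_on Px {..<2 ^ H}"
proof (rule inj_onI)
  fix x y assume e: "Px x = Px y"
  consider "x < n" "y < n" | "\<not> x < n" "\<not> y < n" | "x < n" "\<not> y < n" | "\<not> x < n" "y < n" by blast
  then show "x = y"
  proof cases
    case 1
    then have "ys ! x = ys ! y" using Px[of x] Px[of y] e by simp
    then show ?thesis using ys(1) 1 len_ys by (simp add: nth_eq_iff_index_eq)
  next
    case 2
    then show ?thesis using e by (simp add: Px_def)
  next
    case 3
    then have "Px y = y" "Px x < n" using Px[of x] by (simp_all add: Px_def)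
    then show ?thesis using e 3 by simp
  next
    case 4
    then have "Px x = x" "Px y < n" using Px[of y] by (simp_all add: Px_def)
    then show ?thesis using e 4 by simp
  qed
qed

lemma wave_Pf: "wave H (Pf b)"
proof
  have sub: "Pf b ` {..<2 ^ H} \<subseteq> {..<2 ^ H}"
  proof
    fix z assume "z \<in> Pf b ` {..<2 ^ H}"
    then obtain y where y: "y < 2 ^ H" "z = Pf b y" by auto
    then have "2 ^ H - 1 - y < (2::nat) ^ H" by simp
    then show "z \<in> {..<2 ^ H}" using y Px_less by (auto simp: Pf_def)
  qed
  have inj: "inj_on (Pf b) {..<2 ^ H}"
  proof (rule inj_onI)
    fix x y :: nat assume *: "x \<in> {..<2 ^ H}" "y \<in> {..<2 ^ H}" "Pf b x = Pf b y"
    show "x = y"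
    proof (cases "b = 0")
      case True
      then show ?thesis using * inj_onD[OF inj_Px] by (auto simp: Pf_def)
    next
      case False
      then have "Px (2 ^ H - 1 - x) = Px (2 ^ H - 1 - y)" using * by (simp add: Pf_def)
      then have "2 ^ H - 1 - x = 2 ^ H - 1 - y" by (rule inj_onD[OF inj_Px]) (use * in auto)
      then show ?thesis using * by simp
    qed
  qed
  show "bij_betw (Pf b) {..<2 ^ H} {..<2 ^ H}"
    using inj sub by (simp add: bij_betw_def endo_inj_surj)
qed

lemma Pf_less: "y < 2 ^ H \<Longrightarrow> Pf b y < 2 ^ H"
  using wave.bij[OF wave_Pf[of b]] by (auto simp: bij_betw_def)

definition "K = keyset H (6 * (H + 1) * (H + 1) * 2 ^ H) (Fam H a G Pf)"

lemma IQ: "6 * (H + 1) * (H + 1) * 2 ^ H * (H + 2) * 2 ^ (H + 1) \<le> Q"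
proof -
  have h: "H + 1 \<le> 2 ^ H" by (rule exp_ge_Suc)
  have "6 * (H + 1) * (H + 1) * 2 ^ H * (H + 2) * 2 ^ (H + 1) \<le> 2 ^ 3 * 2 ^ H * 2 ^ H * 2 ^ H * 2 ^ (H + 1) * 2 ^ (H + 1)"
    by (intro mult_le_mono h exp_ge_add2[OF H1]) auto
  also have "\<dots> = 2 ^ (3 + H + H + H + (H + 1) + (H + 1))" by (simp only: power_add)
  also have "\<dots> \<le> 2 ^ (10 * H)" using H1 by (intro power_increasing) auto
  finally show ?thesis by (simp only: Q_def)
qed

lemma K: "finite K" "card K * (H + 2) \<le> 6 * 2 ^ H" "K \<subseteq> {..<Q}"
proof -
  have "(H + 2) ^ 5 \<le> (2 ^ lam) ^ 5" using lam(1) by (intro power_mono) auto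
  also have "\<dots> = 2 ^ (5 * lam)" by (simp flip: power_mult add: mult.commute)
  also have "\<dots> \<le> 2 ^ (a * G)" using GJ(1) by (intro power_increasing) auto
  finally have "(H + 2) ^ 5 \<le> 2 ^ (a * G)" .
  then show "finite K" "card K * (H + 2) \<le> 6 * 2 ^ H"
    unfolding K_def using card_keyset_Fam[of H Pf a G, OF wave_Pf] by blast+
  show "K \<subseteq> {..<Q}" unfolding K_def by (rule keyset_less[OF IQ])
qed

lemma R: "0 < R" "4 * card K \<le> R" "R \<le> 2 ^ (H + 4)" "R < 2 ^ (2 ^ L)" "(H + 2) * R \<le> 24 * 2 ^ H + (H + 2)"
proof -
  show "0 < R" by (simp add: R_def)
  have "4 * card K * (H + 2) \<le> 24 * 2 ^ H" using K(2) by simp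
  then have "4 * card K \<le> 24 * 2 ^ H div (H + 2)" by (subst less_eq_div_iff_mult_less_eq) auto
  then show "4 * card K \<le> R" by (simp add: R_def)
  have "24 * 2 ^ H div (H + 2) \<le> 24 * 2 ^ H div (3::nat)" using H1 by (intro div_le_mono2) auto
  also have "\<dots> = 8 * 2 ^ H" by simp
  finally have "R \<le> 8 * 2 ^ H + 1" by (simp add: R_def)
  also have "\<dots> \<le> 2 ^ (H + 4)" by (simp add: power_add)
  finally show 1: "R \<le> 2 ^ (H + 4)" .
  have "H + 4 < 4 * 2 ^ lam" using lam(1) by simp
  also have "\<dots> = 2 ^ L" by (simp add: L_def power_add)
  finally have "(2::nat) ^ (H + 4) < 2 ^ (2 ^ L)" by (intro power_strict_increasing) auto
  then show "R < 2 ^ (2 ^ L)" using 1 by linarith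
  have "(H + 2) * (24 * 2 ^ H div (H + 2)) \<le> 24 * 2 ^ H" by (rule times_div_less_eq_dividend)
  then show "(H + 2) * R \<le> 24 * 2 ^ H + (H + 2)" by (simp only: R_def add_mult_distrib2 mult_1_right)
qed

lemma exists_tables:
  "\<exists>am tab. (\<forall>i<L. am i < Q * R) \<and> (\<forall>i s. tab i s = 0 \<or> tab i s - 1 \<in> K) \<and>
     (\<forall>x\<in>K. \<exists>i<L. tab i (hsh Q R (am i) x) = Suc x)"
  by (rule exists_dictionary) (use K R in \<open>auto simp: Q_def\<close>)

end

lemma nth_append_shift: "i < m \<Longrightarrow> length ls = k \<Longrightarrow> (ls @ map g [0..<m]) ! (k + i) = g i"
  by (simp add: nth_append)

lemma mod6: "(6 * h + 3 * b + c) div 6 = h" "(6 * h + 3 * b + c) mod 6 div 3 = b" "(6 * h + 3 * b + c) mod 3 = c"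
  if "b < 2" "c < 3" for h b c :: nat
proof -
  have x: "3 * b + c < 6" using that by simp
  have e: "6 * h + 3 * b + c = h * 6 + (3 * b + c)" by simp
  show "(6 * h + 3 * b + c) div 6 = h" unfolding e using mult_plus_parts[OF x] by blast
  have "(6 * h + 3 * b + c) mod 6 = b * 3 + c" unfolding e using mult_plus_parts[OF x] by simp
  then show "(6 * h + 3 * b + c) mod 6 div 3 = b" using mult_plus_parts[OF that(2)] by simp
  have e3: "6 * h + 3 * b + c = (2 * h + b) * 3 + c" by simp
  show "(6 * h + 3 * b + c) mod 3 = c" unfolding e3 using mult_plus_parts[OF that(2)] by blast
qed

text \<open>For \<open>h = (H - 1) div a\<close> the shift by \<open>a * (h + 1)\<close> bits is a
  shift by at least \<open>H\<close>, so the least such \<open>h\<close> lies within the range of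
  heights.\<close>

lemma exists_level:
  fixes a x :: nat
  assumes "1 \<le> a" "x < 2 ^ H" "1 \<le> H"
  defines "h \<equiv> LEAST h. x div 2 ^ (a * (h + 1)) = 0"
  shows "h \<le> (H - 1) div a \<and> x div 2 ^ (a * (h + 1)) = 0 \<and> (h = 0 \<or> x div 2 ^ (a * h) \<noteq> 0)"
proof -
  let ?P = "\<lambda>h. x div 2 ^ (a * (h + 1)) = 0"
  have "H \<le> a * ((H - 1) div a + 1)"
  proof -
    have "(H - 1) mod a < a" using assms(1) by simp
    moreover have "a * ((H - 1) div a) + (H - 1) mod a = H - 1" by (rule mult_div_mod_eq)
    ultimately show ?thesis using assms(3) unfolding add_mult_distrib2 by linarith
  qed
  then have "(2::nat) ^ H \<le> 2 ^ (a * ((H - 1) div a + 1))" by (intro power_increasing) auto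
  then have P: "?P ((H - 1) div a)" using assms(2) by (intro div_less) linarith
  have 1: "?P h" unfolding h_def by (rule LeastI[of ?P, OF P])
  have 2: "h \<le> (H - 1) div a" unfolding h_def by (rule Least_le[of ?P, OF P])
  have 3: "h = 0 \<or> x div 2 ^ (a * h) \<noteq> 0"
  proof (cases h)
    case (Suc k)
    then have "\<not> ?P k" using not_less_Least[of k ?P] by (simp add: h_def)
    then show ?thesis using Suc by simp
  qed simp
  show ?thesis using 1 2 3 by blast
qed

section \<open>The arrays and their layout\<close>

locale build = build_points n w a S xs ys
  for n w a :: nat and S and xs ys +
  fixes am :: "nat \<Rightarrow> nat" and tab :: "nat \<Rightarrow> nat \<Rightarrow> nat"
  assumes am: "i < L \<Longrightarrow> am i < Q * R"
    and tab: "tab i s = 0 \<or> tab i s - 1 \<in> K"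
    and tabK: "x \<in> K \<Longrightarrow> \<exists>i<L. tab i (hsh Q R (am i) x) = Suc x"
begin

definition fixed :: "nat list list" where
  "fixed = [[2 ^ H, H, a, n, R, Q, Q * R, L],
     map (\<lambda>x. card {i. i < n \<and> fst (xs ! i) < x}) [0..<n + 2],
     map (\<lambda>x. card {i. i < n \<and> snd (ys ! i) < x}) [0..<n + 2],
     map fst xs, map snd xs,
     map (\<lambda>x. LEAST h. x div 2 ^ (a * (h + 1)) = 0) [0..<2 ^ H],
     map (Pf 0) [0..<2 ^ H], map (Pf 1) [0..<2 ^ H],
     map (\<lambda>h. h - kf (2 ^ a) h) [0..<hm + 1], map (kkf a) [0..<hm + 1],
     map (ebf a lam) [0..<hm + 1], map (shf a G) [0..<hm + 1],
     map am [0..<L],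
     map (\<lambda>z. tab (z div R) (z mod R)) [0..<L * R],
     map (\<lambda>z. if tab (z div R) (z mod R) = 0 then 0 else plo H (Fam H a G Pf) (tab (z div R) (z mod R) - 1)) [0..<L * R],
     map (\<lambda>z. if tab (z div R) (z mod R) = 0 then 0 else phi H (Fam H a G Pf) (tab (z div R) (z mod R) - 1)) [0..<L * R]]"

text \<open>Slot \<open>i\<close> of the array of maxima belongs to the block of length \<open>2 ^ r\<close> whose number is \<open>i\<close> without its leading bit.\<close>

definition hv :: "nat \<Rightarrow> nat \<Rightarrow> nat \<Rightarrow> nat" where
  "hv b h i = (let r = H + 1 - blen i in if r \<le> a * G then wave.amax H (Pf b) (a * h) r (i - 2 ^ (H - r)) else 0)"

text \<open>The width is that of a child number and an offset. Height 0 has no jumps but keeps its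
  place in the numbering of the arrays, with an empty array whose width only has to be
  positive.\<close>

definition recs :: "nat \<Rightarrow> nat \<Rightarrow> nat \<times> nat list" where
  "recs h b = (if h = 0 then (1, []) else
     (kkf a h + ebf a lam h, map (wave.jrec H (Pf b) (a * h) (kkf a h) (ebf a lam h)) [0..<2 ^ H]))"

definition bases :: "nat \<Rightarrow> nat \<Rightarrow> nat \<times> nat list" where
  "bases h b = (20 * H, if h = 0 then [] else
     map (\<lambda>z. wave.jbase H (Pf b) (a * h) (kkf a h) (ebf a lam h) (z div 2 ^ kkf a h) (z mod 2 ^ kkf a h))
       [0..<2 ^ (H - ebf a lam h) * 2 ^ kkf a h])"

definition maxs :: "nat \<Rightarrow> nat \<Rightarrow> nat \<times> nat list" where
  "maxs h b = (a * G + 1, map (hv b h) [0..<2 * 2 ^ H])"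

definition leveled :: "nat \<Rightarrow> nat \<times> nat list" where
  "leveled i = (let h = i div 6; b = i mod 6 div 3; c = i mod 3 in
     if c = 0 then recs h b else if c = 1 then bases h b else maxs h b)"

definition "arrays = map (Pair (20 * H)) fixed @ map leveled [0..<6 * (hm + 1)]"

lemma length_fixed: "length fixed = 16" by (simp add: fixed_def)

lemma arrays_fixed: "i < 16 \<Longrightarrow> map snd arrays ! i = fixed ! i"
  by (simp add: arrays_def nth_append length_fixed comp_def)

lemma arrays_leveled:
  assumes "h \<le> hm" "b < 2" "c < 3"
  shows "map snd arrays ! (16 + c + 6 * h + 3 * b) = snd (if c = 0 then recs h b else if c = 1 then bases h b else maxs h b)"
proof -
  have l: "6 * h + 3 * b + c < 6 * (hm + 1)" using assms by simp
  have e: "16 + c + 6 * h + 3 * b = 16 + (6 * h + 3 * b + c)" by simp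
  have "map snd arrays ! (16 + c + 6 * h + 3 * b) = snd (arrays ! (16 + (6 * h + 3 * b + c)))"
    unfolding e using l by (intro nth_map) (simp add: arrays_def length_fixed)
  also have "arrays ! (16 + (6 * h + 3 * b + c)) = leveled (6 * h + 3 * b + c)"
    unfolding arrays_def using l by (intro nth_append_shift) (simp_all add: length_fixed)
  also have "\<dots> = (if c = 0 then recs h b else if c = 1 then bases h b else maxs h b)"
    unfolding leveled_def Let_def mod6[OF assms(2,3)] ..
  finally show ?thesis .
qed

lemma kk: "0 < h \<Longrightarrow> h \<le> hm \<Longrightarrow> kkf a h \<le> a * h" "0 < h \<Longrightarrow> 0 < kkf a h" "ebf a lam h \<le> a * h"
proof -
  have D: "2 \<le> (2::nat) ^ a" using a1 power_increasing[of 1 a "2::nat"] by simp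
  show "0 < h \<Longrightarrow> h \<le> hm \<Longrightarrow> kkf a h \<le> a * h" using kf_step(2)[OF D] by (simp add: kkf_def)
  show "0 < h \<Longrightarrow> 0 < kkf a h" using kf_step(1)[OF D] a1 by (simp add: kkf_def)
  show "ebf a lam h \<le> a * h" by (simp add: ebf_def)
qed

lemma hv_eq:
  assumes "h \<le> hm" "r \<le> shf a G h" "q < 2 ^ (H - r)"
  shows "hv b h (2 ^ (H - r) + q) = wave.amax H (Pf b) (a * h) r q" "2 ^ (H - r) + q < 2 * 2 ^ H"
proof -
  have r1: "r \<le> a * h" "r \<le> a * G" using assms(2) by (auto simp: shf_def min_def split: if_splits intro: order_trans)
  then have rH: "r \<le> H" using hmH(2)[OF assms(1)] by linarith
  have "blen (2 ^ (H - r) + q) = H - r + 1" using assms(3) by (intro blen_power) auto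
  then have "H + 1 - blen (2 ^ (H - r) + q) = r" using rH by simp
  then show "hv b h (2 ^ (H - r) + q) = wave.amax H (Pf b) (a * h) r q" using r1 by (simp add: hv_def)
  have "(2::nat) ^ (H - r) \<le> 2 ^ H" by (intro power_increasing) auto
  then show "2 ^ (H - r) + q < 2 * 2 ^ H" using assms(3) by linarith
qed

text \<open>The products formed in hashing stay below \<open>2 ^ (21 * H + 4)\<close>, well within a
  word of \<open>40 * H\<close> bits.\<close>

lemma Pow_bounds: "Q * R * Q \<le> 2 ^ w" "L * R < 2 ^ w" "Q < 2 ^ w" "Q * R < 2 ^ (20 * H)" "L \<le> 2 ^ (H + 2)"
proof -
  have "Q * R * Q \<le> 2 ^ (10 * H) * 2 ^ (H + 4) * 2 ^ (10 * H)" unfolding Q_def using R(3) by (intro mult_le_mono) auto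
  also have "\<dots> = 2 ^ (10 * H + (H + 4) + 10 * H)" by (simp only: power_add)
  also have "\<dots> \<le> 2 ^ w" using w40 H1 by (intro power_increasing) auto
  finally show "Q * R * Q \<le> 2 ^ w" .
  have "L \<le> H + 1 + 2" using lam(2) by (simp add: L_def)
  also have "\<dots> \<le> 2 ^ (H + 1 + 1)" by (rule exp_ge_add2) simp
  finally show L: "L \<le> 2 ^ (H + 2)" by simp
  then have "L * R \<le> 2 ^ (H + 2) * 2 ^ (H + 4)" using R(3) by (intro mult_le_mono)
  also have "\<dots> = 2 ^ (H + 2 + (H + 4))" by (simp only: power_add)
  also have "\<dots> < 2 ^ w" using w40 H1 by (intro power_strict_increasing) auto
  finally show "L * R < 2 ^ w" .
  show "Q < 2 ^ w" unfolding Q_def using w40 H1 by (intro power_strict_increasing) auto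
  have "Q * R \<le> 2 ^ (10 * H) * 2 ^ (H + 4)" unfolding Q_def using R(3) by (intro mult_le_mono) auto
  also have "\<dots> = 2 ^ (10 * H + (H + 4))" by (simp only: power_add)
  also have "\<dots> < 2 ^ (20 * H)" using H1 by (intro power_strict_increasing) auto
  finally show "Q * R < 2 ^ (20 * H)" .
qed

lemma LR_index: "i < L \<Longrightarrow> s < R \<Longrightarrow> i * R + s < L * R"
proof -
  assume "i < L" "s < R"
  then have "i * R + s < (i + 1) * R" by simp
  also have "\<dots> \<le> L * R" using \<open>i < L\<close> by (intro mult_le_mono1) simp
  finally show ?thesis .
qed

lemma fixed_nth:
  "fixed ! 0 = [2 ^ H, H, a, n, R, Q, Q * R, L]"
  "fixed ! 1 = map (\<lambda>x. card {i. i < n \<and> fst (xs ! i) < x}) [0..<n + 2]"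
  "fixed ! 2 = map (\<lambda>x. card {i. i < n \<and> snd (ys ! i) < x}) [0..<n + 2]"
  "fixed ! 3 = map fst xs" "fixed ! 4 = map snd xs"
  "fixed ! 5 = map (\<lambda>x. LEAST h. x div 2 ^ (a * (h + 1)) = 0) [0..<2 ^ H]"
  "b < 2 \<Longrightarrow> fixed ! (6 + b) = map (Pf b) [0..<2 ^ H]"
  "fixed ! 8 = map (\<lambda>h. h - kf (2 ^ a) h) [0..<hm + 1]" "fixed ! 9 = map (kkf a) [0..<hm + 1]"
  "fixed ! 10 = map (ebf a lam) [0..<hm + 1]" "fixed ! 11 = map (shf a G) [0..<hm + 1]"
  "fixed ! 12 = map am [0..<L]"
  "fixed ! 13 = map (\<lambda>z. tab (z div R) (z mod R)) [0..<L * R]"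
  "fixed ! 14 = map (\<lambda>z. if tab (z div R) (z mod R) = 0 then 0 else plo H (Fam H a G Pf) (tab (z div R) (z mod R) - 1)) [0..<L * R]"
  "fixed ! 15 = map (\<lambda>z. if tab (z div R) (z mod R) = 0 then 0 else phi H (Fam H a G Pf) (tab (z div R) (z mod R) - 1)) [0..<L * R]"
proof -
  show "fixed ! (6 + b) = map (Pf b) [0..<2 ^ H]" if "b < 2"
  proof -
    have "b = 0 \<or> b = 1" using that by auto
    then show ?thesis by (auto simp: fixed_def simp del: upt_Suc)
  qed
qed (simp_all add: fixed_def del: upt_Suc)

sublocale point_ds w H a n L Q R G Pf am tab "map snd arrays" lam J hm xs ys S
proof (intro point_ds.intro range_ds.intro level_ds.intro dict_ds.intro level_ds_axioms.intro range_ds_axioms.intro point_ds_axioms.intro)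
  note af = arrays_fixed
  show "1 \<le> H" "1 \<le> a" "40 * H \<le> w" by (rule H1 a1 w40)+
  show "16 \<le> length (map snd arrays)" "length (map snd arrays) = 16 + 6 * (hm + 1)"
    by (simp_all add: arrays_def length_fixed)
  show "map snd arrays ! 0 = [2 ^ H, H, a, n, R, Q, Q * R, L]" by (simp add: af fixed_nth)
  show "length (map snd arrays ! 12) = L" "\<And>i. i < L \<Longrightarrow> map snd arrays ! 12 ! i = am i"
    by (simp_all add: af fixed_nth)
  have z: "(i * R + s) div R = i" "(i * R + s) mod R = s" if "s < R" for i s using that by auto
  show "length (map snd arrays ! 13) = L * R" "length (map snd arrays ! 14) = L * R" "length (map snd arrays ! 15) = L * R"
    by (simp_all add: af fixed_nth)
  show "map snd arrays ! 13 ! (i * R + s) = tab i s" if "i < L" "s < R" for i s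
    using LR_index[OF that] that(2) by (simp add: af fixed_nth z[OF that(2)])
  show "map snd arrays ! 14 ! (i * R + s) = (if tab i s = 0 then 0 else plo H (Fam H a G Pf) (tab i s - 1))" if "i < L" "s < R" for i s
    using LR_index[OF that] that(2) by (simp add: af fixed_nth z[OF that(2)])
  show "map snd arrays ! 15 ! (i * R + s) = (if tab i s = 0 then 0 else phi H (Fam H a G Pf) (tab i s - 1))" if "i < L" "s < R" for i s
    using LR_index[OF that] that(2) by (simp add: af fixed_nth z[OF that(2)])
  show "\<And>i. i < L \<Longrightarrow> am i < Q * R" by (rule am)
  show "\<And>i s. tab i s = 0 \<or> tab i s - 1 \<in> keyset H (6 * (H + 1) * (H + 1) * 2 ^ H) (Fam H a G Pf)" by (rule tab[unfolded K_def])
  show "\<And>x. x \<in> keyset H (6 * (H + 1) * (H + 1) * 2 ^ H) (Fam H a G Pf) \<Longrightarrow> \<exists>i<L. tab i (hsh Q R (am i) x) = Suc x"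
    by (rule tabK[unfolded K_def])
  show "0 < Q" by (simp add: Q_def)
  show "0 < R" by (rule R)
  show "Q * R * Q \<le> 2 ^ w" "L * R < 2 ^ w" "Q < 2 ^ w" by (rule Pow_bounds)+
  show "6 * (H + 1) * (H + 1) * 2 ^ H * (H + 2) * 2 ^ (H + 1) \<le> Q" by (rule IQ)
  show "\<And>i. Fam H a G Pf i 0 = 0" by (rule Fam_0[OF wave_Pf])
  show "hm = (H - 1) div a" by (rule hm_def)
  show "\<And>b. b < 2 \<Longrightarrow> wave H (Pf b)" by (rule wave_Pf)
  have "map snd arrays ! (6 + b) = map (Pf b) [0..<2 ^ H]" if "b < 2" for b
    using af[of "6 + b"] fixed_nth(7)[OF that] that by simp
  then show "length (map snd arrays ! (6 + b)) = 2 ^ H" "y < 2 ^ H \<Longrightarrow> map snd arrays ! (6 + b) ! y = Pf b y" if "b < 2" for b y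
    using that by simp_all
  show "length (map snd arrays ! 8) = hm + 1" "length (map snd arrays ! 9) = hm + 1"
    "length (map snd arrays ! 10) = hm + 1" "length (map snd arrays ! 11) = hm + 1"
    by (simp_all add: af fixed_nth del: upt_Suc)
  show "map snd arrays ! 8 ! h = h - kf (2 ^ a) h" "map snd arrays ! 9 ! h = kkf a h"
    "map snd arrays ! 10 ! h = ebf a lam h" "map snd arrays ! 11 ! h = shf a G h" if "h \<le> hm" for h
    using that by (simp_all add: af fixed_nth del: upt_Suc)
  show "length (map snd arrays ! (16 + 6 * h + 3 * b)) = 2 ^ H"
    "j < 2 ^ H \<Longrightarrow> map snd arrays ! (16 + 6 * h + 3 * b) ! j = wave.jrec H (Pf b) (a * h) (kkf a h) (ebf a lam h) j"
    if "b < 2" "0 < h" "h \<le> hm" for b h j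
    using arrays_leveled[OF that(3,1), of 0] that(2) by (simp_all add: recs_def)
  show "length (map snd arrays ! (17 + 6 * h + 3 * b)) = 2 ^ (H - ebf a lam h) * 2 ^ kkf a h" if "b < 2" "0 < h" "h \<le> hm" for b h
    using arrays_leveled[OF that(3,1), of 1] that(2) by (simp add: bases_def)
  show "map snd arrays ! (17 + 6 * h + 3 * b) ! (i * 2 ^ kkf a h + s) = wave.jbase H (Pf b) (a * h) (kkf a h) (ebf a lam h) i s"
    if "b < 2" "0 < h" "h \<le> hm" "i < 2 ^ (H - ebf a lam h)" "s < 2 ^ kkf a h" for b h i s
  proof -
    define M where "M = (2::nat) ^ kkf a h"
    have s: "s < M" using that(5) by (simp add: M_def)
    have "i * M + s < (i + 1) * M" using s by simp
    also have "\<dots> \<le> 2 ^ (H - ebf a lam h) * M" using that(4) by (intro mult_le_mono1) simp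
    finally have l: "i * M + s < 2 ^ (H - ebf a lam h) * M" .
    have p: "(i * M + s) div M = i" "(i * M + s) mod M = s" using s by auto
    show ?thesis using arrays_leveled[OF that(3,1), of 1] that(2) l p
      unfolding bases_def M_def[symmetric] by simp
  qed
  show "length (map snd arrays ! (18 + 6 * h + 3 * b)) = 2 * 2 ^ H" if "b < 2" "h \<le> hm" for b h
    using arrays_leveled[OF that(2,1), of 2] by (simp add: maxs_def)
  show "map snd arrays ! (18 + 6 * h + 3 * b) ! (2 ^ (H - r) + q) = wave.amax H (Pf b) (a * h) r q"
    if "b < 2" "h \<le> hm" "r \<le> shf a G h" "q < 2 ^ (H - r)" for b h r q
  proof -
    note hv = hv_eq(1)[OF that(2-4), of b] hv_eq(2)[OF that(2-4)]
    have "map snd arrays ! (18 + 6 * h + 3 * b) = map (hv b h) [0..<2 * 2 ^ H]"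
      using arrays_leveled[OF that(2,1), of 2] by (simp add: maxs_def)
    then show ?thesis using hv by (simp only: nth_map_upt minus_nat.diff_0 add_0 length_upt)
  qed
  show "hm < (2 ^ a) ^ J" by (rule hmJ)
  show "a \<le> 2 * H" using lam H1 by linarith
  show "length (map snd arrays ! 5) = 2 ^ H" by (simp add: af fixed_nth)
  show "map snd arrays ! 5 ! x \<le> hm \<and> x div 2 ^ (a * (map snd arrays ! 5 ! x + 1)) = 0 \<and>
        (map snd arrays ! 5 ! x = 0 \<or> x div 2 ^ (a * map snd arrays ! 5 ! x) \<noteq> 0)" if "x < 2 ^ H" for x
  proof -
    have "map snd arrays ! 5 ! x = (LEAST h. x div 2 ^ (a * (h + 1)) = 0)" using that af[of 5] by (simp add: fixed_nth)
    then show ?thesis using exists_level[OF a1 that H1] unfolding hm_def by simp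
  qed
  show "\<And>y. y < 2 ^ H \<Longrightarrow> Pf 1 y = Pf 0 (2 ^ H - 1 - y)" by (simp add: Pf_def)
  show "length xs = n" "distinct xs" "set xs = S" "sorted (map fst xs)" "length ys = n" "distinct ys" "set ys = S" "sorted (map snd ys)"
    by (rule len_xs len_ys xs ys)+
  show "S \<subseteq> {1..n} \<times> {1..n}" "n \<le> 2 ^ H" by (rule S nH)+
  show "length (map snd arrays ! 1) = n + 2" "length (map snd arrays ! 2) = n + 2"
    "length (map snd arrays ! 3) = n" "length (map snd arrays ! 4) = n"
    by (simp_all add: af fixed_nth fixed_nth(2)[unfolded One_nat_def] len_xs del: upt_Suc)
  show "map snd arrays ! 1 ! x = card {i. i < n \<and> fst (xs ! i) < x}" "map snd arrays ! 2 ! x = card {i. i < n \<and> snd (ys ! i) < x}"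
    if "x \<le> n + 1" for x
    using that by (simp_all add: af fixed_nth fixed_nth(2)[unfolded One_nat_def] del: upt_Suc)
  show "map snd arrays ! 3 ! p = fst (xs ! p)" "map snd arrays ! 4 ! p = snd (xs ! p)" if "p < n" for p
    using that by (simp_all add: af fixed_nth len_xs)
  show "\<And>y. y < n \<Longrightarrow> Pf 0 y < n \<and> xs ! Pf 0 y = ys ! y" using Px by (simp add: Pf_def)
qed

end

text \<open>A word holds \<open>w div d\<close> entries, which is at least half of
  \<open>w / d\<close>, so packing wastes at most a factor 2.\<close>

lemma div_div_le:
  fixes d w l :: nat
  assumes "0 < d" "d < w"
  shows "real (l div (w div d)) \<le> 2 * real d * real l / real w"
proof -
  define q where "q = w div d"
  have q: "1 \<le> q" using assms by (simp add: q_def Suc_le_eq div_greater_zero_iff)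
  have "d * q + w mod d = w" unfolding q_def by (rule mult_div_mod_eq)
  moreover have "w mod d < d" using assms by simp
  moreover have "d * 1 \<le> d * q" using q by (intro mult_le_mono2)
  ultimately have "w \<le> 2 * (d * q)" by linarith
  then have "real w \<le> real (2 * (d * q))" by (simp only: of_nat_le_iff)
  then have wq: "real w \<le> 2 * real d * real q" by simp
  have "real (l div q) \<le> real l / real q" by (rule of_nat_div_le_of_nat)
  also have "\<dots> = 2 * real d * real l / (2 * real d * real q)" using assms q by (simp add: field_simps)
  also have "\<dots> \<le> 2 * real d * real l / real w" using wq assms by (intro divide_left_mono) auto
  finally show ?thesis by (simp add: q_def)
qed

lemma div_div_le_self: "(l::nat) div (w div d) \<le> l" by simp

section \<open>Entry widths, query time and space\<close>

context build
begin

lemma n_less_pow: "2 ^ H < (2::nat) ^ (20 * H)" "2 ^ H \<ge> (2::nat)"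
  using H1 power_increasing[of 1 H "2::nat"] by (auto intro: power_strict_increasing)

lemma fixed_ok: "vs \<in> set fixed \<Longrightarrow> v \<in> set vs \<Longrightarrow> v < 2 ^ (20 * H)"
proof -
  assume vs: "vs \<in> set fixed" and v: "v \<in> set vs"
  have small: "x < 2 ^ (20 * H)" if "x \<le> 2 ^ H" for x :: nat using that n_less_pow(1) by linarith
  have HH: "H \<le> 2 ^ H" using less_exp[of H] by (rule less_imp_le)
  have c: "card {i. i < n \<and> f (zs ! i) < x} \<le> 2 ^ H" for f :: "nat \<times> nat \<Rightarrow> nat" and zs x
  proof -
    have "card {i. i < n \<and> f (zs ! i) < x} \<le> card {..<n}" by (intro card_mono) auto
    then show ?thesis using nH by simp
  qed
  have pt: "fst p \<le> 2 ^ H" "snd p \<le> 2 ^ H" if "p \<in> set xs" for p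
  proof -
    have "p \<in> {1..n} \<times> {1..n}" using that xs(3) S by blast
    then have "fst p \<le> n" "snd p \<le> n" by (auto simp: mem_Times_iff)
    then show "fst p \<le> 2 ^ H" "snd p \<le> 2 ^ H" using nH by linarith+
  qed
  have hh: "h - kf (2 ^ a) h \<le> 2 ^ H" "kkf a h \<le> 2 ^ H" "ebf a lam h \<le> 2 ^ H" "shf a G h \<le> 2 ^ H" if "h \<le> hm" for h
  proof -
    have "a * h \<le> 2 ^ H" "h \<le> 2 ^ H" using hmH(2,3)[OF that] HH by linarith+
    moreover have "kkf a h \<le> a * h"
      using kk(1)[of h] that by (cases "h = 0") (auto simp: kkf_def kf.simps)
    moreover have "shf a G h \<le> a * h" by (simp add: shf_def)
    ultimately show "h - kf (2 ^ a) h \<le> 2 ^ H" "kkf a h \<le> 2 ^ H" "ebf a lam h \<le> 2 ^ H" "shf a G h \<le> 2 ^ H"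
      using kk(3)[of h] by linarith+
  qed
  have lv: "(LEAST h. x div 2 ^ (a * (h + 1)) = 0) \<le> 2 ^ H" if "x < 2 ^ H" for x :: nat
  proof -
    have "(LEAST h. x div 2 ^ (a * (h + 1)) = 0) \<le> hm" using exists_level[OF a1 that H1] unfolding hm_def by blast
    then show ?thesis using hmH(3)[of hm] HH by linarith
  qed
  have QR: "x < 2 ^ (20 * H)" if "x \<le> Q * R" for x using that Pow_bounds(4) by linarith
  have Q1: "1 \<le> Q" "1 \<le> R" using R(1) by (auto simp: Q_def)
  have "Q * 1 \<le> Q * R" "1 * R \<le> Q * R" using Q1 by (intro mult_le_mono; simp)+
  then have QR': "Q < 2 ^ (20 * H)" "R < 2 ^ (20 * H)" using QR by simp_all
  have tb: "tab i s < 2 ^ (20 * H)" for i s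
    proof (cases "tab i s = 0")
    case False
    then have "tab i s - 1 < Q" using tab[of i s] K(3) by (metis lessThan_iff subsetD)
    then show ?thesis using QR'(1) by linarith
  qed simp
  have F: "Fam H a G Pf z x \<le> 2 ^ H" for z x by (rule Fam_le[OF wave_Pf])
  have Lb: "L < 2 ^ (20 * H)"
  proof -
    have "L \<le> 2 ^ (H + 2)" by (rule Pow_bounds)
    also have "\<dots> < 2 ^ (20 * H)" using H1 by (intro power_strict_increasing) auto
    finally show ?thesis .
  qed
  have aH: "a < 2 ^ (20 * H)"
  proof -
    have "a \<le> L" using lam(4) by (simp add: L_def)
    then show ?thesis using Lb by linarith
  qed
  have f67: "fixed ! 6 = map (Pf 0) [0..<2 ^ H]" "fixed ! 7 = map (Pf 1) [0..<2 ^ H]" by (simp_all add: fixed_def)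
  obtain i where i: "i < 16" "vs = fixed ! i" using vs length_fixed by (metis in_set_conv_nth)
  have "i = 0 \<or> i = 1 \<or> i = 2 \<or> i = 3 \<or> i = 4 \<or> i = 5 \<or> i = 6 \<or> i = 7 \<or> i = 8 \<or> i = 9 \<or> i = 10 \<or> i = 11 \<or> i = 12 \<or> i = 13 \<or> i = 14 \<or> i = 15"
    using i(1) by presburger
  then consider (c0) "i = 0" | (c1) "i = 1" | (c2) "i = 2" | (c3) "i = 3" | (c4) "i = 4" | (c5) "i = 5" | (c6) "i = 6" | (c7) "i = 7"
    | (c8) "i = 8" | (c9) "i = 9" | (c10) "i = 10" | (c11) "i = 11" | (c12) "i = 12" | (c13) "i = 13" | (c14) "i = 14" | (c15) "i = 15"
    by blast
  then show ?thesis
  proof cases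
    case c0
    then have "v \<in> {2 ^ H, H, a, n, R, Q, Q * R, L}" using v i(2) by (simp add: fixed_nth)
    then show ?thesis using n_less_pow(1) small[OF HH] aH small[OF nH] QR' Pow_bounds(4) Lb by blast
  next
    case c1
    then obtain x where "v = card {i. i < n \<and> fst (xs ! i) < x}" using v i(2) by (auto simp: fixed_nth(2)[unfolded One_nat_def] simp del: upt_Suc)
    then show ?thesis using small[OF c] by simp
  next
    case c2
    then obtain x where "v = card {i. i < n \<and> snd (ys ! i) < x}" using v i(2) by (auto simp: fixed_nth simp del: upt_Suc)
    then show ?thesis using small[OF c] by simp
  next
    case c3
    then show ?thesis using v i(2) small[OF pt(1)] by (auto simp: fixed_nth)
  next
    case c4
    then show ?thesis using v i(2) small[OF pt(2)] by (auto simp: fixed_nth)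
  next
    case c5
    then obtain x :: nat where "x < 2 ^ H" "v = (LEAST h. x div 2 ^ (a * (h + 1)) = 0)" using v i(2) by (auto simp: fixed_nth)
    then show ?thesis using small[OF lv] by blast
  next
    case c6
    then obtain x :: nat where "x < 2 ^ H" "v = Pf 0 x" using v i(2) f67 by auto
    then show ?thesis using small[OF less_imp_le[OF Pf_less]] by simp
  next
    case c7
    then obtain x :: nat where "x < 2 ^ H" "v = Pf 1 x" using v i(2) f67 by auto
    then show ?thesis using small[OF less_imp_le[OF Pf_less]] by simp
  next
    case c8
    then obtain h where "h \<le> hm" "v = h - kf (2 ^ a) h" using v i(2) by (auto simp: fixed_nth less_Suc_eq_le simp del: upt_Suc)
    then show ?thesis using small[OF hh(1)] by simp
  next
    case c9
    then obtain h where "h \<le> hm" "v = kkf a h" using v i(2) by (auto simp: fixed_nth less_Suc_eq_le simp del: upt_Suc)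
    then show ?thesis using small[OF hh(2)] by simp
  next
    case c10
    then obtain h where "h \<le> hm" "v = ebf a lam h" using v i(2) by (auto simp: fixed_nth less_Suc_eq_le simp del: upt_Suc)
    then show ?thesis using small[OF hh(3)] by simp
  next
    case c11
    then obtain h where "h \<le> hm" "v = shf a G h" using v i(2) by (auto simp: fixed_nth less_Suc_eq_le simp del: upt_Suc)
    then show ?thesis using small[OF hh(4)] by simp
  next
    case c12
    then obtain l where "l < L" "v = am l" using v i(2) by (auto simp: fixed_nth)
    then show ?thesis using QR[OF less_imp_le[OF am]] by simp
  next
    case c13
    then show ?thesis using v i(2) tb by (auto simp: fixed_nth)
  next
    case c14
    then show ?thesis using v i(2) small[OF F] by (auto simp: fixed_nth plo_def)
  next
    case c15
    then show ?thesis using v i(2) small[OF F] by (auto simp: fixed_nth phi_def)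
  qed
qed

lemma leveled_ok:
  assumes h: "h \<le> hm"
  shows "0 < fst (recs h b)" "fst (recs h b) < w" "v \<in> set (snd (recs h b)) \<Longrightarrow> v < 2 ^ fst (recs h b)"
    "0 < fst (bases h b)" "fst (bases h b) < w" "v \<in> set (snd (bases h b)) \<Longrightarrow> v < 2 ^ fst (bases h b)"
    "0 < fst (maxs h b)" "fst (maxs h b) < w" "v \<in> set (snd (maxs h b)) \<Longrightarrow> v < 2 ^ fst (maxs h b)"
proof -
  note wv = wave_Pf[of b]
  have aH: "a * h \<le> H" using hmH(2)[OF h] by simp
  have kl: "kkf a h \<le> a * h" if "0 < h" using kk(1)[OF that h] .
  show "0 < fst (recs h b)" using kk(2)[of h] by (auto simp: recs_def)
  show "fst (recs h b) < w"
  proof (cases "h = 0")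
    case False
    then have "kkf a h + ebf a lam h \<le> 2 * H" using kl kk(3)[of h] aH by linarith
    then show ?thesis using w40 H1 False by (simp add: recs_def)
  qed (use w40 H1 in \<open>simp add: recs_def\<close>)
  show "v < 2 ^ fst (recs h b)" if rv: "v \<in> set (snd (recs h b))"
  proof -
    have h0: "0 < h" using rv by (auto simp: recs_def split: if_splits)
    then obtain j where "j < 2 ^ H" "v = wave.jrec H (Pf b) (a * h) (kkf a h) (ebf a lam h) j"
      using rv by (auto simp: recs_def)
    then show ?thesis using wave.jump(2)[OF wv kl[OF h0] aH kk(3)] h0 by (simp add: recs_def)
  qed
  show "0 < fst (bases h b)" "fst (bases h b) < w" using H1 w40 by (simp_all add: bases_def)
  show "v < 2 ^ fst (bases h b)" if v: "v \<in> set (snd (bases h b))"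
  proof -
    obtain z where "v = wave.jbase H (Pf b) (a * h) (kkf a h) (ebf a lam h) (z div 2 ^ kkf a h) (z mod 2 ^ kkf a h)"
      using v by (auto simp: bases_def split: if_splits)
    then have "v < 2 ^ H" using wave.jbase_less[OF wv aH] by simp
    then have "v < 2 ^ (20 * H)" using n_less_pow(1) by (rule less_trans)
    then show ?thesis by (simp add: bases_def)
  qed
  show "0 < fst (maxs h b)" by (simp add: maxs_def)
  show "fst (maxs h b) < w" using GJ(2) lam(2) H1 w40 by (simp add: maxs_def)
  show "v < 2 ^ fst (maxs h b)" if v: "v \<in> set (snd (maxs h b))"
  proof -
    obtain i where i: "v = hv b h i" using v by (auto simp: maxs_def)
    define r where "r = H + 1 - blen i"
    show ?thesis
    proof (cases "r \<le> a * G")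
      case True
      then have "v = wave.amax H (Pf b) (a * h) r (i - 2 ^ (H - r))" using i unfolding r_def by (simp add: hv_def Let_def)
      then have "v < 2 ^ r" using wave.amax[OF wv] by simp
      also have "\<dots> \<le> 2 ^ (a * G + 1)" using True by (intro power_increasing) auto
      finally show ?thesis by (simp add: maxs_def)
    next
      case False
      then show ?thesis using i by (simp add: hv_def Let_def r_def maxs_def)
    qed
  qed
qed

lemma leveled_cases: "i < 6 * (hm + 1) \<Longrightarrow>
    \<exists>h\<le>hm. \<exists>b. leveled i = recs h b \<or> leveled i = bases h b \<or> leveled i = maxs h b"
proof -
  assume i: "i < 6 * (hm + 1)"
  have "i div 6 \<le> hm" using i by simp
  then show ?thesis by (intro exI[of _ "i div 6"] exI[of _ "i mod 6 div 3"] conjI) (auto simp: leveled_def Let_def)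
qed

lemma arrays_ok: "\<forall>(d, vs)\<in>set arrays. 0 < d \<and> d < w \<and> (\<forall>v\<in>set vs. v < 2 ^ d)"
proof
  fix p assume "p \<in> set arrays"
  then consider vs where "vs \<in> set fixed" "p = (20 * H, vs)" | i where "i < 6 * (hm + 1)" "p = leveled i"
    unfolding arrays_def by auto
  then have "0 < fst p \<and> fst p < w \<and> (\<forall>v\<in>set (snd p). v < 2 ^ fst p)"
  proof cases
    case 1
    then show ?thesis using fixed_ok w40 H1 by simp
  next
    case 2
    then obtain h b where h: "h \<le> hm" "p = recs h b \<or> p = bases h b \<or> p = maxs h b" using leveled_cases by metis
    then show ?thesis using leveled_ok[OF h(1)] by blast
  qed
  then show "case p of (d, vs) \<Rightarrow> 0 < d \<and> d < w \<and> (\<forall>v\<in>set vs. v < 2 ^ d)" by (simp add: case_prod_unfold)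
qed

text \<open>Step functions cost about \<open>lam ^ 2\<close>, a search over heights times the
  dictionary levels. The tests in blocks are about \<open>2 ^ a * lam\<close> descents of about
  \<open>2 ^ a * lam\<close> jumps. The loop over children multiplies both by
  \<open>2 ^ a\<close>.\<close>

lemma time_bound: "TS + 1 \<le> 60 * (2 ^ a) ^ 3 * lam ^ 2"
proof -
  define D where "D = (2::nat) ^ a"
  have D: "1 \<le> D" by (simp add: D_def)
  have l: "2 \<le> lam" by (rule lam)
  have "H + 1 < 2 ^ lam" using lam(1) by linarith
  then have "blen (H + 1) \<le> lam" by (rule blen_le)
  then have "(L + 1) * (blen (H + 1) + 2) \<le> (3 * lam) * (2 * lam)" using l by (intro mult_le_mono) (auto simp: L_def)
  then have TP: "(L + 1) * (blen (H + 1) + 2) \<le> 6 * lam ^ 2" by (simp add: power2_eq_square)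
  have Dl: "D * (lam + 2) \<le> D * (2 * lam)" using l by (intro mult_le_mono2) simp
  have "D * J \<le> D * (lam + 1)" using GJ(5) by (intro mult_le_mono2)
  then have 1: "D * J + 1 \<le> 2 * D * lam" using Dl D by (simp add: algebra_simps)
  have b: "blen (2 ^ (a * G)) \<le> a * G + 1" by (rule blen_le) simp
  have "D * (2 * G + 1) \<le> D * (2 * (6 * lam) + 1)" using GJ(4) by (intro mult_le_mono2) simp
  also have "\<dots> \<le> D * (13 * lam)" using l by (intro mult_le_mono2) simp
  finally have 2: "D * (2 * G + 1) \<le> 13 * (D * lam)" by simp
  have 3: "1 * lam \<le> D * lam" using D by (intro mult_le_mono1)
  have "blen (2 ^ (a * G)) + D * (2 * G + 1) + 1 \<le> 20 * (D * lam)" using b GJ(2) l 2 3 by linarith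
  then have "(D * J + 1) * (blen (2 ^ (a * G)) + D * (2 * G + 1) + 1) \<le> (2 * D * lam) * (20 * (D * lam))"
    using 1 by (intro mult_le_mono)
  also have "\<dots> = 40 * (D ^ 2 * lam ^ 2)" by (simp add: power2_eq_square)
  finally have 4: "(D * J + 1) * (blen (2 ^ (a * G)) + D * (2 * G + 1) + 1) \<le> 40 * (D ^ 2 * lam ^ 2)" .
  have "1 \<le> D ^ 2" using D by (rule one_le_power)
  then have 5: "1 * lam ^ 2 \<le> D ^ 2 * lam ^ 2" by (intro mult_le_mono1)
  have "1 \<le> lam ^ 2" using l by (intro one_le_power) simp
  then have "3 * ((L + 1) * (blen (H + 1) + 2)) + (D * J + 1) * (blen (2 ^ (a * G)) + D * (2 * G + 1) + 1) + 1 \<le> 59 * (D ^ 2 * lam ^ 2)"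
    using TP 4 5 by linarith
  then have "D * (3 * ((L + 1) * (blen (H + 1) + 2)) + (D * J + 1) * (blen (2 ^ (a * G)) + D * (2 * G + 1) + 1) + 1) \<le> D * (59 * (D ^ 2 * lam ^ 2))"
    by (rule mult_le_mono2)
  also have "\<dots> = 59 * (D ^ 3 * lam ^ 2)" by (simp add: power2_eq_square power3_eq_cube)
  finally have 6: "TS \<le> 59 * (D ^ 3 * lam ^ 2)" unfolding D_def .
  have "1 \<le> D ^ 3 * lam ^ 2" using D l by (metis (no_types, lifting) Suc_leI \<open>1 \<le> lam\<^sup>2\<close> mult_le_mono nat_mult_1 one_le_power)
  then have "TS + 1 \<le> 60 * (D ^ 3 * lam ^ 2)" using 6 by linarith
  then show ?thesis unfolding D_def by (simp only: mult.assoc)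
qed

end

context build
begin

definition "cost p = length (snd p) div (w div fst p) + (1::nat)"

lemma length_mem:
  "length (mem_of w arrays) = 4 * (16 + 6 * (hm + 1)) + (\<Sum>vs\<leftarrow>fixed. cost (20 * H, vs)) +
     (\<Sum>h<hm + 1. \<Sum>b<2. cost (recs h b) + cost (bases h b) + cost (maxs h b))"
proof -
  have 1: "(\<Sum>(d, vs)\<leftarrow>arrays. length vs div (w div d) + 1) = (\<Sum>p\<leftarrow>arrays. cost p)"
    by (simp add: cost_def case_prod_unfold)
  have six: "6 * (hm + 1) = (hm + 1) * (2 * 3)" by simp
  have "(\<Sum>p\<leftarrow>map leveled [0..<6 * (hm + 1)]. cost p) = (\<Sum>i\<in>set [0..<6 * (hm + 1)]. cost (leveled i))"
    unfolding map_map by (subst interv_sum_list_conv_sum_set_nat) (simp add: comp_def)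
  also have "\<dots> = (\<Sum>i<(hm + 1) * (2 * 3). cost (leveled i))" unfolding set_upt atLeast0LessThan six ..
  also have "\<dots> = (\<Sum>h<hm + 1. \<Sum>b<2. \<Sum>c<3. cost (leveled (h * (2 * 3) + (b * 3 + c))))"
    unfolding sum_nested[of _ "hm + 1"] sum_nested[of _ 2] ..
  also have "\<dots> = (\<Sum>h<hm + 1. \<Sum>b<2. cost (recs h b) + cost (bases h b) + cost (maxs h b))"
  proof (intro sum.cong refl)
    fix h b assume "b \<in> {..<2::nat}"
    then have b: "b < 2" by simp
    have e: "h * (2 * 3) + (b * 3 + c) = 6 * h + 3 * b + c" for c by simp
    have l: "leveled (h * (2 * 3) + (b * 3 + c)) = (if c = 0 then recs h b else if c = 1 then bases h b else maxs h b)" if "c < 3" for c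
      unfolding e leveled_def Let_def mod6[OF b that] ..
    have s3: "(\<Sum>c<3. g c) = g 0 + g 1 + g 2" for g :: "nat \<Rightarrow> nat" by (simp add: numeral_3_eq_3 numeral_2_eq_2)
    show "(\<Sum>c<3. cost (leveled (h * (2 * 3) + (b * 3 + c)))) = cost (recs h b) + cost (bases h b) + cost (maxs h b)"
      unfolding s3 by (simp only: l) simp
  qed
  finally have 2: "(\<Sum>p\<leftarrow>map leveled [0..<6 * (hm + 1)]. cost p) = \<dots>" .
  show ?thesis
    unfolding length_mem_of 1 unfolding arrays_def map_append sum_list_append 2
    by (simp add: length_fixed comp_def)
qed

text \<open>\<open>L\<close> is at most \<open>2 * (H + 2)\<close>, and \<open>(H + 2) * R\<close>
  is linear in \<open>2 ^ H\<close> by the spare factor in the bound on the number of keys.\<close>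

lemma LR_le: "L * R \<le> 52 * 2 ^ H"
proof -
  have "L \<le> 2 * (H + 2)" using lam(2) by (simp add: L_def)
  then have "L * R \<le> 2 * (H + 2) * R" by (rule mult_le_mono1)
  also have "\<dots> = 2 * ((H + 2) * R)" by simp
  also have "\<dots> \<le> 2 * (24 * 2 ^ H + (H + 2))" using R(5) by (rule mult_le_mono2)
  also have "\<dots> \<le> 2 * (24 * 2 ^ H + 2 * 2 ^ H)" using exp_ge_add2[OF H1] by simp
  finally show ?thesis by simp
qed

lemma fixed_cost: "(\<Sum>vs\<leftarrow>fixed. cost (20 * H, vs)) \<le> 185 * 2 ^ H"
proof -
  have "(\<Sum>vs\<leftarrow>fixed. cost (20 * H, vs)) \<le> (\<Sum>vs\<leftarrow>fixed. length vs + 1)"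
    by (rule sum_list_mono) (simp add: cost_def)
  also have "\<dots> = 8 + 2 * (n + 2) + 2 * n + 3 * 2 ^ H + 4 * (hm + 1) + L + 3 * (L * R) + 16"
    by (simp add: fixed_def len_xs del: upt_Suc)
  also have "\<dots> \<le> 185 * 2 ^ H"
  proof -
    define N M where "N = (2::nat) ^ H" and "M = L * R"
    have "hm + 1 \<le> N" using hmH(3)[of hm] exp_ge_Suc[of H] unfolding N_def by linarith
    moreover have "L \<le> 4 * N" using Pow_bounds(5) by (simp add: power_add N_def)
    moreover have "M \<le> 52 * N" "n \<le> N" "2 \<le> N" using LR_le nH n_less_pow(2) by (simp_all only: N_def M_def)
    ultimately show ?thesis unfolding N_def[symmetric] M_def[symmetric] add_mult_distrib2 by linarith
  qed
  finally show ?thesis .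
qed

text \<open>A record takes at most \<open>2 * kkf a h + lam\<close> bits, because \<open>ebf\<close>
  is at most \<open>kkf a h + lam\<close>. Words of at least \<open>40 * H\<close> bits and the loss
  of a factor 2 in packing give the denominator \<open>20 * H\<close>.\<close>

lemma recs_cost:
  assumes "0 < h" "h \<le> hm"
  shows "real (cost (recs h b)) \<le> 2 ^ H * (2 * real a * real (kf (2 ^ a) h) + real lam) / (20 * real H) + 1"
proof -
  define d where "d = kkf a h + ebf a lam h"
  have f: "fst (recs h b) = d" "length (snd (recs h b)) = 2 ^ H" using assms(1) by (simp_all add: recs_def d_def)
  have dl: "d \<le> 2 * kkf a h + lam" by (simp add: d_def ebf_def)
  have "real (2 ^ H div (w div d)) \<le> 2 * real d * real (2 ^ H) / real w"
    by (rule div_div_le) (use leveled_ok(1,2)[OF assms(2), of b] f in simp_all)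
  also have "\<dots> \<le> 2 * real d * real (2 ^ H) / real (40 * H)"
    using w40 H1 by (intro divide_left_mono) (auto simp del: of_nat_mult of_nat_power)
  also have "\<dots> = 2 ^ H * real d / (20 * real H)" using H1 by (simp add: field_simps)
  also have "\<dots> \<le> 2 ^ H * real (2 * kkf a h + lam) / (20 * real H)"
    using dl by (intro divide_right_mono mult_left_mono) (auto simp del: of_nat_add of_nat_mult)
  finally show ?thesis unfolding cost_def f by (simp add: kkf_def mult.assoc)
qed

text \<open>There are \<open>2 ^ (H - e + kkf a h)\<close> base values, each taking at most one
  word. If the block exponent \<open>e\<close> is \<open>kkf a h + lam\<close>, this is
  \<open>2 ^ (H - lam)\<close>; if it is limited to \<open>a * h\<close>, the number decays
  exponentially in the remaining height \<open>h - kf (2 ^ a) h\<close>.\<close>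

lemma bases_cost:
  assumes "0 < h" "h \<le> hm"
  shows "real (cost (bases h b)) \<le> 2 ^ H / 2 ^ lam + 2 ^ H * (1 / 2) ^ (h - kf (2 ^ a) h) + 1"
proof -
  define e where "e = ebf a lam h"
  have eH: "e \<le> H" using kk(3)[of h] hmH(2)[OF assms(2)] by (simp add: e_def)
  have "length (snd (bases h b)) = 2 ^ (H - e) * 2 ^ kkf a h" using assms(1) by (simp add: bases_def e_def)
  then have "cost (bases h b) \<le> 2 ^ (H - e) * 2 ^ kkf a h + 1" unfolding cost_def using div_div_le_self by (metis add_le_mono1)
  then have "real (cost (bases h b)) \<le> real (2 ^ (H - e) * 2 ^ kkf a h + 1)" by (simp only: of_nat_le_iff)
  also have "\<dots> = 2 ^ H * 2 ^ kkf a h / 2 ^ e + 1" 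
  proof -
    have "(2::real) ^ (H - e) = 2 ^ H / 2 ^ e" using eH by (intro power_diff) auto
    then show ?thesis by simp
  qed
  also have "\<dots> \<le> 2 ^ H / 2 ^ lam + 2 ^ H * (1 / 2) ^ (h - kf (2 ^ a) h) + 1"
  proof (cases "kkf a h + lam \<le> a * h")
    case True
    then have "e = kkf a h + lam" by (simp add: e_def ebf_def)
    then have "2 ^ H * 2 ^ kkf a h / 2 ^ e = 2 ^ H / (2::real) ^ lam" by (simp add: power_add)
    then show ?thesis by simp
  next
    case False
    then have e: "e = a * h" by (simp add: e_def ebf_def)
    have k: "kkf a h \<le> a * h" by (rule kk(1)[OF assms])
    have "2 ^ H * 2 ^ kkf a h / 2 ^ e = 2 ^ H * ((2::real) ^ kkf a h / 2 ^ (a * h))" by (simp add: e)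
    also have "(2::real) ^ kkf a h / 2 ^ (a * h) = (1 / 2) ^ (a * h - kkf a h)"
      using k by (simp add: power_diff power_one_over field_simps)
    also have "(1 / 2) ^ (a * h - kkf a h) \<le> (1 / 2 :: real) ^ (h - kf (2 ^ a) h)"
    proof (rule power_decreasing)
      have "1 * (h - kf (2 ^ a) h) \<le> a * (h - kf (2 ^ a) h)" using a1 by (rule mult_le_mono1)
      then show "h - kf (2 ^ a) h \<le> a * h - kkf a h" by (simp add: kkf_def diff_mult_distrib2)
    qed auto
    finally have "2 ^ H * 2 ^ kkf a h / 2 ^ e \<le> 2 ^ H * (1 / 2 :: real) ^ (h - kf (2 ^ a) h)" by simp
    moreover have "0 \<le> (2::real) ^ H / 2 ^ lam" by simp
    ultimately show ?thesis by linarith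
  qed
  finally show ?thesis .
qed

text \<open>An offset takes at most \<open>7 * lam\<close> bits, and over all block lengths there
  are \<open>2 * 2 ^ H\<close> slots.\<close>

lemma maxs_cost: "h \<le> hm \<Longrightarrow> real (cost (maxs h b)) \<le> 2 ^ H * (14 * real lam) / (20 * real H) + 1"
proof -
  assume h: "h \<le> hm"
  define d where "d = a * G + 1"
  have f: "fst (maxs h b) = d" "length (snd (maxs h b)) = 2 * 2 ^ H" by (simp_all add: maxs_def d_def)
  have dl: "d \<le> 7 * lam" using GJ(2) lam(3) by (simp add: d_def)
  have "real (2 * 2 ^ H div (w div d)) \<le> 2 * real d * real (2 * 2 ^ H) / real w"
    by (rule div_div_le) (use leveled_ok(7,8)[OF h, of b] f in simp_all)
  also have "\<dots> \<le> 2 * real d * real (2 * 2 ^ H) / real (40 * H)"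
    using w40 H1 by (intro divide_left_mono) (auto simp del: of_nat_mult of_nat_power)
  also have "\<dots> = 2 ^ H * (2 * real d) / (20 * real H)" using H1 by (simp add: field_simps)
  also have "\<dots> \<le> 2 ^ H * (2 * real (7 * lam)) / (20 * real H)"
    using dl by (intro divide_right_mono mult_left_mono) (auto simp del: of_nat_mult)
  finally show ?thesis unfolding cost_def f by simp
qed

lemma zero_cost: "cost (recs 0 b) = 1" "cost (bases 0 b) = 1"
  by (simp_all add: cost_def recs_def bases_def)

text \<open>Over the heights the \<open>kf\<close> parts of the records sum to at most
  \<open>J * hm\<close> by \<open>sum_kf\<close>. As \<open>J\<close> is at most
  \<open>lam / a + 1\<close> and \<open>a * hm \<le> H\<close>, division by the word length leaves
  about \<open>2 ^ H * lam / a\<close>. The \<open>O(lam)\<close> bits per position in records and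
  maxima amount to the same, since there are about \<open>H / a\<close> heights.\<close>

lemma space_bound: "real (length (mem_of w arrays)) \<le> 300 * 2 ^ H * (real lam / real a + 1)"
proof -
  define N X l where "N = (2::real) ^ H" and "X = real lam / real a + 1" and "l = real lam"
  have D: "2 \<le> (2::nat) ^ a" using a1 power_increasing[of 1 a "2::nat"] by simp
  have N: "2 \<le> N" using power_increasing[OF H1, of "2::real"] by (simp add: N_def)
  have a: "1 \<le> real a" and Hr: "1 \<le> real H" using a1 H1 by auto
  have X: "1 \<le> X" by (simp add: X_def)
  have NX: "N * 1 \<le> N * X" using X N by (intro mult_left_mono) auto
  have JX: "real J \<le> X" unfolding J_def X_def using of_nat_div_le_of_nat[of lam a] by simp
  have hmH': "real a * real hm \<le> real H" using hmH(2)[of hm] by (metis less_imp_le of_nat_le_iff of_nat_mult order_refl)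
  have hm1: "real hm + 1 \<le> N"
  proof -
    have "hm + 1 \<le> 2 ^ H" using hmH(3)[of hm] exp_ge_Suc[of H] by linarith
    then have "real (hm + 1) \<le> real (2 ^ H)" by (simp only: of_nat_le_iff)
    then show ?thesis by (simp add: N_def)
  qed
  define f where "f h = N * (2 * real a * real (kf (2 ^ a) h) + l) / (20 * real H)" for h
  define g where "g h = N / 2 ^ lam + N * (1 / 2) ^ (h - kf (2 ^ a) h)" for h
  define m where "m = N * (14 * l) / (20 * real H)"
  have f0: "0 \<le> f h" "0 \<le> g h" for h using N by (simp_all add: f_def g_def l_def)
  have c: "real (cost (recs h b) + cost (bases h b) + cost (maxs h b)) \<le> (if h = 0 then 0 else f h + g h) + (m + 3)" if "h \<le> hm" for h b
    using recs_cost[of h b] bases_cost[of h b] maxs_cost[of h b] that zero_cost[of b]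
    by (cases "h = 0") (auto simp: f_def g_def m_def N_def l_def)
  have "real (\<Sum>h<hm + 1. \<Sum>b<2. cost (recs h b) + cost (bases h b) + cost (maxs h b)) \<le>
     (\<Sum>h<hm + 1. \<Sum>b<(2::nat). (if h = 0 then 0 else f h + g h) + (m + 3))"
    unfolding of_nat_sum by (intro sum_mono c) auto
  also have "\<dots> = 2 * ((\<Sum>h<hm + 1. if h = 0 then 0 else f h + g h) + (real hm + 1) * (m + 3))"
    by (simp only: sum_constant sum.distrib sum_distrib_left[symmetric] card_lessThan) (simp add: algebra_simps sum_distrib_left)
  also have "(\<Sum>h<hm + 1. if h = 0 then 0 else f h + g h) = (\<Sum>h = 1..hm. f h) + (\<Sum>h = 1..hm. g h)"
  proof -
    have "{..<hm + 1} = insert 0 {1..hm}" by auto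
    then have "(\<Sum>h<hm + 1. if h = 0 then 0 else f h + g h) = (\<Sum>h\<in>{1..hm}. if h = 0 then 0 else f h + g h)" by simp
    also have "\<dots> = (\<Sum>h = 1..hm. f h + g h)" by (intro sum.cong) auto
    finally show ?thesis by (simp only: sum.distrib)
  qed
  finally have lev: "real (\<Sum>h<hm + 1. \<Sum>b<2. cost (recs h b) + cost (bases h b) + cost (maxs h b)) \<le>
     2 * ((\<Sum>h = 1..hm. f h) + (\<Sum>h = 1..hm. g h) + (real hm + 1) * (m + 3))" .
  have F: "(\<Sum>h = 1..hm. f h) \<le> N * X"
  proof -
    have sk: "real (\<Sum>h = 1..hm. kf (2 ^ a) h) \<le> X * real hm"
    proof -
      have "real (\<Sum>h = 1..hm. kf (2 ^ a) h) \<le> real (J * hm)" using sum_kf[OF D hmJ] by (simp only: of_nat_le_iff)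
      also have "\<dots> \<le> X * real hm" using JX by (simp add: mult_right_mono)
      finally show ?thesis .
    qed
    have "(\<Sum>h = 1..hm. f h) = N * (2 * real a * real (\<Sum>h = 1..hm. kf (2 ^ a) h) + l * real hm) / (20 * real H)"
      by (simp add: f_def sum_divide_distrib[symmetric] sum_distrib_left[symmetric] sum.distrib algebra_simps)
    also have "\<dots> \<le> N * (2 * real a * (X * real hm) + X * real a * real hm) / (20 * real H)"
    proof -
      have "l \<le> X * real a" using a by (simp add: X_def l_def field_simps)
      then show ?thesis using sk N by (intro divide_right_mono mult_left_mono add_mono mult_right_mono) auto
    qed
    also have "\<dots> = 3 * N * X * (real a * real hm) / (20 * real H)" by (simp add: algebra_simps)
    also have "\<dots> \<le> 3 * N * X * real H / (20 * real H)" using hmH' N X by (intro divide_right_mono mult_left_mono) auto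
    also have "\<dots> = 3 / 20 * (N * X)" using Hr by simp
    finally show ?thesis using N X mult_nonneg_nonneg[of N X] by linarith
  qed
  \<comment> \<open>\<open>2 ^ lam\<close> exceeds the number of heights, so the first summands of
    \<open>g\<close> add up to at most \<open>2 ^ H\<close>; the second ones are handled by
    \<open>sum_kf_half\<close>.\<close>
  have Gs: "(\<Sum>h = 1..hm. g h) \<le> 3 * (N * X)"
  proof -
    have "(\<Sum>h = 1..hm. g h) = N * (real hm / 2 ^ lam) + N * (\<Sum>h = 1..hm. (1 / 2) ^ (h - kf (2 ^ a) h))"
      by (simp add: g_def sum.distrib sum_distrib_left)
    also have "\<dots> \<le> N * 1 + N * (2 * X)"
    proof (intro add_mono mult_left_mono)
      have "hm \<le> 2 ^ lam" using hmH(3)[of hm] lam(1) by linarith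
      then have "real hm \<le> real (2 ^ lam)" by (simp only: of_nat_le_iff)
      then show "real hm / 2 ^ lam \<le> 1" by simp
      show "(\<Sum>h = 1..hm. (1 / 2) ^ (h - kf (2 ^ a) h)) \<le> 2 * X" using sum_kf_half[OF D hmJ] JX by linarith
    qed (use N in auto)
    finally show ?thesis using NX by linarith
  qed
  have M: "(real hm + 1) * m \<le> 2 * (N * X)"
  proof -
    have lH: "l \<le> 2 * real H" using lam(2) H1 by (simp add: l_def)
    have la: "l = (X - 1) * real a" using a by (simp add: X_def l_def)
    have "(real hm + 1) * l = (X - 1) * (real a * real hm) + l" by (subst la) (simp add: la algebra_simps)
    also have "\<dots> \<le> (X - 1) * real H + 2 * real H" using X hmH' lH by (intro add_mono mult_left_mono) auto
    also have "\<dots> = (X + 1) * real H" by (simp add: algebra_simps)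
    also have "\<dots> \<le> 2 * X * real H" using X by (intro mult_right_mono) auto
    finally have "N * 14 * ((real hm + 1) * l) / (20 * real H) \<le> N * 14 * (2 * X * real H) / (20 * real H)"
      using N by (intro divide_right_mono mult_left_mono) auto
    also have "\<dots> = 28 / 20 * (N * X)" using Hr by simp
    also have "\<dots> \<le> 2 * (N * X)" using NX N by linarith
    finally have "N * 14 * ((real hm + 1) * l) / (20 * real H) \<le> 2 * (N * X)" .
    moreover have "(real hm + 1) * m = N * 14 * ((real hm + 1) * l) / (20 * real H)" unfolding m_def by algebra
    ultimately show ?thesis by simp
  qed
  have "real (length (mem_of w arrays)) = real (4 * (16 + 6 * (hm + 1))) + real (\<Sum>vs\<leftarrow>fixed. cost (20 * H, vs)) +
     real (\<Sum>h<hm + 1. \<Sum>b<2. cost (recs h b) + cost (bases h b) + cost (maxs h b))"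
    unfolding length_mem by (simp only: of_nat_add)
  also have "\<dots> \<le> 300 * (N * X)"
  proof -
    have "real (\<Sum>vs\<leftarrow>fixed. cost (20 * H, vs)) \<le> real (185 * 2 ^ H)" using fixed_cost by (simp only: of_nat_le_iff)
    then have "real (\<Sum>vs\<leftarrow>fixed. cost (20 * H, vs)) \<le> 185 * N" by (simp add: N_def)
    moreover define z where "z = real hm + 1"
    moreover have "real (4 * (16 + 6 * (hm + 1))) = 64 + 24 * z" by (simp add: z_def)
    moreover have "real (\<Sum>h<hm + 1. \<Sum>b<2. cost (recs h b) + cost (bases h b) + cost (maxs h b)) \<le>
       2 * (\<Sum>h = 1..hm. f h) + 2 * (\<Sum>h = 1..hm. g h) + 2 * (z * m) + 6 * z"
      using lev unfolding z_def[symmetric] distrib_left by linarith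
    moreover have "z * m \<le> 2 * (N * X)" "z \<le> N" using M hm1 by (simp_all only: z_def)
    ultimately show ?thesis using F Gs NX N by linarith
  qed
  finally show ?thesis by (simp add: N_def X_def mult.assoc)
qed

lemma length_less: "length (mem_of w arrays) < 2 ^ w"
proof -
  have "real lam / real a \<le> real lam / 1" using a1 by (intro divide_left_mono) auto
  moreover have "real lam + 1 \<le> 2 ^ (H + 1)"
  proof -
    have "lam + 1 \<le> 2 ^ (H + 1)" using lam(2) exp_ge_add2[OF H1] by linarith
    then have "real (lam + 1) \<le> real (2 ^ (H + 1))" by (simp only: of_nat_le_iff)
    then show ?thesis by simp
  qed
  ultimately have "real lam / real a + 1 \<le> 2 ^ (H + 1)" by linarith
  then have "300 * 2 ^ H * (real lam / real a + 1) \<le> 2 ^ 9 * 2 ^ H * 2 ^ (H + 1)" by (intro mult_mono) auto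
  also have "\<dots> = (2::real) ^ (9 + H + (H + 1))" by (simp only: power_add)
  also have "\<dots> < 2 ^ w" using w40 H1 by (intro power_strict_increasing) auto
  finally have "real (length (mem_of w arrays)) < 2 ^ w" using space_bound by linarith
  then show ?thesis by simp
qed

lemma memory:
  "represents w PROG S (real (length PROG + clen INIT + clen BODY + 10) * (60 * (2 ^ a) ^ 3 * real lam ^ 2)) {mem_of w arrays}"
proof -
  have w3: "3 \<le> w" using w40 H1 by linarith
  note m = mem_of_lay[OF arrays_ok w3 length_less]
  have "real (TS + 1) \<le> real (60 * (2 ^ a) ^ 3 * lam ^ 2)" using time_bound by (simp only: of_nat_le_iff)
  also have "\<dots> = 60 * (2 ^ a) ^ 3 * real lam ^ 2" by simp
  finally have "real (TS + 1) \<le> 60 * (2 ^ a) ^ 3 * real lam ^ 2" .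
  then show ?thesis by (intro represents_mem m mult_left_mono) auto
qed

end

lemma exists_memory:
  assumes "S \<subseteq> {1..n} \<times> {1..n}" "card S = n" "40 * lg_bits n \<le> w" "1 \<le> a" "a \<le> ceillog2 (lg_bits n + 2)"
  defines "lam \<equiv> ceillog2 (lg_bits n + 2)"
  shows "\<exists>m. represents w PROG S (real (length PROG + clen INIT + clen BODY + 10) * (60 * (2 ^ a) ^ 3 * real lam ^ 2)) {m} \<and>
     real (length m) \<le> 300 * 2 ^ lg_bits n * (real lam / real a + 1)"
proof -
  have "finite S" using assms(1) by (rule finite_subset) simp
  obtain xs where xs: "distinct xs" "set xs = S" "sorted (map fst xs)" using exists_sorted_list[OF \<open>finite S\<close>, of fst] by blast
  obtain ys where ys: "distinct ys" "set ys = S" "sorted (map snd ys)" using exists_sorted_list[OF \<open>finite S\<close>, of snd] by blast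
  interpret build_points n w a S xs ys by unfold_locales (use assms(1-5) xs ys in auto)
  obtain am tab where "(\<forall>i<L. am i < Q * R) \<and> (\<forall>i s. tab i s = 0 \<or> tab i s - 1 \<in> K) \<and>
     (\<forall>x\<in>K. \<exists>i<L. tab i (hsh Q R (am i) x) = Suc x)" using exists_tables by blast
  then interpret build n w a S xs ys am tab by unfold_locales auto
  show ?thesis
    using memory space_bound unfolding assms(6) lam_def H_def by blast
qed

section \<open>Choice of the branching\<close>

definition loglam :: "nat \<Rightarrow> nat" where
  "loglam n = ceillog2 (lg_bits n + 2)"

lemma loglam_ge: "1 \<le> loglam n"
  unfolding loglam_def by (subst ceillog2_ge_iff) auto

lemma cmult_bigo: "f \<in> O[F](g) \<Longrightarrow> (\<lambda>n. c * f n :: real) \<in> O[F](g)"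
  by (cases "c = 0") simp_all

text \<open>The code and the factor 40 do not depend on \<open>\<kappa>\<close>, which enters the
  space bound alone: a machine word counts as at most \<open>\<kappa>\<close> words of
  \<open>lg_bits n\<close> bits.\<close>

lemma structureI:
  fixes af :: "nat \<Rightarrow> nat"
  assumes af: "\<And>n. 1 \<le> af n" "\<And>n. af n \<le> loglam n"
    and sp: "(\<lambda>n. 2 ^ lg_bits n * (real (loglam n) / real (af n) + 1)) \<in> O(s)"
    and ti: "(\<lambda>n. (2 ^ af n) ^ 3 * real (loglam n) ^ 2) \<in> O(t)"
  shows "sorted_range_reporting_structure s t"
  unfolding sorted_range_reporting_structure_def
proof (intro exI[of _ PROG] exI[of _ 40] allI)
  fix \<kappa> :: nat
  define sf where "sf n = real \<kappa> * 300 * (2 ^ lg_bits n * (real (loglam n) / real (af n) + 1))" for n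
  define tf where "tf n = real (length PROG + clen INIT + clen BODY + 10) * 60 * ((2 ^ af n) ^ 3 * real (loglam n) ^ 2)" for n
  have main: "\<forall>n S w. S \<subseteq> {1..n} \<times> {1..n} \<and> card S = n \<and> 40 * lg_bits n \<le> w \<and> w \<le> \<kappa> * lg_bits n \<longrightarrow>
        (\<exists>M. represents w PROG S (tf n) M \<and> (\<forall>m\<in>M. real (length m) * real w / real (lg_bits n) \<le> sf n))"
  proof (intro allI impI)
    fix n S w assume a: "S \<subseteq> {1..n} \<times> {1..n} \<and> card S = n \<and> 40 * lg_bits n \<le> w \<and> w \<le> \<kappa> * lg_bits n"
    obtain m where m: "represents w PROG S (real (length PROG + clen INIT + clen BODY + 10) * (60 * (2 ^ af n) ^ 3 * real (loglam n) ^ 2)) {m}"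
      "real (length m) \<le> 300 * 2 ^ lg_bits n * (real (loglam n) / real (af n) + 1)"
      using exists_memory[of S n w "af n", folded loglam_def] a af by blast
    have H: "0 < real (lg_bits n)" by (simp add: lg_bits_def)
    have "real w \<le> real (\<kappa> * lg_bits n)" using a by (simp only: of_nat_le_iff)
    then have "real w / real (lg_bits n) \<le> real \<kappa>" using H by (simp add: field_simps)
    then have "real (length m) * (real w / real (lg_bits n)) \<le> (300 * 2 ^ lg_bits n * (real (loglam n) / real (af n) + 1)) * real \<kappa>"
      using m(2) by (intro mult_mono) auto
    then have "real (length m) * real w / real (lg_bits n) \<le> sf n" by (simp add: sf_def mult_ac)
    moreover have "represents w PROG S (tf n) {m}" using m(1) by (simp only: tf_def mult.assoc)
    ultimately show "\<exists>M. represents w PROG S (tf n) M \<and> (\<forall>m\<in>M. real (length m) * real w / real (lg_bits n) \<le> sf n)"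
      by (intro exI[of _ "{m}"]) simp
  qed
  have "sf \<in> O(s)" unfolding sf_def by (rule cmult_bigo[OF sp])
  moreover have "tf \<in> O(t)" unfolding tf_def by (rule cmult_bigo[OF ti])
  ultimately show "\<exists>space\<in>O(s). \<exists>time\<in>O(t). \<forall>n S w. S \<subseteq> {1..n} \<times> {1..n} \<and> card S = n \<and> 40 * lg_bits n \<le> w \<and> w \<le> \<kappa> * lg_bits n \<longrightarrow>
        (\<exists>M. represents w PROG S (time n) M \<and> (\<forall>m\<in>M. real (length m) * real w / real (lg_bits n) \<le> space n))"
    using main by blast
qed

text \<open>From 256 on the iterated logarithm is at least 3, which absorbs the additive constants
  caused by rounding.\<close>

lemma loglam_bounds:
  assumes n: "256 \<le> n"
  defines "x \<equiv> log 2 (real n)"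
  shows "8 \<le> x" "3 \<le> log 2 x" "2 ^ lg_bits n \<le> 2 * real n" "2 ^ loglam n \<le> 6 * x"
    "real (loglam n) \<le> 2 * log 2 x"
proof -
  have lg2: "log 2 (2 ^ k) = real k" for k by (simp add: log_nat_power)
  have "log 2 (2 ^ 8) \<le> log 2 (real n)" using n by (subst log_le_cancel_iff) auto
  then show x: "8 \<le> x" unfolding lg2 x_def by simp
  have "log 2 (2 ^ 3) \<le> log 2 x" using x by (subst log_le_cancel_iff) auto
  then show y: "3 \<le> log 2 x" unfolding lg2 by simp
  have c1: "1 \<le> ceillog2 n" using n by (subst ceillog2_ge_iff) auto
  then have H: "lg_bits n = ceillog2 n" by (simp add: lg_bits_def)
  have "2 ^ ceillog2 n < 2 * n" using n by (intro two_power_ceillog2_gt) simp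
  then have "real (2 ^ ceillog2 n) \<le> real (2 * n)" by (simp only: of_nat_le_iff)
  then show "2 ^ lg_bits n \<le> 2 * real n" by (simp add: H)
  have "real (ceillog2 n) < x + 1" unfolding x_def using n by (intro ceillog2_less_log) simp
  then have Hx: "real (lg_bits n) \<le> x + 1" by (simp add: H)
  have "2 ^ loglam n < 2 * (lg_bits n + 2)" unfolding loglam_def by (intro two_power_ceillog2_gt) simp
  then have "real (2 ^ loglam n) \<le> real (2 * (lg_bits n + 2))" by (simp only: of_nat_le_iff)
  then have "2 ^ loglam n \<le> 2 * real (lg_bits n) + 4" by simp
  then show p: "2 ^ loglam n \<le> 6 * x" using Hx x by linarith
  have "real (loglam n) = log 2 (2 ^ loglam n)" unfolding lg2 ..
  also have "\<dots> \<le> log 2 (6 * x)" using p x by (subst log_le_cancel_iff) auto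
  also have "\<dots> = log 2 6 + log 2 x" using x by (intro log_mult_pos) auto
  also have "\<dots> \<le> log 2 (2 ^ 3) + log 2 x" by (intro add_right_mono) (subst log_le_cancel_iff, auto)
  also have "\<dots> = 3 + log 2 x" unfolding lg2 by simp
  finally show "real (loglam n) \<le> 2 * log 2 x" using y by linarith
qed

lemma structure_loglog:
  "sorted_range_reporting_structure (\<lambda>n. real n * log 2 (log 2 (real n))) (\<lambda>n. (log 2 (log 2 (real n)))\<^sup>2)"
proof (rule structureI[where af = "\<lambda>_. 1"])
  show "1 \<le> loglam n" for n by (rule loglam_ge)
  have "eventually (\<lambda>n. norm (2 ^ lg_bits n * (real (loglam n) / real 1 + 1)) \<le> 8 * norm (real n * log 2 (log 2 (real n)))) at_top"
    using eventually_ge_at_top[of 256]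
  proof eventually_elim
    case (elim n)
    note b = loglam_bounds[OF elim]
    have "2 ^ lg_bits n * (real (loglam n) / real 1 + 1) \<le> (2 * real n) * (4 * log 2 (log 2 (real n)))"
      using b by (intro mult_mono) auto
    then show ?case using b(2) by (simp add: abs_mult)
  qed
  then show "(\<lambda>n. 2 ^ lg_bits n * (real (loglam n) / real 1 + 1)) \<in> O(\<lambda>n. real n * log 2 (log 2 (real n)))" by (rule bigoI)
  have "eventually (\<lambda>n. norm ((2 ^ 1) ^ 3 * real (loglam n) ^ 2) \<le> 32 * norm ((log 2 (log 2 (real n)))\<^sup>2)) at_top"
    using eventually_ge_at_top[of 256]
  proof eventually_elim
    case (elim n)
    note b = loglam_bounds[OF elim]
    have "real (loglam n) ^ 2 \<le> (2 * log 2 (log 2 (real n))) ^ 2" using b by (intro power_mono) auto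
    then show ?case by (simp add: power_mult_distrib)
  qed
  then show "(\<lambda>n. (2 ^ 1) ^ 3 * real (loglam n) ^ 2) \<in> O(\<lambda>n. (log 2 (log 2 (real n)))\<^sup>2)" by (rule bigoI)
qed simp

text \<open>With \<open>af n\<close> about \<open>\<delta> * loglam n\<close>, the cube of
  \<open>2 ^ af n\<close> is of the order of \<open>log 2 n powr (3 * \<delta>)\<close>. Taking at
  most \<open>\<epsilon> / 4\<close> for \<open>\<delta>\<close> leaves a quarter of the exponent
  for the factor \<open>loglam n ^ 2\<close>; the cap 1 ensures
  \<open>af n \<le> loglam n\<close>.\<close>

lemma structure_linear:
  assumes e: "0 < (\<epsilon>::real)"
  shows "sorted_range_reporting_structure (\<lambda>n. real n) (\<lambda>n. log 2 (real n) powr \<epsilon>)"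
proof -
  define \<delta> where "\<delta> = min (\<epsilon> / 4) 1"
  have d: "0 < \<delta>" "\<delta> \<le> 1" "3 * \<delta> \<le> 3 * \<epsilon> / 4" using e by (auto simp: \<delta>_def)
  define af where "af n = max 1 (nat \<lfloor>\<delta> * real (loglam n)\<rfloor>)" for n
  have afr: "\<delta> * real (loglam n) \<le> 2 * real (af n)" "real (af n) \<le> \<delta> * real (loglam n) + 1" "1 \<le> af n" for n
  proof -
    have p: "0 \<le> \<delta> * real (loglam n)" using d(1) by simp
    have r: "real (nat \<lfloor>\<delta> * real (loglam n)\<rfloor>) = of_int \<lfloor>\<delta> * real (loglam n)\<rfloor>" using p by simp
    show 1: "1 \<le> af n" by (simp add: af_def)
    have "\<delta> * real (loglam n) \<le> real (nat \<lfloor>\<delta> * real (loglam n)\<rfloor>) + 1" unfolding r by linarith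
    also have "real (nat \<lfloor>\<delta> * real (loglam n)\<rfloor>) \<le> real (af n)" by (simp add: af_def)
    finally show "\<delta> * real (loglam n) \<le> 2 * real (af n)" using 1 by simp
    have "real (nat \<lfloor>\<delta> * real (loglam n)\<rfloor>) \<le> \<delta> * real (loglam n)" unfolding r by linarith
    moreover have "real (af n) = max 1 (real (nat \<lfloor>\<delta> * real (loglam n)\<rfloor>))" by (simp only: af_def of_nat_max of_nat_1)
    ultimately show "real (af n) \<le> \<delta> * real (loglam n) + 1" using p by linarith
  qed
  show ?thesis
  proof (rule structureI[where af = af])
    show "1 \<le> af n" for n by (rule afr)
    show "af n \<le> loglam n" for n
    proof -
      have "\<delta> * real (loglam n) \<le> 1 * real (loglam n)" using d(2) by (intro mult_right_mono) auto
      then have "\<lfloor>\<delta> * real (loglam n)\<rfloor> \<le> int (loglam n)" by (simp add: floor_le_iff)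
      then show ?thesis using loglam_ge[of n] by (simp add: af_def nat_le_iff)
    qed
    have "eventually (\<lambda>n. norm (2 ^ lg_bits n * (real (loglam n) / real (af n) + 1)) \<le> (2 * (2 / \<delta> + 1)) * norm (real n)) at_top"
      using eventually_ge_at_top[of 256]
    proof eventually_elim
      case (elim n)
      have "real (loglam n) / real (af n) \<le> 2 / \<delta>" using afr(1,3)[of n] d(1) by (simp add: field_simps)
      then have "2 ^ lg_bits n * (real (loglam n) / real (af n) + 1) \<le> (2 * real n) * (2 / \<delta> + 1)"
        using loglam_bounds(3)[OF elim] by (intro mult_mono) auto
      then show ?case by (simp add: abs_mult mult_ac)
    qed
    then show "(\<lambda>n. 2 ^ lg_bits n * (real (loglam n) / real (af n) + 1)) \<in> O(real)" by (rule bigoI)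
    define c where "c = 8 * 6 powr (3 * \<delta>) * (4 * (8 / \<epsilon> / ln 2) ^ 2)"
    have "eventually (\<lambda>n. norm ((2 ^ af n) ^ 3 * real (loglam n) ^ 2) \<le> c * norm (log 2 (real n) powr \<epsilon>)) at_top"
      using eventually_ge_at_top[of 256]
    proof eventually_elim
      case (elim n)
      define x where "x = log 2 (real n)"
      note b = loglam_bounds[OF elim, folded x_def]
      have "((2::real) ^ af n) ^ 3 = 2 powr (3 * real (af n))"
        by (simp add: powr_realpow[symmetric] powr_powr mult.commute flip: power_mult)
      also have "\<dots> \<le> 2 powr (3 + real (loglam n) * (3 * \<delta>))" using afr(2)[of n] by (intro powr_mono) (auto simp: algebra_simps)
      also have "\<dots> = 8 * (2 ^ loglam n) powr (3 * \<delta>)" by (simp add: powr_add powr_powr[symmetric] powr_realpow)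
      also have "\<dots> \<le> 8 * (6 * x) powr (3 * \<delta>)" using b(4) d(1) by (intro mult_left_mono powr_mono2) auto
      also have "\<dots> = 8 * 6 powr (3 * \<delta>) * x powr (3 * \<delta>)" using b(1) by (simp add: powr_mult)
      also have "\<dots> \<le> 8 * 6 powr (3 * \<delta>) * x powr (3 * \<epsilon> / 4)" using b(1) d(3) by (intro mult_left_mono powr_mono) auto
      finally have 1: "((2::real) ^ af n) ^ 3 \<le> 8 * 6 powr (3 * \<delta>) * x powr (3 * \<epsilon> / 4)" .
      \<comment> \<open>Half of the remaining exponent \<open>\<epsilon> / 4\<close>, because the
        bound is squared below.\<close>
      have "ln x \<le> x powr (\<epsilon> / 8) / (\<epsilon> / 8)" using b(1) e by (intro ln_powr_bound) auto
      then have "log 2 x \<le> 8 / \<epsilon> / ln 2 * x powr (\<epsilon> / 8)" by (simp add: log_def field_simps)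
      then have "2 * log 2 x \<le> 2 * (8 / \<epsilon> / ln 2 * x powr (\<epsilon> / 8))" by simp
      then have "real (loglam n) ^ 2 \<le> (2 * (8 / \<epsilon> / ln 2 * x powr (\<epsilon> / 8))) ^ 2" using b(5) by (intro power_mono) auto
      also have "\<dots> = 4 * (8 / \<epsilon> / ln 2) ^ 2 * (x powr (\<epsilon> / 8)) ^ 2" by (simp only: power_mult_distrib) simp
      also have "(x powr (\<epsilon> / 8)) ^ 2 = x powr (\<epsilon> / 4)" by (simp add: power2_eq_square powr_add[symmetric])
      finally have 2: "real (loglam n) ^ 2 \<le> 4 * (8 / \<epsilon> / ln 2) ^ 2 * x powr (\<epsilon> / 4)" .
      have "((2::real) ^ af n) ^ 3 * real (loglam n) ^ 2 \<le>
          (8 * 6 powr (3 * \<delta>) * x powr (3 * \<epsilon> / 4)) * (4 * (8 / \<epsilon> / ln 2) ^ 2 * x powr (\<epsilon> / 4))"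
        using 1 2 by (intro mult_mono) auto
      also have "\<dots> = c * (x powr (3 * \<epsilon> / 4) * x powr (\<epsilon> / 4))" by (simp only: c_def mult_ac)
      also have "x powr (3 * \<epsilon> / 4) * x powr (\<epsilon> / 4) = x powr \<epsilon>" by (simp add: powr_add[symmetric])
      finally show ?case by (simp add: x_def)
    qed
    then show "(\<lambda>n. (2 ^ af n) ^ 3 * real (loglam n) ^ 2) \<in> O(\<lambda>n. log 2 (real n) powr \<epsilon>)" by (rule bigoI)
  qed
qed

theorem theorem1:
  fixes \<epsilon> :: real
  assumes "\<epsilon> > 0"
  shows "sorted_range_reporting_structure (\<lambda>n. real n) (\<lambda>n. log 2 (real n) powr \<epsilon>) \<and>
         sorted_range_reporting_structure
           (\<lambda>n. real n * log 2 (log 2 (real n))) (\<lambda>n. (log 2 (log 2 (real n)))\<^sup>2)"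
  using structure_linear[OF assms] structure_loglog by blast

end
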